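(* Consider the piecewise quadratic family $$\dot x=-y+d_jx+l_jx^2+m_jxy+n_jy^2,\qquad \dot y=x(1-y),\qquad \text{if } (-1)^jy<0,\quad j=1,2,$$ with real parameters $(d_1,d_2,l_1,l_2,m_1,m_2,n_1,n_2)$. The maximal weak-focus order of the origin in this family is $5$. This maximal order is attained when the parameters lie on $$\mathcal T=\{d_1=d_2=2l_2+3n_1-n_2=2l_1-n_1+3n_2=m_1-m_2=0,\ \ m_2(n_1+n_2-1)(n_2-n_1)\neq0\}.$$ Additionally, the weak-foci on $\mathcal T$ unfold $4$ crossing limit cycles of small amplitude bifurcating from the origin, multiplicities taken into account, when perturbing inside this family.
   Context: Here $j=1$ on $\{y>0\}$ and $j=2$ on $\{y<0\}$. When $|d_j|<2$, orbits near the origin turn counterclockwise around it. Let $\Pi_1$ be the half-return map from the positive to the negative $x$-half-axis through $y>0$, and $\Pi_2$ the half-return map from the negative to the positive $x$-half-axis through $y<0$, points being parametrized by their distance $r_0$ to the origin. The displacement map is $\Delta(r_0)=\Pi_2^{-1}(r_0)-\Pi_1(r_0)=\sum_{k\ge1}W_kr_0^k$. Weak-focus order: for $d_1=d_2=0$ (then $W_1=0$), the origin is a weak-focus of order $\ell$ if $W_k=0$ for $1\le k\le \ell-1$ and $W_\ell\ne0$. A crossing limit cycle is an isolated periodic orbit meeting $\{y=0\}$ only at points where both vector fields are transversal to this line and point to the same side. Those near and surrounding the origin correspond to isolated positive zeros of $\Delta$, and the multiplicity of a limit cycle is the multiplicity of the zero. A parameter value $\lambda_0$ "unfolds $k$ limit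 cycles of small amplitude bifurcating from the origin, multiplicities taken into account" if for every neighborhood $U$ of the origin and every neighborhood $V$ of $\lambda_0$ in the parameter space of the family there is $\lambda\in V$ for which the system has $k$ crossing limit cycles in $U$ surrounding the origin, counted with multiplicity. *)

theory Defs
  imports "HOL-Analysis.Analysis"
begin

text \<open>Parameters are tuples \<open>(d1, d2, l1, l2, m1, m2, n1, n2)\<close>; the product type carries
  the usual topology of eight-dimensional real space.\<close>

type_synonym params = "real \<times> real \<times> real \<times> real \<times> real \<times> real \<times> real \<times> real"

fun quadratic_field :: "real \<Rightarrow> real \<Rightarrow> real \<Rightarrow> real \<Rightarrow> real \<times> real \<Rightarrow> real \<times> real" where
  "quadratic_field d l m n (x, y) =
     (- y + d * x + l * x\<^sup>2 + m * x * y + n * y\<^sup>2, x * (1 - y))"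

fun upper_field :: "params \<Rightarrow> real \<times> real \<Rightarrow> real \<times> real" where
  "upper_field (d1, d2, l1, l2, m1, m2, n1, n2) = quadratic_field d1 l1 m1 n1"

fun lower_field :: "params \<Rightarrow> real \<times> real \<Rightarrow> real \<times> real" where
  "lower_field (d1, d2, l1, l2, m1, m2, n1, n2) = quadratic_field d2 l2 m2 n2"

definition upper_half :: "(real \<times> real) set" where
  "upper_half = {p. snd p > 0}"

definition lower_half :: "(real \<times> real) set" where
  "lower_half = {p. snd p < 0}"

text \<open>A solution arc of the field \<open>X\<close> from \<open>p\<close> to \<open>q\<close> whose interior lies in \<open>H\<close>.\<close>

definition solution_arc ::
  "(real \<times> real \<Rightarrow> real \<times> real) \<Rightarrow> (real \<times> real) set \<Rightarrow> real \<times> real \<Rightarrow> real \<times> real \<Rightarrow> bool" where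
  "solution_arc X H p q \<longleftrightarrow>
     (\<exists>T>0. \<exists>\<gamma>. \<gamma> 0 = p \<and> \<gamma> T = q \<and>
        (\<forall>t\<in>{0..T}. (\<gamma> has_vector_derivative X (\<gamma> t)) (at t within {0..T})) \<and>
        (\<forall>t\<in>{0<..<T}. \<gamma> t \<in> H))"

text \<open>Graphs of the half-return maps, in the distances to the origin:
  \<open>return1 \<theta> r s\<close> means that the first half-return map sends \<open>r\<close> to \<open>s\<close>, and
  \<open>return2 \<theta> s r\<close> that the second one sends \<open>s\<close> to \<open>r\<close>.\<close>

definition return1 :: "params \<Rightarrow> real \<Rightarrow> real \<Rightarrow> bool" where
  "return1 \<theta> r s \<longleftrightarrow>
     r > 0 \<and> s > 0 \<and> solution_arc (upper_field \<theta>) upper_half (r, 0) (- s, 0)"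

definition return2 :: "params \<Rightarrow> real \<Rightarrow> real \<Rightarrow> bool" where
  "return2 \<theta> s r \<longleftrightarrow>
     s > 0 \<and> r > 0 \<and> solution_arc (lower_field \<theta>) lower_half (- s, 0) (r, 0)"

definition displacement_domain :: "params \<Rightarrow> real set" where
  "displacement_domain \<theta> = {r. (\<exists>s. return1 \<theta> r s) \<and> (\<exists>s. return2 \<theta> s r)}"

definition displacement :: "params \<Rightarrow> real \<Rightarrow> real" where
  "displacement \<theta> r = (THE s. return2 \<theta> s r) - (THE s. return1 \<theta> r s)"

text \<open>The displacement map is the sum of a convergent power series around \<open>a\<close>; this is
  a one-sided statement for \<open>a = 0\<close> and a two-sided one for \<open>a > 0\<close>.\<close>

definition displacement_series :: "params \<Rightarrow> real \<Rightarrow> (nat \<Rightarrow> real) \<Rightarrow> bool" where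
  "displacement_series \<theta> a c \<longleftrightarrow>
     (\<exists>\<rho>>0. \<forall>r>0. \<bar>r - a\<bar> < \<rho> \<longrightarrow>
        r \<in> displacement_domain \<theta> \<and> (\<lambda>k. c k * (r - a) ^ k) sums displacement \<theta> r)"

definition displacement_coeff :: "params \<Rightarrow> nat \<Rightarrow> real" where
  "displacement_coeff \<theta> = (THE w. w 0 = 0 \<and> displacement_series \<theta> 0 w)"

fun zero_traces :: "params \<Rightarrow> bool" where
  "zero_traces (d1, d2, l1, l2, m1, m2, n1, n2) \<longleftrightarrow> d1 = 0 \<and> d2 = 0"

definition weak_focus_of_order :: "params \<Rightarrow> nat \<Rightarrow> bool" where
  "weak_focus_of_order \<theta> k \<longleftrightarrow>
     zero_traces \<theta> \<and> k \<ge> 1 \<and>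
     (\<forall>i. 1 \<le> i \<and> i < k \<longrightarrow> displacement_coeff \<theta> i = 0) \<and> displacement_coeff \<theta> k \<noteq> 0"

text \<open>Both fields have second component \<open>x\<close> on the line \<open>y = 0\<close>. So they are transversal to
  that line and point to the same side everywhere but at the origin, an equilibrium of both: sliding motion does not occur, and every periodic orbit of
  the piecewise system obeys the crossing convention below.\<close>

definition crossing_solution :: "params \<Rightarrow> (real \<Rightarrow> real \<times> real) \<Rightarrow> bool" where
  "crossing_solution \<theta> \<gamma> \<longleftrightarrow>
     (\<forall>t.
       (\<gamma> t \<in> upper_half \<longrightarrow> (\<gamma> has_vector_derivative upper_field \<theta> (\<gamma> t)) (at t)) \<and>
       (\<gamma> t \<in> lower_half \<longrightarrow> (\<gamma> has_vector_derivative lower_field \<theta> (\<gamma> t)) (at t)) \<and>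
       (snd (\<gamma> t) = 0 \<longrightarrow>
          snd (upper_field \<theta> (\<gamma> t)) > 0 \<and> snd (lower_field \<theta> (\<gamma> t)) > 0 \<and>
          (\<gamma> has_vector_derivative lower_field \<theta> (\<gamma> t)) (at_left t) \<and>
          (\<gamma> has_vector_derivative upper_field \<theta> (\<gamma> t)) (at_right t)
        \<or> snd (upper_field \<theta> (\<gamma> t)) < 0 \<and> snd (lower_field \<theta> (\<gamma> t)) < 0 \<and>
          (\<gamma> has_vector_derivative upper_field \<theta> (\<gamma> t)) (at_left t) \<and>
          (\<gamma> has_vector_derivative lower_field \<theta> (\<gamma> t)) (at_right t)))"

definition periodic_orbit :: "params \<Rightarrow> (real \<times> real) set \<Rightarrow> bool" where
  "periodic_orbit \<theta> \<Gamma> \<longleftrightarrow>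
     (\<exists>\<gamma> T. crossing_solution \<theta> \<gamma> \<and> T > 0 \<and> (\<forall>t. \<gamma> (t + T) = \<gamma> t) \<and>
        (\<exists>t. \<gamma> t \<noteq> \<gamma> 0) \<and> \<Gamma> = range \<gamma>)"

definition crossing_limit_cycle :: "params \<Rightarrow> (real \<times> real) set \<Rightarrow> bool" where
  "crossing_limit_cycle \<theta> \<Gamma> \<longleftrightarrow>
     periodic_orbit \<theta> \<Gamma> \<and> (\<exists>p\<in>\<Gamma>. snd p = 0) \<and>
     (\<exists>N. open N \<and> \<Gamma> \<subseteq> N \<and> (\<forall>\<Gamma>'. periodic_orbit \<theta> \<Gamma>' \<and> \<Gamma>' \<subseteq> N \<longrightarrow> \<Gamma>' = \<Gamma>))"

definition displacement_zero_of_multiplicity :: "params \<Rightarrow> real \<Rightarrow> nat \<Rightarrow> bool" where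
  "displacement_zero_of_multiplicity \<theta> r k \<longleftrightarrow>
     r > 0 \<and> k \<ge> 1 \<and>
     (\<exists>c. displacement_series \<theta> r c \<and> (\<forall>i<k. c i = 0) \<and> c k \<noteq> 0)"

definition cycle_of_multiplicity :: "params \<Rightarrow> (real \<times> real) set \<Rightarrow> nat \<Rightarrow> bool" where
  "cycle_of_multiplicity \<theta> \<Gamma> k \<longleftrightarrow>
     (\<exists>r>0. (r, 0) \<in> \<Gamma> \<and> displacement_zero_of_multiplicity \<theta> r k)"

text \<open>The set \<open>C\<close> need not contain every limit cycle in \<open>U\<close>, as \<open>U\<close> may be large and
  contain further limit cycles that do not bifurcate from the origin.\<close>

definition unfolds_limit_cycles :: "params \<Rightarrow> nat \<Rightarrow> bool" where
  "unfolds_limit_cycles \<theta>\<^sub>0 k \<longleftrightarrow>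
     (\<forall>U V. open U \<and> (0, 0) \<in> U \<and> open V \<and> \<theta>\<^sub>0 \<in> V \<longrightarrow>
        (\<exists>\<theta>\<in>V. \<exists>C \<mu>. finite C \<and>
           (\<forall>\<Gamma>\<in>C. crossing_limit_cycle \<theta> \<Gamma> \<and> \<Gamma> \<subseteq> U \<and> (0, 0) \<in> inside \<Gamma> \<and>
              cycle_of_multiplicity \<theta> \<Gamma> (\<mu> \<Gamma>)) \<and>
           (\<Sum>\<Gamma>\<in>C. \<mu> \<Gamma>) = k))"

definition weak_focus_set :: "params set" where
  "weak_focus_set = {(d1, d2, l1, l2, m1, m2, n1, n2).
     d1 = 0 \<and> d2 = 0 \<and> 2 * l2 + 3 * n1 - n2 = 0 \<and> 2 * l1 - n1 + 3 * n2 = 0 \<and> m1 - m2 = 0 \<and>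
     m2 * (n1 + n2 - 1) * (n2 - n1) \<noteq> 0}"

end

theory Submission
  imports Defs "HOL-Complex_Analysis.Complex_Analysis"
begin

text \<open>In each half-plane write \<open>w = 1 - b y\<close> with \<open>b = 1\<close> above; reflecting in the \<open>x\<close>-axis and
  reversing time turns the lower half-plane into an upper one with \<open>b = - 1\<close> and parameters
  \<open>(- d2, - l2, m2, - n2)\<close>. The substitution \<open>z = x w^(l b)\<close> leads to the Lienard equation
  \<open>z dz + dG = z dF\<close> with \<open>G' = y (1 - n y) w^(2 l b - 1)\<close> and \<open>F' = (d + m y) w^(l b - 1)\<close>. Introducing
  \<open>v\<close> by \<open>v^2 / 2 = G y\<close>, one gets a rotation in the \<open>(z, v)\<close>-plane perturbed by a single analytic
  function, the damping \<open>\<phi> v = F'(y) dy/dv\<close>. Hence the leading term of the displacement map is a positive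
  multiple of the leading term of \<open>\<phi>2 - \<phi>1\<close>, of one degree higher.

  For vanishing traces \<open>\<phi> = m v X v\<close>, where \<open>X\<close> and \<open>y / v\<close> solve a first-order system of formal power
  series. Comparing the coefficients of the two half-planes gives the focal values up to order five;
  when they all vanish the parameters belong to one of three families on which \<open>\<phi>1 = \<phi>2\<close>.

  For the unfolding, perturbing \<open>l\<close>, then \<open>l2\<close>, \<open>m2\<close> and \<open>d1\<close> makes the lower
  coefficients nonzero one after the other with alternating signs, which yields four positive zeros.
  The fifth derivative of the displacement map does not vanish, so by Rolle's theorem these zeros, together with the
  zero at the origin, exhaust the multiplicity and are all simple. Each of them is the crossing of an explicit
  closed curve with the positive half-axis.\<close>

section \<open>Ordinary differential equations\<close>

text \<open>In the \<open>(z, v)\<close>-plane both half-systems perturb the same rotation over the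
  same half-turn, so the displacement is the difference of solutions of two equations that differ
  only in the damping; neither half-return map is ever computed. For complex initial values the
  difference of two solutions satisfies a linear equation whose coefficient is an averaged
  derivative, so difference quotients of a half-return map are explicit exponentials and the map is
  holomorphic. This pays twice: it gives the power series, and Cauchy's inequality turns uniform
  closeness of displacement maps into closeness of fifth derivatives. For this, one disc must serve
  an open set of parameters, hence the locales with uniform bounds. The bound \<open>1/40\<close> on
  the damping keeps solutions in the domain during a half-turn and the weights in the variation of
  constants within \<open>3/10\<close> of 1, so that a sign of \<open>\<phi>2 - \<phi>1\<close>
  passes to the displacement. An isolated zero is not yet an isolated periodic orbit: nearby orbits
  might close only after several turns. They are excluded at their largest crossing, where
  monotonicity of both half-return maps forces a zero.\<close>

lemma has_vector_derivative_continuous_on: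
  assumes "\<And>t. t \<in> S \<Longrightarrow> (u has_vector_derivative u' t) (at t within S)"
  shows "continuous_on S u"
  using assms has_vector_derivative_continuous unfolding continuous_on_eq_continuous_within by blast

text \<open>With \<open>L * T < 1\<close> the integral operator is already a contraction in the
  supremum norm. The application has \<open>L = 3/50\<close> and \<open>T = pi\<close>, so one
  interval covers the whole half-turn.\<close>

lemma picard_lindelof:
  fixes F :: "real \<Rightarrow> 'a::euclidean_space \<Rightarrow> 'a"
  assumes T: "0 \<le> T" and R: "0 \<le> R"
    and cont: "continuous_on ({0..T} \<times> cball x0 R) (\<lambda>(t, x). F t x)"
    and lip: "\<And>t x y. t \<in> {0..T} \<Longrightarrow> x \<in> cball x0 R \<Longrightarrow> y \<in> cball x0 R \<Longrightarrow> norm (F t x - F t y) \<le> L * norm (x - y)"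
    and L: "0 \<le> L" "L * T < 1"
    and bound: "\<And>t x. t \<in> {0..T} \<Longrightarrow> x \<in> cball x0 R \<Longrightarrow> norm (F t x) \<le> M"
    and MR: "M * T \<le> R"
  obtains u where "u 0 = x0" "\<And>t. t \<in> {0..T} \<Longrightarrow> u t \<in> cball x0 R"
    "\<And>t. t \<in> {0..T} \<Longrightarrow> (u has_vector_derivative F t (u t)) (at t within {0..T})"
proof -
  \<comment> \<open>Bounded continuous functions are defined on the whole line, so time is clamped
    to \<open>{0..T}\<close>.\<close>
  define cl where "cl t = max 0 (min T t)" for t :: real
  have cl: "cl t \<in> {0..T}" for t using T by (auto simp: cl_def)
  have cl_id: "t \<in> {0..T} \<Longrightarrow> cl t = t" for t by (auto simp: cl_def)
  have cl_cont: "continuous_on UNIV cl" unfolding cl_def by (intro continuous_intros)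
  define S where "S = (PiC UNIV (\<lambda>_. cball x0 R) :: (real \<Rightarrow>\<^sub>C 'a) set)"
  have inS: "u \<in> S \<longleftrightarrow> (\<forall>t. apply_bcontfun u t \<in> cball x0 R)" for u
    by (auto simp: S_def mem_PiC_iff)
  define I where "I u t = x0 + integral {0..t} (\<lambda>s. F s (apply_bcontfun u s))" for u :: "real \<Rightarrow>\<^sub>C 'a" and t
  have Fcont: "continuous_on {0..T} (\<lambda>s. F s (apply_bcontfun u s))" if "u \<in> S" for u
    using that
    by (intro continuous_on_compose2[OF cont, where f = "\<lambda>s. (s, apply_bcontfun u s)", simplified])
       (auto intro!: continuous_intros simp: inS)
  have Fint: "(\<lambda>s. F s (apply_bcontfun u s)) integrable_on {0..t}" if "u \<in> S" "t \<in> {0..T}" for u t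
    using that by (intro integrable_continuous_interval continuous_on_subset[OF Fcont]) auto
  have Ider: "(I u has_vector_derivative F t (apply_bcontfun u t)) (at t within {0..T})"
    if "u \<in> S" "t \<in> {0..T}" for u t
    unfolding I_def using integral_has_vector_derivative[OF Fcont[OF that(1)] that(2)]
    by (auto intro!: derivative_eq_intros)
  have Icont: "continuous_on {0..T} (I u)" if "u \<in> S" for u
    by (rule has_vector_derivative_continuous_on) (rule Ider[OF that])
  have "norm (F 0 x0) \<le> M" using T R by (intro bound) auto
  then have M0: "0 \<le> M" by (rule order_trans[OF norm_ge_zero])
  have Ibd: "I u t \<in> cball x0 R" if "u \<in> S" "t \<in> {0..T}" for u t
  proof -
    have "norm (integral {0..t} (\<lambda>s. F s (apply_bcontfun u s))) \<le> M * (t - 0)"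
      using that bound inS by (intro integral_bound continuous_on_subset[OF Fcont]) auto
    also have "\<dots> \<le> M * T" using that M0 by (intro mult_left_mono) auto
    finally show ?thesis using MR by (auto simp: I_def dist_norm)
  qed
  define \<Phi> where "\<Phi> u = Bcontfun (\<lambda>t. I u (cl t))" for u
  have \<Phi>: "apply_bcontfun (\<Phi> u) t = I u (cl t)" if "u \<in> S" for u t
  proof -
    have "(\<lambda>t. I u (cl t)) \<in> bcontfun"
    proof (rule bcontfun_normI)
      show "continuous_on UNIV (\<lambda>t. I u (cl t))"
        by (rule continuous_on_compose2[OF Icont[OF that] cl_cont]) (use cl in auto)
      show "norm (I u (cl t)) \<le> norm x0 + R" for t
        using Ibd[OF that cl[of t]] norm_triangle_sub[of "I u (cl t)" x0] by (simp add: dist_norm norm_minus_commute)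
    qed
    then show ?thesis by (simp add: \<Phi>_def Bcontfun_inverse)
  qed
  have "\<exists>!u. u \<in> S \<and> \<Phi> u = u"
  proof (rule Banach_fix[where c = "L * T"])
    show "complete S" unfolding S_def complete_eq_closed by (intro closed_PiC) auto
    have "const_bcontfun x0 \<in> S" using R by (auto simp: inS const_bcontfun.rep_eq)
    then show "S \<noteq> {}" by blast
    show "0 \<le> L * T" using L T by simp
    show "L * T < 1" by fact
    show "\<Phi> ` S \<subseteq> S" using \<Phi> Ibd cl by (auto simp: inS)
    show "dist (\<Phi> u) (\<Phi> w) \<le> L * T * dist u w" if "u \<in> S" "w \<in> S" for u w
    proof (rule dist_bound)
      fix t
      let ?t = "cl t"
      have t: "?t \<in> {0..T}" by (rule cl)
      have "I u ?t - I w ?t = integral {0..?t} (\<lambda>s. F s (apply_bcontfun u s) - F s (apply_bcontfun w s))"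
        unfolding I_def by (subst integral_diff) (use Fint that t in auto)
      also have "norm \<dots> \<le> (L * dist u w) * (?t - 0)"
      proof (rule integral_bound)
        show "continuous_on {0..?t} (\<lambda>s. F s (apply_bcontfun u s) - F s (apply_bcontfun w s))"
          using t that by (intro continuous_intros continuous_on_subset[OF Fcont]) auto
        show "norm (F s (apply_bcontfun u s) - F s (apply_bcontfun w s)) \<le> L * dist u w" if s: "s \<in> {0..?t}" for s
        proof -
          have "norm (F s (apply_bcontfun u s) - F s (apply_bcontfun w s)) \<le> L * norm (apply_bcontfun u s - apply_bcontfun w s)"
            using \<open>u \<in> S\<close> \<open>w \<in> S\<close> inS s t by (intro lip) auto
          also have "\<dots> \<le> L * dist u w"
            using dist_bounded[of u s w] L by (intro mult_left_mono) (auto simp: dist_norm)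
          finally show ?thesis .
        qed
      qed (use t in auto)
      also have "\<dots> \<le> (L * dist u w) * T" using t L by (intro mult_left_mono) auto
      finally show "dist (apply_bcontfun (\<Phi> u) t) (apply_bcontfun (\<Phi> w) t) \<le> L * T * dist u w"
        using that by (simp add: \<Phi> dist_norm mult_ac)
    qed
  qed
  then obtain u where u: "u \<in> S" "\<Phi> u = u" by auto
  have eq: "apply_bcontfun u t = I u t" if "t \<in> {0..T}" for t
    using \<Phi>[OF u(1), of t] u(2) cl_id[OF that] by simp
  show thesis
  proof (rule that[of "I u"])
    show "I u 0 = x0" by (simp add: I_def)
    show "I u t \<in> cball x0 R" if "t \<in> {0..T}" for t using Ibd[OF u(1) that] .
    show "(I u has_vector_derivative F t (I u t)) (at t within {0..T})" if "t \<in> {0..T}" for t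
      using Ider[OF u(1) that] eq[OF that] by simp
  qed
qed

text \<open>A Gronwall argument: the squared distance times \<open>exp (- 2 * L * t)\<close> is
  nonincreasing and starts at zero. The Lipschitz estimate is asked only along the two solutions,
  which suits fields that are Lipschitz on bounded sets.\<close>

lemma ode_unique:
  fixes u w :: "real \<Rightarrow> 'a::real_inner"
  assumes u: "\<And>t. t \<in> {a..b} \<Longrightarrow> (u has_vector_derivative F t (u t)) (at t within {a..b})"
    and w: "\<And>t. t \<in> {a..b} \<Longrightarrow> (w has_vector_derivative F t (w t)) (at t within {a..b})"
    and lip: "\<And>t. t \<in> {a..b} \<Longrightarrow> norm (F t (u t) - F t (w t)) \<le> L * norm (u t - w t)"
    and eq: "u a = w a" and t: "t \<in> {a..b}"
  shows "u t = w t"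
proof -
  define D where "D t = u t - w t" for t
  define e where "e t = (D t \<bullet> D t) * exp (- 2 * L * t)" for t
  have D': "(D has_vector_derivative F t (u t) - F t (w t)) (at t within {a..b})" if "t \<in> {a..b}" for t
    unfolding D_def using u[OF that] w[OF that] by (rule has_vector_derivative_diff)
  have e': "(e has_real_derivative ((2 * (D s \<bullet> (F s (u s) - F s (w s))) - 2 * L * (D s \<bullet> D s)) * exp (- 2 * L * s))) (at s within {a..b})"
    if "s \<in> {a..b}" for s
  proof -
    have "(e has_derivative (\<lambda>h. h * ((2 * (D s \<bullet> (F s (u s) - F s (w s))) - 2 * L * (D s \<bullet> D s)) * exp (- 2 * L * s)))) (at s within {a..b})"
      unfolding e_def using D'[OF that] unfolding has_vector_derivative_def
      by (auto intro!: derivative_eq_intros simp: algebra_simps inner_commute)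
    then show ?thesis by (simp add: has_field_derivative_def mult.commute[of _ "_ * _"] fun_eq_iff mult_commute_abs)
  qed
  have "e t \<le> e a"
  proof (rule DERIV_nonpos_imp_decreasing_open[of a t])
    show "a \<le> t" using t by simp
    show "continuous_on {a..t} e"
      by (rule continuous_on_subset[OF DERIV_continuous_on[OF e']]) (use t in auto)
    fix s assume s: "a < s" "s < t"
    have "D s \<bullet> (F s (u s) - F s (w s)) \<le> norm (D s) * norm (F s (u s) - F s (w s))"
      by (rule norm_cauchy_schwarz)
    also have "\<dots> \<le> norm (D s) * (L * norm (D s))"
      using lip[of s] s t by (intro mult_left_mono) (auto simp: D_def)
    also have "\<dots> = L * (D s \<bullet> D s)" by (simp add: dot_square_norm power2_eq_square)
    finally have "(2 * (D s \<bullet> (F s (u s) - F s (w s))) - 2 * L * (D s \<bullet> D s)) * exp (- 2 * L * s) \<le> 0"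
      by (intro mult_nonpos_nonneg) auto
    moreover have "at s within {a..b} = at s" using s t by (intro at_within_interior) auto
    ultimately show "\<exists>y. (e has_real_derivative y) (at s) \<and> y \<le> 0"
      using e'[of s] s t by (auto intro!: exI)
  qed
  moreover have "e a = 0" by (simp add: e_def D_def eq)
  ultimately have "D t \<bullet> D t \<le> 0"
    by (simp add: e_def mult_le_0_iff not_le[symmetric])
  then have "D t \<bullet> D t = 0" by (intro antisym) auto
  then show ?thesis by (simp add: D_def)
qed

text \<open>Variation of constants, with integrating factor
  \<open>exp (- integral {0..t} A)\<close>. It serves twice: with \<open>B = 0\<close> for two
  solutions of one equation, and with a forcing term for solutions of two equations.\<close>

lemma linear_ode_formula:
  fixes A B D :: "real \<Rightarrow> complex"
  assumes T: "0 \<le> T" and A: "continuous_on {0..T} A" and B: "continuous_on {0..T} B"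
    and D: "\<And>t. t \<in> {0..T} \<Longrightarrow> (D has_vector_derivative A t * D t + B t) (at t within {0..T})"
  shows "D T = exp (integral {0..T} A) * (D 0 + integral {0..T} (\<lambda>t. exp (- integral {0..t} A) * B t))"
proof -
  define E where "E t = exp (- integral {0..t} A)" for t
  have E: "(E has_vector_derivative - A t * E t) (at t within {0..T})" if "t \<in> {0..T}" for t
  proof -
    have 1: "((\<lambda>t. - integral {0..t} A) has_vector_derivative - A t) (at t within {0..T})"
      using integral_has_vector_derivative[OF A that] by (rule has_vector_derivative_minus)
    show ?thesis
      using field_vector_diff_chain_within[OF 1 has_field_derivative_at_within[OF DERIV_exp]]
      by (simp add: E_def[abs_def] o_def)
  qed
  have "((\<lambda>t. E t * B t) has_integral E T * D T - E 0 * D 0) {0..T}"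
  proof (rule fundamental_theorem_of_calculus[OF T])
    fix t assume t: "t \<in> {0..T}"
    show "((\<lambda>t. E t * D t) has_vector_derivative E t * B t) (at t within {0..T})"
      using has_vector_derivative_mult[OF E[OF t] D[OF t]] by (simp add: algebra_simps)
  qed
  then have "integral {0..T} (\<lambda>t. E t * B t) = E T * D T - E 0 * D 0" by (rule integral_unique)
  moreover have "E 0 = 1" by (simp add: E_def)
  moreover have "exp (integral {0..T} A) * E T = 1" by (simp add: E_def exp_minus)
  ultimately show ?thesis unfolding E_def[symmetric]
    by (simp add: algebra_simps)
qed

text \<open>Hadamard's form of the difference quotient, the mean of the derivative over a segment.
  It is continuous also across \<open>x = y\<close> and makes the difference of two solutions a
  solution of a linear equation.\<close>

definition div_diff :: "(real \<Rightarrow> complex \<Rightarrow> complex) \<Rightarrow> real \<Rightarrow> complex \<Rightarrow> complex \<Rightarrow> complex" where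
  "div_diff f' t x y = integral (cbox 0 1) (\<lambda>s. f' t (y + of_real s * (x - y)))"

context
  fixes f f' :: "real \<Rightarrow> complex \<Rightarrow> complex" and I :: "real set" and S :: "complex set"
  assumes S: "convex S"
    and deriv: "\<And>t x. t \<in> I \<Longrightarrow> x \<in> S \<Longrightarrow> (f t has_field_derivative f' t x) (at x)"
    and cont: "continuous_on (I \<times> S) (\<lambda>(t, x). f' t x)"
begin

lemma segment_in: "x \<in> S \<Longrightarrow> y \<in> S \<Longrightarrow> s \<in> {0..1} \<Longrightarrow> y + of_real s * (x - y) \<in> S"
  using convexD_alt[OF S, of y x s] by (auto simp: algebra_simps scaleR_conv_of_real)

lemma div_diff: 
  assumes "t \<in> I" "x \<in> S" "y \<in> S"
  shows "f t x - f t y = div_diff f' t x y * (x - y)"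
proof -
  have "((\<lambda>s. f' t (y + of_real s * (x - y)) * (x - y)) has_integral
      f t (y + of_real 1 * (x - y)) - f t (y + of_real 0 * (x - y))) {0..1::real}"
  proof (rule fundamental_theorem_of_calculus)
    fix s :: real assume s: "s \<in> {0..1}"
    have 1: "((\<lambda>s. y + of_real s * (x - y)) has_vector_derivative (x - y)) (at s within {0..1})"
      by (auto intro!: derivative_eq_intros)
    show "((\<lambda>s. f t (y + of_real s * (x - y))) has_vector_derivative f' t (y + of_real s * (x - y)) * (x - y)) (at s within {0..1})"
      using field_vector_diff_chain_within[OF 1, of "f t" "f' t (y + of_real s * (x - y))"]
        deriv[OF assms(1) segment_in[OF assms(2,3) s]]
      by (auto simp: o_def mult.commute intro: has_field_derivative_at_within)
  qed simp
  then have "((\<lambda>s. f' t (y + of_real s * (x - y)) * (x - y)) has_integral f t x - f t y) (cbox 0 1)" by simp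
  moreover have "continuous_on (cbox 0 1) (\<lambda>s. f' t (y + of_real s * (x - y)))"
    by (rule continuous_on_compose2[OF cont, where f = "\<lambda>s. (t, y + of_real s * (x - y))", simplified])
       (use assms segment_in in \<open>auto intro!: continuous_intros\<close>)
  then have "((\<lambda>s. f' t (y + of_real s * (x - y)) * (x - y)) has_integral div_diff f' t x y * (x - y)) (cbox 0 1)"
    unfolding div_diff_def by (intro has_integral_mult_left integrable_integral integrable_continuous)
  ultimately show ?thesis by (rule has_integral_unique)
qed

lemma continuous_on_div_diff:
  "continuous_on (I \<times> S \<times> S) (\<lambda>(t, x, y). div_diff f' t x y)"
proof -
  have "continuous_on ((I \<times> S \<times> S) \<times> cbox 0 1) (\<lambda>(p, s). f' (fst p) (snd (snd p) + of_real s * (fst (snd p) - snd (snd p))))"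
    unfolding split_beta
    by (rule continuous_on_compose2[OF cont, where f = "\<lambda>(p, s). (fst p, snd (snd p) + of_real s * (fst (snd p) - snd (snd p)))", unfolded split_beta, simplified])
       (use segment_in in \<open>auto intro!: continuous_intros\<close>)
  from integral_continuous_on_param[OF this] show ?thesis
    by (simp add: div_diff_def split_beta)
qed

lemma norm_div_diff_le:
  assumes "t \<in> I" "x \<in> S" "y \<in> S" "\<And>x. x \<in> S \<Longrightarrow> norm (f' t x) \<le> L"
  shows "norm (div_diff f' t x y) \<le> L"
proof -
  have "norm (integral {0..1} (\<lambda>s. f' t (y + of_real s * (x - y)))) \<le> L * (1 - 0)"
  proof (rule integral_bound)
    show "continuous_on {0..1} (\<lambda>s. f' t (y + of_real s * (x - y)))"
      by (rule continuous_on_compose2[OF cont, where f = "\<lambda>s. (t, y + of_real s * (x - y))", simplified])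
         (use assms segment_in in \<open>auto intro!: continuous_intros\<close>)
  qed (use assms segment_in in auto)
  then show ?thesis by (simp add: div_diff_def)
qed

end

section \<open>Damped rotations in polar coordinates\<close>

text \<open>With \<open>z = w cos t\<close> and \<open>v = w sin t\<close> the equation \<open>z dz + v dv = z \<phi>(v) dv\<close> reads \<open>dw/dt = polar_rhs \<phi> t w\<close>.\<close>

definition polar_rhs :: "(complex \<Rightarrow> complex) \<Rightarrow> real \<Rightarrow> complex \<Rightarrow> complex" where
  "polar_rhs \<phi> t w = w * of_real ((cos t)\<^sup>2) * \<phi> (w * of_real (sin t)) /
     (1 - of_real (cos t * sin t) * \<phi> (w * of_real (sin t)))"

definition polar_rhs_deriv :: "(complex \<Rightarrow> complex) \<Rightarrow> real \<Rightarrow> complex \<Rightarrow> complex" where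
  "polar_rhs_deriv \<phi> t w =
     of_real ((cos t)\<^sup>2) * \<phi> (w * of_real (sin t)) /
       (1 - of_real (cos t * sin t) * \<phi> (w * of_real (sin t))) +
     of_real ((cos t)\<^sup>2 * sin t) * (w * deriv \<phi> (w * of_real (sin t))) /
       (1 - of_real (cos t * sin t) * \<phi> (w * of_real (sin t)))\<^sup>2"

lemma norm_mult_sin_le: "norm (w * complex_of_real (sin t)) \<le> norm w"
  by (simp add: norm_mult mult_left_le)

lemma norm_mult_sin_less: "norm w < d \<Longrightarrow> norm (w * complex_of_real (sin t)) < d"
  using norm_mult_sin_le[of w t] by linarith

lemma abs_cos_sin_le_1: "\<bar>cos t * sin t :: real\<bar> \<le> 1"
  by (simp add: abs_mult mult_le_one)

lemma pi_bound: "pi \<le> 16/5"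
  using pi_approx by simp

text \<open>The condition \<open>sym\<close> makes the damping real on the real axis. The bound
  \<open>1/40\<close> yields the Lipschitz constant \<open>3/50\<close>, and
  \<open>3/50 * pi < 1/5\<close> is small enough for the contraction and for the later estimates of
  exponentials.\<close>

locale damping =
  fixes \<phi> :: "complex \<Rightarrow> complex" and \<delta> :: real
  assumes delta_pos: "0 < \<delta>"
    and holo: "\<phi> holomorphic_on ball 0 \<delta>"
    and bound: "\<And>v. norm v < \<delta> \<Longrightarrow> norm (\<phi> v) \<le> 1/40"
    and sym: "\<And>v. norm v < \<delta> \<Longrightarrow> \<phi> (cnj v) = cnj (\<phi> v)"
begin

lemma norm_denom_diff:
  assumes "norm w < \<delta>"
  shows "norm (of_real (cos t * sin t) * \<phi> (w * of_real (sin t))) \<le> 1/40"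
proof -
  have "\<bar>cos t * sin t\<bar> * norm (\<phi> (w * of_real (sin t))) \<le> 1 * (1/40)"
    by (intro mult_mono bound norm_mult_sin_less assms abs_cos_sin_le_1) auto
  then show ?thesis by (simp add: norm_mult abs_mult)
qed

lemma norm_denom_ge:
  assumes "norm w < \<delta>"
  shows "norm (1 - of_real (cos t * sin t) * \<phi> (w * of_real (sin t))) \<ge> 39/40"
  using norm_denom_diff[OF assms, of t]
    norm_triangle_ineq2[of 1 "of_real (cos t * sin t) * \<phi> (w * of_real (sin t))"] 
  unfolding norm_one by linarith

lemma denom_nz:
  assumes "norm w < \<delta>"
  shows "1 - of_real (cos t * sin t) * \<phi> (w * of_real (sin t)) \<noteq> 0"
  using norm_denom_ge[OF assms, of t] by force

lemma has_field_derivative_symbol: "norm v < \<delta> \<Longrightarrow> (\<phi> has_field_derivative deriv \<phi> v) (at v)"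
  using holomorphic_derivI[OF holo open_ball] by simp

lemma polar_rhs_has_derivative:
  assumes "norm w < \<delta>"
  shows "(polar_rhs \<phi> t has_field_derivative polar_rhs_deriv \<phi> t w) (at w)"
proof -
  have 1: "((\<lambda>w. \<phi> (w * of_real (sin t))) has_field_derivative deriv \<phi> (w * of_real (sin t)) * of_real (sin t)) (at w)"
    by (rule DERIV_chain2[where f = \<phi> and g = "\<lambda>w. w * of_real (sin t)", OF has_field_derivative_symbol[OF norm_mult_sin_less[OF assms, of t]]])
       (auto intro!: derivative_eq_intros)
  show ?thesis
    unfolding polar_rhs_def[abs_def] polar_rhs_deriv_def
    by (rule derivative_eq_intros 1 refl denom_nz[OF assms])+
       (use denom_nz[OF assms, of t] in \<open>simp add: divide_simps; simp add: algebra_simps power2_eq_square\<close>)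
qed

lemma continuous_on_symbol: "continuous_on (ball 0 \<delta>) \<phi>"
  by (rule holomorphic_on_imp_continuous_on[OF holo])

lemma continuous_on_symbol_deriv: "continuous_on (ball 0 \<delta>) (deriv \<phi>)"
  by (rule holomorphic_on_imp_continuous_on[OF holomorphic_deriv[OF holo open_ball]])

lemma continuous_on_polar_rhs: "continuous_on (UNIV \<times> ball 0 \<delta>) (\<lambda>(t, w). polar_rhs \<phi> t w)"
  unfolding polar_rhs_def split_beta
  by (intro continuous_intros continuous_on_compose2[OF continuous_on_symbol])
     (use norm_mult_sin_less denom_nz in \<open>auto simp: dist_norm\<close>)

lemma continuous_on_polar_rhs_deriv: "continuous_on (UNIV \<times> ball 0 \<delta>) (\<lambda>(t, w). polar_rhs_deriv \<phi> t w)"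
  unfolding polar_rhs_deriv_def split_beta
  by (intro continuous_intros continuous_on_compose2[OF continuous_on_symbol] continuous_on_compose2[OF continuous_on_symbol_deriv])
     (use norm_mult_sin_less denom_nz in \<open>auto simp: dist_norm\<close>)

text \<open>Cauchy's estimate on a disc of radius \<open>\<delta>/2\<close> bounds the derivative by
  \<open>1/(20 * \<delta>)\<close>; the factor \<open>w\<close> compensates the denominator, so the
  result does not depend on \<open>\<delta>\<close>.\<close>

lemma norm_mult_deriv_le:
  assumes "norm w < \<delta>/2"
  shows "norm (w * deriv \<phi> (w * of_real (sin t))) \<le> 1/40"
proof -
  let ?v = "w * of_real (sin t)"
  have v: "norm ?v < \<delta>/2" by (rule norm_mult_sin_less[OF assms])
  have sub: "cball ?v (\<delta>/2) \<subseteq> ball 0 \<delta>"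
  proof
    fix x assume "x \<in> cball ?v (\<delta>/2)"
    then have "norm (x - ?v) \<le> \<delta>/2" by (simp add: dist_norm norm_minus_commute)
    then show "x \<in> ball 0 \<delta>" using v norm_triangle_sub[of x ?v] by simp
  qed
  have "norm ((deriv ^^ 1) \<phi> ?v) \<le> fact 1 * (1/40) / (\<delta>/2) ^ 1"
  proof (rule Cauchy_inequality)
    show "\<phi> holomorphic_on ball ?v (\<delta>/2)"
      by (rule holomorphic_on_subset[OF holo]) (use sub ball_subset_cball in blast)
    show "continuous_on (cball ?v (\<delta>/2)) \<phi>"
      by (rule continuous_on_subset[OF continuous_on_symbol sub])
    show "norm (\<phi> x) \<le> 1/40" if "norm (?v - x) = \<delta>/2" for x
      using sub that by (intro bound) (auto simp: dist_norm subset_iff)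
  qed (use delta_pos in auto)
  then have "norm (deriv \<phi> ?v) \<le> 1/(20 * \<delta>)" by simp
  then have "norm w * norm (deriv \<phi> ?v) \<le> (\<delta>/2) * (1/(20 * \<delta>))"
    using assms delta_pos by (intro mult_mono) auto
  then show ?thesis using delta_pos by (simp add: norm_mult)
qed

text \<open>The two terms of the derivative are bounded by \<open>1/39\<close> and
  \<open>40/1521\<close>, whose sum is below \<open>3/50\<close>.\<close>

lemma norm_polar_rhs_deriv_le:
  assumes "norm w < \<delta>/2"
  shows "norm (polar_rhs_deriv \<phi> t w) \<le> 3/50"
proof -
  have w: "norm w < \<delta>" using assms delta_pos by linarith
  let ?d = "1 - of_real (cos t * sin t) * \<phi> (w * of_real (sin t))"
  note d = norm_denom_ge[OF w, of t]
  have c2: "norm (complex_of_real ((cos t)\<^sup>2)) \<le> 1"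
    by (simp add: norm_power abs_square_le_1)
  have c2s: "norm (complex_of_real ((cos t)\<^sup>2 * sin t)) \<le> 1"
    by (simp add: norm_mult norm_power abs_square_le_1 mult_le_one)
  have "norm (of_real ((cos t)\<^sup>2) * \<phi> (w * of_real (sin t)) / ?d) \<le> (1 * (1/40)) / (39/40)"
    unfolding norm_divide norm_mult
    by (intro frac_le mult_mono c2 bound[OF norm_mult_sin_less[OF w]] d) auto
  moreover have "norm (of_real ((cos t)\<^sup>2 * sin t) * (w * deriv \<phi> (w * of_real (sin t))) / ?d\<^sup>2) \<le> (1 * (1/40)) / (39/40)\<^sup>2"
    unfolding norm_divide norm_mult[of "of_real ((cos t)\<^sup>2 * sin t)"] norm_power
    by (intro frac_le mult_mono power_mono c2s norm_mult_deriv_le[OF assms] d) auto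
  ultimately show ?thesis
    unfolding polar_rhs_deriv_def
    by (intro norm_triangle_le) (simp add: power2_eq_square)
qed

lemma polar_rhs_lipschitz:
  assumes "norm x < \<delta>/2" "norm y < \<delta>/2"
  shows "norm (polar_rhs \<phi> t x - polar_rhs \<phi> t y) \<le> 3/50 * norm (x - y)"
proof -
  show ?thesis
  proof (rule field_differentiable_bound[where S = "ball 0 (\<delta>/2)" and f = "polar_rhs \<phi> t" and f' = "polar_rhs_deriv \<phi> t"])
    show "(polar_rhs \<phi> t has_field_derivative polar_rhs_deriv \<phi> t z) (at z within ball 0 (\<delta>/2))"
      if "z \<in> ball 0 (\<delta>/2)" for z
      using that delta_pos by (intro has_field_derivative_at_within[OF polar_rhs_has_derivative]) auto
    show "norm (polar_rhs_deriv \<phi> t z) \<le> 3/50" if "z \<in> ball 0 (\<delta>/2)" for z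
      using that by (intro norm_polar_rhs_deriv_le) simp
  qed (use assms in simp_all)
qed

lemma norm_polar_rhs_le: "norm x < \<delta>/2 \<Longrightarrow> norm (polar_rhs \<phi> t x) \<le> 3/50 * norm x"
  using polar_rhs_lipschitz[of x 0 t] delta_pos by (simp add: polar_rhs_def)

text \<open>An arbitrary choice that \<open>polar_sol_unique\<close> shows to be harmless. Starting
  below \<open>\<delta>/4\<close> and moving by at most half the initial modulus keeps the solution
  below \<open>\<delta>/2\<close>, where the Lipschitz bound holds.\<close>

definition polar_sol :: "complex \<Rightarrow> real \<Rightarrow> complex" where
  "polar_sol x = (SOME u. u 0 = x \<and> (\<forall>t\<in>{0..pi}. u t \<in> cball x (norm x / 2) \<and>
     (u has_vector_derivative polar_rhs \<phi> t (u t)) (at t within {0..pi})))"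

definition half_return :: "complex \<Rightarrow> complex" where
  "half_return x = polar_sol x pi"

lemma in_cball_half: "norm x < \<delta>/4 \<Longrightarrow> u \<in> cball x (norm x / 2) \<Longrightarrow> norm u < \<delta>/2"
  using norm_triangle_sub[of u x] delta_pos by (simp add: dist_norm norm_minus_commute)

lemma polar_sol:
  assumes x: "norm x < \<delta>/4"
  shows "polar_sol x 0 = x"
    "\<And>t. t \<in> {0..pi} \<Longrightarrow> polar_sol x t \<in> cball x (norm x / 2)"
    "\<And>t. t \<in> {0..pi} \<Longrightarrow> (polar_sol x has_vector_derivative polar_rhs \<phi> t (polar_sol x t)) (at t within {0..pi})"
proof -
  note nb = in_cball_half[OF x]
  have sub: "{0..pi} \<times> cball x (norm x / 2) \<subseteq> UNIV \<times> ball 0 \<delta>" using nb delta_pos by fastforce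
  have "\<exists>u. u 0 = x \<and> (\<forall>t\<in>{0..pi}. u t \<in> cball x (norm x / 2) \<and>
     (u has_vector_derivative polar_rhs \<phi> t (u t)) (at t within {0..pi}))"
  \<comment> \<open>The speed is at most \<open>3/50\<close> times the modulus, hence
    \<open>3/50 * (3/2 * norm x)\<close> on the ball; over a half-turn this amounts to at most
    \<open>norm x / 2\<close>, so the ball is not left.\<close>
  proof (rule picard_lindelof[where T = pi and R = "norm x / 2" and F = "polar_rhs \<phi>" and L = "3/50" and M = "3/50 * (3/2 * norm x)" and ?x0.0 = x])
    show "continuous_on ({0..pi} \<times> cball x (norm x / 2)) (\<lambda>(t, x). polar_rhs \<phi> t x)"
      by (rule continuous_on_subset[OF continuous_on_polar_rhs sub])
    show "norm (polar_rhs \<phi> t y) \<le> 3/50 * (3/2 * norm x)" if "y \<in> cball x (norm x / 2)" for t y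
    proof -
      have "norm (polar_rhs \<phi> t y) \<le> 3/50 * norm y" by (rule norm_polar_rhs_le[OF nb[OF that]])
      also have "norm y \<le> 3/2 * norm x" using that norm_triangle_sub[of y x] by (simp add: dist_norm norm_minus_commute)
      finally show ?thesis by simp
    qed
    show "3/50 * pi < 1" using pi_bound by simp
    have "norm x * pi \<le> norm x * (16/5)" using pi_bound by (intro mult_left_mono) auto
    then have "norm x * pi * 9 \<le> norm x * 50" using norm_ge_zero[of x] by linarith
    then show "3/50 * (3/2 * norm x) * pi \<le> norm x / 2" by (simp add: mult_ac)
    show "norm (polar_rhs \<phi> t y - polar_rhs \<phi> t z) \<le> 3/50 * norm (y - z)"
      if "y \<in> cball x (norm x / 2)" "z \<in> cball x (norm x / 2)" for t y z
      by (rule polar_rhs_lipschitz[OF nb[OF that(1)] nb[OF that(2)]])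
    show "\<exists>u. u 0 = x \<and> (\<forall>t\<in>{0..pi}. u t \<in> cball x (norm x / 2) \<and>
       (u has_vector_derivative polar_rhs \<phi> t (u t)) (at t within {0..pi}))"
      if "u 0 = x" "\<And>t. t \<in> {0..pi} \<Longrightarrow> u t \<in> cball x (norm x / 2)"
        "\<And>t. t \<in> {0..pi} \<Longrightarrow> (u has_vector_derivative polar_rhs \<phi> t (u t)) (at t within {0..pi})" for u
      using that by blast
  qed auto
  from someI_ex[OF this] show "polar_sol x 0 = x"
    "\<And>t. t \<in> {0..pi} \<Longrightarrow> polar_sol x t \<in> cball x (norm x / 2)"
    "\<And>t. t \<in> {0..pi} \<Longrightarrow> (polar_sol x has_vector_derivative polar_rhs \<phi> t (polar_sol x t)) (at t within {0..pi})"
    unfolding polar_sol_def[symmetric] by blast+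
qed

lemma norm_polar_sol_less: "norm x < \<delta>/4 \<Longrightarrow> t \<in> {0..pi} \<Longrightarrow> norm (polar_sol x t) < \<delta>/2"
  using in_cball_half polar_sol(2) by blast

lemma norm_polar_sol_le: "norm x < \<delta>/4 \<Longrightarrow> t \<in> {0..pi} \<Longrightarrow> norm (polar_sol x t) \<le> 3/2 * norm x"
  using polar_sol(2)[of x t] norm_triangle_sub[of "polar_sol x t" x] by (simp add: dist_norm norm_minus_commute)

lemma continuous_on_polar_sol: "norm x < \<delta>/4 \<Longrightarrow> continuous_on {0..pi} (polar_sol x)"
  using polar_sol(3) by (rule has_vector_derivative_continuous_on)

lemma polar_sol_unique:
  assumes x: "norm x < \<delta>/4" and u0: "u 0 = x"
    and ub: "\<And>t. t \<in> {0..pi} \<Longrightarrow> norm (u t) < \<delta>/2"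
    and u: "\<And>t. t \<in> {0..pi} \<Longrightarrow> (u has_vector_derivative polar_rhs \<phi> t (u t)) (at t within {0..pi})"
    and t: "t \<in> {0..pi}"
  shows "u t = polar_sol x t"
  by (rule ode_unique[where F = "polar_rhs \<phi>" and L = "3/50", OF u polar_sol(3)[OF x] polar_rhs_lipschitz])
     (use ub t norm_polar_sol_less[OF x] polar_sol(1)[OF x] u0 in auto)

lemma polar_rhs_cnj: "norm w < \<delta> \<Longrightarrow> polar_rhs \<phi> t (cnj w) = cnj (polar_rhs \<phi> t w)"
  using sym[OF norm_mult_sin_less, of w t] by (simp add: polar_rhs_def)

text \<open>Conjugates of solutions are solutions; by uniqueness, real initial values therefore give
  real solutions.\<close>

lemma polar_sol_cnj:
  assumes x: "norm x < \<delta>/4" and t: "t \<in> {0..pi}"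
  shows "polar_sol (cnj x) t = cnj (polar_sol x t)"
proof -
  have "cnj (polar_sol x t) = polar_sol (cnj x) t"
  proof (rule polar_sol_unique[where u = "\<lambda>t. cnj (polar_sol x t)"])
    fix s assume s: "s \<in> {0..pi}"
    have *: "((\<lambda>t. cnj (polar_sol x t)) has_vector_derivative cnj (polar_rhs \<phi> s (polar_sol x s))) (at s within {0..pi})"
      by (rule bounded_linear.has_vector_derivative[OF bounded_linear_cnj polar_sol(3)[OF x s]])
    have "norm (polar_sol x s) < \<delta>" using norm_polar_sol_less[OF x s] delta_pos by linarith
    then show "((\<lambda>t. cnj (polar_sol x t)) has_vector_derivative polar_rhs \<phi> s (cnj (polar_sol x s))) (at s within {0..pi})"
      using * by (simp add: polar_rhs_cnj)
  qed (use x t polar_sol(1)[OF x] norm_polar_sol_less[OF x] in auto)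
  then show ?thesis by simp
qed

lemma polar_sol_real:
  assumes r: "\<bar>r\<bar> < \<delta>/4" and t: "t \<in> {0..pi}"
  shows "polar_sol (of_real r) t = of_real (Re (polar_sol (of_real r) t))"
  using polar_sol_cnj[of "of_real r" t] assms by (simp add: complex_eq_iff)

lemma Re_polar_sol_bounds:
  assumes r: "0 < r" "r < \<delta>/4" and t: "t \<in> {0..pi}"
  shows "r / 2 \<le> Re (polar_sol (of_real r) t)" "Re (polar_sol (of_real r) t) \<le> 3/2 * r"
proof -
  have "\<bar>Re (polar_sol (of_real r) t - of_real r)\<bar> \<le> norm (polar_sol (of_real r) t - of_real r)"
    by (rule abs_Re_le_cmod)
  also have "\<dots> \<le> r / 2" using polar_sol(2)[of "of_real r" t] r t by (simp add: dist_norm norm_minus_commute)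
  finally have "\<bar>Re (polar_sol (of_real r) t) - r\<bar> \<le> r / 2" by simp
  then show "r / 2 \<le> Re (polar_sol (of_real r) t)" "Re (polar_sol (of_real r) t) \<le> 3/2 * r"
    unfolding abs_le_iff by linarith+
qed

lemma Re_polar_sol_has_derivative:
  assumes r: "0 < r" "r < \<delta>/4" and t: "t \<in> {0..pi}"
  defines "\<rho> \<equiv> \<lambda>t. Re (polar_sol (of_real r) t)"
  shows "(\<rho> has_real_derivative \<rho> t * (cos t)\<^sup>2 * Re (\<phi> (of_real (\<rho> t * sin t))) /
     (1 - cos t * sin t * Re (\<phi> (of_real (\<rho> t * sin t))))) (at t within {0..pi})"
proof -
  have eq: "polar_sol (of_real r) t = of_real (\<rho> t)"
    unfolding \<rho>_def using polar_sol_real[of r t] r t by auto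
  have "norm (complex_of_real (\<rho> t)) < \<delta>/2" unfolding eq[symmetric] using r t by (intro norm_polar_sol_less) auto
  then have "norm (complex_of_real (\<rho> t)) < \<delta>" using delta_pos by linarith
  then have "norm (complex_of_real (\<rho> t) * of_real (sin t)) < \<delta>" by (rule norm_mult_sin_less)
  then have "\<phi> (of_real (\<rho> t * sin t)) = cnj (\<phi> (of_real (\<rho> t * sin t)))"
    using sym[of "of_real (\<rho> t * sin t)"] by simp
  then have eq2: "\<phi> (of_real (\<rho> t * sin t)) = of_real (Re (\<phi> (of_real (\<rho> t * sin t))))"
    by (simp add: complex_eq_iff)
  have "polar_rhs \<phi> t (of_real (\<rho> t)) = of_real (\<rho> t * (cos t)\<^sup>2 * Re (\<phi> (of_real (\<rho> t * sin t))) /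
     (1 - cos t * sin t * Re (\<phi> (of_real (\<rho> t * sin t)))))"
    unfolding polar_rhs_def by (subst (1 2) of_real_mult[symmetric], subst (1 2) eq2) simp
  then have "(polar_sol (of_real r) has_vector_derivative of_real (\<rho> t * (cos t)\<^sup>2 * Re (\<phi> (of_real (\<rho> t * sin t))) /
     (1 - cos t * sin t * Re (\<phi> (of_real (\<rho> t * sin t)))))) (at t within {0..pi})"
    using polar_sol(3)[of "of_real r" t] r t eq by simp
  from bounded_linear.has_vector_derivative[OF bounded_linear_Re this]
  show ?thesis by (simp add: \<rho>_def has_real_derivative_iff_has_vector_derivative)
qed

end

section \<open>Holomorphic dependence of the half-turn on the initial value\<close>

context damping
begin

abbreviation rate :: "real \<Rightarrow> complex \<Rightarrow> complex \<Rightarrow> complex" where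
  "rate \<equiv> div_diff (polar_rhs_deriv \<phi>)"

lemma has_derivative_half_ball:
  "t \<in> {0..pi} \<Longrightarrow> x \<in> ball 0 (\<delta>/2) \<Longrightarrow> (polar_rhs \<phi> t has_field_derivative polar_rhs_deriv \<phi> t x) (at x)"
  using delta_pos by (intro polar_rhs_has_derivative) auto

lemma continuous_on_half_ball:
  "continuous_on ({0..pi} \<times> ball 0 (\<delta>/2)) (\<lambda>(t, x). polar_rhs_deriv \<phi> t x)"
  by (rule continuous_on_subset[OF continuous_on_polar_rhs_deriv]) (use delta_pos in auto)

lemmas rate_diff = div_diff[OF convex_ball has_derivative_half_ball continuous_on_half_ball, simplified]
lemmas continuous_on_rate = continuous_on_div_diff[OF convex_ball has_derivative_half_ball continuous_on_half_ball]

lemma norm_rate_le: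
  "t \<in> {0..pi} \<Longrightarrow> x \<in> ball 0 (\<delta>/2) \<Longrightarrow> y \<in> ball 0 (\<delta>/2) \<Longrightarrow> norm (rate t x y) \<le> 3/50"
  by (rule norm_div_diff_le[OF convex_ball has_derivative_half_ball continuous_on_half_ball])
     (use norm_polar_rhs_deriv_le in auto)

lemma continuous_on_rate_along:
  assumes "continuous_on {0..pi} u" "continuous_on {0..pi} w"
    and "\<And>t. t \<in> {0..pi} \<Longrightarrow> norm (u t) < \<delta>/2" "\<And>t. t \<in> {0..pi} \<Longrightarrow> norm (w t) < \<delta>/2"
  shows "continuous_on {0..pi} (\<lambda>t. rate t (u t) (w t))"
  by (rule continuous_on_compose2[OF continuous_on_rate, where f = "\<lambda>t. (t, u t, w t)", simplified])
     (use assms in \<open>auto intro!: continuous_intros\<close>)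

lemma norm_integral_rate_le:
  assumes "continuous_on {0..pi} u" "continuous_on {0..pi} w"
    and "\<And>t. t \<in> {0..pi} \<Longrightarrow> norm (u t) < \<delta>/2" "\<And>t. t \<in> {0..pi} \<Longrightarrow> norm (w t) < \<delta>/2"
    and ab: "0 \<le> a" "a \<le> b" "b \<le> pi"
  shows "norm (integral {a..b} (\<lambda>t. rate t (u t) (w t))) \<le> 1/5"
proof -
  have "norm (integral {a..b} (\<lambda>t. rate t (u t) (w t))) \<le> 3/50 * (b - a)"
  proof (rule integral_bound)
    show "continuous_on {a..b} (\<lambda>t. rate t (u t) (w t))"
      by (rule continuous_on_subset[OF continuous_on_rate_along]) (use assms in auto)
    show "norm (rate t (u t) (w t)) \<le> 3/50" if "t \<in> {a..b}" for t
      using assms that by (intro norm_rate_le) auto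
  qed (use assms in auto)
  also have "\<dots> \<le> 3/50 * (16/5)" using ab pi_bound by (intro mult_left_mono) auto
  finally show ?thesis by simp
qed

text \<open>The difference solves a homogeneous linear equation with coefficient
  \<open>rate\<close>. The exponential factor gives Lipschitz dependence, monotonicity on the real
  axis and, in the limit \<open>y = x\<close>, the derivative.\<close>

lemma polar_sol_diff:
  assumes x: "norm x < \<delta>/4" and y: "norm y < \<delta>/4" and T: "T \<in> {0..pi}"
  shows "polar_sol x T - polar_sol y T =
    (x - y) * exp (integral {0..T} (\<lambda>t. rate t (polar_sol x t) (polar_sol y t)))"
proof -
  let ?A = "\<lambda>t. rate t (polar_sol x t) (polar_sol y t)"
  let ?D = "\<lambda>t. polar_sol x t - polar_sol y t"
  have "?D T = exp (integral {0..T} ?A) * (?D 0 + integral {0..T} (\<lambda>t. exp (- integral {0..t} ?A) * 0))"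
  proof (rule linear_ode_formula)
    show "continuous_on {0..T} ?A"
      by (rule continuous_on_subset[OF continuous_on_rate_along])
         (use x y T norm_polar_sol_less continuous_on_polar_sol in auto)
    fix t assume t: "t \<in> {0..T}"
    then have t': "t \<in> {0..pi}" using T by auto
    have "(?D has_vector_derivative polar_rhs \<phi> t (polar_sol x t) - polar_rhs \<phi> t (polar_sol y t)) (at t within {0..pi})"
      by (rule has_vector_derivative_diff[OF polar_sol(3)[OF x t'] polar_sol(3)[OF y t']])
    then have "(?D has_vector_derivative ?A t * ?D t) (at t within {0..pi})"
      using norm_polar_sol_less[OF x t'] norm_polar_sol_less[OF y t'] t' by (subst (asm) rate_diff) auto
    then show "(?D has_vector_derivative ?A t * ?D t + 0) (at t within {0..T})"
      using T by (auto intro: has_vector_derivative_within_subset)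
  qed (use T in auto)
  then show ?thesis using polar_sol(1)[OF x] polar_sol(1)[OF y] by simp
qed

lemma norm_polar_sol_diff_le:
  assumes x: "norm x < \<delta>/4" and y: "norm y < \<delta>/4" and T: "T \<in> {0..pi}"
  shows "norm (polar_sol x T - polar_sol y T) \<le> 2 * norm (x - y)"
proof -
  have "norm (integral {0..T} (\<lambda>t. rate t (polar_sol x t) (polar_sol y t))) \<le> 1/5"
    using T x y by (intro norm_integral_rate_le norm_polar_sol_less continuous_on_polar_sol) auto
  then have "norm (exp (integral {0..T} (\<lambda>t. rate t (polar_sol x t) (polar_sol y t)))) \<le> 2"
    by (intro exp_bound_half) simp
  then have "norm (x - y) * norm (exp (integral {0..T} (\<lambda>t. rate t (polar_sol x t) (polar_sol y t)))) \<le> norm (x - y) * 2"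
    by (intro mult_left_mono) auto
  then show ?thesis by (simp add: polar_sol_diff[OF assms] norm_mult)
qed

lemma continuous_on_polar_sol_joint:
  "continuous_on (ball 0 (\<delta>/4) \<times> {0..pi}) (\<lambda>(x, t). polar_sol x t)"
  unfolding continuous_on_iff
proof (intro ballI allI impI)
  fix p :: "complex \<times> real" and e :: real
  assume p: "p \<in> ball 0 (\<delta>/4) \<times> {0..pi}" and e: "0 < e"
  obtain x t where xt: "p = (x, t)" by (cases p)
  with p have x: "x \<in> ball 0 (\<delta>/4)" and t: "t \<in> {0..pi}" by auto
  obtain d where d: "d > 0" "\<And>s. s \<in> {0..pi} \<Longrightarrow> dist s t < d \<Longrightarrow> dist (polar_sol x s) (polar_sol x t) < e/2"
    using continuous_on_polar_sol[of x] x t e unfolding continuous_on_iff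
    by (metis half_gt_zero mem_ball_0)
  have "dist (polar_sol y s) (polar_sol x t) < e"
    if "y \<in> ball 0 (\<delta>/4)" "s \<in> {0..pi}" "dist (y, s) (x, t) < min d (e/4)" for y s
  proof -
    have "dist y x < e/4" "dist s t < d"
      using that(3) dist_fst_le[of "(y, s)" "(x, t)"] dist_snd_le[of "(y, s)" "(x, t)"] by auto
    moreover have "dist (polar_sol y s) (polar_sol x s) \<le> 2 * dist y x"
      unfolding dist_norm using that x by (intro norm_polar_sol_diff_le) auto
    ultimately have "dist (polar_sol y s) (polar_sol x s) < e/2" "dist (polar_sol x s) (polar_sol x t) < e/2"
      using d(2)[OF that(2)] by auto
    then show ?thesis using dist_triangle[of "polar_sol y s" "polar_sol x t" "polar_sol x s"] by linarith
  qed
  then show "\<exists>d>0. \<forall>p'\<in>ball 0 (\<delta>/4) \<times> {0..pi}. dist p' p < d \<longrightarrow>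
      dist (case p' of (x, t) \<Rightarrow> polar_sol x t) (case p of (x, t) \<Rightarrow> polar_sol x t) < e"
    using d(1) e by (intro exI[of _ "min d (e/4)"]) (auto simp: xt)
qed

text \<open>The difference quotient at \<open>x\<close> is the exponential of
  \<open>polar_sol_diff\<close>; it has a limit because its exponent is an integral of a jointly
  continuous function.\<close>

lemma half_return_has_derivative:
  assumes x: "norm x < \<delta>/4"
  shows "(half_return has_field_derivative exp (integral {0..pi} (\<lambda>t. rate t (polar_sol x t) (polar_sol x t)))) (at x)"
proof -
  define h where "h y = integral (cbox 0 pi) (\<lambda>t. rate t (polar_sol y t) (polar_sol x t))" for y
  have "continuous_on (ball 0 (\<delta>/4)) h"
    unfolding h_def
  proof (rule integral_continuous_on_param)
    have sub: "(\<lambda>p. (snd p, polar_sol (fst p) (snd p), polar_sol x (snd p))) ` (ball 0 (\<delta>/4) \<times> cbox 0 pi)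
        \<subseteq> {0..pi} \<times> ball 0 (\<delta>/2) \<times> ball 0 (\<delta>/2)"
      using norm_polar_sol_less x by auto
    have c: "continuous_on (ball 0 (\<delta>/4) \<times> cbox 0 pi) (\<lambda>p. (snd p, polar_sol (fst p) (snd p), polar_sol x (snd p)))"
      using continuous_on_polar_sol_joint
      by (intro continuous_intros continuous_on_compose2[OF continuous_on_polar_sol[OF x]]) (auto simp: split_beta)
    show "continuous_on (ball 0 (\<delta>/4) \<times> cbox 0 pi) (\<lambda>(y, t). rate t (polar_sol y t) (polar_sol x t))"
      using continuous_on_compose2[OF continuous_on_rate c sub] by (simp add: split_beta)
  qed
  then have "isCont h x" using x by (simp add: continuous_on_eq_continuous_at)
  then have "((\<lambda>y. exp (h y)) \<longlongrightarrow> exp (h x)) (at x)"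
    by (intro tendsto_exp) (simp add: isCont_def)
  moreover have "eventually (\<lambda>y. exp (h y) = (half_return y - half_return x) / (y - x)) (at x)"
  proof -
    have "eventually (\<lambda>y. y \<in> ball 0 (\<delta>/4)) (at x)"
      using x by (intro eventually_at_in_open') auto
    moreover have "eventually (\<lambda>y. y \<noteq> x) (at x)" by (rule eventually_neq_at_within)
    ultimately show ?thesis
      by eventually_elim (use polar_sol_diff[OF _ x, of _ pi] in \<open>simp add: half_return_def h_def\<close>)
  qed
  ultimately have "((\<lambda>y. (half_return y - half_return x) / (y - x)) \<longlongrightarrow> exp (h x)) (at x)"
    by (rule Lim_transform_eventually)
  then show ?thesis by (simp add: has_field_derivative_iff h_def)
qed

lemma half_return_holomorphic: "half_return holomorphic_on ball 0 (\<delta>/4)"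
  unfolding holomorphic_on_open[OF open_ball]
proof
  fix x :: complex assume "x \<in> ball 0 (\<delta>/4)"
  then show "\<exists>f'. (half_return has_field_derivative f') (at x)"
    using half_return_has_derivative[of x] by auto
qed

lemma half_return_0: "half_return 0 = 0"
  using polar_sol(2)[of 0 pi] delta_pos by (simp add: half_return_def)

lemma Re_half_return_bounds:
  assumes "0 < r" "r < \<delta>/4"
  shows "r / 2 \<le> Re (half_return (of_real r))" "Re (half_return (of_real r)) \<le> 3/2 * r"
  using Re_polar_sol_bounds[OF assms, of pi] by (auto simp: half_return_def)

text \<open>The difference of the images is \<open>s - r\<close> times \<open>exp z\<close> with
  \<open>norm z \<le> 1/5\<close>, and such an exponential has positive real part. The monotonicity
  is needed to isolate limit cycles.\<close>

lemma Re_half_return_less: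
  assumes "0 < r" "r < s" "s < \<delta>/4"
  shows "Re (half_return (of_real r)) < Re (half_return (of_real s))"
proof -
  define z where "z = integral {0..pi} (\<lambda>t. rate t (polar_sol (of_real s) t) (polar_sol (of_real r) t))"
  have "norm z \<le> 1/5" unfolding z_def
    using assms by (intro norm_integral_rate_le norm_polar_sol_less continuous_on_polar_sol) auto
  then have "norm (exp z - 1) \<le> 3/10" using norm_exp_bounds(2)[of z] by simp
  then have "\<bar>Re (exp z - 1)\<bar> \<le> 3/10" using abs_Re_le_cmod order_trans by blast
  then have "Re (exp z) > 0" by (simp add: abs_if split: if_splits)
  then have "(s - r) * Re (exp z) > 0" using assms by simp
  moreover have "half_return (of_real s) - half_return (of_real r) = of_real (s - r) * exp z"
    unfolding half_return_def z_def using assms by (subst polar_sol_diff) auto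
  then have "Re (half_return (of_real s) - half_return (of_real r)) = (s - r) * Re (exp z)"
    by simp
  ultimately show ?thesis by simp
qed

end

section \<open>Comparison of two damped rotations\<close>

locale damping_pair = D1: damping \<phi>1 \<delta> + D2: damping \<phi>2 \<delta> for \<phi>1 \<phi>2 \<delta>
begin

text \<open>The two right-hand sides are compared along the second solution; this is the forcing
  term in the linear equation for the difference of the solutions.\<close>

definition gap :: "complex \<Rightarrow> real \<Rightarrow> complex" where
  "gap x t = polar_rhs \<phi>2 t (D2.polar_sol x t) - polar_rhs \<phi>1 t (D2.polar_sol x t)"

lemma gap_eq:
  assumes x: "norm x < \<delta>/4" and t: "t \<in> {0..pi}"
  defines "u \<equiv> D2.polar_sol x t"
  shows "gap x t = u * of_real ((cos t)\<^sup>2) * (\<phi>2 (u * of_real (sin t)) - \<phi>1 (u * of_real (sin t))) /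
    ((1 - of_real (cos t * sin t) * \<phi>1 (u * of_real (sin t))) * (1 - of_real (cos t * sin t) * \<phi>2 (u * of_real (sin t))))"
proof -
  have u: "norm u < \<delta>" using D2.norm_polar_sol_less[OF x t] D1.delta_pos by (simp add: u_def)
  show ?thesis
    using D1.denom_nz[OF u, of t] D2.denom_nz[OF u, of t]
    unfolding gap_def u_def[symmetric] polar_rhs_def
    by (simp add: divide_simps) (simp add: algebra_simps)
qed

lemma continuous_on_gap:
  assumes x: "norm x < \<delta>/4"
  shows "continuous_on {0..pi} (gap x)"
proof -
  have sub: "(\<lambda>t. (t, D2.polar_sol x t)) ` {0..pi} \<subseteq> UNIV \<times> ball 0 \<delta>"
    using D2.norm_polar_sol_less[OF x] D1.delta_pos by fastforce
  have c: "continuous_on {0..pi} (\<lambda>t. (t, D2.polar_sol x t))"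
    by (intro continuous_intros D2.continuous_on_polar_sol[OF x])
  show ?thesis unfolding gap_def
    using continuous_on_diff[OF continuous_on_compose2[OF D2.continuous_on_polar_rhs c sub] continuous_on_compose2[OF D1.continuous_on_polar_rhs c sub]]
    by simp
qed

lemma half_return_diff:
  assumes x: "norm x < \<delta>/4"
  defines "A \<equiv> \<lambda>t. D1.rate t (D2.polar_sol x t) (D1.polar_sol x t)"
  shows "D2.half_return x - D1.half_return x = integral {0..pi} (\<lambda>t. exp (integral {t..pi} A) * gap x t)"
proof -
  let ?D = "\<lambda>t. D2.polar_sol x t - D1.polar_sol x t"
  have A: "continuous_on {0..pi} A"
    unfolding A_def
    by (rule D1.continuous_on_rate_along)
       (use x D1.norm_polar_sol_less D2.norm_polar_sol_less D1.continuous_on_polar_sol D2.continuous_on_polar_sol in auto)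
  have "?D pi = exp (integral {0..pi} A) * (?D 0 + integral {0..pi} (\<lambda>t. exp (- integral {0..t} A) * gap x t))"
  proof (rule linear_ode_formula[OF _ A continuous_on_gap[OF x]])
    fix t assume t: "t \<in> {0..pi}"
    have "(?D has_vector_derivative polar_rhs \<phi>2 t (D2.polar_sol x t) - polar_rhs \<phi>1 t (D1.polar_sol x t)) (at t within {0..pi})"
      by (rule has_vector_derivative_diff[OF D2.polar_sol(3)[OF x t] D1.polar_sol(3)[OF x t]])
    moreover have "polar_rhs \<phi>1 t (D2.polar_sol x t) - polar_rhs \<phi>1 t (D1.polar_sol x t) = A t * ?D t"
      unfolding A_def using D1.norm_polar_sol_less[OF x t] D2.norm_polar_sol_less[OF x t] t by (subst D1.rate_diff) auto
    ultimately show "(?D has_vector_derivative A t * ?D t + gap x t) (at t within {0..pi})"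
      by (simp add: gap_def algebra_simps)
  qed auto
  also have "?D 0 = 0" using D1.polar_sol(1)[OF x] D2.polar_sol(1)[OF x] by simp
  also have "exp (integral {0..pi} A) * (0 + integral {0..pi} (\<lambda>t. exp (- integral {0..t} A) * gap x t))
      = integral {0..pi} (\<lambda>t. exp (integral {0..pi} A) * (exp (- integral {0..t} A) * gap x t))"
    by simp
  also have "\<dots> = integral {0..pi} (\<lambda>t. exp (integral {t..pi} A) * gap x t)"
  proof (rule integral_cong)
    fix t assume t: "t \<in> {0..pi}"
    have "integral {0..t} A + integral {t..pi} A = integral {0..pi} A"
      using t by (intro Henstock_Kurzweil_Integration.integral_combine integrable_continuous_interval A) auto
    then have "integral {t..pi} A = integral {0..pi} A - integral {0..t} A" by (simp add: algebra_simps)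
    then show "exp (integral {0..pi} A) * (exp (- integral {0..t} A) * gap x t) = exp (integral {t..pi} A) * gap x t"
      by (simp add: exp_diff exp_minus divide_inverse)
  qed
  finally show ?thesis by (simp add: D1.half_return_def D2.half_return_def)
qed

lemma norm_weight:
  assumes x: "norm x < \<delta>/4" and t: "t \<in> {0..pi}"
  defines "A \<equiv> \<lambda>t. D1.rate t (D2.polar_sol x t) (D1.polar_sol x t)"
  shows "norm (exp (integral {t..pi} A) - 1) \<le> 3/10"
proof -
  have "norm (integral {t..pi} A) \<le> 1/5" unfolding A_def
    by (rule D1.norm_integral_rate_le)
       (use x t D1.norm_polar_sol_less D2.norm_polar_sol_less D1.continuous_on_polar_sol D2.continuous_on_polar_sol in auto)
  then show ?thesis using norm_exp_bounds(2)[of "integral {t..pi} A"] by simp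
qed

text \<open>The weights in the variation of constants lie within \<open>3/10\<close> of 1, so
  replacing them by 1 costs at most \<open>3/10\<close> of a majorant of the gap. A gap of one sign
  is its own majorant up to sign, and then the sign of the integral survives.\<close>

lemma half_return_diff_approx:
  assumes x: "norm x < \<delta>/4" and b: "\<And>t. t \<in> {0..pi} \<Longrightarrow> norm (gap x t) \<le> \<beta> t"
    and \<beta>: "continuous_on {0..pi} \<beta>"
  shows "norm (D2.half_return x - D1.half_return x - integral {0..pi} (gap x)) \<le> 3/10 * integral {0..pi} \<beta>"
proof -
  define A where "A = (\<lambda>t. D1.rate t (D2.polar_sol x t) (D1.polar_sol x t))"
  have A: "continuous_on {0..pi} A"
    unfolding A_def
    by (rule D1.continuous_on_rate_along)
       (use x D1.norm_polar_sol_less D2.norm_polar_sol_less D1.continuous_on_polar_sol D2.continuous_on_polar_sol in auto)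
  have 1: "continuous_on {0..pi} (\<lambda>t. integral {t..pi} A)"
  proof (rule continuous_on_eq[where f = "\<lambda>t. integral {0..pi} A - integral {0..t} A"])
    show "continuous_on {0..pi} (\<lambda>t. integral {0..pi} A - integral {0..t} A)"
      by (intro continuous_intros indefinite_integral_continuous_1 integrable_continuous_interval A)
    fix t assume t: "t \<in> {0..pi}"
    have "integral {0..t} A + integral {t..pi} A = integral {0..pi} A"
      using t by (intro Henstock_Kurzweil_Integration.integral_combine integrable_continuous_interval A) auto
    then show "integral {0..pi} A - integral {0..t} A = integral {t..pi} A" by (simp add: algebra_simps)
  qed
  note g = continuous_on_gap[OF x]
  have "D2.half_return x - D1.half_return x - integral {0..pi} (gap x)
      = integral {0..pi} (\<lambda>t. exp (integral {t..pi} A) * gap x t) - integral {0..pi} (gap x)"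
    by (simp add: half_return_diff[OF x] A_def)
  also have "\<dots> = integral {0..pi} (\<lambda>t. exp (integral {t..pi} A) * gap x t - gap x t)"
    by (intro integral_diff[symmetric] integrable_continuous_interval continuous_intros 1 g)
  also have "norm \<dots> \<le> integral {0..pi} (\<lambda>t. 3/10 * \<beta> t)"
  proof (rule integral_norm_bound_integral)
    show "(\<lambda>t. exp (integral {t..pi} A) * gap x t - gap x t) integrable_on {0..pi}"
      by (intro integrable_continuous_interval continuous_intros 1 g)
    show "(\<lambda>t. 3/10 * \<beta> t) integrable_on {0..pi}"
      by (intro integrable_continuous_interval continuous_intros \<beta>)
    fix t assume t: "t \<in> {0..pi}"
    have "norm (exp (integral {t..pi} A) * gap x t - gap x t) = norm (exp (integral {t..pi} A) - 1) * norm (gap x t)"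
      by (simp add: norm_mult[symmetric] algebra_simps)
    also have "\<dots> \<le> 3/10 * \<beta> t"
      using norm_weight[OF x t] b[OF t] by (intro mult_mono) (auto simp: A_def)
    finally show "norm (exp (integral {t..pi} A) * gap x t - gap x t) \<le> 3/10 * \<beta> t" .
  qed
  finally show ?thesis by simp
qed

lemma norm_gap_le:
  assumes x: "norm x < \<delta>/4" and t: "t \<in> {0..pi}" and M: "\<And>v. norm v < \<delta>/2 \<Longrightarrow> norm (\<phi>2 v - \<phi>1 v) \<le> M"
  shows "norm (gap x t) \<le> 2 * norm x * M"
proof -
  let ?u = "D2.polar_sol x t"
  have u: "norm ?u < \<delta>/2" "norm ?u < \<delta>" using D2.norm_polar_sol_less[OF x t] D1.delta_pos by auto
  have M0: "0 \<le> M" using M[of 0] D1.delta_pos norm_ge_zero order_trans by (metis half_gt_zero norm_zero)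
  let ?d1 = "1 - of_real (cos t * sin t) * \<phi>1 (?u * of_real (sin t))"
  let ?d2 = "1 - of_real (cos t * sin t) * \<phi>2 (?u * of_real (sin t))"
  have c2: "norm (complex_of_real ((cos t)\<^sup>2)) \<le> 1"
    by (simp add: norm_power abs_square_le_1)
  have "norm (gap x t) = norm ?u * norm (complex_of_real ((cos t)\<^sup>2)) * norm (\<phi>2 (?u * of_real (sin t)) - \<phi>1 (?u * of_real (sin t))) / (norm ?d1 * norm ?d2)"
    by (simp only: gap_eq[OF x t] norm_divide norm_mult)
  also have "\<dots> \<le> (3/2 * norm x) * 1 * M / ((39/40) * (39/40))"
    using D1.norm_denom_ge[OF u(2), of t] D2.norm_denom_ge[OF u(2), of t] M0
    by (intro frac_le mult_mono c2 M norm_mult_sin_less u D2.norm_polar_sol_le x t) auto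
  also have "\<dots> \<le> 2 * norm x * M" using M0 by (simp add: mult_mono)
  finally show ?thesis .
qed

lemma norm_half_return_diff_le:
  assumes x: "norm x < \<delta>/4" and M: "\<And>v. norm v < \<delta>/2 \<Longrightarrow> norm (\<phi>2 v - \<phi>1 v) \<le> M"
  shows "norm (D2.half_return x - D1.half_return x) \<le> 10 * norm x * M"
proof -
  note g = norm_gap_le[OF x _ M]
  have M0: "0 \<le> M" using M[of 0] D1.delta_pos norm_ge_zero order_trans by (metis half_gt_zero norm_zero)
  have "norm (D2.half_return x - D1.half_return x - integral {0..pi} (gap x)) \<le> 3/10 * integral {0..pi} (\<lambda>t. 2 * norm x * M)"
    by (rule half_return_diff_approx[OF x g]) auto
  moreover have "norm (integral {0..pi} (gap x)) \<le> (2 * norm x * M) * (pi - 0)"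
    by (rule integral_bound[OF _ continuous_on_gap[OF x] g]) auto
  moreover have "norm (D2.half_return x - D1.half_return x) \<le> norm (integral {0..pi} (gap x)) + norm (D2.half_return x - D1.half_return x - integral {0..pi} (gap x))"
    by (rule norm_triangle_sub)
  moreover have "norm x * M * pi \<le> norm x * M * (16/5)" using M0 pi_bound by (intro mult_left_mono) auto
  ultimately have "norm (D2.half_return x - D1.half_return x) \<le> 26/10 * (norm x * M * (16/5))" by (simp add: mult_ac)
  also have "\<dots> \<le> 10 * norm x * M" using M0 by (simp add: mult_ac mult_right_mono)
  finally show ?thesis .
qed

text \<open>The first-order weight with which a monomial \<open>v ^ j\<close> of the damping
  difference enters the displacement.\<close>

definition cos_sin_moment :: "nat \<Rightarrow> real" where
  "cos_sin_moment j = integral {0..pi} (\<lambda>t. (cos t)\<^sup>2 * sin t ^ j)"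

lemma cos_sin_moment_pos: "0 < cos_sin_moment j"
proof -
  let ?f = "\<lambda>t::real. (cos t)\<^sup>2 * sin t ^ j"
  have c: "continuous_on {0..pi} ?f" by (intro continuous_intros)
  have nn: "0 \<le> ?f t" if "t \<in> {0..pi}" for t using that by (intro mult_nonneg_nonneg zero_le_power2 zero_le_power[OF sin_ge_zero]) auto
  have "?f (pi/4) \<noteq> 0" using cos_gt_zero_pi[of "pi/4"] sin_gt_zero[of "pi/4"] by auto
  moreover have "pi/4 \<in> {0..pi}" by auto
  ultimately have "cos_sin_moment j \<noteq> 0"
    unfolding cos_sin_moment_def using integral_eq_0_iff[OF c pi_gt_zero nn] by blast
  moreover have "0 \<le> cos_sin_moment j" unfolding cos_sin_moment_def
    by (rule integral_nonneg[OF integrable_continuous_interval[OF c] nn])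
  ultimately show ?thesis by simp
qed

text \<open>On the real axis the gap has the sign of \<open>\<phi>2 - \<phi>1\<close>, because its
  other factors are nonnegative and its denominators near 1. Comparisons with \<open>x ^ j\<close>
  therefore carry over, with the radius between \<open>r/2\<close> and \<open>3/2 * r\<close>; the
  radius as a factor raises the degree by one.\<close>

lemma half_return_diff_real_bounds:
  assumes r: "0 < r" "r < \<delta>/4" and \<alpha>: "0 \<le> \<alpha>"
    and b: "\<And>x. 0 \<le> x \<Longrightarrow> x \<le> 3/2 * r \<Longrightarrow> \<alpha> * x ^ j \<le> Re (\<phi>2 (of_real x) - \<phi>1 (of_real x))"
      "\<And>x. 0 \<le> x \<Longrightarrow> x \<le> 3/2 * r \<Longrightarrow> Re (\<phi>2 (of_real x) - \<phi>1 (of_real x)) \<le> \<beta> * x ^ j"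
  shows "\<alpha> * (r/2) ^ Suc j * (cos_sin_moment j / 2) \<le> Re (D2.half_return (of_real r) - D1.half_return (of_real r))"
    "Re (D2.half_return (of_real r) - D1.half_return (of_real r)) \<le> \<beta> * (3/2 * r) ^ Suc j * (2 * cos_sin_moment j)"
proof -
  define u where "u t = Re (D2.polar_sol (of_real r) t)" for t
  define f1 where "f1 x = Re (\<phi>1 (of_real x))" for x
  define f2 where "f2 x = Re (\<phi>2 (of_real x))" for x
  define d1 where "d1 t = 1 - cos t * sin t * f1 (u t * sin t)" for t
  define d2 where "d2 t = 1 - cos t * sin t * f2 (u t * sin t)" for t
  define g where "g t = u t * (cos t)\<^sup>2 * (f2 (u t * sin t) - f1 (u t * sin t)) / (d1 t * d2 t)" for t
  have x: "norm (complex_of_real r) < \<delta>/4" using r by simp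
  have bt: "0 \<le> \<beta>"
  proof -
    have "0 \<le> \<alpha> * r ^ j" using \<alpha> r by simp
    also have "\<dots> \<le> \<beta> * r ^ j" by (rule order_trans[OF b]) (use r in auto)
    finally show ?thesis using zero_less_power[OF r(1), of j] by (simp add: zero_le_mult_iff)
  qed
  have ub: "r / 2 \<le> u t" "u t \<le> 3/2 * r" if "t \<in> {0..pi}" for t
    unfolding u_def by (rule D2.Re_polar_sol_bounds[OF r that])+
  have sol: "D2.polar_sol (of_real r) t = of_real (u t)" if "t \<in> {0..pi}" for t
    unfolding u_def using D2.polar_sol_real[of r t] r that by simp
  have f: "\<phi>1 (of_real y) = of_real (f1 y)" "\<phi>2 (of_real y) = of_real (f2 y)" if "\<bar>y\<bar> < \<delta>" for y
    using D1.sym[of "of_real y"] D2.sym[of "of_real y"] that by (simp_all add: f1_def f2_def complex_eq_iff)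
  have us: "0 \<le> u t * sin t" "u t * sin t \<le> 3/2 * r" "\<bar>u t * sin t\<bar> < \<delta>" if "t \<in> {0..pi}" for t
  proof -
    show 1: "0 \<le> u t * sin t" using ub(1)[OF that] r that sin_ge_zero[of t] by (intro mult_nonneg_nonneg) auto
    show 2: "u t * sin t \<le> 3/2 * r"
      using mult_mono[OF ub(2)[OF that] sin_le_one[of t]] r sin_ge_zero[of t] that by simp
    show "\<bar>u t * sin t\<bar> < \<delta>" using 1 2 r by simp
  qed
  have d: "39/40 \<le> d1 t" "d1 t \<le> 41/40" "39/40 \<le> d2 t" "d2 t \<le> 41/40" if t: "t \<in> {0..pi}" for t
  proof -
    have n: "norm (complex_of_real (u t)) < \<delta>" using ub[OF t] r by simp
    have "\<bar>cos t * sin t * f1 (u t * sin t)\<bar> \<le> 1/40"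
      using D1.norm_denom_diff[OF n, of t] f(1)[OF us(3)[OF t]] by (simp flip: of_real_mult)
    then show "39/40 \<le> d1 t" "d1 t \<le> 41/40" unfolding d1_def abs_le_iff by linarith+
    have "\<bar>cos t * sin t * f2 (u t * sin t)\<bar> \<le> 1/40"
      using D2.norm_denom_diff[OF n, of t] f(2)[OF us(3)[OF t]] by (simp flip: of_real_mult)
    then show "39/40 \<le> d2 t" "d2 t \<le> 41/40" unfolding d2_def abs_le_iff by linarith+
  qed
  have gap: "gap (of_real r) t = of_real (g t)" if t: "t \<in> {0..pi}" for t
    unfolding gap_eq[OF x t] sol[OF t] g_def d1_def d2_def using f[OF us(3)[OF t]] by simp
  have diff: "\<alpha> * (u t * sin t) ^ j \<le> f2 (u t * sin t) - f1 (u t * sin t)"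
    "f2 (u t * sin t) - f1 (u t * sin t) \<le> \<beta> * (u t * sin t) ^ j" if t: "t \<in> {0..pi}" for t
    using b[OF us(1,2)[OF t]] by (auto simp: f1_def f2_def)
  have lower: "\<alpha> * (r/2) ^ Suc j * (3/4 * ((cos t)\<^sup>2 * sin t ^ j)) \<le> g t" if t: "t \<in> {0..pi}" for t
  proof -
    have s: "0 \<le> sin t" using t by (simp add: sin_ge_zero)
    have "\<alpha> * (r/2) ^ Suc j * (3/4 * ((cos t)\<^sup>2 * sin t ^ j)) = (r/2) * (cos t)\<^sup>2 * (\<alpha> * ((r/2) * sin t) ^ j) * (3/4)"
      by (simp add: power_mult_distrib power_divide)
    also have "\<dots> \<le> (r/2) * (cos t)\<^sup>2 * (\<alpha> * ((r/2) * sin t) ^ j) / ((41/40) * (41/40))"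
      using \<alpha> r s by (simp add: field_simps mult_nonneg_nonneg)
    also have "\<dots> \<le> u t * (cos t)\<^sup>2 * (f2 (u t * sin t) - f1 (u t * sin t)) / (d1 t * d2 t)"
    proof (intro frac_le mult_mono)
      have "\<alpha> * ((r/2) * sin t) ^ j \<le> \<alpha> * (u t * sin t) ^ j"
        using \<alpha> r s ub(1)[OF t] by (intro mult_left_mono power_mono mult_right_mono) auto
      then show "\<alpha> * ((r/2) * sin t) ^ j \<le> f2 (u t * sin t) - f1 (u t * sin t)" using diff(1)[OF t] by linarith
      have "0 \<le> \<alpha> * (u t * sin t) ^ j" using us(1)[OF t] \<alpha> by simp
      then have "0 \<le> f2 (u t * sin t) - f1 (u t * sin t)" using diff(1)[OF t] by linarith
      then show "0 \<le> u t * (cos t)\<^sup>2 * (f2 (u t * sin t) - f1 (u t * sin t))" using ub(1)[OF t] r by simp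
    qed (use ub[OF t] d[OF t] r \<alpha> s in auto)
    finally show ?thesis by (simp add: g_def)
  qed
  have upper: "g t \<le> \<beta> * (3/2 * r) ^ Suc j * (6/5 * ((cos t)\<^sup>2 * sin t ^ j))" if t: "t \<in> {0..pi}" for t
  proof -
    have s: "0 \<le> sin t" using t by (simp add: sin_ge_zero)
    have "g t \<le> (3/2 * r) * (cos t)\<^sup>2 * (\<beta> * ((3/2 * r) * sin t) ^ j) / ((39/40) * (39/40))"
      unfolding g_def
    proof (intro frac_le mult_mono)
      have "\<beta> * (u t * sin t) ^ j \<le> \<beta> * ((3/2 * r) * sin t) ^ j"
        using bt r s ub[OF t] by (intro mult_left_mono power_mono mult_right_mono) auto
      then show "f2 (u t * sin t) - f1 (u t * sin t) \<le> \<beta> * ((3/2 * r) * sin t) ^ j" using diff(2)[OF t] by linarith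
      have "0 \<le> \<alpha> * (u t * sin t) ^ j" using us(1)[OF t] \<alpha> by simp
      then show "0 \<le> f2 (u t * sin t) - f1 (u t * sin t)" using diff(1)[OF t] by linarith
    qed (use ub[OF t] d[OF t] r bt s in auto)
    also have "\<dots> \<le> (3/2 * r) * (cos t)\<^sup>2 * (\<beta> * ((3/2 * r) * sin t) ^ j) * (6/5)"
      using bt r s by (simp add: field_simps mult_nonneg_nonneg)
    also have "\<dots> = \<beta> * (3/2 * r) ^ Suc j * (6/5 * ((cos t)\<^sup>2 * sin t ^ j))"
      by (simp add: power_mult_distrib power_divide)
    finally show ?thesis .
  qed
  have gcont: "continuous_on {0..pi} g"
  proof -
    have "continuous_on {0..pi} (\<lambda>t. Re (gap (of_real r) t))"
      by (intro continuous_intros continuous_on_gap[OF x])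
    then show ?thesis by (rule continuous_on_eq) (simp add: gap)
  qed
  have mcont: "continuous_on {0..pi} (\<lambda>t::real. (cos t)\<^sup>2 * sin t ^ j)" by (intro continuous_intros)
  define G where "G = integral {0..pi} g"
  have "integral {0..pi} (\<lambda>t. \<alpha> * (r/2) ^ Suc j * (3/4 * ((cos t)\<^sup>2 * sin t ^ j))) \<le> G"
    unfolding G_def by (intro integral_le integrable_continuous_interval continuous_intros gcont mcont lower)
  then have G1: "\<alpha> * (r/2) ^ Suc j * (3/4 * cos_sin_moment j) \<le> G"
    by (simp only: cos_sin_moment_def integral_mult_right)
  have "G \<le> integral {0..pi} (\<lambda>t. \<beta> * (3/2 * r) ^ Suc j * (6/5 * ((cos t)\<^sup>2 * sin t ^ j)))"
    unfolding G_def by (intro integral_le integrable_continuous_interval continuous_intros gcont mcont upper)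
  then have G2: "G \<le> \<beta> * (3/2 * r) ^ Suc j * (6/5 * cos_sin_moment j)"
    by (simp only: cos_sin_moment_def integral_mult_right)
  have gpos: "0 \<le> g t" if t: "t \<in> {0..pi}" for t
  proof -
    have "0 \<le> \<alpha> * (r/2) ^ Suc j * (3/4 * ((cos t)\<^sup>2 * sin t ^ j))"
      using \<alpha> r sin_ge_zero[of t] t by (intro mult_nonneg_nonneg) auto
    then show ?thesis using lower[OF t] by linarith
  qed
  have "integral {0..pi} (gap (of_real r)) = integral {0..pi} (\<lambda>t. of_real (g t))"
    by (rule integral_cong) (simp add: gap)
  also have "\<dots> = of_real G" unfolding G_def
    by (rule integral_unique[OF has_integral_of_real[OF integrable_integral[OF integrable_continuous_interval[OF gcont]]]])
  finally have I: "integral {0..pi} (gap (of_real r)) = of_real G" .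
  have "norm (D2.half_return (of_real r) - D1.half_return (of_real r) - integral {0..pi} (gap (of_real r))) \<le> 3/10 * integral {0..pi} g"
    by (rule half_return_diff_approx[OF x _ gcont]) (use gap gpos in simp)
  then have "norm (D2.half_return (of_real r) - D1.half_return (of_real r) - of_real G) \<le> 3/10 * G"
    unfolding I G_def .
  then have "\<bar>Re (D2.half_return (of_real r) - D1.half_return (of_real r) - of_real G)\<bar> \<le> 3/10 * G"
    using abs_Re_le_cmod order_trans by blast
  \<comment> \<open>The constants in the conclusion come from \<open>7/10 * 3/4 \<ge> 1/2\<close>
    and \<open>13/10 * 6/5 \<le> 2\<close>: the first factors account for the weights, the second
    for the denominators.\<close>
  then have "7/10 * G \<le> Re (D2.half_return (of_real r) - D1.half_return (of_real r))"
    "Re (D2.half_return (of_real r) - D1.half_return (of_real r)) \<le> 13/10 * G"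
    unfolding abs_le_iff by auto
  moreover have "\<alpha> * (r/2) ^ Suc j * (cos_sin_moment j / 2) \<le> 7/10 * (\<alpha> * (r/2) ^ Suc j * (3/4 * cos_sin_moment j))"
    using \<alpha> r cos_sin_moment_pos[of j] by (simp add: field_simps)
  moreover have "13/10 * (\<beta> * (3/2 * r) ^ Suc j * (6/5 * cos_sin_moment j)) \<le> \<beta> * (3/2 * r) ^ Suc j * (2 * cos_sin_moment j)"
    using bt r cos_sin_moment_pos[of j] by (simp add: field_simps)
  ultimately show "\<alpha> * (r/2) ^ Suc j * (cos_sin_moment j / 2) \<le> Re (D2.half_return (of_real r) - D1.half_return (of_real r))"
    "Re (D2.half_return (of_real r) - D1.half_return (of_real r)) \<le> \<beta> * (3/2 * r) ^ Suc j * (2 * cos_sin_moment j)"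
    using G1 G2 by linarith+
qed

lemma half_return_cong:
  assumes eq: "\<And>v. norm v < e \<Longrightarrow> \<phi>1 v = \<phi>2 v" and x: "norm x < \<delta>/4" "norm x < e/2"
  shows "D2.half_return x = D1.half_return x"
proof -
  have "gap x t = 0" if t: "t \<in> {0..pi}" for t
  proof -
    have "norm (D2.polar_sol x t * of_real (sin t)) < e"
      by (rule norm_mult_sin_less) (use D2.norm_polar_sol_le[OF x(1) t] x norm_ge_zero[of x] in linarith)
    then show ?thesis by (simp add: gap_eq[OF x(1) t] eq)
  qed
  then have "norm (D2.half_return x - D1.half_return x - integral {0..pi} (gap x)) \<le> 3/10 * integral {0..pi} (\<lambda>_. 0::real)"
    by (intro half_return_diff_approx x) auto
  moreover have "integral {0..pi} (gap x) = integral {0..pi} (\<lambda>_. 0)"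
    by (rule integral_cong) fact
  ultimately show ?thesis by simp
qed

end

section \<open>The Lienard normal form\<close>

text \<open>This is \<open>G' y / y\<close>; the principal logarithm makes it holomorphic in the
  unit disc.\<close>

definition lienard_weight :: "real \<Rightarrow> real \<Rightarrow> real \<Rightarrow> complex \<Rightarrow> complex" where
  "lienard_weight b l n y = (1 - of_real n * y) * exp (of_real (2 * l * b - 1) * Ln (1 - of_real b * y))"

definition energy_factor :: "real \<Rightarrow> real \<Rightarrow> real \<Rightarrow> complex \<Rightarrow> complex" where
  "energy_factor b l n y = 2 * integral (cbox 0 1) (\<lambda>s. of_real s * lienard_weight b l n (of_real s * y))"

text \<open>\<open>energy_factor\<close> is \<open>2 G y / y^2\<close> without its removable singularity, and \<open>energy_root\<close> is the
  coordinate \<open>v\<close>.\<close>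

definition energy_root :: "real \<Rightarrow> real \<Rightarrow> real \<Rightarrow> complex \<Rightarrow> complex" where
  "energy_root b l n y = y * csqrt (energy_factor b l n y)"

text \<open>Differentiating \<open>v^2 / 2 = G y\<close> gives \<open>dv/dy = G' y / v\<close>. The
  factor \<open>y\<close> cancels, which leaves a formula that is regular at the origin.\<close>

definition energy_root_deriv :: "real \<Rightarrow> real \<Rightarrow> real \<Rightarrow> complex \<Rightarrow> complex" where
  "energy_root_deriv b l n y = lienard_weight b l n y / csqrt (energy_factor b l n y)"

lemma Re_one_minus_pos:
  fixes b :: real
  assumes "\<bar>b\<bar> = 1" "norm y < 1"
  shows "0 < Re (1 - of_real b * y)"
proof -
  have "\<bar>Re (of_real b * y)\<bar> \<le> norm (of_real b * y)" by (rule abs_Re_le_cmod)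
  also have "\<dots> < 1" using assms by (simp add: norm_mult)
  finally show ?thesis by (simp add: abs_if split: if_splits)
qed

lemma one_minus_notin_nonpos:
  fixes b :: real and y :: complex
  assumes "\<bar>b\<bar> = 1" "norm y < 1"
  shows "1 - of_real b * y \<notin> \<real>\<^sub>\<le>\<^sub>0"
  using Re_one_minus_pos[OF assms] by (auto simp: complex_nonpos_Reals_iff)

lemma norm_of_real_mult_less:
  assumes "s \<in> {0..1}" "norm (y::complex) < r"
  shows "norm (of_real s * y) < r"
proof -
  have "norm (of_real s * y) \<le> 1 * norm y"
    unfolding norm_mult using assms by (intro mult_right_mono) auto
  then show ?thesis using assms(2) by simp
qed

section \<open>Regularity of the energy coordinate\<close>

context
  fixes b :: real
  assumes b: "\<bar>b\<bar> = 1"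
begin

text \<open>Continuity is joint in the parameters and \<open>y\<close>, because the radii found
  later must serve a neighbourhood of parameters.\<close>

lemma continuous_on_weight:
  "continuous_on (UNIV \<times> UNIV \<times> ball 0 1) (\<lambda>(l, n, y). lienard_weight b l n y)"
  unfolding lienard_weight_def split_beta
  by (intro continuous_intros) (use one_minus_notin_nonpos[OF b] in auto)

lemma holomorphic_weight: "lienard_weight b l n holomorphic_on ball 0 1"
  unfolding lienard_weight_def
  by (intro holomorphic_intros) (use one_minus_notin_nonpos[OF b] in auto)

lemma continuous_on_energy_factor:
  "continuous_on (UNIV \<times> UNIV \<times> ball 0 1) (\<lambda>(l, n, y). energy_factor b l n y)"
proof -
  have c: "continuous_on ((UNIV \<times> UNIV \<times> ball 0 1) \<times> cbox 0 1) (\<lambda>p. (fst (fst p), fst (snd (fst p)), of_real (snd p) * snd (snd (fst p))) :: real \<times> real \<times> complex)"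
    by (intro continuous_intros)
  have sub: "(\<lambda>p. (fst (fst p), fst (snd (fst p)), of_real (snd p) * snd (snd (fst p)))) ` ((UNIV \<times> UNIV \<times> ball 0 1) \<times> cbox 0 1)
      \<subseteq> (UNIV \<times> UNIV \<times> ball 0 1 :: (real \<times> real \<times> complex) set)"
    using norm_of_real_mult_less[of _ _ 1] by auto
  have "continuous_on ((UNIV \<times> UNIV \<times> ball 0 1) \<times> cbox 0 1)
     (\<lambda>(p, s). of_real s * lienard_weight b (fst p) (fst (snd p)) (of_real s * snd (snd p)))"
    using continuous_on_compose2[OF continuous_on_weight c sub]
    by (auto simp: split_beta intro!: continuous_intros)
  from integral_continuous_on_param[OF this] show ?thesis
    by (auto simp: energy_factor_def split_beta intro!: continuous_intros)
qed

lemma weight_0 [simp]: "lienard_weight b l n 0 = 1"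
  by (simp add: lienard_weight_def)

lemma energy_factor_0: "energy_factor b l n 0 = 1"
proof -
  have "((\<lambda>s::real. complex_of_real s) has_integral of_real (1^2/2 - 0^2/2)) {0..1}"
    by (rule has_integral_of_real[OF fundamental_theorem_of_calculus])
       (auto intro!: derivative_eq_intros simp: has_real_derivative_iff_has_vector_derivative[symmetric])
  then show ?thesis by (simp add: energy_factor_def integral_unique)
qed

text \<open>A primitive \<open>G\<close> exists on the disc. Integrating its derivative along the
  ray from the origin to \<open>y\<close> identifies \<open>G y - G 0\<close> with
  \<open>y^2 / 2\<close> times the energy factor.\<close>

lemma energy_has_derivative:
  assumes y: "norm y < 1"
  shows "((\<lambda>y. y\<^sup>2 * energy_factor b l n y / 2) has_field_derivative y * lienard_weight b l n y) (at y)"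
proof -
  have "(\<lambda>y. y * lienard_weight b l n y) holomorphic_on ball 0 1"
    by (intro holomorphic_intros holomorphic_weight)
  then obtain G where G: "\<And>y. y \<in> ball 0 1 \<Longrightarrow> (G has_field_derivative y * lienard_weight b l n y) (at y within ball 0 1)"
    using holomorphic_convex_primitive'[of "ball 0 1" "\<lambda>y. y * lienard_weight b l n y"] by auto
  then have G: "(G has_field_derivative y * lienard_weight b l n y) (at y)" if "norm y < 1" for y
    using G[of y] that at_within_open[of y "ball 0 1"] by simp
  have eq: "G y - G 0 = y\<^sup>2 * energy_factor b l n y / 2" if y: "norm y < 1" for y
  proof -
    have "((\<lambda>s. (of_real s * y) * lienard_weight b l n (of_real s * y) * y) has_integral
        G (of_real 1 * y) - G (of_real 0 * y)) {0..1}"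
    proof (rule fundamental_theorem_of_calculus)
      fix s :: real assume s: "s \<in> {0..1}"
      have 1: "((\<lambda>s. of_real s * y) has_vector_derivative y) (at s within {0..1})"
        by (auto intro!: derivative_eq_intros)
      show "((\<lambda>s. G (of_real s * y)) has_vector_derivative (of_real s * y) * lienard_weight b l n (of_real s * y) * y) (at s within {0..1})"
        using field_vector_diff_chain_within[OF 1 has_field_derivative_at_within[OF G[OF norm_of_real_mult_less[OF s y]]]]
        by (simp add: o_def mult_ac)
    qed simp
    then have "((\<lambda>s. (of_real s * y) * lienard_weight b l n (of_real s * y) * y) has_integral G y - G 0) (cbox 0 1)"
      by simp
    then have "integral (cbox 0 1) (\<lambda>s. (of_real s * y) * lienard_weight b l n (of_real s * y) * y) = G y - G 0"
      by (rule integral_unique)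
    moreover have "(\<lambda>s. (of_real s * y) * lienard_weight b l n (of_real s * y) * y)
       = (\<lambda>s. y\<^sup>2 * (of_real s * lienard_weight b l n (of_real s * y)))"
      by (simp add: power2_eq_square mult_ac)
    ultimately show ?thesis by (simp add: energy_factor_def)
  qed
  have "((\<lambda>y. G y - G 0) has_field_derivative y * lienard_weight b l n y) (at y)"
    using G[OF y] by (auto intro!: derivative_eq_intros)
  moreover have "eventually (\<lambda>y. G y - G 0 = y\<^sup>2 * energy_factor b l n y / 2) (nhds y)"
  proof -
    have "eventually (\<lambda>y::complex. y \<in> ball 0 1) (nhds y)" using y by (intro eventually_nhds_in_open) auto
    then show ?thesis by eventually_elim (use eq in auto)
  qed
  ultimately show ?thesis
    using DERIV_cong_ev[OF refl, of "\<lambda>y. G y - G 0" "\<lambda>y. y\<^sup>2 * energy_factor b l n y / 2"] by simp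
qed

lemma weight_cnj: "norm y < 1 \<Longrightarrow> lienard_weight b l n (cnj y) = cnj (lienard_weight b l n y)"
  using cnj_Ln[OF one_minus_notin_nonpos[OF b, of y]] by (simp add: lienard_weight_def exp_cnj)

lemma energy_factor_cnj:
  assumes "norm y < 1"
  shows "energy_factor b l n (cnj y) = cnj (energy_factor b l n y)"
proof -
  have "integral (cbox 0 1) (\<lambda>s. of_real s * lienard_weight b l n (of_real s * cnj y)) =
    integral (cbox 0 1) (\<lambda>s. cnj (of_real s * lienard_weight b l n (of_real s * y)))"
  proof (rule integral_cong)
    fix s :: real assume "s \<in> cbox 0 1"
    then have "norm (of_real s * y) < 1" using norm_of_real_mult_less[of s y 1] assms by auto
    from weight_cnj[OF this] show "of_real s * lienard_weight b l n (of_real s * cnj y) = cnj (of_real s * lienard_weight b l n (of_real s * y))"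
      by simp
  qed
  then show ?thesis by (simp add: energy_factor_def integral_cnj)
qed

text \<open>At the origin the difference quotient is the square root itself. Elsewhere the energy
  factor \<open>K\<close> is \<open>2 G y / y^2\<close>, with derivative
  \<open>(2 E - 2 K) / y\<close> for the weight \<open>E\<close>, and the terms with
  \<open>K\<close> cancel in the product rule.\<close>

lemma energy_root_has_derivative:
  assumes y: "norm y < 1" and K: "0 < Re (energy_factor b l n y)"
  shows "(energy_root b l n has_field_derivative energy_root_deriv b l n y) (at y)"
proof -
  let ?K = "energy_factor b l n" and ?E = "lienard_weight b l n"
  have nz: "?K y \<notin> \<real>\<^sub>\<le>\<^sub>0" "?K y \<noteq> 0" "csqrt (?K y) \<noteq> 0" using K by (auto simp: complex_nonpos_Reals_iff)
  show ?thesis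
  proof (cases "y = 0")
    case True
    have "continuous_on (ball 0 1) (\<lambda>y. ?K y)"
      using continuous_on_compose2[OF continuous_on_energy_factor, of "ball 0 1" "\<lambda>y. (l, n, y)"]
      by (simp add: continuous_on_Pair continuous_on_const continuous_on_id image_subset_iff)
    then have "isCont ?K 0" by (simp add: continuous_on_eq_continuous_at)
    then have "isCont (\<lambda>y. csqrt (?K y)) 0"
      using nz(1) True continuous_at_csqrt by (intro isCont_o2[of 0 ?K csqrt]) auto
    then have "((\<lambda>y. csqrt (?K y)) \<longlongrightarrow> 1) (at 0)" by (simp add: isCont_def energy_factor_0)
    moreover have "eventually (\<lambda>y. csqrt (?K y) = (energy_root b l n y - energy_root b l n 0) / (y - 0)) (at 0)"
      using eventually_neq_at_within[of 0] by eventually_elim (simp add: energy_root_def)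
    ultimately show ?thesis
      unfolding has_field_derivative_iff True
      by (auto simp: energy_root_deriv_def energy_factor_0 intro: Lim_transform_eventually)
  next
    case False
    have quot: "((\<lambda>y. 2 * H y / y\<^sup>2) has_field_derivative (2 * D * y\<^sup>2 - 2 * H y * (2 * y)) / (y\<^sup>2 * y\<^sup>2)) (at y)"
      if "(H has_field_derivative D) (at y)" for H :: "complex \<Rightarrow> complex" and D
      using that False by (auto intro!: derivative_eq_intros)
    have "(2 * (y * ?E y) * y\<^sup>2 - 2 * (y\<^sup>2 * ?K y / 2) * (2 * y)) / (y\<^sup>2 * y\<^sup>2) = (2 * ?E y - 2 * ?K y) / y"
      using False by (simp add: field_simps power2_eq_square)
    with quot[OF energy_has_derivative[OF y, of l n]]
    have "((\<lambda>y. 2 * (y\<^sup>2 * ?K y / 2) / y\<^sup>2) has_field_derivative (2 * ?E y - 2 * ?K y) / y) (at y)"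
      by (simp only:)
    moreover have "eventually (\<lambda>y. 2 * (y\<^sup>2 * ?K y / 2) / y\<^sup>2 = ?K y) (nhds y)"
    proof -
      have "eventually (\<lambda>y. y \<in> - {0::complex}) (nhds y)" using False by (intro eventually_nhds_in_open) auto
      then show ?thesis by eventually_elim auto
    qed
    ultimately have K': "(?K has_field_derivative (2 * ?E y - 2 * ?K y) / y) (at y)"
      using DERIV_cong_ev[OF refl, of "\<lambda>y. 2 * (y\<^sup>2 * ?K y / 2) / y\<^sup>2" ?K] by simp
    have "(csqrt has_field_derivative inverse (2 * csqrt (?K y))) (at (?K y))"
      by (rule has_field_derivative_csqrt[OF nz(1)])
    from DERIV_chain2[where f = csqrt and g = ?K, OF this K']
    have "((\<lambda>y. csqrt (?K y)) has_field_derivative inverse (2 * csqrt (?K y)) * ((2 * ?E y - 2 * ?K y) / y)) (at y)" .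
    then have "((\<lambda>y. y * csqrt (?K y)) has_field_derivative csqrt (?K y) + inverse (2 * csqrt (?K y)) * ((2 * ?E y - 2 * ?K y) / y) * y) (at y)"
      using DERIV_mult[OF DERIV_ident] by force
    moreover have "csqrt (?K y) + inverse (2 * csqrt (?K y)) * ((2 * ?E y - 2 * ?K y) / y) * y = energy_root_deriv b l n y"
    proof -
      have "csqrt (?K y) * csqrt (?K y) = ?K y" by (metis power2_csqrt power2_eq_square)
      then show ?thesis using False nz(3) by (simp add: energy_root_deriv_def field_simps)
    qed
    ultimately show ?thesis by (simp add: energy_root_def[abs_def])
  qed
qed

end

text \<open>One radius \<open>r0\<close> serves a compact set \<open>N\<close> of parameters
  \<open>(l, n)\<close>. The first estimate keeps the square root off its branch cut; the second
  makes \<open>energy_root\<close> a perturbation of the identity, hence invertible by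
  contraction.\<close>

locale lienard_normal_form =
  fixes b r0 :: real and N :: "(real \<times> real) set"
  assumes b: "\<bar>b\<bar> = 1" and r0: "0 < r0" "r0 \<le> 1/2" and N: "compact N"
    and near: "\<And>l n y. (l, n) \<in> N \<Longrightarrow> norm y \<le> r0 \<Longrightarrow> norm (energy_factor b l n y - 1) \<le> 1/2"
      "\<And>l n y. (l, n) \<in> N \<Longrightarrow> norm y \<le> r0 \<Longrightarrow> norm (energy_root_deriv b l n y - 1) \<le> 1/2"
begin

lemma Re_energy_factor_pos:
  assumes "(l, n) \<in> N" "norm y \<le> r0"
  shows "0 < Re (energy_factor b l n y)"
proof -
  have "\<bar>Re (energy_factor b l n y - 1)\<bar> \<le> 1/2"
    using near(1)[OF assms] abs_Re_le_cmod order_trans by blast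
  then show ?thesis by (simp add: abs_if split: if_splits)
qed

lemma energy_root_deriv_nz: "(l, n) \<in> N \<Longrightarrow> norm y \<le> r0 \<Longrightarrow> energy_root_deriv b l n y \<noteq> 0"
  using near(2)[of l n y] by auto

lemma root_derivative:
  "(l, n) \<in> N \<Longrightarrow> norm y \<le> r0 \<Longrightarrow> (energy_root b l n has_field_derivative energy_root_deriv b l n y) (at y)"
  using r0 by (intro energy_root_has_derivative b Re_energy_factor_pos) auto

lemma root_near_id:
  assumes ln: "(l, n) \<in> N" and x: "norm x \<le> r0" and y: "norm y \<le> r0"
  shows "norm ((x - energy_root b l n x) - (y - energy_root b l n y)) \<le> 1/2 * norm (x - y)"
proof (rule field_differentiable_bound[where S = "cball 0 r0" and f' = "\<lambda>y. 1 - energy_root_deriv b l n y" and f = "\<lambda>y. y - energy_root b l n y"])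
  fix z :: complex assume "z \<in> cball 0 r0"
  then have z: "norm z \<le> r0" by simp
  show "((\<lambda>y. y - energy_root b l n y) has_field_derivative 1 - energy_root_deriv b l n z) (at z within cball 0 r0)"
    by (rule has_field_derivative_at_within) (auto intro!: derivative_eq_intros root_derivative[OF ln z])
  show "norm (1 - energy_root_deriv b l n z) \<le> 1/2"
    using near(2)[OF ln z] by (simp add: norm_minus_commute)
qed (use x y in auto)

lemma energy_root_0 [simp]: "energy_root b l n 0 = 0"
  by (simp add: energy_root_def)

lemma norm_root_ge:
  assumes "(l, n) \<in> N" "norm y \<le> r0"
  shows "norm y \<le> 2 * norm (energy_root b l n y)"
  using root_near_id[OF assms, of 0] r0 norm_triangle_ineq2[of y "y - energy_root b l n y"] by simp

lemma root_inj:
  assumes "(l, n) \<in> N" "norm x \<le> r0" "norm y \<le> r0" "energy_root b l n x = energy_root b l n y"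
  shows "x = y"
  using root_near_id[OF assms(1-3)] assms(4) by simp

definition root_inv :: "real \<Rightarrow> real \<Rightarrow> complex \<Rightarrow> complex" where
  "root_inv l n v = (THE y. norm y \<le> r0 \<and> energy_root b l n y = v)"

text \<open>Preimages of \<open>v\<close> are the fixed points of
  \<open>y - energy_root b l n y + v\<close>, which contracts by \<open>1/2\<close> and maps the
  ball to itself when \<open>norm v \<le> r0/2\<close>.\<close>

lemma root_surj:
  assumes ln: "(l, n) \<in> N" and v: "norm v \<le> r0/2"
  shows "\<exists>y. norm y \<le> r0 \<and> energy_root b l n y = v"
proof -
  have "\<exists>!y. y \<in> cball 0 r0 \<and> y - energy_root b l n y + v = y"
  proof (rule Banach_fix[where c = "1/2"])
    show "complete (cball 0 r0 :: complex set)" by (simp add: complete_eq_closed)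
    show "(\<lambda>y. y - energy_root b l n y + v) ` cball 0 r0 \<subseteq> cball 0 r0"
    proof safe
      fix y :: complex assume y: "y \<in> cball 0 r0"
      then have "norm (y - energy_root b l n y) \<le> 1/2 * norm y"
        using root_near_id[OF ln, of y 0] r0 by simp
      then have "norm (y - energy_root b l n y + v) \<le> 1/2 * norm y + r0/2"
        using v norm_triangle_ineq[of "y - energy_root b l n y" v] by linarith
      then show "y - energy_root b l n y + v \<in> cball 0 r0" using y by simp
    qed
    show "dist (x - energy_root b l n x + v) (y - energy_root b l n y + v) \<le> 1/2 * dist x y"
      if "x \<in> cball 0 r0" "y \<in> cball 0 r0" for x y
      using root_near_id[OF ln, of x y] that by (simp add: dist_norm)
  qed (use r0 in auto)
  then show ?thesis by auto
qed

lemma root_inv: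
  assumes "(l, n) \<in> N" "norm v \<le> r0/2"
  shows "norm (root_inv l n v) \<le> r0" "energy_root b l n (root_inv l n v) = v"
proof -
  have "\<exists>!y. norm y \<le> r0 \<and> energy_root b l n y = v"
    using root_surj[OF assms] root_inj[OF assms(1)] by blast
  from theI'[OF this] show "norm (root_inv l n v) \<le> r0" "energy_root b l n (root_inv l n v) = v"
    unfolding root_inv_def by auto
qed

lemma root_inv_eqI: "(l, n) \<in> N \<Longrightarrow> norm y \<le> r0 \<Longrightarrow> root_inv l n (energy_root b l n y) = y"
  unfolding root_inv_def using root_inj by (intro the_equality) auto

lemma norm_root_inv_le: "(l, n) \<in> N \<Longrightarrow> norm v \<le> r0/2 \<Longrightarrow> norm (root_inv l n v) \<le> 2 * norm v"
  using norm_root_ge[of l n "root_inv l n v"] root_inv[of l n v] by simp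

lemma root_inv_0: "(l, n) \<in> N \<Longrightarrow> root_inv l n 0 = 0"
  using root_inv_eqI[of l n 0] r0 by simp

lemma continuous_on_near:
  "continuous_on (N \<times> cball 0 r0) (\<lambda>(p, y). energy_factor b (fst p) (snd p) y)"
  "continuous_on (N \<times> cball 0 r0) (\<lambda>(p, y). lienard_weight b (fst p) (snd p) y)"
proof -
  have c: "continuous_on (N \<times> cball 0 r0) (\<lambda>x. (fst (fst x), snd (fst x), snd x) :: real \<times> real \<times> complex)"
    by (intro continuous_intros)
  have s: "(\<lambda>x. (fst (fst x), snd (fst x), snd x)) ` (N \<times> cball 0 r0) \<subseteq> (UNIV \<times> UNIV \<times> ball 0 1 :: (real \<times> real \<times> complex) set)"
    using r0 by auto
  show "continuous_on (N \<times> cball 0 r0) (\<lambda>(p, y). energy_factor b (fst p) (snd p) y)"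
    using continuous_on_compose2[OF continuous_on_energy_factor[OF b] c s] by (simp add: split_beta)
  show "continuous_on (N \<times> cball 0 r0) (\<lambda>(p, y). lienard_weight b (fst p) (snd p) y)"
    using continuous_on_compose2[OF continuous_on_weight[OF b] c s] by (simp add: split_beta)
qed

lemma continuous_on_csqrt_energy:
  "continuous_on (N \<times> cball 0 r0) (\<lambda>(p, y). csqrt (energy_factor b (fst p) (snd p) y))"
proof -
  have s: "(\<lambda>(p, y). energy_factor b (fst p) (snd p) y) ` (N \<times> cball 0 r0) \<subseteq> - \<real>\<^sub>\<le>\<^sub>0"
    using Re_energy_factor_pos by (fastforce simp: complex_nonpos_Reals_iff)
  show ?thesis
    using continuous_on_compose2[OF continuous_on_csqrt continuous_on_near(1) s] by (simp add: split_beta)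
qed

lemma csqrt_energy_nz: "(l, n) \<in> N \<Longrightarrow> norm y \<le> r0 \<Longrightarrow> csqrt (energy_factor b l n y) \<noteq> 0"
  using Re_energy_factor_pos[of l n y] by auto

lemma weight_nz: "(l, n) \<in> N \<Longrightarrow> norm y \<le> r0 \<Longrightarrow> lienard_weight b l n y \<noteq> 0"
  using energy_root_deriv_nz[of l n y] by (auto simp: energy_root_deriv_def)

lemma continuous_on_root_deriv:
  "continuous_on (N \<times> cball 0 r0) (\<lambda>(p, y). energy_root_deriv b (fst p) (snd p) y)"
  using continuous_on_divide[OF continuous_on_near(2) continuous_on_csqrt_energy] csqrt_energy_nz
  by (auto simp: energy_root_deriv_def split_beta)

text \<open>The map that keeps the parameters and sends \<open>y\<close> to \<open>v\<close> is a
  continuous injection on a compact set, so its inverse is continuous, jointly in parameters and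
  \<open>v\<close>.\<close>

lemma continuous_on_root_inv:
  "continuous_on (N \<times> cball 0 (r0/2)) (\<lambda>(p, v). root_inv (fst p) (snd p) v)"
proof -
  let ?f = "\<lambda>(p, y). (p, energy_root b (fst p) (snd p) y)"
  let ?g = "\<lambda>(p, v). (p, root_inv (fst p) (snd p) v)"
  have f: "continuous_on (N \<times> cball 0 r0) ?f"
    using continuous_on_csqrt_energy by (auto simp: energy_root_def split_beta intro!: continuous_intros)
  have "continuous_on (?f ` (N \<times> cball 0 r0)) ?g"
    by (rule continuous_on_inv[OF f]) (use N root_inv_eqI in \<open>auto intro: compact_Times\<close>)
  moreover have "N \<times> cball 0 (r0/2) \<subseteq> ?f ` (N \<times> cball 0 r0)"
  proof
    fix x :: "(real \<times> real) \<times> complex" assume "x \<in> N \<times> cball 0 (r0/2)"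
    then obtain l n v where x: "x = ((l, n), v)" "(l, n) \<in> N" "norm v \<le> r0/2" by auto
    from root_inv[OF x(2,3)] show "x \<in> ?f ` (N \<times> cball 0 r0)"
      using x by (auto intro!: image_eqI[of _ _ "((l, n), root_inv l n v)"])
  qed
  ultimately have "continuous_on (N \<times> cball 0 (r0/2)) ?g" by (rule continuous_on_subset)
  from continuous_on_snd[OF this] show ?thesis by (simp add: split_beta)
qed

lemma root_inv_has_derivative:
  assumes ln: "(l, n) \<in> N" and v: "norm v < r0/2"
  shows "(root_inv l n has_field_derivative inverse (energy_root_deriv b l n (root_inv l n v))) (at v)"
proof (rule has_field_derivative_inverse_basic[where t = "ball 0 (r0/2)" and f = "energy_root b l n"])
  have v': "norm v \<le> r0/2" using v by simp
  show "(energy_root b l n has_field_derivative energy_root_deriv b l n (root_inv l n v)) (at (root_inv l n v))"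
    by (rule root_derivative[OF ln root_inv(1)[OF ln v']])
  show "energy_root_deriv b l n (root_inv l n v) \<noteq> 0"
    by (rule energy_root_deriv_nz[OF ln root_inv(1)[OF ln v']])
  have "continuous_on (cball 0 (r0/2)) (\<lambda>v. case ((l, n), v) of (p, v) \<Rightarrow> root_inv (fst p) (snd p) v)"
    by (rule continuous_on_compose2[OF continuous_on_root_inv]) (use ln in \<open>auto intro!: continuous_intros\<close>)
  then have "continuous_on (ball 0 (r0/2)) (root_inv l n)" by (auto elim: continuous_on_subset)
  then show "isCont (root_inv l n) v" using v by (simp add: continuous_on_eq_continuous_at)
  show "energy_root b l n (root_inv l n z) = z" if "z \<in> ball 0 (r0/2)" for z
    using root_inv(2)[OF ln, of z] that by simp
qed (use v in auto)

lemma root_inv_cnj: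
  assumes ln: "(l, n) \<in> N" and v: "norm v \<le> r0/2"
  shows "root_inv l n (cnj v) = cnj (root_inv l n v)"
proof -
  let ?y = "root_inv l n v"
  have y: "norm ?y \<le> r0" "norm ?y < 1" using root_inv(1)[OF ln v] r0 by auto
  have "energy_factor b l n ?y \<notin> \<real>\<^sub>\<le>\<^sub>0" using Re_energy_factor_pos[OF ln y(1)] by (auto simp: complex_nonpos_Reals_iff)
  then have "energy_root b l n (cnj ?y) = cnj (energy_root b l n ?y)"
    by (simp add: energy_root_def energy_factor_cnj[OF b y(2)] cnj_csqrt)
  also have "\<dots> = cnj v" using root_inv(2)[OF ln v] by simp
  finally show ?thesis using root_inv_eqI[OF ln, of "cnj ?y"] y(1) by simp
qed

lemma root_inv_real:
  assumes ln: "(l, n) \<in> N" and v: "\<bar>v\<bar> \<le> r0/2"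
  shows "root_inv l n (of_real v) = of_real (Re (root_inv l n (of_real v)))"
  using root_inv_cnj[OF ln, of "of_real v"] v by (simp add: complex_eq_iff)

lemma root_inv_pos:
  assumes ln: "(l, n) \<in> N" and v: "0 < v" "v \<le> r0/2"
  shows "0 < Re (root_inv l n (of_real v))"
proof -
  let ?y = "root_inv l n (of_real v)"
  let ?K = "energy_factor b l n ?y"
  have nv: "norm (complex_of_real v) \<le> r0/2" using v by simp
  have y: "norm ?y \<le> r0" "norm ?y < 1" using root_inv(1)[OF ln nv] r0 by auto
  have yr: "?y = of_real (Re ?y)" using root_inv_real[OF ln, of v] v by simp
  then have "cnj ?y = ?y" by (metis complex_cnj_complex_of_real)
  then have "?K = cnj ?K" using energy_factor_cnj[OF b y(2), of l n] by simp
  then have K: "?K = of_real (Re ?K)" by (simp add: complex_eq_iff)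
  have Kp: "0 < Re ?K" by (rule Re_energy_factor_pos[OF ln y(1)])
  have "csqrt ?K = of_real (sqrt (Re ?K))" using K Kp by (metis csqrt_of_real_nonneg less_imp_le Re_complex_of_real Im_complex_of_real)
  then have "of_real v = of_real (Re ?y) * complex_of_real (sqrt (Re ?K))"
    using root_inv(2)[OF ln nv] yr by (simp add: energy_root_def)
  then have "v = Re ?y * sqrt (Re ?K)" by (metis of_real_eq_iff of_real_mult)
  then show ?thesis using v Kp by (metis real_sqrt_gt_zero zero_less_mult_pos2)
qed

text \<open>The damping \<open>\<phi>\<close> attached to one half-plane; the reciprocal of
  \<open>energy_root_deriv\<close> is the factor \<open>dy/dv\<close>.\<close>

definition symbol :: "real \<Rightarrow> real \<Rightarrow> real \<Rightarrow> real \<Rightarrow> complex \<Rightarrow> complex" where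
  "symbol d l m n v = (of_real d + of_real m * root_inv l n v) * exp (of_real (l * b - 1) * Ln (1 - of_real b * root_inv l n v)) /
     energy_root_deriv b l n (root_inv l n v)"

lemma one_minus_root_inv:
  assumes "(l, n) \<in> N" "norm v \<le> r0/2"
  shows "1 - of_real b * root_inv l n v \<notin> \<real>\<^sub>\<le>\<^sub>0" "1 - of_real b * root_inv l n v \<noteq> 0"
    "0 < Re (1 - of_real b * root_inv l n v)"
proof -
  have "norm (root_inv l n v) < 1" using root_inv(1)[OF assms] r0 by simp
  from one_minus_notin_nonpos[OF b this] Re_one_minus_pos[OF b this]
  show "1 - of_real b * root_inv l n v \<notin> \<real>\<^sub>\<le>\<^sub>0" "1 - of_real b * root_inv l n v \<noteq> 0"
    "0 < Re (1 - of_real b * root_inv l n v)" by auto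
qed

lemma holomorphic_root_inv: "(l, n) \<in> N \<Longrightarrow> root_inv l n holomorphic_on ball 0 (r0/2)"
  unfolding holomorphic_on_open[OF open_ball]
proof
  fix v :: complex assume "(l, n) \<in> N" "v \<in> ball 0 (r0/2)"
  then show "\<exists>f'. (root_inv l n has_field_derivative f') (at v)"
    using root_inv_has_derivative[of l n v] by auto
qed

lemma holomorphic_symbol:
  assumes ln: "(l, n) \<in> N"
  shows "symbol d l m n holomorphic_on ball 0 (r0/2)"
proof -
  have "deriv (root_inv l n) holomorphic_on ball 0 (r0/2)"
    by (rule holomorphic_deriv[OF holomorphic_root_inv[OF ln] open_ball])
  then have hol: "(\<lambda>v. (of_real d + of_real m * root_inv l n v) * exp (of_real (l * b - 1) * Ln (1 - of_real b * root_inv l n v)) *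
     deriv (root_inv l n) v) holomorphic_on ball 0 (r0/2)"
    using one_minus_root_inv(1)[OF ln] by (intro holomorphic_intros holomorphic_root_inv[OF ln]) auto
  have eq: "deriv (root_inv l n) v = inverse (energy_root_deriv b l n (root_inv l n v))" if "v \<in> ball 0 (r0/2)" for v
    using DERIV_imp_deriv[OF root_inv_has_derivative[OF ln, of v]] that by simp
  show ?thesis
    by (rule holomorphic_transform[OF hol]) (simp only: symbol_def divide_inverse eq)
qed

lemma root_deriv_cnj:
  assumes ln: "(l, n) \<in> N" and y: "norm y \<le> r0"
  shows "energy_root_deriv b l n (cnj y) = cnj (energy_root_deriv b l n y)"
proof -
  have y': "norm y < 1" using y r0 by simp
  have "energy_factor b l n y \<notin> \<real>\<^sub>\<le>\<^sub>0" using Re_energy_factor_pos[OF ln y] by (auto simp: complex_nonpos_Reals_iff)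
  then show ?thesis by (simp add: energy_root_deriv_def energy_factor_cnj[OF b y'] weight_cnj[OF b y'] cnj_csqrt)
qed

lemma symbol_cnj:
  assumes ln: "(l, n) \<in> N" and v: "norm v \<le> r0/2"
  shows "symbol d l m n (cnj v) = cnj (symbol d l m n v)"
  using root_deriv_cnj[OF ln root_inv(1)[OF ln v]] cnj_Ln[OF one_minus_root_inv(1)[OF ln v]]
  by (simp add: symbol_def root_inv_cnj[OF ln v] exp_cnj)

lemma continuous_on_symbol:
  "continuous_on {(p, v). (fst (snd p), snd (snd (snd p))) \<in> N \<and> norm v \<le> r0/2}
    (\<lambda>(p, v). symbol (fst p) (fst (snd p)) (fst (snd (snd p))) (snd (snd (snd p))) v)"
proof -
  let ?S = "{(p :: real \<times> real \<times> real \<times> real, v). (fst (snd p), snd (snd (snd p))) \<in> N \<and> norm v \<le> r0/2}"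
  let ?q = "\<lambda>x :: (real \<times> real \<times> real \<times> real) \<times> complex. (fst (snd (fst x)), snd (snd (snd (fst x))))"
  have Y: "continuous_on ?S (\<lambda>x. root_inv (fst (?q x)) (snd (?q x)) (snd x))"
  proof -
    have c: "continuous_on ?S (\<lambda>x. (?q x, snd x))" by (intro continuous_intros)
    have s: "(\<lambda>x. (?q x, snd x)) ` ?S \<subseteq> N \<times> cball 0 (r0/2)" by auto
    show ?thesis using continuous_on_compose2[OF continuous_on_root_inv c s] by simp
  qed
  have J: "continuous_on ?S (\<lambda>x. energy_root_deriv b (fst (?q x)) (snd (?q x)) (root_inv (fst (?q x)) (snd (?q x)) (snd x)))"
  proof -
    have c: "continuous_on ?S (\<lambda>x. (?q x, root_inv (fst (?q x)) (snd (?q x)) (snd x)))" 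
      by (rule continuous_on_Pair[OF _ Y]) (intro continuous_intros)
    have s: "(\<lambda>x. (?q x, root_inv (fst (?q x)) (snd (?q x)) (snd x))) ` ?S \<subseteq> N \<times> cball 0 r0"
      using root_inv(1) by auto
    show ?thesis using continuous_on_compose2[OF continuous_on_root_deriv c s] by simp
  qed
  have Jnz: "energy_root_deriv b (fst (?q x)) (snd (?q x)) (root_inv (fst (?q x)) (snd (?q x)) (snd x)) \<noteq> 0" if "x \<in> ?S" for x
  proof -
    obtain d l m n v where x: "x = ((d, l, m, n), v)" by (metis surj_pair)
    then have "(l, n) \<in> N" "norm v \<le> r0/2" using that by auto
    then show ?thesis using energy_root_deriv_nz root_inv(1) by (simp add: x)
  qed
  have "continuous_on ?S (\<lambda>x. 1 - of_real b * root_inv (fst (?q x)) (snd (?q x)) (snd x))"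
    by (intro continuous_intros Y)
  then have L: "continuous_on ?S (\<lambda>x. Ln (1 - of_real b * root_inv (fst (?q x)) (snd (?q x)) (snd x)))"
    by (rule continuous_on_Ln') (use one_minus_root_inv(1) in auto)
  have "continuous_on ?S (\<lambda>x. of_real (fst (fst x)) + of_real (fst (snd (snd (fst x)))) * root_inv (fst (?q x)) (snd (?q x)) (snd x))"
    by (rule continuous_on_add[OF _ continuous_on_mult[OF _ Y]]) (intro continuous_intros)+
  moreover have "continuous_on ?S (\<lambda>x. exp (of_real (fst (snd (fst x)) * b - 1) * Ln (1 - of_real b * root_inv (fst (?q x)) (snd (?q x)) (snd x))))"
    by (rule continuous_on_exp[OF continuous_on_mult[OF _ L]]) (intro continuous_intros)
  ultimately have "continuous_on ?S (\<lambda>x. (of_real (fst (fst x)) + of_real (fst (snd (snd (fst x)))) * root_inv (fst (?q x)) (snd (?q x)) (snd x)) *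
      exp (of_real (fst (snd (fst x)) * b - 1) * Ln (1 - of_real b * root_inv (fst (?q x)) (snd (?q x)) (snd x))) /
      energy_root_deriv b (fst (?q x)) (snd (?q x)) (root_inv (fst (?q x)) (snd (?q x)) (snd x)))"
    using Jnz by (intro continuous_on_divide[OF continuous_on_mult J]) blast+
  then show ?thesis unfolding symbol_def split_beta fst_conv snd_conv .
qed

lemma damping_symbol:
  assumes "(l, n) \<in> N" "0 < \<delta>" "\<delta> \<le> r0/2" "\<And>v. norm v < \<delta> \<Longrightarrow> norm (symbol d l m n v) \<le> 1/40"
  shows "damping (symbol d l m n) \<delta>"
proof
  show "symbol d l m n holomorphic_on ball 0 \<delta>"
    by (rule holomorphic_on_subset[OF holomorphic_symbol[OF assms(1)]]) (use assms in auto)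
  show "symbol d l m n (cnj v) = cnj (symbol d l m n v)" if "norm v < \<delta>" for v
    by (rule symbol_cnj[OF assms(1)]) (use assms that in auto)
qed (use assms in auto)

end

text \<open>At \<open>y = 0\<close> both quantities to be controlled equal 1, so joint continuity
  supplies a neighbourhood in which they stay within \<open>1/2\<close> of 1.\<close>

lemma lienard_normal_form_exists:
  assumes b: "\<bar>b\<bar> = 1"
  obtains e r0 where "0 < e" "lienard_normal_form b r0 (cball l e \<times> cball n e)"
proof -
  let ?S = "UNIV \<times> UNIV \<times> ball 0 1 :: (real \<times> real \<times> complex) set"
  have os: "open ?S" by (intro open_Times) auto
  have in0: "(l, n, 0) \<in> ?S" by simp
  have K: "isCont (\<lambda>(l, n, y). energy_factor b l n y) (l, n, 0)"
    using continuous_on_energy_factor[OF b] in0 os by (simp add: continuous_on_eq_continuous_at)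
  have E: "isCont (\<lambda>(l, n, y). lienard_weight b l n y) (l, n, 0)"
    using continuous_on_weight[OF b] in0 os by (simp add: continuous_on_eq_continuous_at)
  have K0: "energy_factor b l n 0 = 1" by (rule energy_factor_0[OF b])
  have sq: "isCont (\<lambda>x. csqrt (case x of (l, n, y) \<Rightarrow> energy_factor b l n y)) (l, n, 0)"
    using K K0 by (intro isCont_o2[OF K] continuous_at_csqrt) auto
  have J: "isCont (\<lambda>x. (case x of (l, n, y) \<Rightarrow> lienard_weight b l n y) / csqrt (case x of (l, n, y) \<Rightarrow> energy_factor b l n y)) (l, n, 0)"
    by (rule isCont_divide[OF E sq]) (simp add: K0)
  obtain d1 where d1: "d1 > 0" "\<And>x. dist x (l, n, 0) < d1 \<Longrightarrow> dist (case x of (l, n, y) \<Rightarrow> energy_factor b l n y) 1 < 1/2"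
    using K[unfolded continuous_at_eps_delta, rule_format, of "1/2"] by (auto simp: K0)
  obtain d2 where d2: "d2 > 0" "\<And>x. dist x (l, n, 0) < d2 \<Longrightarrow>
      dist ((case x of (l, n, y) \<Rightarrow> lienard_weight b l n y) / csqrt (case x of (l, n, y) \<Rightarrow> energy_factor b l n y)) 1 < 1/2"
    using J[unfolded continuous_at_eps_delta, rule_format, of "1/2"] by (auto simp: K0 weight_0[OF b])
  \<comment> \<open>The distance of two triples is at most the sum of three coordinate distances,
    each at most \<open>e\<close>; a quarter of \<open>min d1 d2\<close> leaves room for
    that.\<close>
  define e where "e = min (min d1 d2 / 4) (1/2)"
  have e: "0 < e" using d1 d2 by (simp add: e_def)
  have dist: "dist (l', n', y) (l, n, 0) < min d1 d2" if "(l', n') \<in> cball l e \<times> cball n e" "norm y \<le> e" for l' n' and y :: complex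
  proof -
    have "dist (l', n', y) (l, n, 0) \<le> dist l' l + dist (n', y) (n, 0)"
      by (metis dist_Pair_Pair sqrt_sum_squares_le_sum zero_le_dist)
    also have "dist (n', y) (n, 0) \<le> dist n' n + dist y 0"
      by (metis dist_Pair_Pair sqrt_sum_squares_le_sum zero_le_dist)
    finally have "dist (l', n', y) (l, n, 0) \<le> 3 * e" using that by (simp add: dist_commute)
    then show ?thesis using d1 d2 by (simp add: e_def min_def split: if_splits)
  qed
  show thesis
  proof (rule that[OF e])
    show "lienard_normal_form b e (cball l e \<times> cball n e)"
    proof
      fix l' n' and y :: complex assume a: "(l', n') \<in> cball l e \<times> cball n e" "norm y \<le> e"
      show "norm (energy_factor b l' n' y - 1) \<le> 1/2"
        using d1(2)[of "(l', n', y)"] dist[OF a] by (simp add: dist_norm)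
      show "norm (energy_root_deriv b l' n' y - 1) \<le> 1/2"
        using d2(2)[of "(l', n', y)"] dist[OF a] by (simp add: dist_norm energy_root_deriv_def)
    qed (use b e in \<open>auto simp: e_def intro: compact_Times\<close>)
  qed
qed

text \<open>Derivatives are relative to sets because the change of time below lives on a closed
  interval, with one-sided derivatives at its ends.\<close>

lemma has_real_derivative_inverse_within:
  fixes f g :: "real \<Rightarrow> real"
  assumes f: "(f has_real_derivative D) (at (g y) within S)" and D: "D \<noteq> 0"
    and y: "y \<in> T" and g: "\<And>z. z \<in> T \<Longrightarrow> g z \<in> S" "\<And>z. z \<in> T \<Longrightarrow> f (g z) = z"
    and cont: "continuous (at y within T) g"
  shows "(g has_real_derivative inverse D) (at y within T)"
proof -
  have "((\<lambda>z. (f z - f (g y)) / (z - g y)) \<longlongrightarrow> D) (at (g y) within S)"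
    using f by (simp add: has_field_derivative_iff)
  moreover have "filterlim g (at (g y) within S) (at y within T)"
    unfolding filterlim_at
  proof
    show "eventually (\<lambda>z. g z \<in> S \<and> g z \<noteq> g y) (at y within T)"
      unfolding eventually_at_filter using g y by (auto intro!: always_eventually) metis
    show "(g \<longlongrightarrow> g y) (at y within T)" using cont by (simp add: continuous_within)
  qed
  ultimately have "((\<lambda>z. (f (g z) - f (g y)) / (g z - g y)) \<longlongrightarrow> D) (at y within T)"
    by (rule filterlim_compose)
  then have "((\<lambda>z. inverse ((f (g z) - f (g y)) / (g z - g y))) \<longlongrightarrow> inverse D) (at y within T)"
    using D by (rule tendsto_inverse)
  moreover have "eventually (\<lambda>z. inverse ((f (g z) - f (g y)) / (g z - g y)) = (g z - g y) / (z - y)) (at y within T)"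
    unfolding eventually_at_filter using g y by (auto intro!: always_eventually)
  ultimately show ?thesis unfolding has_field_derivative_iff by (rule Lim_transform_eventually)
qed

text \<open>The curve runs along the field at the wrong speed. True time is the integral of
  \<open>\<tau>\<close>, and its inverse \<open>\<sigma>\<close> is the reparametrization.\<close>

lemma time_change:
  fixes c :: "real \<Rightarrow> 'a::real_normed_vector"
  assumes ab: "a < b"
    and c: "\<And>s. s \<in> {a..b} \<Longrightarrow> (c has_vector_derivative \<tau> s *\<^sub>R F (c s)) (at s within {a..b})"
    and \<tau>: "continuous_on {a..b} \<tau>" "\<And>s. s \<in> {a..b} \<Longrightarrow> 0 < \<tau> s"
  obtains T \<sigma> where "0 < T" "\<sigma> 0 = a" "\<sigma> T = b" "\<sigma> ` {0..T} = {a..b}"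
    "\<And>t. 0 < t \<Longrightarrow> t < T \<Longrightarrow> a < \<sigma> t \<and> \<sigma> t < b"
    "\<And>t. t \<in> {0..T} \<Longrightarrow> ((c \<circ> \<sigma>) has_vector_derivative F (c (\<sigma> t))) (at t within {0..T})"
proof -
  define S where "S s = integral {a..s} \<tau>" for s
  have S': "(S has_real_derivative \<tau> s) (at s within {a..b})" if "s \<in> {a..b}" for s
    unfolding S_def has_real_derivative_iff_has_vector_derivative by (rule integral_has_vector_derivative[OF \<tau>(1) that])
  have Sc: "continuous_on {a..b} S" using S' by (rule DERIV_continuous_on)
  have mono: "S x < S y" if "a \<le> x" "x < y" "y \<le> b" for x y
  proof (rule DERIV_pos_imp_increasing_open[OF that(2)])
    show "continuous_on {x..y} S" by (rule continuous_on_subset[OF Sc]) (use that in auto)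
    fix s assume s: "x < s" "s < y"
    then have "at s within {a..b} = at s" using that by (intro at_within_interior) auto
    then show "\<exists>D. DERIV S s :> D \<and> 0 < D" using S'[of s] \<tau>(2)[of s] s that by auto
  qed
  have S0: "S a = 0" by (simp add: S_def)
  define T where "T = S b"
  have T: "0 < T" using mono[of a b] ab S0 by (simp add: T_def)
  have inj: "inj_on S {a..b}"
    by (rule inj_onI) (metis atLeastAtMost_iff linorder_neq_iff mono)
  have img: "S ` {a..b} = {0..T}"
  proof
    show "S ` {a..b} \<subseteq> {0..T}"
      using mono S0 ab unfolding T_def by (force simp: le_less)
    show "{0..T} \<subseteq> S ` {a..b}"
      using IVT'[OF _ _ _ Sc] S0 ab unfolding T_def by (fastforce simp: image_iff)
  qed
  define \<sigma> where "\<sigma> = the_inv_into {a..b} S"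
  have \<sigma>S: "\<sigma> (S s) = s" if "s \<in> {a..b}" for s unfolding \<sigma>_def by (rule the_inv_into_f_f[OF inj that])
  have \<sigma>: "\<sigma> t \<in> {a..b}" "S (\<sigma> t) = t" if "t \<in> {0..T}" for t
  proof -
    obtain s where "s \<in> {a..b}" "t = S s" using \<open>t \<in> {0..T}\<close> img by blast
    then show "\<sigma> t \<in> {a..b}" "S (\<sigma> t) = t" using \<sigma>S by auto
  qed
  have \<sigma>c: "continuous_on {0..T} \<sigma>"
    unfolding img[symmetric] by (rule continuous_on_inv[OF Sc]) (use \<sigma>S in auto)
  have \<sigma>': "(\<sigma> has_real_derivative inverse (\<tau> (\<sigma> t))) (at t within {0..T})" if t: "t \<in> {0..T}" for t
    by (rule has_real_derivative_inverse_within[where g = \<sigma>, OF S'[OF \<sigma>(1)[OF t]]])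
       (use \<tau>(2)[OF \<sigma>(1)[OF t]] \<sigma> t \<sigma>c in \<open>auto simp: continuous_on_eq_continuous_within\<close>)
  show thesis
  proof (rule that[OF T])
    show "\<sigma> 0 = a" using \<sigma>S[of a] S0 ab by simp
    show "\<sigma> T = b" using \<sigma>S[of b] ab by (simp add: T_def)
    show "\<sigma> ` {0..T} = {a..b}" unfolding img[symmetric] image_image using \<sigma>S by (auto simp: image_iff)
    show "a < \<sigma> t \<and> \<sigma> t < b" if "0 < t" "t < T" for t
      using \<sigma>[of t] that S0 T_def by (auto simp: less_le)
    show "((c \<circ> \<sigma>) has_vector_derivative F (c (\<sigma> t))) (at t within {0..T})" if t: "t \<in> {0..T}" for t
    proof -
      have "(c has_vector_derivative \<tau> (\<sigma> t) *\<^sub>R F (c (\<sigma> t))) (at (\<sigma> t) within \<sigma> ` {0..T})"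
        by (rule has_vector_derivative_within_subset[OF c[OF \<sigma>(1)[OF t]]]) (use \<sigma> in auto)
      from vector_diff_chain_within[OF \<sigma>'[OF t, unfolded has_real_derivative_iff_has_vector_derivative] this]
      show ?thesis using \<tau>(2)[OF \<sigma>(1)[OF t]] by simp
    qed
  qed
qed

section \<open>Half-return maps\<close>

definition half_field :: "real \<Rightarrow> real \<Rightarrow> real \<Rightarrow> real \<Rightarrow> real \<Rightarrow> real \<times> real \<Rightarrow> real \<times> real" where
  "half_field b d l m n p =
     (- snd p + d * fst p + l * (fst p)\<^sup>2 + m * fst p * snd p + n * (snd p)\<^sup>2, fst p * (1 - b * snd p))"

section \<open>The half-return curve in the original coordinates\<close>

context lienard_normal_form
begin

text \<open>The inverse coordinate change \<open>v \<mapsto> y\<close> on the real axis, where it is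
  real-valued; \<open>slope\<close> is \<open>dv/dy\<close> at the corresponding point.\<close>

definition height :: "real \<Rightarrow> real \<Rightarrow> real \<Rightarrow> real" where
  "height l n v = Re (root_inv l n (of_real v))"

definition slope :: "real \<Rightarrow> real \<Rightarrow> real \<Rightarrow> real" where
  "slope l n v = Re (energy_root_deriv b l n (root_inv l n (of_real v)))"

context
  fixes l n :: real
  assumes ln: "(l, n) \<in> N"
begin

lemma root_inv_height: "\<bar>v\<bar> \<le> r0/2 \<Longrightarrow> root_inv l n (of_real v) = of_real (height l n v)"
  unfolding height_def by (rule root_inv_real[OF ln])

lemma abs_height_le: "\<bar>v\<bar> \<le> r0/2 \<Longrightarrow> \<bar>height l n v\<bar> \<le> 2 * \<bar>v\<bar>"
  using norm_root_inv_le[OF ln, of "of_real v"] root_inv_height[of v] by simp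

lemma height_pos: "0 < v \<Longrightarrow> v \<le> r0/2 \<Longrightarrow> 0 < height l n v"
  unfolding height_def by (rule root_inv_pos[OF ln])

lemma height_0: "height l n 0 = 0"
  using root_inv_0[OF ln] by (simp add: height_def)

lemma one_minus_height_bounds:
  assumes "\<bar>v\<bar> \<le> r0/2"
  shows "1/2 \<le> 1 - b * height l n v" "1 - b * height l n v \<le> 3/2"
proof -
  have "\<bar>b * height l n v\<bar> \<le> 1/2"
    using abs_height_le[OF assms] b assms r0 by (simp add: abs_mult)
  then show "1/2 \<le> 1 - b * height l n v" "1 - b * height l n v \<le> 3/2" unfolding abs_le_iff by linarith+
qed

lemma deriv_slope:
  assumes "\<bar>v\<bar> \<le> r0/2"
  shows "energy_root_deriv b l n (of_real (height l n v)) = of_real (slope l n v)" "1/2 \<le> slope l n v"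
proof -
  have nv: "norm (complex_of_real v) \<le> r0/2" using assms by simp
  note y = root_inv(1)[OF ln nv]
  have "energy_root_deriv b l n (of_real (height l n v)) = cnj (energy_root_deriv b l n (of_real (height l n v)))"
    using root_deriv_cnj[OF ln y] root_inv_height[OF assms] by simp
  then show "energy_root_deriv b l n (of_real (height l n v)) = of_real (slope l n v)"
    unfolding slope_def root_inv_height[OF assms] by (simp add: complex_eq_iff)
  have "\<bar>Re (energy_root_deriv b l n (root_inv l n (of_real v)) - 1)\<bar> \<le> 1/2"
    using near(2)[OF ln y] abs_Re_le_cmod order_trans by blast
  then show "1/2 \<le> slope l n v" by (simp add: slope_def abs_if split: if_splits)
qed

lemma height_has_derivative:
  assumes "\<bar>v\<bar> < r0/2"
  shows "(height l n has_real_derivative inverse (slope l n v)) (at v)"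
proof -
  have v: "norm (complex_of_real v) < r0/2" using assms by simp
  have "(root_inv l n has_field_derivative of_real (inverse (slope l n v))) (at (of_real v))"
    using root_inv_has_derivative[OF ln v] root_inv_height[of v] deriv_slope(1)[of v] assms by simp
  from bounded_linear.has_vector_derivative[OF bounded_linear_Re has_vector_derivative_real_field[OF this]]
  have "((\<lambda>v. Re (root_inv l n (of_real v))) has_real_derivative inverse (slope l n v)) (at v)"
    unfolding has_real_derivative_iff_has_vector_derivative Re_complex_of_real .
  then show ?thesis by (simp add: height_def[abs_def])
qed

lemma exp_Ln_height:
  assumes "\<bar>v\<bar> \<le> r0/2"
  shows "exp (of_real c * Ln (1 - of_real b * of_real (height l n v))) = complex_of_real ((1 - b * height l n v) powr c)"
proof -
  have p: "0 < 1 - b * height l n v" using one_minus_height_bounds[OF assms] by linarith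
  have "1 - of_real b * of_real (height l n v) = complex_of_real (1 - b * height l n v)" by simp
  then have "Ln (1 - of_real b * of_real (height l n v)) = of_real (ln (1 - b * height l n v))"
    using Ln_of_real[OF p] by simp
  then show ?thesis using p by (simp add: powr_def exp_of_real[symmetric] mult.commute)
qed

text \<open>The relation \<open>v dv/dy = G' y\<close> in real form. Through it the potential enters
  the verification that \<open>half_curve\<close> follows the field.\<close>

lemma height_energy:
  assumes "\<bar>v\<bar> \<le> r0/2"
  shows "v * slope l n v = height l n v * (1 - n * height l n v) * (1 - b * height l n v) powr (2 * l * b - 1)"
proof -
  have nv: "norm (complex_of_real v) \<le> r0/2" using assms by simp
  let ?y = "complex_of_real (height l n v)"
  have y: "norm ?y \<le> r0" "energy_root b l n ?y = of_real v"
    using root_inv[OF ln nv] root_inv_height[OF assms] by auto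
  have "of_real v * energy_root_deriv b l n ?y = ?y * csqrt (energy_factor b l n ?y) * (lienard_weight b l n ?y / csqrt (energy_factor b l n ?y))"
    unfolding y(2)[symmetric] by (simp add: energy_root_def energy_root_deriv_def)
  also have "\<dots> = ?y * lienard_weight b l n ?y" using csqrt_energy_nz[OF ln y(1)] by simp
  also have "\<dots> = ?y * (1 - of_real n * ?y) * complex_of_real ((1 - b * height l n v) powr (2 * l * b - 1))"
    by (simp only: lienard_weight_def exp_Ln_height[OF assms] mult.assoc)
  finally have "complex_of_real (v * slope l n v) = of_real (height l n v * (1 - n * height l n v) * (1 - b * height l n v) powr (2 * l * b - 1))"
    unfolding deriv_slope(1)[OF assms] by simp
  then show ?thesis by (simp only: of_real_eq_iff)
qed

lemma symbol_real:
  assumes "\<bar>v\<bar> \<le> r0/2"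
  shows "Re (symbol d l m n (of_real v)) = (d + m * height l n v) * (1 - b * height l n v) powr (l * b - 1) / slope l n v"
proof -
  have "symbol d l m n (of_real v) = of_real ((d + m * height l n v) * (1 - b * height l n v) powr (l * b - 1) / slope l n v)"
    unfolding symbol_def root_inv_height[OF assms] exp_Ln_height[OF assms] deriv_slope(1)[OF assms] by simp
  then show ?thesis by simp
qed

lemma continuous_on_height_slope:
  "continuous_on {-r0/2..r0/2} (height l n)" "continuous_on {-r0/2..r0/2} (slope l n)"
proof -
  have 1: "continuous_on {-r0/2..r0/2} (\<lambda>v. root_inv l n (of_real v))"
  proof -
    have "continuous_on {-r0/2..r0/2} (\<lambda>v. ((l, n), complex_of_real v))" by (intro continuous_intros)
    moreover have "(\<lambda>v. ((l, n), complex_of_real v)) ` {-r0/2..r0/2} \<subseteq> N \<times> cball 0 (r0/2)" using ln by auto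
    ultimately show ?thesis using continuous_on_compose2[OF continuous_on_root_inv] by fastforce
  qed
  then show "continuous_on {-r0/2..r0/2} (height l n)"
    unfolding height_def[abs_def] by (intro continuous_intros)
  have "(\<lambda>v. ((l, n), root_inv l n (of_real v))) ` {-r0/2..r0/2} \<subseteq> N \<times> cball 0 r0"
    using ln by (auto intro!: root_inv(1))
  from continuous_on_compose2[OF continuous_on_root_deriv continuous_on_Pair[OF continuous_on_const 1] this]
  have "continuous_on {-r0/2..r0/2} (\<lambda>v. energy_root_deriv b l n (root_inv l n (of_real v)))" by simp
  then show "continuous_on {-r0/2..r0/2} (slope l n)"
    unfolding slope_def[abs_def] by (intro continuous_intros)
qed

end

text \<open>The polar solution carried back through all substitutions:
  \<open>z = \<rho> cos t\<close>, \<open>v = \<rho> sin t\<close>, then \<open>y\<close> from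
  \<open>v\<close> and \<open>x = z w^(- l b)\<close>.\<close>

definition half_curve :: "real \<Rightarrow> real \<Rightarrow> real \<Rightarrow> real \<Rightarrow> real \<Rightarrow> real \<Rightarrow> real \<times> real" where
  "half_curve d l m n r t = (let \<rho> = Re (damping.polar_sol (symbol d l m n) (of_real r) t); v = \<rho> * sin t in
     (\<rho> * cos t * (1 - b * height l n v) powr (- (l * b)), height l n v))"

lemma b_square: "b * b = 1"
  using b by (metis abs_mult_self_eq mult_1)

context
  fixes d l m n \<delta> r :: real
  assumes ln: "(l, n) \<in> N" and damp: "damping (symbol d l m n) \<delta>" and \<delta>: "\<delta> \<le> r0/2"
    and r: "0 < r" "r < \<delta>/4"
begin

interpretation damping "symbol d l m n" \<delta> by (rule damp)

abbreviation "radius t \<equiv> Re (polar_sol (of_real r) t)"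

lemma radius_sin_bounds:
  assumes "t \<in> {0..pi}"
  shows "0 \<le> radius t * sin t" "radius t * sin t \<le> 3/2 * r" "\<bar>radius t * sin t\<bar> < r0/2"
    "\<bar>radius t * sin t\<bar> \<le> r0/2"
proof -
  note b = Re_polar_sol_bounds[OF r assms]
  show 1: "0 \<le> radius t * sin t" using b(1) r assms sin_ge_zero[of t] by (intro mult_nonneg_nonneg) auto
  show 2: "radius t * sin t \<le> 3/2 * r"
    using mult_mono[OF b(2) sin_le_one[of t]] r sin_ge_zero[of t] assms by simp
  show "\<bar>radius t * sin t\<bar> < r0/2" "\<bar>radius t * sin t\<bar> \<le> r0/2" using 1 2 r \<delta> by auto
qed

lemma half_curve_start: "half_curve d l m n r 0 = (r, 0)"
  using polar_sol(1)[of "of_real r"] r height_0[OF ln] by (simp add: half_curve_def)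

lemma half_curve_end: "half_curve d l m n r pi = (- Re (half_return (of_real r)), 0)"
  using height_0[OF ln] by (simp add: half_curve_def half_return_def)

lemma half_curve_upper:
  assumes "0 < t" "t < pi"
  shows "0 < snd (half_curve d l m n r t)"
proof -
  have t: "t \<in> {0..pi}" using assms by auto
  have "0 < radius t * sin t" using Re_polar_sol_bounds(1)[OF r t] r sin_gt_zero[OF assms] by auto
  then show ?thesis using height_pos[OF ln] radius_sin_bounds[OF t] by (simp add: half_curve_def Let_def)
qed

text \<open>Needed for the winding of the cycle around the origin: the radius and the power of
  \<open>w\<close> are both positive.\<close>

lemma half_curve_horizontal:
  assumes t: "t \<in> {0..pi}"
  shows "\<exists>c>0. fst (half_curve d l m n r t) = c * cos t"
proof -
  have "0 < radius t" using Re_polar_sol_bounds(1)[OF r t] r by linarith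
  moreover have "0 < 1 - b * height l n (radius t * sin t)"
    using one_minus_height_bounds(1)[OF ln radius_sin_bounds(4)[OF t]] by linarith
  ultimately show ?thesis
    by (intro exI[of _ "radius t * (1 - b * height l n (radius t * sin t)) powr (- (l * b))"]) (simp add: half_curve_def Let_def)
qed

text \<open>Since \<open>w\<close> lies between \<open>1/2\<close> and \<open>3/2\<close>, its
  logarithm is at most 1 in modulus, which bounds the power of \<open>w\<close> by
  \<open>exp \<bar>l\<bar>\<close>. A bound linear in \<open>r\<close> puts cycles of small radius
  into a given neighbourhood of the origin.\<close>

lemma norm_half_curve_le:
  assumes t: "t \<in> {0..pi}"
  shows "norm (half_curve d l m n r t) \<le> (2 * exp \<bar>l\<bar> + 3) * r"
proof -
  let ?v = "radius t * sin t"
  let ?w = "1 - b * height l n ?v"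
  note rb = Re_polar_sol_bounds[OF r t] and vb = radius_sin_bounds[OF t]
  have w: "1/2 \<le> ?w" "?w \<le> 3/2" by (rule one_minus_height_bounds[OF ln vb(4)])+
  have "\<bar>ln ?w\<bar> \<le> 1"
  proof -
    have "ln ?w \<le> ?w - 1" using w by (intro ln_le_minus_one) auto
    moreover have "ln (1/?w) \<le> 1/?w - 1" using w by (intro ln_le_minus_one) auto
    moreover have "1/?w \<le> 2" using w by (simp add: divide_simps)
    ultimately show ?thesis using w by (simp add: ln_div)
  qed
  then have "\<bar>- (l * b) * ln ?w\<bar> \<le> \<bar>l\<bar>" using b by (simp add: abs_mult mult_left_le)
  then have "?w powr (- (l * b)) \<le> exp \<bar>l\<bar>" using w by (simp add: powr_def abs_le_iff)
  then have "\<bar>radius t\<bar> * \<bar>cos t\<bar> * ?w powr (- (l * b)) \<le> (3/2 * r) * 1 * exp \<bar>l\<bar>"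
    using rb r by (intro mult_mono) auto
  moreover have "(3/2 * r) * 1 * exp \<bar>l\<bar> \<le> 2 * exp \<bar>l\<bar> * r" using r by simp
  ultimately have "\<bar>radius t\<bar> * \<bar>cos t\<bar> * ?w powr (- (l * b)) \<le> 2 * exp \<bar>l\<bar> * r" by (rule order_trans)
  then have "\<bar>fst (half_curve d l m n r t)\<bar> \<le> 2 * exp \<bar>l\<bar> * r"
    by (simp add: half_curve_def Let_def abs_mult)
  moreover have "\<bar>snd (half_curve d l m n r t)\<bar> \<le> 3 * r"
    using abs_height_le[OF ln vb(4)] vb(1,2) by (simp add: half_curve_def Let_def)
  moreover have "norm (half_curve d l m n r t) \<le> \<bar>fst (half_curve d l m n r t)\<bar> + \<bar>snd (half_curve d l m n r t)\<bar>"
    by (metis norm_Pair_le prod.collapse real_norm_def)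
  ultimately show ?thesis by (simp add: algebra_simps)
qed

lemma half_curve_has_derivative:
  obtains \<tau> where "continuous_on {0..pi} \<tau>" "\<And>t. t \<in> {0..pi} \<Longrightarrow> 0 < \<tau> t"
    "\<And>t. t \<in> {0..pi} \<Longrightarrow> (half_curve d l m n r has_vector_derivative \<tau> t *\<^sub>R half_field b d l m n (half_curve d l m n r t)) (at t within {0..pi})"
proof -
  define R where "R = (\<lambda>t. radius t)"
  define V where "V t = R t * sin t" for t
  define Y where "Y t = height l n (V t)" for t
  define W where "W t = 1 - b * Y t" for t
  define J where "J t = slope l n (V t)" for t
  define \<phi> where "\<phi> t = (d + m * Y t) * W t powr (l * b - 1) / J t" for t
  define \<kappa> where "\<kappa> t = 1 - cos t * sin t * \<phi> t" for t
  \<comment> \<open>The speed is dictated by the second component: the field has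
    \<open>X t * W t\<close> there, whereas \<open>Y\<close> has derivative
    \<open>R t * cos t / (\<kappa> t * J t)\<close>.\<close>
  define \<tau> where "\<tau> t = W t powr (l * b - 1) / (\<kappa> t * J t)" for t
  have Vb: "\<bar>V t\<bar> < r0/2" "\<bar>V t\<bar> \<le> r0/2" if "t \<in> {0..pi}" for t
    using radius_sin_bounds[OF that] by (auto simp: V_def R_def)
  have Wp: "0 < W t" if "t \<in> {0..pi}" for t
    using one_minus_height_bounds(1)[OF ln Vb(2)[OF that]] by (simp add: W_def Y_def)
  have Jp: "0 < J t" if "t \<in> {0..pi}" for t
    using deriv_slope(2)[OF ln Vb(2)[OF that]] by (simp add: J_def)
  have \<phi>: "Re (symbol d l m n (of_real (V t))) = \<phi> t" if "t \<in> {0..pi}" for t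
    using symbol_real[OF ln Vb(2)[OF that]] by (simp add: \<phi>_def Y_def W_def J_def)
  have \<kappa>p: "0 < \<kappa> t" if t: "t \<in> {0..pi}" for t
  proof -
    have "\<bar>V t\<bar> < \<delta>" using radius_sin_bounds(1,2)[OF t] r by (simp add: V_def R_def)
    then have "norm (complex_of_real (V t)) < \<delta>" by simp
    then have "norm (symbol d l m n (of_real (V t))) \<le> 1/40" by (rule bound)
    then have "\<bar>\<phi> t\<bar> \<le> 1/40" using abs_Re_le_cmod[of "symbol d l m n (of_real (V t))"] \<phi>[OF t] by linarith
    then have "\<bar>cos t * sin t\<bar> * \<bar>\<phi> t\<bar> \<le> 1 * (1/40)" by (intro mult_mono abs_cos_sin_le_1) auto
    then have "\<bar>cos t * sin t * \<phi> t\<bar> \<le> 1/40" by (simp add: abs_mult)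
    then show ?thesis unfolding \<kappa>_def abs_le_iff by linarith
  qed
  have \<rho>': "(R has_real_derivative R t * (cos t)\<^sup>2 * \<phi> t / \<kappa> t) (at t within {0..pi})" if t: "t \<in> {0..pi}" for t
    using Re_polar_sol_has_derivative[OF r t] \<phi>[OF t] by (simp add: \<kappa>_def V_def R_def)
  have V': "(V has_real_derivative R t * cos t / \<kappa> t) (at t within {0..pi})" if t: "t \<in> {0..pi}" for t
  proof -
    have "(V has_real_derivative R t * (cos t)\<^sup>2 * \<phi> t / \<kappa> t * sin t + R t * cos t) (at t within {0..pi})"
      unfolding V_def[abs_def] using \<rho>'[OF t] by (auto intro!: derivative_eq_intros)
    moreover have "R t * (cos t)\<^sup>2 * \<phi> t / \<kappa> t * sin t + R t * cos t = R t * cos t / \<kappa> t"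
      using \<kappa>p[OF t] by (simp add: field_simps) (simp add: \<kappa>_def power2_eq_square algebra_simps)
    ultimately show ?thesis by simp
  qed
  have Y': "(Y has_real_derivative R t * cos t / (\<kappa> t * J t)) (at t within {0..pi})" if t: "t \<in> {0..pi}" for t
    using DERIV_chain2[OF height_has_derivative[OF ln Vb(1)[OF t]] V'[OF t]]
    by (simp add: Y_def[abs_def] J_def divide_inverse mult_ac)
  \<comment> \<open>Together with \<open>V'\<close> this is the equation
    \<open>z dz + v dv = z \<phi> dv\<close> in the parameter \<open>t\<close>.\<close>
  have Z': "((\<lambda>t. R t * cos t) has_real_derivative (\<phi> t * (R t * cos t) - V t) / \<kappa> t) (at t within {0..pi})" if t: "t \<in> {0..pi}" for t
  proof -
    have "((\<lambda>t. R t * cos t) has_real_derivative R t * (cos t)\<^sup>2 * \<phi> t / \<kappa> t * cos t - R t * sin t) (at t within {0..pi})"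
      using \<rho>'[OF t] by (auto intro!: derivative_eq_intros)
    moreover have "R t * (cos t)\<^sup>2 * \<phi> t / \<kappa> t * cos t - R t * sin t = (\<phi> t * (R t * cos t) - V t) / \<kappa> t"
    proof -
      have "R t * (cos t)\<^sup>2 * \<phi> t * cos t - R t * sin t * \<kappa> t
          = R t * \<phi> t * cos t * ((cos t)\<^sup>2 + (sin t)\<^sup>2) - V t"
        unfolding \<kappa>_def V_def by algebra
      also have "\<dots> = \<phi> t * (R t * cos t) - V t" by simp
      finally show ?thesis using \<kappa>p[OF t] by (simp add: field_simps)
    qed
    ultimately show ?thesis by simp
  qed
  define X where "X t = R t * cos t * W t powr (- (l * b))" for t
  have X': "(X has_real_derivative (\<phi> t * (R t * cos t) - V t) / \<kappa> t * W t powr (- (l * b)) +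
      R t * cos t * (l * W t powr (- (l * b) - 1) * (R t * cos t / (\<kappa> t * J t)))) (at t within {0..pi})" if t: "t \<in> {0..pi}" for t
  proof -
    have "(W has_real_derivative - b * (R t * cos t / (\<kappa> t * J t))) (at t within {0..pi})"
      unfolding W_def[abs_def] using Y'[OF t] by (auto intro!: derivative_eq_intros)
    then have "((\<lambda>t. W t powr (- (l * b))) has_real_derivative
        (- (l * b)) * W t powr (- (l * b) - 1) * (- b * (R t * cos t / (\<kappa> t * J t)))) (at t within {0..pi})"
      using DERIV_chain2[where g = W, OF has_real_derivative_powr[OF Wp[OF t], of "- (l * b)"]] by blast
    moreover have "(- (l * b)) * W t powr (- (l * b) - 1) * (- b * (R t * cos t / (\<kappa> t * J t)))
      = (b * b) * (l * W t powr (- (l * b) - 1) * (R t * cos t / (\<kappa> t * J t)))" by (simp add: mult_ac)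
    ultimately have "((\<lambda>t. W t powr (- (l * b))) has_real_derivative l * W t powr (- (l * b) - 1) * (R t * cos t / (\<kappa> t * J t))) (at t within {0..pi})"
      by (simp only: b_square mult_1)
    from DERIV_mult[OF Z'[OF t] this] show ?thesis
      unfolding X_def[abs_def] by (simp add: add.commute mult_ac)
  qed
  have curve: "half_curve d l m n r = (\<lambda>t. (X t, Y t))"
    by (simp add: half_curve_def[abs_def] Let_def X_def Y_def W_def V_def R_def)
  show thesis
  proof (rule that[of \<tau>])
    show "0 < \<tau> t" if "t \<in> {0..pi}" for t
      using Wp[OF that] \<kappa>p[OF that] Jp[OF that] by (simp add: \<tau>_def)
    have Vc: "continuous_on {0..pi} V" by (rule DERIV_continuous_on[OF V'])
    have Yc: "continuous_on {0..pi} Y" by (rule DERIV_continuous_on[OF Y'])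
    have Vsub: "V ` {0..pi} \<subseteq> {-r0/2..r0/2}" 
    proof
      fix v assume "v \<in> V ` {0..pi}"
      then have "\<bar>v\<bar> \<le> r0/2" using Vb(2) by blast
      then show "v \<in> {-r0/2..r0/2}" by auto
    qed
    have Jc: "continuous_on {0..pi} J"
      unfolding J_def[abs_def] by (rule continuous_on_compose2[OF continuous_on_height_slope(2)[OF ln] Vc Vsub])
    have Wc: "continuous_on {0..pi} W" unfolding W_def[abs_def] by (intro continuous_intros Yc)
    have Wpc: "continuous_on {0..pi} (\<lambda>t. W t powr (l * b - 1))"
      using Wp by (intro continuous_intros Wc) force
    have \<phi>c: "continuous_on {0..pi} \<phi>"
      unfolding \<phi>_def[abs_def] using Jp by (intro continuous_intros Yc Jc Wpc) force
    have "continuous_on {0..pi} \<kappa>" unfolding \<kappa>_def[abs_def] by (intro continuous_intros \<phi>c)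
    then show "continuous_on {0..pi} \<tau>"
      unfolding \<tau>_def[abs_def] using Jp \<kappa>p by (intro continuous_on_divide continuous_on_mult Wpc Jc) force+
    fix t assume t: "t \<in> {0..pi}"
    have e: "V t * J t = Y t * (1 - n * Y t) * W t powr (2 * l * b - 1)"
      using height_energy[OF ln Vb(2)[OF t]] by (simp add: Y_def J_def W_def)
    define q where "q = W t powr (l * b)"
    have q: "q > 0" using Wp[OF t] by (simp add: q_def)
    have pw: "W t powr (l * b - 1) = q / W t" "W t powr (- (l * b)) = 1 / q" "W t powr (- (l * b) - 1) = 1 / (q * W t)"
      "W t powr (2 * l * b - 1) = q * q / W t"
      using Wp[OF t] by (simp_all add: q_def powr_diff powr_minus divide_inverse powr_add[symmetric] mult_ac)
    have J0: "J t \<noteq> 0" "\<kappa> t \<noteq> 0" "W t \<noteq> 0" "q \<noteq> 0" using Jp[OF t] \<kappa>p[OF t] Wp[OF t] q by auto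
    have e': "V t = Y t * (1 - n * Y t) * (q * q) / (W t * J t)"
      using e[unfolded pw(4)] J0 by (simp add: field_simps)
    have "\<tau> t *\<^sub>R half_field b d l m n (X t, Y t) =
        ((\<phi> t * (R t * cos t) - V t) / \<kappa> t * W t powr (- (l * b)) +
         R t * cos t * (l * W t powr (- (l * b) - 1) * (R t * cos t / (\<kappa> t * J t))), R t * cos t / (\<kappa> t * J t))"
    proof -
      have "\<tau> t * (X t * W t) = R t * cos t / (\<kappa> t * J t)"
        unfolding \<tau>_def X_def pw using J0 by (simp add: field_simps)
      moreover have "\<tau> t * (- Y t + d * X t + l * (X t)\<^sup>2 + m * X t * Y t + n * (Y t)\<^sup>2)
        = (\<phi> t * (R t * cos t) - V t) / \<kappa> t * W t powr (- (l * b)) +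
          R t * cos t * (l * W t powr (- (l * b) - 1) * (R t * cos t / (\<kappa> t * J t)))"
        unfolding \<tau>_def X_def \<phi>_def e' pw using J0
        by (simp add: divide_simps) (simp add: algebra_simps power2_eq_square)
      ultimately show ?thesis by (simp add: half_field_def W_def)
    qed
    then show "(half_curve d l m n r has_vector_derivative \<tau> t *\<^sub>R half_field b d l m n (half_curve d l m n r t)) (at t within {0..pi})"
      unfolding curve
      using has_vector_derivative_Pair[OF X'[OF t, unfolded has_real_derivative_iff_has_vector_derivative] Y'[OF t, unfolded has_real_derivative_iff_has_vector_derivative]]
      by simp
  qed
qed

end

end

section \<open>Uniqueness of solution arcs and reflection of the lower half-plane\<close>

definition lipschitz_on_bounded :: "('a::real_normed_vector \<Rightarrow> 'a) \<Rightarrow> bool" where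
  "lipschitz_on_bounded F \<longleftrightarrow> (\<forall>M. \<exists>L. \<forall>p\<in>cball 0 M. \<forall>q\<in>cball 0 M. norm (F p - F q) \<le> L * norm (p - q))"

lemma abs_mult_diff_le:
  fixes x y x' y' :: real
  assumes "\<bar>x\<bar> \<le> M" "\<bar>y'\<bar> \<le> M" "\<bar>x - x'\<bar> \<le> a" "\<bar>y - y'\<bar> \<le> a"
  shows "\<bar>x * y - x' * y'\<bar> \<le> 2 * M * a"
proof -
  have "x * y - x' * y' = x * (y - y') + y' * (x - x')" by (simp add: algebra_simps)
  moreover have "\<bar>x * (y - y')\<bar> \<le> M * a" "\<bar>y' * (x - x')\<bar> \<le> M * a"
    unfolding abs_mult using assms by (auto intro!: mult_mono)
  ultimately show ?thesis using abs_triangle_ineq[of "x * (y - y')" "y' * (x - x')"] by linarith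
qed

lemma half_field_lipschitz: "lipschitz_on_bounded (half_field b d l m n)"
  unfolding lipschitz_on_bounded_def
proof
  fix M :: real
  define L where "L = (1 + \<bar>d\<bar> + \<bar>l\<bar> * (2 * M) + \<bar>m\<bar> * (2 * M) + \<bar>n\<bar> * (2 * M)) + (1 + \<bar>b\<bar> * (2 * M))"
  have "norm (half_field b d l m n p - half_field b d l m n q) \<le> L * norm (p - q)"
    if "p \<in> cball 0 M" "q \<in> cball 0 M" for p q
  proof -
    obtain x y x' y' where pq: "p = (x, y)" "q = (x', y')" by (metis surj_pair)
    have bd: "\<bar>x\<bar> \<le> M" "\<bar>y\<bar> \<le> M" "\<bar>x'\<bar> \<le> M" "\<bar>y'\<bar> \<le> M"
      using that norm_fst_le[of x y] norm_snd_le[of y x] norm_fst_le[of x' y'] norm_snd_le[of y' x']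
      by (auto simp: pq)
    define a where "a = norm (p - q)"
    have df: "\<bar>x - x'\<bar> \<le> a" "\<bar>y - y'\<bar> \<le> a"
      using norm_fst_le[of "x - x'" "y - y'"] norm_snd_le[of "y - y'" "x - x'"] by (auto simp: pq a_def)
    have xx: "\<bar>x * x - x' * x'\<bar> \<le> 2 * M * a" by (rule abs_mult_diff_le) (use bd df in auto)
    have yy: "\<bar>y * y - y' * y'\<bar> \<le> 2 * M * a" by (rule abs_mult_diff_le) (use bd df in auto)
    have xy: "\<bar>x * y - x' * y'\<bar> \<le> 2 * M * a" by (rule abs_mult_diff_le) (use bd df in auto)
    have e1: "fst (half_field b d l m n p - half_field b d l m n q)
      = - (y - y') + d * (x - x') + l * (x * x - x' * x') + m * (x * y - x' * y') + n * (y * y - y' * y')"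
      by (simp add: half_field_def pq power2_eq_square algebra_simps)
    have e2: "snd (half_field b d l m n p - half_field b d l m n q) = (x - x') + - b * (x * y - x' * y')"
      by (simp add: half_field_def pq algebra_simps)
    have m: "\<bar>c * u\<bar> \<le> \<bar>c\<bar> * w" if "\<bar>u\<bar> \<le> w" for c u w :: real
      using that by (simp add: abs_mult mult_left_mono)
    have "\<bar>fst (half_field b d l m n p - half_field b d l m n q)\<bar>
      \<le> a + \<bar>d\<bar> * a + \<bar>l\<bar> * (2 * M * a) + \<bar>m\<bar> * (2 * M * a) + \<bar>n\<bar> * (2 * M * a)"
      unfolding e1
      by (rule order_trans[OF abs_triangle_ineq add_mono[OF order_trans[OF abs_triangle_ineq add_mono[OF
            order_trans[OF abs_triangle_ineq add_mono[OF order_trans[OF abs_triangle_ineq add_mono[OF _ m[OF df(1)]]] m[OF xx]]] m[OF xy]]] m[OF yy]]])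
         (use df(2) in simp)
    moreover have "\<bar>snd (half_field b d l m n p - half_field b d l m n q)\<bar> \<le> a + \<bar>b\<bar> * (2 * M * a)"
      unfolding e2 by (rule order_trans[OF abs_triangle_ineq add_mono[OF df(1)]]) (use m[OF xy, of "- b"] in simp)
    moreover have "norm (half_field b d l m n p - half_field b d l m n q) \<le>
      \<bar>fst (half_field b d l m n p - half_field b d l m n q)\<bar> + \<bar>snd (half_field b d l m n p - half_field b d l m n q)\<bar>"
      by (metis norm_Pair_le prod.collapse real_norm_def)
    ultimately show ?thesis by (simp add: L_def a_def algebra_simps)
  qed
  then show "\<exists>L. \<forall>p\<in>cball 0 M. \<forall>q\<in>cball 0 M. norm (half_field b d l m n p - half_field b d l m n q) \<le> L * norm (p - q)"
    by blast
qed

lemma autonomous_ode_unique: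
  fixes u w :: "real \<Rightarrow> 'a::real_inner"
  assumes F: "lipschitz_on_bounded F"
    and u: "\<And>t. t \<in> {a..b} \<Longrightarrow> (u has_vector_derivative F (u t)) (at t within {a..b})"
    and w: "\<And>t. t \<in> {a..b} \<Longrightarrow> (w has_vector_derivative F (w t)) (at t within {a..b})"
    and eq: "u a = w a" and t: "t \<in> {a..b}"
  shows "u t = w t"
proof -
  have "bounded (u ` {a..b} \<union> w ` {a..b})"
    using has_vector_derivative_continuous_on[OF u] has_vector_derivative_continuous_on[OF w]
    by (simp add: compact_continuous_image compact_imp_bounded)
  then obtain M where M: "\<And>p. p \<in> u ` {a..b} \<union> w ` {a..b} \<Longrightarrow> norm p \<le> M" unfolding bounded_iff by blast
  obtain L where L: "\<And>p q. p \<in> cball 0 M \<Longrightarrow> q \<in> cball 0 M \<Longrightarrow> norm (F p - F q) \<le> L * norm (p - q)"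
    using F unfolding lipschitz_on_bounded_def by meson
  show ?thesis
    by (rule ode_unique[where F = "\<lambda>_. F" and L = L, OF u w _ eq t]) (use L M in auto)
qed

text \<open>Two arcs from \<open>p\<close> agree as long as both exist. If one ended earlier, its
  end point would be an interior point of the other arc and so lie in \<open>H\<close>.\<close>

lemma solution_arc_unique:
  assumes F: "lipschitz_on_bounded F" and q: "q \<notin> H" "q' \<notin> H"
    and arcs: "solution_arc F H p q" "solution_arc F H p q'"
  shows "q = q'"
proof -
  have *: "q1 = q2 \<and> T1 = T2"
    if "0 < T1" "T1 \<le> T2" "g1 0 = p" "g1 T1 = q1" "g2 0 = p" "g2 T2 = q2" "q1 \<notin> H"
      and g1: "\<forall>t\<in>{0..T1}. (g1 has_vector_derivative F (g1 t)) (at t within {0..T1})"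
      and g2: "\<forall>t\<in>{0..T2}. (g2 has_vector_derivative F (g2 t)) (at t within {0..T2})"
      and H: "\<forall>t\<in>{0<..<T2}. g2 t \<in> H"
    for q1 q2 T1 T2 g1 g2
  proof -
    have "g1 T1 = g2 T1"
    proof (rule autonomous_ode_unique[OF F, of 0 T1])
      show "(g2 has_vector_derivative F (g2 t)) (at t within {0..T1})" if "t \<in> {0..T1}" for t
        by (rule has_vector_derivative_within_subset[of _ _ _ "{0..T2}"]) (use g2 that \<open>T1 \<le> T2\<close> in auto)
    qed (use that in auto)
    then have "\<not> T1 < T2" using H that by auto
    then show ?thesis using that \<open>g1 T1 = g2 T1\<close> by auto
  qed
  obtain T1 g1 where 1: "0 < T1" "g1 0 = p" "g1 T1 = q" "\<forall>t\<in>{0..T1}. (g1 has_vector_derivative F (g1 t)) (at t within {0..T1})" "\<forall>t\<in>{0<..<T1}. g1 t \<in> H"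
    using arcs(1) unfolding solution_arc_def by auto
  obtain T2 g2 where 2: "0 < T2" "g2 0 = p" "g2 T2 = q'" "\<forall>t\<in>{0..T2}. (g2 has_vector_derivative F (g2 t)) (at t within {0..T2})" "\<forall>t\<in>{0<..<T2}. g2 t \<in> H"
    using arcs(2) unfolding solution_arc_def by auto
  show ?thesis
  proof (cases "T1 \<le> T2")
    case True
    then show ?thesis using *[of T1 T2 g1 q g2 q'] 1 2 q by blast
  next
    case False
    then show ?thesis using *[of T2 T1 g2 q' g1 q] 1 2 q by auto
  qed
qed

definition flip :: "real \<times> real \<Rightarrow> real \<times> real" where
  "flip p = (fst p, - snd p)"

lemma flip_flip [simp]: "flip (flip p) = p"
  by (simp add: flip_def)

lemma bounded_linear_flip: "bounded_linear flip"
  unfolding flip_def[abs_def]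
  by (intro bounded_linear_Pair bounded_linear_fst bounded_linear_compose[OF bounded_linear_minus[OF bounded_linear_ident]] bounded_linear_minus bounded_linear_snd)

lemma has_vector_derivative_reverse:
  assumes "(g has_vector_derivative D) (at (a - t) within (\<lambda>s. a - s) ` S)"
  shows "((\<lambda>s. g (a - s)) has_vector_derivative - D) (at t within S)"
proof -
  have "((\<lambda>s::real. a - s) has_vector_derivative - 1) (at t within S)"
    by (auto intro!: derivative_eq_intros)
  from vector_diff_chain_within[OF this assms] show ?thesis by (simp add: o_def)
qed

text \<open>Reversing time exchanges the end points. This is how the inverse of the second
  half-return map becomes a forward map of the same kind as the first.\<close>

lemma solution_arc_reverse:
  assumes F: "\<And>p. G (flip p) = - flip (F p)" and H: "\<And>p. p \<in> H \<Longrightarrow> flip p \<in> H'"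
    and arc: "solution_arc F H p q"
  shows "solution_arc G H' (flip q) (flip p)"
proof -
  obtain T g where g: "0 < T" "g 0 = p" "g T = q" "\<forall>t\<in>{0..T}. (g has_vector_derivative F (g t)) (at t within {0..T})" "\<forall>t\<in>{0<..<T}. g t \<in> H"
    using arc unfolding solution_arc_def by auto
  have "((\<lambda>t. flip (g (T - t))) has_vector_derivative G (flip (g (T - t)))) (at t within {0..T})" if "t \<in> {0..T}" for t
  proof -
    have "(\<lambda>s. T - s) ` {0..T} = {0..T}" by (auto simp: image_iff intro!: bexI[of _ "T - _"])
    then have "(g has_vector_derivative F (g (T - t))) (at (T - t) within (\<lambda>s. T - s) ` {0..T})" using g(4) that by auto
    from bounded_linear.has_vector_derivative[OF bounded_linear_flip has_vector_derivative_reverse[OF this]]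
    show ?thesis by (simp add: F linear_neg[OF bounded_linear.linear[OF bounded_linear_flip]])
  qed
  then show ?thesis unfolding solution_arc_def using g H by (intro exI[of _ T] conjI exI[of _ "\<lambda>t. flip (g (T - t))"]) auto
qed

lemma upper_field_half_field: "upper_field (d1, d2, l1, l2, m1, m2, n1, n2) = half_field 1 d1 l1 m1 n1"
  by (auto simp: half_field_def fun_eq_iff)

lemma lower_field_flip:
  "lower_field (d1, d2, l1, l2, m1, m2, n1, n2) (flip p) = - flip (half_field (-1) (- d2) (- l2) m2 (- n2) p)"
  "half_field (-1) (- d2) (- l2) m2 (- n2) (flip p) = - flip (lower_field (d1, d2, l1, l2, m1, m2, n1, n2) p)"
  by (cases p; simp add: half_field_def flip_def algebra_simps)+

lemma lower_arc_iff:
  "solution_arc (lower_field (d1, d2, l1, l2, m1, m2, n1, n2)) lower_half (- s, 0) (r, 0) \<longleftrightarrow>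
   solution_arc (half_field (-1) (- d2) (- l2) m2 (- n2)) upper_half (r, 0) (- s, 0)"
proof
  assume "solution_arc (lower_field (d1, d2, l1, l2, m1, m2, n1, n2)) lower_half (- s, 0) (r, 0)"
  from solution_arc_reverse[OF lower_field_flip(2) _ this, of upper_half]
  show "solution_arc (half_field (-1) (- d2) (- l2) m2 (- n2)) upper_half (r, 0) (- s, 0)"
    by (simp add: flip_def upper_half_def lower_half_def)
next
  assume "solution_arc (half_field (-1) (- d2) (- l2) m2 (- n2)) upper_half (r, 0) (- s, 0)"
  from solution_arc_reverse[OF lower_field_flip(1) _ this, of lower_half]
  show "solution_arc (lower_field (d1, d2, l1, l2, m1, m2, n1, n2)) lower_half (- s, 0) (r, 0)"
    by (simp add: flip_def upper_half_def lower_half_def)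
qed

context lienard_normal_form
begin

abbreviation half_map :: "real \<Rightarrow> real \<Rightarrow> real \<Rightarrow> real \<Rightarrow> real \<Rightarrow> real" where
  "half_map d l m n r \<equiv> Re (damping.half_return (symbol d l m n) (of_real r))"

lemma half_arc:
  assumes "(l, n) \<in> N" "damping (symbol d l m n) \<delta>" "\<delta> \<le> r0/2" "0 < r" "r < \<delta>/4"
  obtains T \<sigma> where "0 < T" "\<sigma> 0 = 0" "\<sigma> T = pi" "\<sigma> ` {0..T} = {0..pi}"
    "\<And>t. 0 < t \<Longrightarrow> t < T \<Longrightarrow> 0 < \<sigma> t \<and> \<sigma> t < pi"
    "\<And>t. t \<in> {0..T} \<Longrightarrow> ((half_curve d l m n r \<circ> \<sigma>) has_vector_derivative
      half_field b d l m n (half_curve d l m n r (\<sigma> t))) (at t within {0..T})"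
proof -
  obtain \<tau> where \<tau>: "continuous_on {0..pi} \<tau>" "\<And>t. t \<in> {0..pi} \<Longrightarrow> 0 < \<tau> t"
    "\<And>t. t \<in> {0..pi} \<Longrightarrow> (half_curve d l m n r has_vector_derivative \<tau> t *\<^sub>R half_field b d l m n (half_curve d l m n r t)) (at t within {0..pi})"
    using half_curve_has_derivative[OF assms] by blast
  from time_change[OF pi_gt_zero \<tau>(3) \<tau>(1,2)] obtain T \<sigma> where "0 < T" "\<sigma> 0 = 0" "\<sigma> T = pi" "\<sigma> ` {0..T} = {0..pi}"
    "\<And>t. 0 < t \<Longrightarrow> t < T \<Longrightarrow> 0 < \<sigma> t \<and> \<sigma> t < pi"
    "\<And>t. t \<in> {0..T} \<Longrightarrow> ((half_curve d l m n r \<circ> \<sigma>) has_vector_derivative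
      half_field b d l m n (half_curve d l m n r (\<sigma> t))) (at t within {0..T})"
    by blast
  then show thesis by (rule that)
qed

lemma solution_arc_half_map:
  assumes "(l, n) \<in> N" "damping (symbol d l m n) \<delta>" "\<delta> \<le> r0/2" "0 < r" "r < \<delta>/4"
  shows "solution_arc (half_field b d l m n) upper_half (r, 0) (- half_map d l m n r, 0)"
proof -
  obtain T \<sigma> where g: "0 < T" "\<sigma> 0 = 0" "\<sigma> T = pi" "\<sigma> ` {0..T} = {0..pi}"
    "\<And>t. 0 < t \<Longrightarrow> t < T \<Longrightarrow> 0 < \<sigma> t \<and> \<sigma> t < pi"
    "\<And>t. t \<in> {0..T} \<Longrightarrow> ((half_curve d l m n r \<circ> \<sigma>) has_vector_derivative
      half_field b d l m n (half_curve d l m n r (\<sigma> t))) (at t within {0..T})"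
    using half_arc[OF assms] by blast
  show ?thesis unfolding solution_arc_def
  proof (intro exI[of _ T] exI[of _ "half_curve d l m n r \<circ> \<sigma>"] conjI ballI)
    show "((half_curve d l m n r \<circ> \<sigma>) has_vector_derivative half_field b d l m n ((half_curve d l m n r \<circ> \<sigma>) t)) (at t within {0..T})"
      if "t \<in> {0..T}" for t using g(6)[OF that] by simp
    show "(half_curve d l m n r \<circ> \<sigma>) t \<in> upper_half" if "t \<in> {0<..<T}" for t
      using half_curve_upper[OF assms] g(5)[of t] that by (simp add: upper_half_def)
  qed (use g half_curve_start[OF assms] half_curve_end[OF assms] in auto)
qed

lemma solution_arc_half_map_iff:
  assumes "(l, n) \<in> N" "damping (symbol d l m n) \<delta>" "\<delta> \<le> r0/2" "0 < r" "r < \<delta>/4"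
  shows "solution_arc (half_field b d l m n) upper_half (r, 0) (- s, 0) \<longleftrightarrow> s = half_map d l m n r"
  using solution_arc_half_map[OF assms]
    solution_arc_unique[OF half_field_lipschitz, of "(- s, 0)" upper_half "(- half_map d l m n r, 0)" b d l m n "(r, 0)"]
  by (auto simp: upper_half_def)

end

text \<open>A common \<open>\<delta>\<close> puts both half-return maps on the disc of radius
  \<open>\<delta>/4\<close>; the lower parameters carry the signs of the reflection.\<close>

locale switching_pair =
  up: lienard_normal_form 1 r1 N1 + lo: lienard_normal_form "-1" r2 N2 for r1 N1 r2 N2 +
  fixes d1 d2 l1 l2 m1 m2 n1 n2 \<delta> :: real
  assumes N1: "(l1, n1) \<in> N1" and N2: "(- l2, - n2) \<in> N2" and \<delta>: "\<delta> \<le> r1/2" "\<delta> \<le> r2/2"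
    and damp: "damping (up.symbol d1 l1 m1 n1) \<delta>" "damping (lo.symbol (- d2) (- l2) m2 (- n2)) \<delta>"
begin

abbreviation "\<theta> \<equiv> (d1, d2, l1, l2, m1, m2, n1, n2)"
abbreviation "P1 \<equiv> damping.half_return (up.symbol d1 l1 m1 n1)"
abbreviation "P2 \<equiv> damping.half_return (lo.symbol (- d2) (- l2) m2 (- n2))"

sublocale pair: damping_pair "up.symbol d1 l1 m1 n1" "lo.symbol (- d2) (- l2) m2 (- n2)" \<delta>
  using damp by (simp add: damping_pair_def)

lemma P_pos:
  assumes "0 < r" "r < \<delta>/4"
  shows "0 < Re (P1 (of_real r))" "0 < Re (P2 (of_real r))"
  using pair.D1.Re_half_return_bounds(1)[OF assms] pair.D2.Re_half_return_bounds(1)[OF assms] assms by linarith+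

lemma return1_iff:
  assumes "0 < r" "r < \<delta>/4"
  shows "return1 \<theta> r s \<longleftrightarrow> s = Re (P1 (of_real r))"
  unfolding return1_def upper_field_half_field
  using up.solution_arc_half_map_iff[OF N1 damp(1) \<delta>(1) assms, of s] P_pos[OF assms] assms by auto

lemma return2_iff:
  assumes "0 < r" "r < \<delta>/4"
  shows "return2 \<theta> s r \<longleftrightarrow> s = Re (P2 (of_real r))"
  unfolding return2_def lower_arc_iff
  using lo.solution_arc_half_map_iff[OF N2 damp(2) \<delta>(2) assms, of s] P_pos[OF assms] assms by auto

lemma displacement_eq:
  assumes "0 < r" "r < \<delta>/4"
  shows "r \<in> displacement_domain \<theta>" "displacement \<theta> r = Re (P2 (of_real r) - P1 (of_real r))"
  by (auto simp: displacement_domain_def displacement_def return1_iff[OF assms] return2_iff[OF assms])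

end

section \<open>Crossing solutions and limit cycles\<close>

lemma snd_field:
  "snd (upper_field \<theta> p) = fst p * (1 - snd p)" "snd (lower_field \<theta> p) = fst p * (1 - snd p)"
proof -
  obtain d1 d2 l1 l2 m1 m2 n1 n2 x y where "\<theta> = (d1, d2, l1, l2, m1, m2, n1, n2)" "p = (x, y)"
    by (metis surj_pair)
  then show "snd (upper_field \<theta> p) = fst p * (1 - snd p)" "snd (lower_field \<theta> p) = fst p * (1 - snd p)"
    by simp_all
qed

lemma field_lipschitz: "lipschitz_on_bounded (upper_field \<theta>)" "lipschitz_on_bounded (lower_field \<theta>)"
proof -
  obtain d1 d2 l1 l2 m1 m2 n1 n2 where \<theta>: "\<theta> = (d1, d2, l1, l2, m1, m2, n1, n2)" by (metis surj_pair)
  show "lipschitz_on_bounded (upper_field \<theta>)"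
    unfolding \<theta> upper_field_half_field by (rule half_field_lipschitz)
  have "lower_field \<theta> = half_field 1 d2 l2 m2 n2" by (auto simp: \<theta> half_field_def fun_eq_iff)
  then show "lipschitz_on_bounded (lower_field \<theta>)" using half_field_lipschitz by simp
qed

lemma has_vector_derivative_left_right:
  fixes f :: "real \<Rightarrow> 'a::real_normed_vector"
  assumes "(f has_vector_derivative D) (at_left t)" "(f has_vector_derivative D) (at_right t)"
  shows "(f has_vector_derivative D) (at t)"
proof -
  have "(f has_vector_derivative D) (at t within {..<t} \<union> {t<..})"
    using assms unfolding has_vector_derivative_def has_derivative_within
    by (simp add: at_within_union filterlim_sup)
  moreover have "{..<t} \<union> {t<..} = UNIV - {t}" by auto
  moreover have "at t within UNIV - {t} = at t" by (simp add: at_within_def)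
  ultimately show ?thesis by simp
qed

context
  fixes \<theta> :: params and \<gamma> :: "real \<Rightarrow> real \<times> real"
  assumes sol: "crossing_solution \<theta> \<gamma>"
begin

lemma crossing_upper: "snd (\<gamma> t) > 0 \<Longrightarrow> (\<gamma> has_vector_derivative upper_field \<theta> (\<gamma> t)) (at t)"
  using sol by (auto simp: crossing_solution_def upper_half_def)

lemma crossing_lower: "snd (\<gamma> t) < 0 \<Longrightarrow> (\<gamma> has_vector_derivative lower_field \<theta> (\<gamma> t)) (at t)"
  using sol by (auto simp: crossing_solution_def lower_half_def)

lemma crossing_pos:
  assumes "snd (\<gamma> t) = 0" "fst (\<gamma> t) > 0"
  shows "(\<gamma> has_vector_derivative lower_field \<theta> (\<gamma> t)) (at_left t)" "(\<gamma> has_vector_derivative upper_field \<theta> (\<gamma> t)) (at_right t)"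
proof -
  have "\<not> snd (upper_field \<theta> (\<gamma> t)) < 0" using assms by (simp add: snd_field)
  then show "(\<gamma> has_vector_derivative lower_field \<theta> (\<gamma> t)) (at_left t)" "(\<gamma> has_vector_derivative upper_field \<theta> (\<gamma> t)) (at_right t)"
    using sol[unfolded crossing_solution_def, THEN spec, of t] assms(1) by simp_all
qed

lemma crossing_neg:
  assumes "snd (\<gamma> t) = 0" "fst (\<gamma> t) < 0"
  shows "(\<gamma> has_vector_derivative upper_field \<theta> (\<gamma> t)) (at_left t)" "(\<gamma> has_vector_derivative lower_field \<theta> (\<gamma> t)) (at_right t)"
proof -
  have "\<not> 0 < snd (upper_field \<theta> (\<gamma> t))" using assms by (simp add: snd_field)
  then show "(\<gamma> has_vector_derivative upper_field \<theta> (\<gamma> t)) (at_left t)" "(\<gamma> has_vector_derivative lower_field \<theta> (\<gamma> t)) (at_right t)"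
    using sol[unfolded crossing_solution_def, THEN spec, of t] assms(1) by simp_all
qed

lemma crossing_nz: "snd (\<gamma> t) = 0 \<Longrightarrow> fst (\<gamma> t) \<noteq> 0"
  using sol unfolding crossing_solution_def by (auto simp: snd_field)

text \<open>Both fields have the same second component, so the height is differentiable even where
  the solution has a corner. Its zeros and signs can then be studied by ordinary calculus.\<close>

lemma snd_crossing_has_derivative: "((\<lambda>t. snd (\<gamma> t)) has_real_derivative fst (\<gamma> t) * (1 - snd (\<gamma> t))) (at t)"
proof -
  have *: "((\<lambda>t. snd (\<gamma> t)) has_vector_derivative fst (\<gamma> t) * (1 - snd (\<gamma> t))) (at t within S)"
    if "(\<gamma> has_vector_derivative D) (at t within S)" "snd D = fst (\<gamma> t) * (1 - snd (\<gamma> t))" for D S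
    using bounded_linear.has_vector_derivative[OF bounded_linear_snd that(1)] that(2) by simp
  consider "snd (\<gamma> t) > 0" | "snd (\<gamma> t) < 0" | "snd (\<gamma> t) = 0" "fst (\<gamma> t) > 0" | "snd (\<gamma> t) = 0" "fst (\<gamma> t) < 0"
    using crossing_nz by fastforce
  then have "((\<lambda>t. snd (\<gamma> t)) has_vector_derivative fst (\<gamma> t) * (1 - snd (\<gamma> t))) (at t)"
  proof cases
    case 1 then show ?thesis by (intro *[OF crossing_upper]) (auto simp: snd_field)
  next
    case 2 then show ?thesis by (intro *[OF crossing_lower]) (auto simp: snd_field)
  next
    case 3 then show ?thesis
      by (intro has_vector_derivative_left_right *[OF crossing_pos(1)] *[OF crossing_pos(2)]) (auto simp: snd_field)
  next
    case 4 then show ?thesis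
      by (intro has_vector_derivative_left_right *[OF crossing_neg(1)] *[OF crossing_neg(2)]) (auto simp: snd_field)
  qed
  then show ?thesis by (simp add: has_real_derivative_iff_has_vector_derivative)
qed

lemma isCont_crossing: "isCont \<gamma> t"
proof -
  consider "snd (\<gamma> t) > 0" | "snd (\<gamma> t) < 0" | "snd (\<gamma> t) = 0" "fst (\<gamma> t) > 0" | "snd (\<gamma> t) = 0" "fst (\<gamma> t) < 0"
    using crossing_nz by fastforce
  then show ?thesis
  proof cases
    case 1 then show ?thesis using crossing_upper has_vector_derivative_continuous by blast
  next
    case 2 then show ?thesis using crossing_lower has_vector_derivative_continuous by blast
  next
    case 3
    from crossing_pos[OF this] show ?thesis
      unfolding continuous_at_split by (blast intro: has_vector_derivative_continuous)
  next
    case 4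
    from crossing_neg[OF this] show ?thesis
      unfolding continuous_at_split by (blast intro: has_vector_derivative_continuous)
  qed
qed

text \<open>The sign \<open>e\<close> treats both half-planes at once. End points may lie on the
  line if the solution enters or leaves the half-plane there; one-sided derivatives then
  suffice.\<close>

lemma crossing_arc:
  assumes ab: "a < b" and e: "e = 1 \<or> e = - 1" and pos: "\<And>t. a < t \<Longrightarrow> t < b \<Longrightarrow> 0 < e * snd (\<gamma> t)"
    and ea: "snd (\<gamma> a) = 0 \<Longrightarrow> 0 < e * fst (\<gamma> a)" "0 \<le> e * snd (\<gamma> a)"
    and eb: "snd (\<gamma> b) = 0 \<Longrightarrow> e * fst (\<gamma> b) < 0" "0 \<le> e * snd (\<gamma> b)"
    and t: "t \<in> {a..b}"
  defines "F \<equiv> (if e = 1 then upper_field \<theta> else lower_field \<theta>)"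
  shows "(\<gamma> has_vector_derivative F (\<gamma> t)) (at t within {a..b})"
proof (cases "snd (\<gamma> t) = 0")
  case False
  then have "0 < e * snd (\<gamma> t)"
  proof (cases "a < t \<and> t < b")
    case False
    then have "t = a \<or> t = b" using t by auto
    then show ?thesis using ea(2) eb(2) e \<open>snd (\<gamma> t) \<noteq> 0\<close> by (auto simp: less_le)
  qed (use pos in auto)
  then have "(\<gamma> has_vector_derivative F (\<gamma> t)) (at t)"
    using e crossing_upper crossing_lower by (auto simp: F_def)
  then show ?thesis by (rule has_vector_derivative_at_within)
next
  case True
  then have "t = a \<or> t = b" using pos[of t] t by (cases "a < t"; cases "t < b") auto
  then show ?thesis
  proof
    assume "t = a"
    then have "(\<gamma> has_vector_derivative F (\<gamma> t)) (at_right t)"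
      using ea(1) True e crossing_pos(2)[of t] crossing_neg(2)[of t] by (auto simp: F_def)
    then show ?thesis using ab \<open>t = a\<close> by (simp add: at_within_Icc_at_right)
  next
    assume "t = b"
    then have "(\<gamma> has_vector_derivative F (\<gamma> t)) (at_left t)"
      using eb(1) True e crossing_pos(1)[of t] crossing_neg(1)[of t] by (auto simp: F_def)
    then show ?thesis using ab \<open>t = b\<close> by (simp add: at_within_Icc_at_left)
  qed
qed

text \<open>The field that governs the near future is determined by the point
  \<open>\<gamma> a\<close> alone. Hence two solutions through one point obey the same Lipschitz
  equation for a while.\<close>

lemma crossing_forward_arc:
  fixes a :: real
  defines "F \<equiv> (if 0 < snd (\<gamma> a) \<or> snd (\<gamma> a) = 0 \<and> 0 < fst (\<gamma> a) then upper_field \<theta> else lower_field \<theta>)"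
  shows "\<exists>h>0. \<forall>b. a < b \<and> b \<le> a + h \<longrightarrow> (\<forall>t\<in>{a..b}. (\<gamma> has_vector_derivative F (\<gamma> t)) (at t within {a..b}))"
proof -
  define e :: real where "e = (if 0 < snd (\<gamma> a) \<or> snd (\<gamma> a) = 0 \<and> 0 < fst (\<gamma> a) then 1 else - 1)"
  have e: "e = 1 \<or> e = - 1" by (simp add: e_def)
  have ea: "snd (\<gamma> a) = 0 \<Longrightarrow> 0 < e * fst (\<gamma> a)" "0 \<le> e * snd (\<gamma> a)"
    using crossing_nz[of a] by (auto simp: e_def)
  have "\<exists>h>0. \<forall>t. a < t \<and> t < a + h \<longrightarrow> 0 < e * snd (\<gamma> t)"
  proof (cases "snd (\<gamma> a) = 0")
    case True
    have "((\<lambda>t. e * snd (\<gamma> t)) has_real_derivative e * fst (\<gamma> a)) (at a)"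
      using snd_crossing_has_derivative[of a] True by (auto intro!: derivative_eq_intros)
    from DERIV_pos_inc_right[OF this ea(1)[OF True]] obtain h where h: "h > 0" "\<And>k. 0 < k \<Longrightarrow> k < h \<Longrightarrow> 0 < e * snd (\<gamma> (a + k))"
      using True by auto
    show ?thesis using h(1) h(2)[of "_ - a"] by (intro exI[of _ h]) auto
  next
    case False
    have "isCont (\<lambda>t. e * snd (\<gamma> t)) a" by (intro continuous_intros isCont_crossing)
    moreover have "0 < e * snd (\<gamma> a)" using ea(2) False e by (auto simp: less_le)
    ultimately have "eventually (\<lambda>t. 0 < e * snd (\<gamma> t)) (at a)"
      unfolding isCont_def by (rule order_tendstoD)
    then obtain h where "h > 0" "\<And>t. t \<noteq> a \<Longrightarrow> dist t a < h \<Longrightarrow> 0 < e * snd (\<gamma> t)"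
      unfolding eventually_at by auto
    then show ?thesis by (intro exI[of _ h]) (auto simp: dist_real_def)
  qed
  then obtain h where h: "h > 0" "\<And>t. a < t \<Longrightarrow> t < a + h \<Longrightarrow> 0 < e * snd (\<gamma> t)" by auto
  have F: "F = (if e = 1 then upper_field \<theta> else lower_field \<theta>)" by (simp add: F_def e_def)
  have arc: "(\<gamma> has_vector_derivative F (\<gamma> t)) (at t within {a..b})" if "a < b" "b \<le> a + h/2" "t \<in> {a..b}" for b t
  proof -
    have hb: "0 < e * snd (\<gamma> b)" using h(1) that by (intro h(2)) auto
    show ?thesis
      unfolding F
    proof (rule crossing_arc[OF that(1) e _ ea])
      show "0 < e * snd (\<gamma> t)" if "a < t" "t < b" for t using that \<open>b \<le> a + h/2\<close> h(1) by (intro h(2)) auto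
      show "e * fst (\<gamma> b) < 0" if "snd (\<gamma> b) = 0" using hb that by simp
      show "0 \<le> e * snd (\<gamma> b)" using hb by simp
    qed (use that in auto)
  qed
  show ?thesis
  proof (intro exI[of _ "h/2"] conjI allI impI ballI)
    show "0 < h/2" using h(1) by simp
    show "(\<gamma> has_vector_derivative F (\<gamma> t)) (at t within {a..b})" if "a < b \<and> b \<le> a + h/2" "t \<in> {a..b}" for b t
      by (rule arc) (use that in auto)
  qed
qed

end

lemma crossing_solution_shift:
  assumes "crossing_solution \<theta> \<gamma>"
  shows "crossing_solution \<theta> (\<lambda>t. \<gamma> (t + a))"
proof -
  have img: "(\<lambda>s. s + a) ` {..<t} = {..<t + a}" "(\<lambda>s. s + a) ` {t<..} = {t + a<..}" "(\<lambda>s. s + a) ` UNIV = UNIV" for t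
  proof -
    have gen: "(\<lambda>s. s + a) ` {s. s + a \<in> B} = B" for B
    proof
      show "B \<subseteq> (\<lambda>s. s + a) ` {s. s + a \<in> B}"
      proof
        fix x assume "x \<in> B"
        then show "x \<in> (\<lambda>s. s + a) ` {s. s + a \<in> B}" by (intro image_eqI[of _ _ "x - a"]) auto
      qed
    qed auto
    show "(\<lambda>s. s + a) ` {..<t} = {..<t + a}" "(\<lambda>s. s + a) ` {t<..} = {t + a<..}" "(\<lambda>s. s + a) ` UNIV = UNIV"
      using gen[of "{..<t + a}"] gen[of "{t + a<..}"] gen[of UNIV] by (simp_all add: lessThan_def greaterThan_def)
  qed
  have "((\<lambda>t. \<gamma> (t + a)) has_vector_derivative D) (at t within S)"
    if "(\<gamma> has_vector_derivative D) (at (t + a) within (\<lambda>s. s + a) ` S)" for D t S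
  proof -
    have "((\<lambda>t. t + a) has_vector_derivative 1) (at t within S)" by (auto intro!: derivative_eq_intros)
    from vector_diff_chain_within[OF this that] show ?thesis by (simp add: o_def)
  qed
  note shift = this
  have keys: "((\<lambda>t. \<gamma> (t + a)) has_vector_derivative D) (at t)" if "(\<gamma> has_vector_derivative D) (at (t + a))" for D t
    using shift[of D t UNIV] that unfolding img by simp
  have keyl: "((\<lambda>t. \<gamma> (t + a)) has_vector_derivative D) (at_left t)" if "(\<gamma> has_vector_derivative D) (at_left (t + a))" for D t
    using shift[of D t "{..<t}"] that unfolding img by simp
  have keyr: "((\<lambda>t. \<gamma> (t + a)) has_vector_derivative D) (at_right t)" if "(\<gamma> has_vector_derivative D) (at_right (t + a))" for D t
    using shift[of D t "{t<..}"] that unfolding img by simp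
  show ?thesis unfolding crossing_solution_def
  proof (rule allI)
    fix t
    show "(\<gamma> (t + a) \<in> upper_half \<longrightarrow> ((\<lambda>t. \<gamma> (t + a)) has_vector_derivative upper_field \<theta> (\<gamma> (t + a))) (at t)) \<and>
       (\<gamma> (t + a) \<in> lower_half \<longrightarrow> ((\<lambda>t. \<gamma> (t + a)) has_vector_derivative lower_field \<theta> (\<gamma> (t + a))) (at t)) \<and>
       (snd (\<gamma> (t + a)) = 0 \<longrightarrow>
          snd (upper_field \<theta> (\<gamma> (t + a))) > 0 \<and> snd (lower_field \<theta> (\<gamma> (t + a))) > 0 \<and>
          ((\<lambda>t. \<gamma> (t + a)) has_vector_derivative lower_field \<theta> (\<gamma> (t + a))) (at_left t) \<and>
          ((\<lambda>t. \<gamma> (t + a)) has_vector_derivative upper_field \<theta> (\<gamma> (t + a))) (at_right t)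
        \<or> snd (upper_field \<theta> (\<gamma> (t + a))) < 0 \<and> snd (lower_field \<theta> (\<gamma> (t + a))) < 0 \<and>
          ((\<lambda>t. \<gamma> (t + a)) has_vector_derivative upper_field \<theta> (\<gamma> (t + a))) (at_left t) \<and>
          ((\<lambda>t. \<gamma> (t + a)) has_vector_derivative lower_field \<theta> (\<gamma> (t + a))) (at_right t))"
      using assms[unfolded crossing_solution_def, THEN spec, of "t + a"] keys[of _ t] keyl[of _ t] keyr[of _ t]
      by blast
  qed
qed

text \<open>Let \<open>\<tau>\<close> be the supremum of the times up to which both agree.
  Continuity extends the agreement to \<open>\<tau>\<close>, and a common forward arc extends it
  beyond, a contradiction.\<close>

lemma crossing_solution_unique:
  assumes \<gamma>: "crossing_solution \<theta> \<gamma>" and \<gamma>': "crossing_solution \<theta> \<gamma>'" and eq: "\<gamma> 0 = \<gamma>' 0" and t: "0 \<le> t"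
  shows "\<gamma> t = \<gamma>' t"
proof (rule ccontr)
  assume ne: "\<gamma> t \<noteq> \<gamma>' t"
  define S where "S = {s \<in> {0..t}. \<forall>x\<in>{0..s}. \<gamma> x = \<gamma>' x}"
  define \<tau> where "\<tau> = Sup S"
  have S0: "0 \<in> S" using eq t by (auto simp: S_def)
  have bdd: "bdd_above S" unfolding S_def by (auto intro: bdd_aboveI[of _ t])
  have "0 \<le> \<tau>" unfolding \<tau>_def by (rule cSup_upper[OF S0 bdd])
  moreover have "\<tau> \<le> t" unfolding \<tau>_def by (rule cSup_least) (use S0 in \<open>auto simp: S_def\<close>)
  ultimately have \<tau>: "0 \<le> \<tau>" "\<tau> \<le> t" .
  have below: "\<gamma> x = \<gamma>' x" if x: "0 \<le> x" "x < \<tau>" for x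
  proof -
    obtain s where "s \<in> S" "x < s" using less_cSupE[of x S] S0 x(2) unfolding \<tau>_def by blast
    then show ?thesis using x by (auto simp: S_def)
  qed
  have at\<tau>: "\<gamma> \<tau> = \<gamma>' \<tau>"
  proof (cases "\<tau> = 0")
    case False
    then have "\<tau> > 0" using \<tau> by simp
    have "((\<lambda>x. \<gamma> x - \<gamma>' x) \<longlongrightarrow> \<gamma> \<tau> - \<gamma>' \<tau>) (at_left \<tau>)"
      using isCont_crossing[OF \<gamma>, of \<tau>] isCont_crossing[OF \<gamma>', of \<tau>]
      by (intro tendsto_diff) (auto simp: isCont_def intro: tendsto_within_subset)
    moreover have "eventually (\<lambda>x. \<gamma> x - \<gamma>' x = 0) (at_left \<tau>)"
      using eventually_at_left_real[OF \<open>\<tau> > 0\<close>] by eventually_elim (simp add: below)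
    then have "((\<lambda>x. \<gamma> x - \<gamma>' x) \<longlongrightarrow> 0) (at_left \<tau>)" by (rule tendsto_eventually)
    ultimately have "\<gamma> \<tau> - \<gamma>' \<tau> = 0" by (intro tendsto_unique[OF trivial_limit_at_left_real])
    then show ?thesis by simp
  qed (use eq in simp)
  then have "\<tau> < t" using ne \<tau> by (cases "\<tau> = t") auto
  define F where "F = (if 0 < snd (\<gamma> \<tau>) \<or> snd (\<gamma> \<tau>) = 0 \<and> 0 < fst (\<gamma> \<tau>) then upper_field \<theta> else lower_field \<theta>)"
  have F: "lipschitz_on_bounded F" using field_lipschitz by (auto simp: F_def)
  obtain h1 where h1: "h1 > 0" "\<And>b t. \<tau> < b \<Longrightarrow> b \<le> \<tau> + h1 \<Longrightarrow> t \<in> {\<tau>..b} \<Longrightarrow> (\<gamma> has_vector_derivative F (\<gamma> t)) (at t within {\<tau>..b})"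
    using crossing_forward_arc[OF \<gamma>, of \<tau>] unfolding F_def by blast
  obtain h2 where h2: "h2 > 0" "\<And>b t. \<tau> < b \<Longrightarrow> b \<le> \<tau> + h2 \<Longrightarrow> t \<in> {\<tau>..b} \<Longrightarrow> (\<gamma>' has_vector_derivative F (\<gamma>' t)) (at t within {\<tau>..b})"
    using crossing_forward_arc[OF \<gamma>', of \<tau>] unfolding F_def at\<tau> by blast
  define b where "b = min (min (\<tau> + h1) (\<tau> + h2)) t"
  have b: "\<tau> < b" "b \<le> \<tau> + h1" "b \<le> \<tau> + h2" "b \<le> t" using h1 h2 \<open>\<tau> < t\<close> by (auto simp: b_def)
  have "\<gamma> x = \<gamma>' x" if "x \<in> {\<tau>..b}" for x
    by (rule autonomous_ode_unique[OF F h1(2) h2(2) at\<tau> that]) (use b in auto)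
  then have "\<gamma> x = \<gamma>' x" if "x \<in> {0..b}" for x
    using below[of x] that by (cases "x < \<tau>") auto
  then have "b \<in> S" using b \<tau> by (simp add: S_def)
  then have "b \<le> \<tau>" unfolding \<tau>_def by (intro cSup_upper bdd)
  then show False using b by simp
qed

text \<open>The functions \<open>x\<close> and \<open>y\<close> abstract the coordinates of a
  crossing solution; the waiting time 7 is the one of
  \<open>crossing_solution_recurs\<close>.\<close>

lemma next_sign_change:
  fixes x y :: "real \<Rightarrow> real"
  assumes y: "\<And>t. isCont y t" and z: "\<And>t. y t = 0 \<Longrightarrow> x t \<noteq> 0" "\<And>t. y t = 0 \<Longrightarrow> (y has_real_derivative x t) (at t)"
    and rec: "\<And>a. \<exists>t\<in>{a..a + 7}. y t = 0" and t0: "y t0 = 0" "0 < e * x t0" and e: "e = 1 \<or> e = - 1"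
  obtains t1 where "t0 < t1" "y t1 = 0" "e * x t1 < 0" "\<And>t. t0 < t \<Longrightarrow> t < t1 \<Longrightarrow> 0 < e * y t"
proof -
  define f where "f t = e * y t" for t
  have f0: "f t = 0 \<longleftrightarrow> y t = 0" for t using e by (auto simp: f_def)
  have f': "(f has_real_derivative e * x t) (at t)" if "y t = 0" for t
    unfolding f_def[abs_def] using z(2)[OF that] by (auto intro!: derivative_eq_intros)
  have fc: "isCont f t" for t unfolding f_def by (intro continuous_intros y)
  obtain h where h: "h > 0" "\<And>k. 0 < k \<Longrightarrow> k < h \<Longrightarrow> 0 < f (t0 + k)"
    using DERIV_pos_inc_right[OF f'[OF t0(1)] t0(2)] t0(1) by (auto simp: f_def)
  \<comment> \<open>Starting the search at \<open>t0 + h/2\<close> excludes the zero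
    \<open>t0\<close> itself, while the sign before \<open>t0 + h\<close> is already known.\<close>
  define Z where "Z = {t0 + h/2..} \<inter> f -` {0}"
  have "closed Z" unfolding Z_def
    by (intro closed_Int continuous_closed_vimage fc) auto
  moreover have "Z \<noteq> {}" using rec[of "t0 + h/2"] by (auto simp: Z_def f0)
  moreover have bdd: "bdd_below Z" by (auto simp: Z_def intro: bdd_belowI[of _ "t0 + h/2"])
  ultimately have t1: "Inf Z \<in> Z" by (intro closed_contains_Inf)
  define t1 where "t1 = Inf Z"
  have t1Z: "t1 \<in> Z" "f t1 = 0" "t0 + h/2 \<le> t1" using t1 by (auto simp: t1_def Z_def)
  have notZ: "f t \<noteq> 0" if "t0 + h/2 \<le> t" "t < t1" for t
    using cInf_lower[OF _ bdd, of t] that unfolding t1_def by (force simp: Z_def)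
  have pos: "0 < f t" if "t0 < t" "t < t1" for t
  proof (cases "t < t0 + h")
    case True
    then show ?thesis using h(2)[of "t - t0"] that by simp
  next
    case False
    show ?thesis
    proof (rule ccontr)
      assume "\<not> 0 < f t"
      moreover have "0 < f (t0 + h/2)" using h by simp
      moreover have "t0 + h/2 \<le> t" using False h(1) by simp
      ultimately obtain s where "t0 + h/2 \<le> s" "s \<le> t" "f s = 0"
        using IVT2[of f t 0 "t0 + h/2"] fc by (auto simp: less_imp_le)
      then show False using notZ[of s] that by auto
    qed
  qed
  have "e * x t1 < 0"
  proof (rule ccontr)
    assume "\<not> e * x t1 < 0"
    moreover have "e * x t1 \<noteq> 0" using z(1)[of t1] t1Z(2) e f0[of t1] by auto
    ultimately have "0 < e * x t1" by linarith
    from DERIV_pos_inc_left[OF f' this] obtain d where d: "d > 0" "\<And>k. 0 < k \<Longrightarrow> k < d \<Longrightarrow> f (t1 - k) < f t1"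
      using t1Z(2) f0 by auto
    define k where "k = min (d/2) (h/4)"
    have "0 < k" "k < d" "t0 < t1 - k" using d h t1Z(3) by (auto simp: k_def min_def)
    then show False using d(2)[of k] pos[of "t1 - k"] t1Z(2) by simp
  qed
  moreover have "t0 < t1" using t1Z(3) h(1) by simp
  ultimately show thesis using that[of t1] t1Z(2) f0 pos by (auto simp: f_def)
qed

text \<open>Time reversal combined with a change of sign of \<open>y\<close> preserves the
  hypotheses: \<open>- y (- t)\<close> has derivative \<open>x (- t)\<close> at its zeros.\<close>

lemma prev_sign_change:
  fixes x y :: "real \<Rightarrow> real"
  assumes y: "\<And>t. isCont y t" and z: "\<And>t. y t = 0 \<Longrightarrow> x t \<noteq> 0" "\<And>t. y t = 0 \<Longrightarrow> (y has_real_derivative x t) (at t)"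
    and rec: "\<And>a. \<exists>t\<in>{a..a + 7}. y t = 0" and t0: "y t0 = 0" "0 < e * x t0" and e: "e = 1 \<or> e = - 1"
  obtains t1 where "t1 < t0" "y t1 = 0" "e * x t1 < 0" "\<And>t. t1 < t \<Longrightarrow> t < t0 \<Longrightarrow> e * y t < 0"
proof -
  define Y where "Y t = - y (- t)" for t
  have cont: "isCont Y t" for t
    unfolding Y_def by (rule continuous_minus[OF isCont_o2[where f = uminus and g = y, OF _ y]]) (intro continuous_intros)
  have der: "(Y has_real_derivative x (- t)) (at t)" if "Y t = 0" for t
  proof -
    have "(y has_real_derivative x (- t)) (at (- t))" using z(2)[of "- t"] that by (simp add: Y_def)
    from DERIV_minus[OF this[unfolded DERIV_mirror]] show ?thesis by (simp add: Y_def[abs_def])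
  qed
  have nz: "x (- t) \<noteq> 0" if "Y t = 0" for t using z(1)[of "- t"] that by (simp add: Y_def)
  have recY: "\<exists>t\<in>{a..a + 7}. Y t = 0" for a
  proof -
    obtain t where t: "t \<in> {- a - 7..- a - 7 + 7}" "y t = 0" using rec[of "- a - 7"] by blast
    then show ?thesis by (intro bexI[of _ "- t"]) (auto simp: Y_def)
  qed
  obtain s where s: "- t0 < s" "Y s = 0" "e * x (- s) < 0" "\<And>t. - t0 < t \<Longrightarrow> t < s \<Longrightarrow> 0 < e * Y t"
    using next_sign_change[of Y "\<lambda>t. x (- t)" "- t0" e, OF cont nz der recY _ _ e] t0 by (auto simp: Y_def)
  show thesis
  proof (rule that[of "- s"])
    show "e * y t < 0" if "- s < t" "t < t0" for t using s(4)[of "- t"] that by (simp add: Y_def)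
  qed (use s in \<open>auto simp: Y_def\<close>)
qed

text \<open>Along an orbit the left-hand side is minus the angular speed times the squared norm, so
  orbits turn counterclockwise with angular speed at least \<open>1/2\<close>. The term with
  \<open>d\<close> and the cubic terms each take at most a quarter of the squared norm.\<close>

lemma rotation_decreases:
  assumes d: "\<bar>d\<bar> \<le> 1/2" and R: "(\<bar>l\<bar> + \<bar>m\<bar> + \<bar>n\<bar> + 1) * R \<le> 1/4" and p: "norm p \<le> R"
  shows "snd p * fst (quadratic_field d l m n p) - fst p * snd (quadratic_field d l m n p) \<le> - (1/2) * (norm p)\<^sup>2"
proof -
  obtain x y where xy: "p = (x, y)" by (metis surj_pair)
  define N where "N = norm p"
  have N2: "N\<^sup>2 = x\<^sup>2 + y\<^sup>2" by (simp add: N_def xy norm_Pair)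
  have b: "\<bar>x\<bar> \<le> N" "\<bar>y\<bar> \<le> N" "0 \<le> N" using norm_fst_le[of x y] norm_snd_le[of y x] by (auto simp: N_def xy)
  have cub: "\<bar>c * (u * v * w)\<bar> \<le> \<bar>c\<bar> * N * N\<^sup>2" if "\<bar>u\<bar> \<le> N" "\<bar>v\<bar> \<le> N" "\<bar>w\<bar> \<le> N" for c u v w
  proof -
    have "\<bar>u\<bar> * \<bar>v\<bar> * \<bar>w\<bar> \<le> N * N * N" using that b by (intro mult_mono) auto
    then have "\<bar>c\<bar> * (\<bar>u\<bar> * \<bar>v\<bar> * \<bar>w\<bar>) \<le> \<bar>c\<bar> * (N * N * N)" by (intro mult_left_mono) auto
    then show ?thesis by (simp add: abs_mult power2_eq_square mult_ac)
  qed
  have "d * x * y \<le> N\<^sup>2 / 4"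
  proof -
    have "0 \<le> (\<bar>x\<bar> - \<bar>y\<bar>)\<^sup>2" by simp
    then have "\<bar>x\<bar> * \<bar>y\<bar> \<le> N\<^sup>2 / 2" unfolding N2 by (simp add: power2_diff)
    then have "\<bar>d\<bar> * (\<bar>x\<bar> * \<bar>y\<bar>) \<le> (1/2) * (N\<^sup>2 / 2)" using d by (intro mult_mono) auto
    then have "\<bar>d * x * y\<bar> \<le> N\<^sup>2 / 4" by (simp add: abs_mult mult_ac)
    then show ?thesis by simp
  qed
  moreover have "l * (x * x * y) + m * (x * y * y) + n * (y * y * y) + 1 * (x * x * y) \<le> N\<^sup>2 / 4"
  proof -
    have "l * (x * x * y) + m * (x * y * y) + n * (y * y * y) + 1 * (x * x * y)
      \<le> \<bar>l\<bar> * N * N\<^sup>2 + \<bar>m\<bar> * N * N\<^sup>2 + \<bar>n\<bar> * N * N\<^sup>2 + \<bar>1\<bar> * N * N\<^sup>2"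
      using cub[OF b(1,1,2), of l] cub[OF b(1,2,2), of m] cub[OF b(2,2,2), of n] cub[OF b(1,1,2), of 1]
      unfolding abs_le_iff by linarith
    also have "\<dots> = ((\<bar>l\<bar> + \<bar>m\<bar> + \<bar>n\<bar> + 1) * N) * N\<^sup>2" by (simp add: algebra_simps)
    also have "\<dots> \<le> (1/4) * N\<^sup>2"
    proof (rule mult_right_mono)
      have "(\<bar>l\<bar> + \<bar>m\<bar> + \<bar>n\<bar> + 1) * N \<le> (\<bar>l\<bar> + \<bar>m\<bar> + \<bar>n\<bar> + 1) * R" using p by (intro mult_left_mono) (auto simp: N_def)
      then show "(\<bar>l\<bar> + \<bar>m\<bar> + \<bar>n\<bar> + 1) * N \<le> 1/4" using R by linarith
    qed simp
    finally show ?thesis by simp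
  qed
  moreover have "snd p * fst (quadratic_field d l m n p) - fst p * snd (quadratic_field d l m n p) =
    - N\<^sup>2 + d * x * y + (l * (x * x * y) + m * (x * y * y) + n * (y * y * y) + 1 * (x * x * y))"
    unfolding N2 by (simp add: xy algebra_simps power2_eq_square)
  ultimately show ?thesis unfolding N_def[symmetric] by linarith
qed

fun slow_rotation :: "params \<Rightarrow> real \<Rightarrow> bool" where
  "slow_rotation (d1, d2, l1, l2, m1, m2, n1, n2) R \<longleftrightarrow>
     \<bar>d1\<bar> \<le> 1/2 \<and> \<bar>d2\<bar> \<le> 1/2 \<and> (\<bar>l1\<bar> + \<bar>m1\<bar> + \<bar>n1\<bar> + 1) * R \<le> 1/4 \<and> (\<bar>l2\<bar> + \<bar>m2\<bar> + \<bar>n2\<bar> + 1) * R \<le> 1/4"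

text \<open>While the height is nonzero, \<open>arctan (x / y)\<close> decreases at rate at least
  \<open>1/2\<close>. In time 7 it would drop by \<open>7/2\<close>, more than the length
  \<open>pi\<close> of its range.\<close>

lemma crossing_solution_recurs:
  assumes sol: "crossing_solution \<theta> \<gamma>" and R: "slow_rotation \<theta> R" and small: "\<And>t. norm (\<gamma> t) \<le> R"
  shows "\<exists>t\<in>{a..a + 7}. snd (\<gamma> t) = 0"
proof (rule ccontr)
  assume "\<not> (\<exists>t\<in>{a..a + 7}. snd (\<gamma> t) = 0)"
  then have nz: "snd (\<gamma> t) \<noteq> 0" if "t \<in> {a..a + 7}" for t using that by auto
  obtain d1 d2 l1 l2 m1 m2 n1 n2 where \<theta>: "\<theta> = (d1, d2, l1, l2, m1, m2, n1, n2)" by (metis surj_pair)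
  have "\<exists>D. ((\<lambda>t. arctan (fst (\<gamma> t) / snd (\<gamma> t))) has_real_derivative D) (at t) \<and> D \<le> - (1/2)" if t: "t \<in> {a..a + 7}" for t
  proof -
    obtain X where X: "(\<gamma> has_vector_derivative X) (at t)" "snd (\<gamma> t) * fst X - fst (\<gamma> t) * snd X \<le> - (1/2) * (norm (\<gamma> t))\<^sup>2"
    proof (cases "snd (\<gamma> t) > 0")
      case True
      then show thesis using that[OF crossing_upper[OF sol True]] rotation_decreases[OF _ _ small] R by (simp add: \<theta>)
    next
      case False
      then have "snd (\<gamma> t) < 0" using nz[OF t] by simp
      then show thesis using that[OF crossing_lower[OF sol]] rotation_decreases[OF _ _ small] R by (simp add: \<theta>)
    qed
    have x': "((\<lambda>t. fst (\<gamma> t)) has_real_derivative fst X) (at t)"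
      using bounded_linear.has_vector_derivative[OF bounded_linear_fst X(1)] by (simp add: has_real_derivative_iff_has_vector_derivative)
    have y': "((\<lambda>t. snd (\<gamma> t)) has_real_derivative snd X) (at t)"
      using bounded_linear.has_vector_derivative[OF bounded_linear_snd X(1)] by (simp add: has_real_derivative_iff_has_vector_derivative)
    let ?x = "fst (\<gamma> t)" and ?y = "snd (\<gamma> t)"
    have y0: "?y \<noteq> 0" by (rule nz[OF t])
    have "((\<lambda>t. arctan (fst (\<gamma> t) / snd (\<gamma> t))) has_real_derivative inverse (1 + (?x / ?y)\<^sup>2) * ((fst X * ?y - ?x * snd X) / (?y * ?y))) (at t)"
      by (rule DERIV_chain2[OF DERIV_arctan DERIV_divide[OF x' y' y0]])
    moreover have "inverse (1 + (?x / ?y)\<^sup>2) * ((fst X * ?y - ?x * snd X) / (?y * ?y)) \<le> - (1/2)"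
    proof -
      define A where "A = ?x\<^sup>2 + ?y\<^sup>2"
      have pos: "A > 0" using y0 by (simp add: A_def sum_power2_gt_zero_iff)
      have "inverse (1 + (?x / ?y)\<^sup>2) = ?y\<^sup>2 / A" using y0 by (simp add: A_def field_simps)
      then have "inverse (1 + (?x / ?y)\<^sup>2) * ((fst X * ?y - ?x * snd X) / (?y * ?y)) = (?y * fst X - ?x * snd X) / A"
        using y0 by (simp add: power2_eq_square mult_ac)
      also have "\<dots> \<le> (- (1/2) * (norm (\<gamma> t))\<^sup>2) / A"
        by (rule divide_right_mono[OF X(2)]) (use pos in simp)
      also have "(norm (\<gamma> t))\<^sup>2 = A" by (simp add: norm_prod_def A_def)
      also have "(- (1/2) * A) / A = - (1/2)" using pos by simp
      finally show ?thesis .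
    qed
    ultimately show ?thesis by blast
  qed
  then obtain D where D: "\<And>t. t \<in> {a..a + 7} \<Longrightarrow> ((\<lambda>t. arctan (fst (\<gamma> t) / snd (\<gamma> t))) has_real_derivative D t) (at t)"
    "\<And>t. t \<in> {a..a + 7} \<Longrightarrow> D t \<le> - (1/2)" by metis
  obtain \<xi> where "a < \<xi>" "\<xi> < a + 7"
    "arctan (fst (\<gamma> (a + 7)) / snd (\<gamma> (a + 7))) - arctan (fst (\<gamma> a) / snd (\<gamma> a)) = (a + 7 - a) * D \<xi>"
    using MVT2[of a "a + 7" "\<lambda>t. arctan (fst (\<gamma> t) / snd (\<gamma> t))" D] D(1) by auto
  then have "arctan (fst (\<gamma> (a + 7)) / snd (\<gamma> (a + 7))) - arctan (fst (\<gamma> a) / snd (\<gamma> a)) \<le> - (7/2)"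
    using D(2)[of \<xi>] by simp
  then show False
    using arctan_lbound[of "fst (\<gamma> (a + 7)) / snd (\<gamma> (a + 7))"] arctan_ubound[of "fst (\<gamma> a) / snd (\<gamma> a)"] pi_bound by linarith
qed

context switching_pair
begin

text \<open>An arc above followed by an arc below links consecutive positive crossings. The orbit
  need not close after one turn, hence an equation between \<open>P1\<close> and \<open>P2\<close>
  at possibly different radii.\<close>

lemma positive_crossings:
  assumes sol: "crossing_solution \<theta> \<gamma>" and R: "slow_rotation \<theta> R" and small: "\<And>t. norm (\<gamma> t) \<le> R"
    and R\<delta>: "R < \<delta>/4" and t0: "snd (\<gamma> t0) = 0" "0 < fst (\<gamma> t0)"
  shows "\<exists>t>t0. snd (\<gamma> t) = 0 \<and> 0 < fst (\<gamma> t) \<and> Re (P1 (of_real (fst (\<gamma> t0)))) = Re (P2 (of_real (fst (\<gamma> t))))"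
    "\<exists>t<t0. snd (\<gamma> t) = 0 \<and> 0 < fst (\<gamma> t) \<and> Re (P1 (of_real (fst (\<gamma> t)))) = Re (P2 (of_real (fst (\<gamma> t0))))"
proof -
  let ?x = "\<lambda>t. fst (\<gamma> t)" and ?y = "\<lambda>t. snd (\<gamma> t)"
  have cont: "isCont ?y t" for t by (intro continuous_intros isCont_crossing[OF sol])
  have der: "(?y has_real_derivative ?x t) (at t)" if "?y t = 0" for t
    using snd_crossing_has_derivative[OF sol, of t] that by simp
  note nz = crossing_nz[OF sol] and rec = crossing_solution_recurs[OF sol R small]
  have xb: "?x t < \<delta>/4" for t
    using small[of t] R\<delta> norm_fst_le[of "?x t" "?y t"] by simp
  have pt: "\<gamma> t = (?x t, 0)" if "?y t = 0" for t using that by (metis prod.collapse)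
  have arcs: "solution_arc (if e = 1 then upper_field \<theta> else lower_field \<theta>) (if e = 1 then upper_half else lower_half) (\<gamma> a) (\<gamma> b)"
    if "a < b" "?y a = 0" "0 < e * ?x a" "?y b = 0" "e * ?x b < 0" "\<And>t. a < t \<Longrightarrow> t < b \<Longrightarrow> 0 < e * ?y t" "e = 1 \<or> e = - 1" for a b e
  proof -
    note sh = crossing_solution_shift[OF sol, of a]
    have "((\<lambda>t. \<gamma> (t + a)) has_vector_derivative (if e = 1 then upper_field \<theta> else lower_field \<theta>) (\<gamma> (t + a))) (at t within {0..b - a})"
      if "t \<in> {0..b - a}" for t
      by (rule crossing_arc[OF sh]) (use that \<open>a < b\<close> \<open>?y a = 0\<close> \<open>0 < e * ?x a\<close> \<open>?y b = 0\<close> \<open>e * ?x b < 0\<close> \<open>e = 1 \<or> e = - 1\<close>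
          \<open>\<And>t. a < t \<Longrightarrow> t < b \<Longrightarrow> 0 < e * ?y t\<close> in auto)
    moreover have "\<gamma> (t + a) \<in> (if e = 1 then upper_half else lower_half)" if "t \<in> {0<..<b - a}" for t
      using \<open>\<And>t. a < t \<Longrightarrow> t < b \<Longrightarrow> 0 < e * ?y t\<close>[of "t + a"] that \<open>e = 1 \<or> e = - 1\<close> by (auto simp: upper_half_def lower_half_def)
    ultimately show ?thesis unfolding solution_arc_def using \<open>a < b\<close>
      by (intro exI[of _ "b - a"] conjI exI[of _ "\<lambda>t. \<gamma> (t + a)"]) auto
  qed
  have up: "Re (P1 (of_real (?x a))) = - ?x b"
    if "a < b" "?y a = 0" "0 < ?x a" "?y b = 0" "?x b < 0" "\<And>t. a < t \<Longrightarrow> t < b \<Longrightarrow> 0 < ?y t" for a b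
  proof -
    have "return1 \<theta> (?x a) (- ?x b)"
      using arcs[of a b 1] that pt[of a] pt[of b] by (simp add: return1_def)
    then show ?thesis using return1_iff[of "?x a" "- ?x b"] xb that by simp
  qed
  have dn: "Re (P2 (of_real (?x b))) = - ?x a"
    if "a < b" "?y a = 0" "?x a < 0" "?y b = 0" "0 < ?x b" "\<And>t. a < t \<Longrightarrow> t < b \<Longrightarrow> ?y t < 0" for a b
  proof -
    have "return2 \<theta> (- ?x a) (?x b)"
      using arcs[of a b "- 1"] that pt[of a] pt[of b] by (simp add: return2_def)
    then show ?thesis using return2_iff[of "?x b" "- ?x a"] xb that by simp
  qed
  obtain t1 where t1: "t0 < t1" "?y t1 = 0" "?x t1 < 0" "\<And>t. t0 < t \<Longrightarrow> t < t1 \<Longrightarrow> 0 < ?y t"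
    using next_sign_change[of ?y ?x t0 1, OF cont nz der rec] t0 by auto
  obtain t2 where t2: "t1 < t2" "?y t2 = 0" "0 < ?x t2" "\<And>t. t1 < t \<Longrightarrow> t < t2 \<Longrightarrow> ?y t < 0"
    using next_sign_change[of ?y ?x t1 "- 1", OF cont nz der rec] t1 by auto
  show "\<exists>t>t0. ?y t = 0 \<and> 0 < ?x t \<and> Re (P1 (of_real (?x t0))) = Re (P2 (of_real (?x t)))"
    using up[OF t1(1) t0 t1(2-)] dn[OF t2(1) t1(2,3) t2(2-)] t1 t2 by (intro exI[of _ t2]) auto
  obtain s1 where s1: "s1 < t0" "?y s1 = 0" "?x s1 < 0" "\<And>t. s1 < t \<Longrightarrow> t < t0 \<Longrightarrow> ?y t < 0"
    using prev_sign_change[of ?y ?x t0 1, OF cont nz der rec] t0 by auto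
  obtain s2 where s2: "s2 < s1" "?y s2 = 0" "0 < ?x s2" "\<And>t. s2 < t \<Longrightarrow> t < s1 \<Longrightarrow> 0 < ?y t"
    using prev_sign_change[of ?y ?x s1 "- 1", OF cont nz der rec] s1 by auto
  show "\<exists>t<t0. ?y t = 0 \<and> 0 < ?x t \<and> Re (P1 (of_real (?x t))) = Re (P2 (of_real (?x t0)))"
    using dn[OF s1(1,2,3) t0 s1(4)] up[OF s2(1,2,3) s1(2,3) s2(4)] s1 s2 by (intro exI[of _ s2]) auto
qed

text \<open>A periodic orbit in the neighbourhood is examined at its largest positive crossing
  \<open>X\<close>. By monotonicity the next positive crossing gives \<open>P1 X \<le> P2 X\<close>
  and the previous one \<open>P2 X \<le> P1 X\<close>. So \<open>X\<close> is a zero of the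
  displacement near \<open>r\<close>, hence equal to \<open>r\<close>, and uniqueness of solutions
  identifies the orbits.\<close>

lemma crossing_limit_cycle_if_isolated:
  assumes per: "periodic_orbit \<theta> \<Gamma>" and r: "0 < r" "(r, 0) \<in> \<Gamma>" and \<Gamma>: "\<Gamma> \<subseteq> ball 0 R"
    and R: "slow_rotation \<theta> R" "R < \<delta>/4" and \<epsilon>: "0 < \<epsilon>"
    and iso: "\<And>\<rho>. 0 < \<rho> \<Longrightarrow> \<rho> < \<delta>/4 \<Longrightarrow> \<bar>\<rho> - r\<bar> < \<epsilon> \<Longrightarrow> Re (P1 (of_real \<rho>)) = Re (P2 (of_real \<rho>)) \<Longrightarrow> \<rho> = r"
    and once: "\<And>\<rho>. 0 < \<rho> \<Longrightarrow> (\<rho>, 0) \<in> \<Gamma> \<Longrightarrow> \<rho> = r"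
  shows "crossing_limit_cycle \<theta> \<Gamma>"
proof -
  \<comment> \<open>Removing this piece of the half-axis confines positive crossings to distance
    less than \<open>\<epsilon>\<close> from \<open>r\<close>; the weak inequality
    \<open>0 \<le> fst p\<close> keeps the piece closed.\<close>
  define W :: "(real \<times> real) set" where "W = {p. snd p = 0 \<and> 0 \<le> fst p \<and> \<epsilon> \<le> \<bar>fst p - r\<bar>}"
  define N where "N = (ball 0 R - {(0, 0)}) - W"
  have "closed W" unfolding W_def
    by (intro closed_Collect_conj closed_Collect_eq closed_Collect_le continuous_intros)
  then have N: "open N" unfolding N_def by (intro open_Diff) auto
  obtain g0 T0 where g0: "crossing_solution \<theta> g0" "T0 > 0" "\<And>t. g0 (t + T0) = g0 t" "\<Gamma> = range g0"
    using per unfolding periodic_orbit_def by auto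
  have nz: "(0, 0) \<notin> range g" if "crossing_solution \<theta> g" for g
    using crossing_nz[OF that] by (metis fst_conv rangeE snd_conv)
  have "\<Gamma> \<subseteq> N"
  proof
    fix p assume p: "p \<in> \<Gamma>"
    have "p \<notin> W"
    proof
      assume W: "p \<in> W"
      then have p0: "p = (fst p, 0)" "0 \<le> fst p" by (auto simp: W_def prod_eq_iff)
      moreover have "fst p \<noteq> 0" using nz[OF g0(1)] p g0(4) p0(1) by metis
      ultimately have "fst p = r" using once[of "fst p"] p by auto
      then show False using W \<epsilon> by (simp add: W_def)
    qed
    moreover have "p \<noteq> (0, 0)" using nz[OF g0(1)] p g0(4) by metis
    moreover have "p \<in> ball 0 R" using p \<Gamma> by blast
    ultimately show "p \<in> N" by (simp add: N_def)
  qed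
  have reach: "\<exists>a. g a = (r, 0)" if g: "crossing_solution \<theta> g" "T > 0" "\<And>t. g (t + T) = g t" "range g \<subseteq> N" for g T
  proof -
    let ?x = "\<lambda>t. fst (g t)" and ?y = "\<lambda>t. snd (g t)"
    have gN: "g t \<in> N" for t using g(4) by blast
    have inR: "norm (g t) < R" for t using gN[of t] by (simp add: N_def)
    have small: "norm (g t) \<le> R" for t using inR[of t] by simp
    have xb: "?x t < \<delta>/4" for t
      using inR[of t] R(2) norm_fst_le[of "?x t" "?y t"] by simp
    have inW: "\<bar>?x t - r\<bar> < \<epsilon>" if "?y t = 0" "0 < ?x t" for t
      using gN[of t] that by (simp add: N_def W_def not_le)
    have gk: "g (t + real k * T) = g t" for t k
    proof (induction k)
      case (Suc k)
      have "g (t + real (Suc k) * T) = g ((t + real k * T) + T)" by (simp add: algebra_simps)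
      then show ?case using g(3)[of "t + real k * T"] Suc by simp
    qed simp
    have red: "\<exists>s\<in>{0..T}. g s = g t" for t
    proof -
      define k where "k = \<lfloor>t / T\<rfloor>"
      define s where "s = t - of_int k * T"
      have "of_int k \<le> t / T" "t / T < of_int k + 1" unfolding k_def by linarith+
      then have s: "0 \<le> s" "s \<le> T" using g(2) by (auto simp: s_def field_simps)
      have "g s = g t"
      proof (cases "k \<ge> 0")
        case True
        then have "t = s + real (nat k) * T" by (simp add: s_def)
        then show ?thesis using gk[of s "nat k"] by simp
      next
        case False
        then have "s = t + real (nat (- k)) * T" by (simp add: s_def)
        then show ?thesis using gk[of t "nat (- k)"] by simp
      qed
      then show ?thesis using s by auto
    qed
    \<comment> \<open>The crossings of one period form a compact set: the weak inequality makes it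
      closed, and it is strict on solutions because they never meet the origin.\<close>
    define K where "K = {t \<in> {0..T}. ?y t = 0 \<and> 0 \<le> ?x t}"
    have gc: "continuous_on UNIV g" using isCont_crossing[OF g(1)] by (simp add: continuous_on_eq_continuous_at)
    have cx: "continuous_on S ?x" "continuous_on S ?y" for S
      by (rule continuous_on_fst[OF continuous_on_subset[OF gc]], simp, rule continuous_on_snd[OF continuous_on_subset[OF gc]], simp)
    have "compact K"
    proof -
      have "K = {0..T} \<inter> (?y -` {0} \<inter> ?x -` {0..})" by (auto simp: K_def)
      moreover have "isCont ?x t" "isCont ?y t" for t by (intro continuous_intros isCont_crossing[OF g(1)])+
      then have "closed (?y -` {0} \<inter> ?x -` {0..})"
        by (intro closed_Int continuous_closed_vimage) auto
      ultimately show ?thesis using compact_Int_closed[OF compact_Icc] by simp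
    qed
    have Kx: "0 < ?x t" "?y t = 0" if "t \<in> K" for t
      using that crossing_nz[OF g(1), of t] by (auto simp: K_def less_le)
    have toK: "\<exists>s\<in>K. g s = g t" if "?y t = 0" "0 < ?x t" for t
      using red[of t] that by (auto simp: K_def)
    have "K \<noteq> {}"
    proof -
      obtain t where t: "?y t = 0" using crossing_solution_recurs[OF g(1) R(1) small, of 0] by blast
      show ?thesis
      proof (cases "0 < ?x t")
        case True then show ?thesis using toK[OF t] by auto
      next
        case False
        then have "?x t < 0" using crossing_nz[OF g(1) t] by simp
        have c: "isCont ?y s" for s by (intro continuous_intros isCont_crossing[OF g(1)])
        have d: "(?y has_real_derivative ?x s) (at s)" if "?y s = 0" for s
          using snd_crossing_has_derivative[OF g(1), of s] that by simp
        obtain t2 where "?y t2 = 0" "- 1 * ?x t2 < 0"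
          using next_sign_change[of ?y ?x t "- 1", OF c crossing_nz[OF g(1)] d crossing_solution_recurs[OF g(1) R(1) small] t]
            \<open>?x t < 0\<close> by auto
        then show ?thesis using toK[of t2] by auto
      qed
    qed
    note cross = positive_crossings[OF g(1) R(1) small R(2)]
    obtain M where M: "M \<in> K" "\<And>t. t \<in> K \<Longrightarrow> ?x t \<le> ?x M"
      using continuous_attains_sup[OF \<open>compact K\<close> \<open>K \<noteq> {}\<close> cx(1)] by auto
    have mono: "Re (P1 (of_real u)) \<le> Re (P1 (of_real v))" "Re (P2 (of_real u)) \<le> Re (P2 (of_real v))"
      if "0 < u" "u \<le> v" "v < \<delta>/4" for u v
      using pair.D1.Re_half_return_less[of u v] pair.D2.Re_half_return_less[of u v] that
      by (cases "u = v"; simp) (use pair.D2.Re_half_return_less[of u v] that in \<open>cases "u = v"; simp\<close>)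
    have Kmax: "?x t \<le> ?x M" if "?y t = 0" "0 < ?x t" for t
      using toK[OF that] M(2) by metis
    obtain t where t: "?y t = 0" "0 < ?x t" "Re (P1 (of_real (?x M))) = Re (P2 (of_real (?x t)))"
      using cross(1)[of M] Kx[OF M(1)] by auto
    obtain u where u: "?y u = 0" "0 < ?x u" "Re (P1 (of_real (?x u))) = Re (P2 (of_real (?x M)))"
      using cross(2)[of M] Kx[OF M(1)] by auto
    have "Re (P1 (of_real (?x M))) = Re (P2 (of_real (?x M)))"
      using t(3) u(3) mono(2)[OF t(2) Kmax[OF t(1,2)] xb] mono(1)[OF u(2) Kmax[OF u(1,2)] xb] by linarith
    then have "?x M = r" using iso[of "?x M"] Kx[OF M(1)] xb inW[of M] by auto
    then show ?thesis using Kx[OF M(1)] by (intro exI[of _ M]) (simp add: prod_eq_iff)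
  qed
  have sub: "range g \<subseteq> range g'"
    if g: "crossing_solution \<theta> g" "T > 0" "\<And>t. g (t + T) = g t" "range g \<subseteq> N"
      and g': "crossing_solution \<theta> g'" "T' > 0" "\<And>t. g' (t + T') = g' t" "range g' \<subseteq> N" for g T g' T'
  proof
    fix p assume "p \<in> range g"
    then obtain t where t: "p = g t" by auto
    obtain a where a: "g a = (r, 0)" using reach[OF g] by auto
    obtain a' where a': "g' a' = (r, 0)" using reach[OF g'] by auto
    have gk: "g (t + real k * T) = g t" for k
    proof (induction k)
      case (Suc k)
      have "g (t + real (Suc k) * T) = g ((t + real k * T) + T)" by (simp add: algebra_simps)
      then show ?case using g(3)[of "t + real k * T"] Suc by simp
    qed simp
    \<comment> \<open>Uniqueness holds forwards in time, so \<open>t\<close> is first moved beyond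
      \<open>a\<close> by a multiple of the period.\<close>
    obtain k where k: "a - t \<le> real k * T" using reals_Archimedean3[OF g(2)] less_imp_le by blast
    have "g ((t + real k * T - a) + a) = g' ((t + real k * T - a) + a')"
      by (rule crossing_solution_unique[OF crossing_solution_shift[OF g(1)] crossing_solution_shift[OF g'(1)]])
         (use a a' k in auto)
    then show "p \<in> range g'" using gk[of k] t by auto
  qed
  have "\<Gamma>' = \<Gamma>" if \<Gamma>': "periodic_orbit \<theta> \<Gamma>'" "\<Gamma>' \<subseteq> N" for \<Gamma>'
  proof -
    obtain g T where g: "crossing_solution \<theta> g" "T > 0" "\<And>t. g (t + T) = g t" "\<Gamma>' = range g"
      using \<Gamma>'(1) unfolding periodic_orbit_def by auto
    show ?thesis
      using sub[OF g(1-3) _ g0(1-3)] sub[OF g0(1-3) _ g(1-3)] \<Gamma>'(2) \<open>\<Gamma> \<subseteq> N\<close> g(4) g0(4) by auto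
  qed
  then have "\<exists>N. open N \<and> \<Gamma> \<subseteq> N \<and> (\<forall>\<Gamma>'. periodic_orbit \<theta> \<Gamma>' \<and> \<Gamma>' \<subseteq> N \<longrightarrow> \<Gamma>' = \<Gamma>)"
    using N \<open>\<Gamma> \<subseteq> N\<close> by blast
  moreover have "\<exists>p\<in>\<Gamma>. snd p = 0" by (rule bexI[OF _ r(2)]) simp
  ultimately show ?thesis unfolding crossing_limit_cycle_def using per by blast
qed

end

text \<open>Winding numbers live in the complex plane, orbits in a product of two lines. The image
  of a component of the complement lies in a component of the complement of the image, and
  boundedness pulls back.\<close>

lemma inside_linear_isometry:
  fixes h :: "'a::euclidean_space \<Rightarrow> 'b::euclidean_space"
  assumes h: "linear h" and nh: "\<And>p. norm (h p) = norm p" and p: "h p \<in> inside (h ` S)"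
  shows "p \<in> inside S"
proof -
  have inj: "inj h"
    unfolding linear_injective_0[OF h] using nh by (metis norm_eq_zero)
  have "h p \<notin> h ` S" using p by (simp add: inside_def)
  then have "p \<notin> S" by blast
  let ?C = "connected_component_set (- S) p"
  have "h ` ?C \<subseteq> connected_component_set (- h ` S) (h p)"
  proof (rule connected_component_maximal)
    show "h p \<in> h ` ?C" using \<open>p \<notin> S\<close> by (simp add: connected_component_refl)
    show "connected (h ` ?C)"
      by (rule connected_continuous_image[OF linear_continuous_on connected_connected_component])
         (rule h[unfolded linear_conv_bounded_linear])
    show "h ` ?C \<subseteq> - h ` S"
    proof
      fix q assume "q \<in> h ` ?C"
      then obtain z where z: "z \<in> ?C" "q = h z" by blast
      then have "z \<notin> S" using connected_component_subset[of "- S" p] by blast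
      then show "q \<in> - h ` S" using z(2) injD[OF inj] by blast
    qed
  qed
  moreover have "bounded (connected_component_set (- h ` S) (h p))" using p by (simp add: inside_def)
  ultimately have "bounded (h ` ?C)" by (rule bounded_subset[rotated])
  then have "bounded ?C" unfolding bounded_iff by (simp add: nh)
  then show ?thesis using \<open>p \<notin> S\<close> by (simp add: inside_def)
qed

text \<open>Each curve point is joined to the point of the unit circle with the same parameter; by
  the sign conditions the segment misses the origin. So the winding number is 1, as for the circle,
  and the origin is not outside.\<close>

lemma origin_inside_loop:
  fixes c :: "real \<Rightarrow> real \<times> real"
  assumes c: "continuous_on {0..2 * pi} c" and loop: "c 0 = c (2 * pi)"
    and x: "\<And>t. t \<in> {0..2 * pi} \<Longrightarrow> \<exists>a>0. fst (c t) = a * cos t"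
    and y: "\<And>t. t \<in> {0..2 * pi} \<Longrightarrow> sin t \<noteq> 0 \<Longrightarrow> 0 < snd (c t) * sin t"
  shows "(0, 0) \<in> inside (c ` {0..2 * pi})"
proof -
  define h where "h p = Complex (fst p) (snd p)" for p :: "real \<times> real"
  have h: "linear h" by (rule linearI) (auto simp: h_def complex_eq_iff)
  have nh: "norm (h p) = norm p" for p by (simp add: h_def norm_prod_def cmod_def)
  define g where "g t = h (c (2 * pi * t))" for t
  have arg: "2 * pi * t \<in> {0..2 * pi}" if "t \<in> {0..1}" for t using that by (auto simp: mult_left_le)
  have "continuous_on {0..1} (\<lambda>t. c (2 * pi * t))"
    by (rule continuous_on_compose2[OF c]) (use arg in \<open>auto intro!: continuous_intros\<close>)
  then have pg: "path g"
    unfolding path_def g_def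
    by (intro continuous_on_compose2[OF linear_continuous_on[of h UNIV]]) (auto simp: h linear_conv_bounded_linear[symmetric])
  have img: "path_image g = h ` (c ` {0..2 * pi})"
  proof -
    have sc: "(\<lambda>t. 2 * pi * t) ` {0..1} = {0..2 * pi}"
    proof
      show "{0..2 * pi} \<subseteq> (\<lambda>t. 2 * pi * t) ` {0..1}"
      proof
        fix s assume "s \<in> {0..2 * pi}"
        then show "s \<in> (\<lambda>t. 2 * pi * t) ` {0..1}" by (intro image_eqI[of _ _ "s / (2 * pi)"]) auto
      qed
    qed (use arg in auto)
    have "path_image g = (\<lambda>t. h (c (2 * pi * t))) ` {0..1}" by (simp add: path_image_def g_def[abs_def])
    also have "\<dots> = h ` (c ` ((\<lambda>t. 2 * pi * t) ` {0..1}))" by (simp only: image_image)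
    finally show ?thesis unfolding sc .
  qed
  have avoid: "0 \<notin> closed_segment (circlepath 0 1 t) (g t)" if t: "t \<in> {0..1}" for t
  proof
    assume "0 \<in> closed_segment (circlepath 0 1 t) (g t)"
    then obtain u where u: "0 \<le> u" "u \<le> 1" "0 = (1 - u) *\<^sub>R circlepath 0 1 t + u *\<^sub>R g t"
      by (auto simp: in_segment)
    let ?s = "2 * pi * t"
    have cp: "circlepath 0 1 t = Complex (cos ?s) (sin ?s)"
      by (simp add: circlepath exp_eq_polar complex_eq_iff cis.ctr)
    have re: "0 = (1 - u) * cos ?s + u * fst (c ?s)" and im: "0 = (1 - u) * sin ?s + u * snd (c ?s)"
      using u(3) by (auto simp: cp g_def h_def complex_eq_iff)
    obtain a where a: "0 < a" "fst (c ?s) = a * cos ?s" using x[OF arg[OF t]] by auto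
    have pos: "0 < (1 - u) + u * a" using u a(1) by (cases "u = 0") (auto intro: add_nonneg_pos)
    have "((1 - u) + u * a) * cos ?s = 0" using re a(2) by (simp add: algebra_simps)
    then have "cos ?s = 0" using pos by simp
    then have s0: "sin ?s \<noteq> 0" using sin_cos_squared_add[of ?s] by auto
    have ys: "0 < snd (c ?s) * sin ?s" by (rule y[OF arg[OF t] s0])
    have "0 = (1 - u) * (sin ?s)\<^sup>2 + u * (snd (c ?s) * sin ?s)"
      using arg_cong[OF im, of "\<lambda>z. z * sin ?s"] by (simp add: algebra_simps power2_eq_square)
    moreover have "0 < (1 - u) * (sin ?s)\<^sup>2 + u * (snd (c ?s) * sin ?s)"
      using u ys s0 by (cases "u = 0") (auto intro!: add_nonneg_pos)
    ultimately show False by simp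
  qed
  have "winding_number g 0 = winding_number (circlepath 0 1) 0"
  proof (rule winding_number_loops_linear_eq)
    show "pathfinish g = pathstart g" using loop by (simp add: pathfinish_def pathstart_def g_def)
  qed (use pg avoid in auto)
  also have "\<dots> = 1" by (rule winding_number_circlepath) simp
  finally have w: "winding_number g 0 = 1" .
  have g0: "0 \<notin> path_image g"
  proof
    assume "0 \<in> path_image g"
    then obtain t where "t \<in> {0..1}" "g t = 0" by (auto simp: path_image_def)
    then show False using avoid[of t] by (metis ends_in_segment(2))
  qed
  have "0 \<notin> outside (path_image g)"
  proof
    assume "0 \<in> outside (path_image g)"
    then have "winding_number g 0 = 0"
      using pg loop by (intro winding_number_zero_in_outside) (auto simp: pathfinish_def pathstart_def g_def)
    then show False using w by simp
  qed
  then have "0 \<in> inside (path_image g)" using inside_Un_outside[of "path_image g"] g0 by blast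
  then have "h (0, 0) \<in> inside (h ` (c ` {0..2 * pi}))" by (simp add: img h_def complex_eq_iff zero_complex.ctr)
  then show ?thesis by (rule inside_linear_isometry[OF h nh])
qed

text \<open>The two arcs are glued and repeated periodically. At the seams the one-sided derivatives
  are those of the adjoining arcs, as the crossing convention asks.\<close>

lemma periodic_crossing_solution:
  assumes T: "0 < T1" "0 < T2" and rs: "0 < r" "0 < s"
    and g1: "g1 0 = (r, 0)" "g1 T1 = (- s, 0)" "\<And>t. 0 < t \<Longrightarrow> t < T1 \<Longrightarrow> 0 < snd (g1 t)"
      "\<And>t. t \<in> {0..T1} \<Longrightarrow> (g1 has_vector_derivative upper_field \<theta> (g1 t)) (at t within {0..T1})"
    and g2: "g2 0 = (- s, 0)" "g2 T2 = (r, 0)" "\<And>t. 0 < t \<Longrightarrow> t < T2 \<Longrightarrow> snd (g2 t) < 0"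
      "\<And>t. t \<in> {0..T2} \<Longrightarrow> (g2 has_vector_derivative lower_field \<theta> (g2 t)) (at t within {0..T2})"
  obtains \<gamma> where "crossing_solution \<theta> \<gamma>" "\<And>t. \<gamma> (t + (T1 + T2)) = \<gamma> t" "\<gamma> 0 = (r, 0)" "\<gamma> T1 = (- s, 0)"
    "range \<gamma> = g1 ` {0..T1} \<union> g2 ` {0..T2}"
proof -
  define T where "T = T1 + T2"
  have Tp: "0 < T" using T by (simp add: T_def)
  define c where "c t = (if t \<le> T1 then g1 t else g2 (t - T1))" for t
  define k where "k t = \<lfloor>t / T\<rfloor>" for t
  define \<gamma> where "\<gamma> t = c (t - of_int (k t) * T)" for t
  have kI: "k t = j" if "of_int j * T \<le> t" "t < (of_int j + 1) * T" for t j
    unfolding k_def using that Tp by (intro floor_unique) (auto simp: field_simps)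
  have kb: "of_int (k t) * T \<le> t" "t < (of_int (k t) + 1) * T" for t
  proof -
    have "of_int (k t) \<le> t / T" "t / T < of_int (k t) + 1" unfolding k_def by linarith+
    then show "of_int (k t) * T \<le> t" "t < (of_int (k t) + 1) * T" using Tp by (auto simp: field_simps)
  qed
  have A: "\<gamma> t = g1 (t - of_int j * T)" if "t \<in> {of_int j * T..of_int j * T + T1}" for t j
  proof -
    have "k t = j" using that T by (intro kI) (auto simp: T_def algebra_simps)
    then show ?thesis using that by (simp add: \<gamma>_def c_def)
  qed
  \<comment> \<open>The right end point already belongs to the next period, whose initial value is
    the same point \<open>(r, 0)\<close>.\<close>
  have B: "\<gamma> t = g2 (t - (of_int j * T + T1))" if "t \<in> {of_int j * T + T1..(of_int j + 1) * T}" for t j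
  proof (cases "t = (of_int j + 1) * T")
    case True
    have "k t = j + 1" using True Tp by (intro kI) (auto simp: algebra_simps)
    then show ?thesis using True T g1(1) g2(2) by (simp add: \<gamma>_def c_def algebra_simps T_def)
  next
    case False
    then have kt: "k t = j" using that T by (intro kI) (auto simp: T_def algebra_simps)
    show ?thesis
    proof (cases "t = of_int j * T + T1")
      case True
      then have "t - of_int j * T = T1" "t - (of_int j * T + T1) = 0" by auto
      then show ?thesis using kt g1(2) g2(1) by (simp add: \<gamma>_def c_def)
    next
      case False
      then have "\<not> t - of_int j * T \<le> T1" "t - of_int j * T - T1 = t - (of_int j * T + T1)" using that by auto
      then show ?thesis using kt by (simp only: \<gamma>_def c_def if_False)
    qed
  qed
  have shift: "((\<lambda>t. g (t - a)) has_vector_derivative D) (at t within {a..a + S})"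
    if "(g has_vector_derivative D) (at (t - a) within {0..S})" for g :: "real \<Rightarrow> real \<times> real" and a S D t
  proof -
    have "(\<lambda>t. t - a) ` {a..a + S} = {0..S}"
    proof
      show "{0..S} \<subseteq> (\<lambda>t. t - a) ` {a..a + S}"
      proof
        fix x assume "x \<in> {0..S}"
        then show "x \<in> (\<lambda>t. t - a) ` {a..a + S}" by (intro image_eqI[of _ _ "x + a"]) auto
      qed
    qed auto
    moreover have "((\<lambda>t. t - a) has_vector_derivative 1) (at t within {a..a + S})" by (auto intro!: derivative_eq_intros)
    ultimately show ?thesis
      using vector_diff_chain_within[of "\<lambda>t. t - a" 1 t "{a..a + S}" g D] that by (simp add: o_def)
  qed
  have A': "(\<gamma> has_vector_derivative upper_field \<theta> (\<gamma> t)) (at t within {of_int j * T..of_int j * T + T1})"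
    if t: "t \<in> {of_int j * T..of_int j * T + T1}" for t j
  proof -
    have "(g1 has_vector_derivative upper_field \<theta> (g1 (t - of_int j * T))) (at (t - of_int j * T) within {0..T1})"
      using t by (intro g1(4)) auto
    note this = shift[OF this]
    then have "(\<gamma> has_vector_derivative upper_field \<theta> (g1 (t - of_int j * T))) (at t within {of_int j * T..of_int j * T + T1})"
      by (intro has_vector_derivative_transform[OF t, of \<gamma> "\<lambda>t. g1 (t - of_int j * T)"] A)
    then show ?thesis by (simp only: A[OF t])
  qed
  have B': "(\<gamma> has_vector_derivative lower_field \<theta> (\<gamma> t)) (at t within {of_int j * T + T1..(of_int j + 1) * T})"
    if t: "t \<in> {of_int j * T + T1..(of_int j + 1) * T}" for t j
  proof -
    have e: "(of_int j * T + T1) + T2 = (of_int j + 1) * T" by (simp add: T_def algebra_simps)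
    have "(g2 has_vector_derivative lower_field \<theta> (g2 (t - (of_int j * T + T1)))) (at (t - (of_int j * T + T1)) within {0..T2})"
      using t e by (intro g2(4)) auto
    note this = shift[OF this, unfolded e]
    then have "(\<gamma> has_vector_derivative lower_field \<theta> (g2 (t - (of_int j * T + T1)))) (at t within {of_int j * T + T1..(of_int j + 1) * T})"
      by (intro has_vector_derivative_transform[OF t, of \<gamma> "\<lambda>t. g2 (t - (of_int j * T + T1))"] B)
    then show ?thesis by (simp only: B[OF t])
  qed
  have sgnA: "0 < snd (\<gamma> t)" if "of_int j * T < t" "t < of_int j * T + T1" for t j
    using A[of t j] g1(3)[of "t - of_int j * T"] that by simp
  have sgnB: "snd (\<gamma> t) < 0" if "of_int j * T + T1 < t" "t < (of_int j + 1) * T" for t j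
    using B[of t j] g2(3)[of "t - (of_int j * T + T1)"] that by (simp add: T_def algebra_simps)
  have start: "\<gamma> (of_int j * T) = (r, 0)" "\<gamma> (of_int j * T + T1) = (- s, 0)" for j
    using A[of "of_int j * T" j] A[of "of_int j * T + T1" j] T g1 by auto
  have sol: "crossing_solution \<theta> \<gamma>"
    unfolding crossing_solution_def
  proof (rule allI)
    fix t
    define j where "j = k t"
    have e: "of_int j * T + T1 < (of_int j + 1) * T" using T by (simp add: T_def algebra_simps)
    consider "t = of_int j * T" | "of_int j * T < t" "t < of_int j * T + T1" | "t = of_int j * T + T1"
      | "of_int j * T + T1 < t" "t < (of_int j + 1) * T"
      using kb[of t, folded j_def] by linarith
    then show "(\<gamma> t \<in> upper_half \<longrightarrow> (\<gamma> has_vector_derivative upper_field \<theta> (\<gamma> t)) (at t)) \<and>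
       (\<gamma> t \<in> lower_half \<longrightarrow> (\<gamma> has_vector_derivative lower_field \<theta> (\<gamma> t)) (at t)) \<and>
       (snd (\<gamma> t) = 0 \<longrightarrow>
          snd (upper_field \<theta> (\<gamma> t)) > 0 \<and> snd (lower_field \<theta> (\<gamma> t)) > 0 \<and>
          (\<gamma> has_vector_derivative lower_field \<theta> (\<gamma> t)) (at_left t) \<and>
          (\<gamma> has_vector_derivative upper_field \<theta> (\<gamma> t)) (at_right t)
        \<or> snd (upper_field \<theta> (\<gamma> t)) < 0 \<and> snd (lower_field \<theta> (\<gamma> t)) < 0 \<and>
          (\<gamma> has_vector_derivative upper_field \<theta> (\<gamma> t)) (at_left t) \<and>
          (\<gamma> has_vector_derivative lower_field \<theta> (\<gamma> t)) (at_right t))"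
    proof cases
      case 1
      have p: "\<gamma> t = (r, 0)" by (subst 1) (rule start)
      have "(\<gamma> has_vector_derivative upper_field \<theta> (\<gamma> t)) (at t within {t..t + T1})"
        using A'[of t j] 1 T by simp
      then have "(\<gamma> has_vector_derivative upper_field \<theta> (\<gamma> t)) (at_right t)"
        using at_within_Icc_at_right[of t "t + T1"] T by simp
      \<comment> \<open>At the start of a period the left derivative comes from the second arc of
        the period before.\<close>
      moreover have l: "(of_int (j - 1) + 1) * T = t" by (subst 1) simp
      have l2: "of_int (j - 1) * T + T1 < t" using l T by (simp add: T_def algebra_simps)
      have tin: "t \<in> {of_int (j - 1) * T + T1..(of_int (j - 1) + 1) * T}" unfolding l using l2 by simp
      have "(\<gamma> has_vector_derivative lower_field \<theta> (\<gamma> t)) (at t within {of_int (j - 1) * T + T1..t})"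
        using B'[OF tin] unfolding l .
      then have "(\<gamma> has_vector_derivative lower_field \<theta> (\<gamma> t)) (at_left t)"
        using at_within_Icc_at_left[OF l2] by simp
      ultimately show ?thesis using p rs by (auto simp: snd_field upper_half_def lower_half_def)
    next
      case 2
      have "at t within {of_int j * T..of_int j * T + T1} = at t" using 2 by (intro at_within_interior) auto
      then have "(\<gamma> has_vector_derivative upper_field \<theta> (\<gamma> t)) (at t)" using A'[of t j] 2 by simp
      then show ?thesis using sgnA[OF 2] by (auto simp: upper_half_def lower_half_def)
    next
      case 3
      have p: "\<gamma> t = (- s, 0)" by (subst 3) (rule start)
      have "(\<gamma> has_vector_derivative upper_field \<theta> (\<gamma> t)) (at t within {of_int j * T..t})"
        using A'[of t j] 3 T by simp
      then have "(\<gamma> has_vector_derivative upper_field \<theta> (\<gamma> t)) (at_left t)"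
        using at_within_Icc_at_left[of "of_int j * T" t] 3 T by simp
      moreover have "(\<gamma> has_vector_derivative lower_field \<theta> (\<gamma> t)) (at t within {t..(of_int j + 1) * T})"
        using B'[of t j] 3 e by simp
      then have "(\<gamma> has_vector_derivative lower_field \<theta> (\<gamma> t)) (at_right t)"
        using at_within_Icc_at_right[of t "(of_int j + 1) * T"] 3 e by simp
      ultimately show ?thesis using p rs by (auto simp: snd_field upper_half_def lower_half_def)
    next
      case 4
      have "at t within {of_int j * T + T1..(of_int j + 1) * T} = at t" using 4 by (intro at_within_interior) auto
      then have "(\<gamma> has_vector_derivative lower_field \<theta> (\<gamma> t)) (at t)" using B'[of t j] 4 by simp
      then show ?thesis using sgnB[OF 4] by (auto simp: upper_half_def lower_half_def)
    qed
  qed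
  have per: "\<gamma> (t + (T1 + T2)) = \<gamma> t" for t
  proof -
    have "k (t + T) = k t + 1" using kb[of t] by (intro kI) (auto simp: algebra_simps)
    then show ?thesis by (simp add: \<gamma>_def T_def[symmetric] algebra_simps)
  qed
  have "range \<gamma> = g1 ` {0..T1} \<union> g2 ` {0..T2}"
  proof
    show "range \<gamma> \<subseteq> g1 ` {0..T1} \<union> g2 ` {0..T2}"
    proof
      fix p assume "p \<in> range \<gamma>"
      then obtain t where t: "p = \<gamma> t" by auto
      have "0 \<le> t - of_int (k t) * T" "t - of_int (k t) * T < T" using kb[of t] by (auto simp: algebra_simps)
      then show "p \<in> g1 ` {0..T1} \<union> g2 ` {0..T2}" unfolding t \<gamma>_def c_def by (auto simp: T_def)
    qed
    have "g1 t \<in> range \<gamma>" if "t \<in> {0..T1}" for t using A[of t 0] that by (metis of_int_0 mult_zero_left add_0 diff_zero rangeI)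
    moreover have "g2 t \<in> range \<gamma>" if "t \<in> {0..T2}" for t
    proof -
      have "\<gamma> (t + T1) = g2 t" using B[of "t + T1" 0] that by (simp add: T_def)
      then show ?thesis by (metis rangeI)
    qed
    ultimately show "g1 ` {0..T1} \<union> g2 ` {0..T2} \<subseteq> range \<gamma>" by blast
  qed
  moreover have "\<gamma> 0 = (r, 0)" "\<gamma> T1 = (- s, 0)" using start[of 0] by auto
  ultimately show thesis using that[of \<gamma>] sol per by blast
qed

context switching_pair
begin

definition cycle :: "real \<Rightarrow> (real \<times> real) set" where
  "cycle r = up.half_curve d1 l1 m1 n1 r ` {0..pi} \<union> flip ` (lo.half_curve (- d2) (- l2) m2 (- n2) r ` {0..pi})"

context
  fixes r :: real
  assumes r: "0 < r" "r < \<delta>/4" and zero: "Re (P1 (of_real r)) = Re (P2 (of_real r))"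
begin

abbreviation "c1 \<equiv> up.half_curve d1 l1 m1 n1 r"
abbreviation "c2 \<equiv> lo.half_curve (- d2) (- l2) m2 (- n2) r"

lemmas up_curve = up.half_curve_start[OF N1 damp(1) \<delta>(1) r] up.half_curve_end[OF N1 damp(1) \<delta>(1) r]
  and lo_curve = lo.half_curve_start[OF N2 damp(2) \<delta>(2) r] lo.half_curve_end[OF N2 damp(2) \<delta>(2) r]
lemmas up_upper = up.half_curve_upper[OF N1 damp(1) \<delta>(1) r]
  and lo_upper = lo.half_curve_upper[OF N2 damp(2) \<delta>(2) r]

lemma periodic_orbit_cycle: "periodic_orbit \<theta> (cycle r)"
proof -
  obtain T1 \<sigma>1 where 1: "0 < T1" "\<sigma>1 0 = 0" "\<sigma>1 T1 = pi" "\<sigma>1 ` {0..T1} = {0..pi}"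
    "\<And>t. 0 < t \<Longrightarrow> t < T1 \<Longrightarrow> 0 < \<sigma>1 t \<and> \<sigma>1 t < pi"
    "\<And>t. t \<in> {0..T1} \<Longrightarrow> ((c1 \<circ> \<sigma>1) has_vector_derivative half_field 1 d1 l1 m1 n1 (c1 (\<sigma>1 t))) (at t within {0..T1})"
    using up.half_arc[OF N1 damp(1) \<delta>(1) r] by blast
  obtain T2 \<sigma>2 where 2: "0 < T2" "\<sigma>2 0 = 0" "\<sigma>2 T2 = pi" "\<sigma>2 ` {0..T2} = {0..pi}"
    "\<And>t. 0 < t \<Longrightarrow> t < T2 \<Longrightarrow> 0 < \<sigma>2 t \<and> \<sigma>2 t < pi"
    "\<And>t. t \<in> {0..T2} \<Longrightarrow> ((c2 \<circ> \<sigma>2) has_vector_derivative half_field (- 1) (- d2) (- l2) m2 (- n2) (c2 (\<sigma>2 t))) (at t within {0..T2})"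
    using lo.half_arc[OF N2 damp(2) \<delta>(2) r] by blast
  define g2 where "g2 t = flip ((c2 \<circ> \<sigma>2) (T2 - t))" for t
  have rev: "(\<lambda>s. T2 - s) ` {0..T2} = {0..T2}"
  proof
    show "{0..T2} \<subseteq> (\<lambda>s. T2 - s) ` {0..T2}"
    proof
      fix x assume "x \<in> {0..T2}"
      then show "x \<in> (\<lambda>s. T2 - s) ` {0..T2}" by (intro image_eqI[of _ _ "T2 - x"]) auto
    qed
  qed auto
  have g2': "(g2 has_vector_derivative lower_field \<theta> (g2 t)) (at t within {0..T2})" if t: "t \<in> {0..T2}" for t
  proof -
    have "((c2 \<circ> \<sigma>2) has_vector_derivative half_field (- 1) (- d2) (- l2) m2 (- n2) ((c2 \<circ> \<sigma>2) (T2 - t))) (at (T2 - t) within (\<lambda>s. T2 - s) ` {0..T2})"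
      unfolding rev using 2(6)[of "T2 - t"] t by simp
    from bounded_linear.has_vector_derivative[OF bounded_linear_flip has_vector_derivative_reverse[OF this]]
    show ?thesis unfolding g2_def[abs_def] lower_field_flip(1)
      by (simp add: linear_neg[OF bounded_linear.linear[OF bounded_linear_flip]])
  qed
  obtain \<gamma> where \<gamma>: "crossing_solution \<theta> \<gamma>" "\<And>t. \<gamma> (t + (T1 + T2)) = \<gamma> t" "\<gamma> 0 = (r, 0)" "\<gamma> T1 = (- Re (P1 (of_real r)), 0)"
    "range \<gamma> = (c1 \<circ> \<sigma>1) ` {0..T1} \<union> g2 ` {0..T2}"
  proof (rule periodic_crossing_solution[where ?g1.0 = "c1 \<circ> \<sigma>1" and ?g2.0 = g2 and ?T1.0 = T1 and ?T2.0 = T2 and r = r and s = "Re (P1 (of_real r))" and \<theta> = \<theta>])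
    show "((c1 \<circ> \<sigma>1) has_vector_derivative upper_field \<theta> ((c1 \<circ> \<sigma>1) t)) (at t within {0..T1})" if "t \<in> {0..T1}" for t
      using 1(6)[OF that] by (simp only: upper_field_half_field o_apply)
    show "0 < snd ((c1 \<circ> \<sigma>1) t)" if "0 < t" "t < T1" for t using up_upper 1(5)[OF that] by simp
    show "snd (g2 t) < 0" if "0 < t" "t < T2" for t
      using lo_upper 2(5)[of "T2 - t"] that by (simp add: g2_def flip_def)
  qed (use 1 2 g2' r P_pos[OF r] up_curve lo_curve zero in \<open>auto simp: g2_def flip_def\<close>)
  have "g2 ` {0..T2} = flip ` (c2 ` (\<sigma>2 ` ((\<lambda>s. T2 - s) ` {0..T2})))"
    by (simp only: g2_def[abs_def] image_image o_apply)
  then have "range \<gamma> = cycle r"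
    unfolding \<gamma>(5) cycle_def rev 2(4) image_comp[symmetric] 1(4) by simp
  moreover have "\<gamma> T1 \<noteq> \<gamma> 0" using \<gamma>(3,4) r P_pos[OF r] by simp
  ultimately show ?thesis unfolding periodic_orbit_def using \<gamma>(1,2) 1(1) 2(1)
    by (intro exI[of _ \<gamma>] exI[of _ "T1 + T2"]) auto
qed

lemma start_in_cycle: "(r, 0) \<in> cycle r"
proof -
  have "c1 0 \<in> c1 ` {0..pi}" by (rule imageI) simp
  then show ?thesis unfolding cycle_def up_curve(1) by (rule UnI1)
qed

lemma cycle_once: "0 < \<rho> \<Longrightarrow> (\<rho>, 0) \<in> cycle r \<Longrightarrow> \<rho> = r"
proof -
  assume \<rho>: "0 < \<rho>" "(\<rho>, 0) \<in> cycle r"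
  have *: "\<rho> = r" if c: "c t = (\<rho>, 0)" "t \<in> {0..pi}" "c 0 = (r, 0)" "c pi = (- s, 0)" "0 < s" "\<And>t. 0 < t \<Longrightarrow> t < pi \<Longrightarrow> 0 < snd (c t)" for c :: "real \<Rightarrow> real \<times> real" and t s :: real
  proof -
    have "\<not> (0 < t \<and> t < pi)" using c(1) c(6)[of t] by auto
    then have "t = 0 \<or> t = pi" using c(2) by auto
    then show ?thesis using c \<rho>(1) by auto
  qed
  from \<rho>(2) consider t where "t \<in> {0..pi}" "c1 t = (\<rho>, 0)" | t where "t \<in> {0..pi}" "c2 t = (\<rho>, 0)"
    unfolding cycle_def by (auto simp: flip_def prod_eq_iff)
  then show "\<rho> = r"
  proof cases
    case 1
    show ?thesis by (rule *[OF 1(2,1) up_curve P_pos(1)[OF r] up_upper])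
  next
    case 2
    show ?thesis by (rule *[OF 2(2,1) lo_curve P_pos(2)[OF r] lo_upper])
  qed
qed

lemma norm_cycle_le:
  assumes "p \<in> cycle r"
  shows "norm p \<le> (2 * exp (max \<bar>l1\<bar> \<bar>l2\<bar>) + 3) * r"
proof -
  have nf: "norm (flip q) = norm q" for q by (simp add: flip_def norm_prod_def)
  have "norm p \<le> (2 * exp \<bar>l1\<bar> + 3) * r \<or> norm p \<le> (2 * exp \<bar>- l2\<bar> + 3) * r"
    using assms up.norm_half_curve_le[OF N1 damp(1) \<delta>(1) r] lo.norm_half_curve_le[OF N2 damp(2) \<delta>(2) r]
    unfolding cycle_def by (auto simp: nf)
  moreover have "(2 * exp \<bar>l1\<bar> + 3) * r \<le> (2 * exp (max \<bar>l1\<bar> \<bar>l2\<bar>) + 3) * r" 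
    "(2 * exp \<bar>- l2\<bar> + 3) * r \<le> (2 * exp (max \<bar>l1\<bar> \<bar>l2\<bar>) + 3) * r"
    using r by (auto intro!: mult_right_mono)
  ultimately show ?thesis by linarith
qed

text \<open>The reflected lower curve is run as \<open>2 * pi - t\<close>. This preserves the cosine
  and reverses the sine, just as the reflection reverses the height, so the sign conditions of
  \<open>origin_inside_loop\<close> hold on the full turn.\<close>

lemma origin_inside_cycle: "(0, 0) \<in> inside (cycle r)"
proof -
  define c where "c t = (if t \<le> pi then c1 t else flip (c2 (2 * pi - t)))" for t
  have cc1: "continuous_on {0..pi} c1"
  proof (rule up.half_curve_has_derivative[OF N1 damp(1) \<delta>(1) r])
    fix \<tau> assume "\<And>t. t \<in> {0..pi} \<Longrightarrow> (c1 has_vector_derivative \<tau> t *\<^sub>R half_field 1 d1 l1 m1 n1 (c1 t)) (at t within {0..pi})"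
    then show ?thesis by (rule has_vector_derivative_continuous_on)
  qed
  have cc2: "continuous_on {0..pi} c2"
  proof (rule lo.half_curve_has_derivative[OF N2 damp(2) \<delta>(2) r])
    fix \<tau> assume "\<And>t. t \<in> {0..pi} \<Longrightarrow> (c2 has_vector_derivative \<tau> t *\<^sub>R half_field (- 1) (- d2) (- l2) m2 (- n2) (c2 t)) (at t within {0..pi})"
    then show ?thesis by (rule has_vector_derivative_continuous_on)
  qed
  have join: "c1 pi = flip (c2 pi)" "c1 0 = flip (c2 0)" using up_curve lo_curve zero by (auto simp: flip_def)
  have "continuous_on {pi..2 * pi} (\<lambda>t. c2 (2 * pi - t))"
    by (rule continuous_on_compose2[OF cc2]) (auto intro!: continuous_intros)
  then have cf: "continuous_on {pi..2 * pi} (\<lambda>t. flip (c2 (2 * pi - t)))"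
    by (rule continuous_on_compose2[OF linear_continuous_on[OF bounded_linear_flip, of UNIV]]) auto
  have "continuous_on ({0..pi} \<union> {pi..2 * pi}) c"
    unfolding c_def
    by (rule continuous_on_If) (use cc1 cf join in auto)
  moreover have "{0..pi} \<union> {pi..2 * pi} = {0..2 * pi}" by auto
  ultimately have c: "continuous_on {0..2 * pi} c" by simp
  have "(0, 0) \<in> inside (c ` {0..2 * pi})"
  proof (rule origin_inside_loop[OF c])
    show "c 0 = c (2 * pi)" using join by (simp add: c_def)
    fix t assume t: "t \<in> {0..2 * pi}"
    show "\<exists>a>0. fst (c t) = a * cos t"
    proof (cases "t \<le> pi")
      case True
      then show ?thesis using up.half_curve_horizontal[OF N1 damp(1) \<delta>(1) r, of t] t by (simp add: c_def)
    next
      case False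
      then show ?thesis using lo.half_curve_horizontal[OF N2 damp(2) \<delta>(2) r, of "2 * pi - t"] t by (simp add: c_def flip_def)
    qed
    show "0 < snd (c t) * sin t" if s: "sin t \<noteq> 0"
    proof (cases "t \<le> pi")
      case True
      then have "0 < t" "t < pi" using t s by (auto simp: less_le)
      then show ?thesis using up_upper[of t] sin_gt_zero[of t] by (simp add: c_def)
    next
      case False
      then have "t < 2 * pi" using t s by (cases "t = 2 * pi") auto
      then show ?thesis using lo_upper[of "2 * pi - t"] sin_lt_zero[of t] False
        by (simp add: c_def flip_def mult_pos_neg)
    qed
  qed
  moreover have "c ` {0..2 * pi} = cycle r"
  proof
    show "c ` {0..2 * pi} \<subseteq> cycle r"
    proof
      fix p assume "p \<in> c ` {0..2 * pi}"
      then obtain t where t: "t \<in> {0..2 * pi}" "p = c t" by blast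
      show "p \<in> cycle r"
      proof (cases "t \<le> pi")
        case True
        then show ?thesis using t unfolding cycle_def by (intro UnI1 image_eqI[of _ _ t]) (auto simp: c_def)
      next
        case False
        then show ?thesis using t unfolding cycle_def by (intro UnI2 imageI image_eqI[of _ _ "c2 (2 * pi - t)"]) (auto simp: c_def)
      qed
    qed
    have "c1 t \<in> c ` {0..2 * pi}" if "t \<in> {0..pi}" for t using that by (intro image_eqI[of _ _ t]) (auto simp: c_def)
    moreover have "flip (c2 t) \<in> c ` {0..2 * pi}" if t: "t \<in> {0..pi}" for t
    proof (cases "t = pi")
      case True
      then show ?thesis using join by (intro image_eqI[of _ _ pi]) (auto simp: c_def)
    next
      case False
      then show ?thesis using t by (intro image_eqI[of _ _ "2 * pi - t"]) (auto simp: c_def)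
    qed
    ultimately show "cycle r \<subseteq> c ` {0..2 * pi}" unfolding cycle_def by blast
  qed
  ultimately show ?thesis by simp
qed

end

end

section \<open>Power series of the damping\<close>

lemma fps_X_power_dvd_nth: "fps_X ^ k dvd (F :: 'a::comm_ring_1 fps) \<longleftrightarrow> (\<forall>i<k. fps_nth F i = 0)"
proof
  assume "\<forall>i<k. fps_nth F i = 0"
  then have "F = fps_X ^ k * fps_shift k F"
    by (intro fps_ext) (auto simp: fps_X_power_mult_nth)
  then show "fps_X ^ k dvd F" by (rule dvdI)
qed (auto simp: dvd_def fps_X_power_mult_nth)

text \<open>Here \<open>v q\<close> is the inverse of \<open>energy_root\<close> and \<open>F\<close> the series of \<open>1 / ((1 - n y) w^(l b))\<close>; the
  equations come from \<open>y dy = v F^2 (1 - n y) (1 - b y) dv\<close> and the logarithmic derivative of \<open>F\<close>, divided by \<open>v\<close>.\<close>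

definition lienard_fps :: "'a::field_char_0 \<Rightarrow> 'a \<Rightarrow> 'a \<Rightarrow> 'a fps \<Rightarrow> 'a fps \<Rightarrow> bool" where
  "lienard_fps b l n q F \<longleftrightarrow> fps_nth q 0 = 1 \<and> fps_nth F 0 = 1 \<and>
     q * (q + fps_X * fps_deriv q) = F * F * ((1 - fps_const n * (fps_X * q)) * (1 - fps_const b * (fps_X * q))) \<and>
     q * fps_deriv F = F * F * (F * (fps_const (n + l) - fps_const (n * (b + l)) * (fps_X * q)))"

text \<open>Strong induction on the coefficients of the differences \<open>D\<close> and
  \<open>E\<close>. For \<open>k > 0\<close> the second equation forces \<open>k D_k = 0\<close>,
  and then the first forces \<open>(2 + k) E_k = 0\<close>; these factors are nonzero in
  characteristic zero.\<close>

lemma lienard_fps_unique: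
  assumes 1: "lienard_fps b l n q F" and 2: "lienard_fps b l n q' F'"
  shows "F = F'"
proof -
  define E where "E = q - q'"
  define D where "D = F - F'"
  have q: "q = q' + E" and F: "F = F' + D" by (simp_all add: E_def D_def)
  have D0: "fps_nth D 0 = 0" and E0: "fps_nth E 0 = 0" using 1 2 by (simp_all add: D_def E_def lienard_fps_def)
  have c0: "fps_nth q' 0 = 1" "fps_nth q 0 = 1" using 1 2 by (simp_all add: lienard_fps_def)
  define A where "A = (1 - fps_const n * (fps_X * q)) * (1 - fps_const b * (fps_X * q))"
  define B where "B = fps_const (n + l) - fps_const (n * (b + l)) * (fps_X * q)"
  define A1 where "A1 = fps_const (n * b) * fps_X * (q + q') - fps_const n - fps_const b"
  have "A - (1 - fps_const n * (fps_X * q')) * (1 - fps_const b * (fps_X * q')) = fps_X * E * A1"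
    unfolding A_def A1_def q fps_const_mult[symmetric] by (simp add: algebra_simps del: fps_const_add fps_const_mult)
  then have A': "(1 - fps_const n * (fps_X * q')) * (1 - fps_const b * (fps_X * q')) = A - fps_X * E * A1" by (simp add: algebra_simps)
  have B': "fps_const (n + l) - fps_const (n * (b + l)) * (fps_X * q') = B + fps_const (n * (b + l)) * (fps_X * E)"
    by (simp add: B_def q algebra_simps)
  \<comment> \<open>Both differenced equations are arranged so that every term on the right contains
    \<open>D\<close> or \<open>fps_X * E\<close>; these terms then do not contribute at the order
    under consideration.\<close>
  have e1: "E * (q + q' + fps_X * fps_deriv q) + q' * (fps_X * fps_deriv E) = D * ((F + F') * A) + fps_X * E * (F' * F' * A1)"
  proof -
    have "q * (q + fps_X * fps_deriv q) = F * F * A" "q' * (q' + fps_X * fps_deriv q') = F' * F' * (A - fps_X * E * A1)"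
      using 1 2 unfolding lienard_fps_def A' A_def by auto
    then have "q * (q + fps_X * fps_deriv q) - q' * (q' + fps_X * fps_deriv q') = F * F * A - F' * F' * (A - fps_X * E * A1)" by simp
    then show ?thesis unfolding F q by (simp add: algebra_simps)
  qed
  have e2: "E * fps_deriv F + q' * fps_deriv D = D * ((F * F + F * F' + F' * F') * B) - fps_X * E * (F' * F' * F' * fps_const (n * (b + l)))"
  proof -
    have "q * fps_deriv F = F * F * (F * B)" "q' * fps_deriv F' = F' * F' * (F' * (B + fps_const (n * (b + l)) * (fps_X * E)))"
      using 1 2 unfolding lienard_fps_def B' B_def by auto
    then have "q * fps_deriv F - q' * fps_deriv F' = F * F * (F * B) - F' * F' * (F' * (B + fps_const (n * (b + l)) * (fps_X * E)))" by simp
    then show ?thesis unfolding F q by (simp add: algebra_simps)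
  qed
  have "fps_nth E k = 0 \<and> fps_nth D k = 0" for k
  proof (induction k rule: less_induct)
    case (less k)
    then have "fps_X ^ k dvd E" "fps_X ^ k dvd D" by (auto simp: fps_X_power_dvd_nth)
    then obtain e d where ed: "E = fps_X ^ k * e" "D = fps_X ^ k * d" by (auto simp: dvd_def)
    have Dk: "fps_nth D k = 0"
    proof (cases k)
      case 0
      then show ?thesis using D0 by simp
    next
      case (Suc j)
      have "fps_X ^ j dvd E" "fps_X ^ j dvd D" using less Suc by (auto simp: fps_X_power_dvd_nth)
      then have "fps_X ^ j dvd D * ((F * F + F * F' + F' * F') * B) - fps_X * E * (F' * F' * F' * fps_const (n * (b + l))) - E * fps_deriv F"
        by (intro dvd_diff) auto
      then have "fps_X ^ j dvd q' * fps_deriv D" unfolding e2[symmetric] by simp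
      have "fps_nth (E * fps_deriv F + q' * fps_deriv D) j =
        fps_nth (D * ((F * F + F * F' + F' * F') * B) - fps_X * E * (F' * F' * F' * fps_const (n * (b + l)))) j"
        by (simp only: e2)
      moreover have "fps_nth (E * G) j = 0" "fps_nth (D * G) j = 0" for G
        using less Suc by (auto simp: fps_mult_nth intro!: sum.neutral)
      moreover have "fps_nth (q' * fps_deriv D) j = (\<Sum>i=0..j. fps_nth q' i * fps_nth (fps_deriv D) (j - i))" by (simp add: fps_mult_nth)
      moreover have "(\<Sum>i=0..j. fps_nth q' i * fps_nth (fps_deriv D) (j - i)) = (\<Sum>i\<in>{0}. fps_nth q' i * fps_nth (fps_deriv D) (j - i))"
        using less Suc by (intro sum.mono_neutral_right) auto
      ultimately have "fps_nth (fps_deriv D) j = 0"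
        by (simp add: c0 mult.assoc mult.commute[of fps_X] mult.left_commute[of fps_X])
      then show ?thesis using Suc of_nat_neq_0[of j, where 'a = 'a] by simp
    qed
    have "fps_X * E * (F' * F' * A1) = E * (fps_X * (F' * F' * A1))" by (simp only: mult_ac)
    then have "fps_nth (E * (q + q' + fps_X * fps_deriv q) + q' * (fps_X * fps_deriv E)) k =
      fps_nth (D * ((F + F') * A) + E * (fps_X * (F' * F' * A1))) k"
      by (simp only: e1)
    moreover have "fps_nth (G * H) k = fps_nth G k * fps_nth H 0" if "\<And>i. i < k \<Longrightarrow> fps_nth G i = 0" for G H :: "'a fps"
    proof -
      have "fps_nth (G * H) k = (\<Sum>i=0..k. fps_nth G i * fps_nth H (k - i))" by (simp add: fps_mult_nth)
      also have "\<dots> = (\<Sum>i\<in>{k}. fps_nth G i * fps_nth H (k - i))"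
        using that by (intro sum.mono_neutral_right) auto
      finally show ?thesis by simp
    qed
    moreover have XE: "fps_nth (fps_X * fps_deriv E) i = of_nat i * fps_nth E i" for i by (cases i) auto
    ultimately have "fps_nth E k * 2 + of_nat k * fps_nth E k = 0"
      using less Dk by (simp add: c0 mult.commute[of q'])
    then have "(2 + of_nat k) * fps_nth E k = 0" by (simp add: algebra_simps)
    moreover have "(2 + of_nat k :: 'a) \<noteq> 0" by (metis of_nat_eq_0_iff of_nat_add of_nat_numeral add_eq_0_iff_both_eq_0 zero_neq_numeral)
    ultimately show ?case using Dk by simp
  qed
  then have "D = 0" by (intro fps_ext) simp
  then show ?thesis by (simp add: D_def)
qed

text \<open>The recursion is left as polynomial relations instead of closed formulas;
  \<open>algebra\<close> eliminates the intermediate coefficients when the half-planes are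
  compared.\<close>

lemma lienard_fps_coeffs:
  assumes "lienard_fps b l n q F"
  shows "fps_nth F 1 = n + l"
    "3 * fps_nth q 1 = 2 * fps_nth F 1 - (n + b)"
    "2 * fps_nth F 2 + fps_nth q 1 * fps_nth F 1 = 3 * fps_nth F 1 * (n + l) - n * (b + l)"
    "4 * fps_nth q 2 + 2 * fps_nth q 1 ^ 2 = 2 * fps_nth F 2 + fps_nth F 1 ^ 2 - (n + b) * (fps_nth q 1 + 2 * fps_nth F 1) + n * b"
    "3 * fps_nth F 3 + 2 * fps_nth q 1 * fps_nth F 2 + fps_nth q 2 * fps_nth F 1 =
       3 * (n + l) * (fps_nth F 2 + fps_nth F 1 ^ 2) - n * (b + l) * (fps_nth q 1 + 3 * fps_nth F 1)"
proof -
  note s = fps_mult_nth eval_nat_numeral sum.atLeast0_atMost_Suc algebra_simps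
  have c: "fps_nth q 0 = 1" "fps_nth F 0 = 1" using assms by (auto simp: lienard_fps_def)
  have 1: "fps_nth (q * (q + fps_X * fps_deriv q)) k = fps_nth (F * F * ((1 - fps_const n * (fps_X * q)) * (1 - fps_const b * (fps_X * q)))) k" for k
    using assms by (simp add: lienard_fps_def)
  have 2: "fps_nth (q * fps_deriv F) k = fps_nth (F * F * (F * (fps_const (n + l) - fps_const (n * (b + l)) * (fps_X * q)))) k" for k
    using assms by (simp add: lienard_fps_def)
  show "fps_nth F 1 = n + l" using 2[of 0] by (simp add: c s)
  show "3 * fps_nth q 1 = 2 * fps_nth F 1 - (n + b)" using 1[of 1] by (simp add: c s)
  show "2 * fps_nth F 2 + fps_nth q 1 * fps_nth F 1 = 3 * fps_nth F 1 * (n + l) - n * (b + l)"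
    using 2[of 1] by (simp add: c s)
  show "4 * fps_nth q 2 + 2 * fps_nth q 1 ^ 2 = 2 * fps_nth F 2 + fps_nth F 1 ^ 2 - (n + b) * (fps_nth q 1 + 2 * fps_nth F 1) + n * b"
    using 1[of 2] by (simp add: c s)
  show "3 * fps_nth F 3 + 2 * fps_nth q 1 * fps_nth F 2 + fps_nth q 2 * fps_nth F 1 =
       3 * (n + l) * (fps_nth F 2 + fps_nth F 1 ^ 2) - n * (b + l) * (fps_nth q 1 + 3 * fps_nth F 1)"
    using 2[of 2] by (simp add: c s)
qed

text \<open>For \<open>l = - n\<close> the second equation integrates to \<open>F^(- 2) = 1 + n (b - n) v^2\<close>.\<close>

lemma lienard_fps_center1:
  assumes 1: "lienard_fps b (- n) n q F" and 2: "lienard_fps b' (- n') n' q' F'" and eq: "n * (b - n) = n' * (b' - n')"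
  shows "F = F'"
proof -
  have nz: "fps_nth F 0 = 1" "fps_nth F' 0 = 1" using assms by (auto simp: lienard_fps_def)
  have der: "fps_deriv ((inverse G)\<^sup>2) = 2 * fps_const (m * (c - m)) * fps_X" if G: "lienard_fps c (- m) m p G" for c m :: 'a and p G
  proof -
    have nz: "fps_nth G 0 = 1" "fps_nth p 0 = 1" using G by (auto simp: lienard_fps_def)
    then have p0: "p \<noteq> 0" by auto
    have "p * fps_deriv G = p * - (fps_const (m * (c - m)) * fps_X * G ^ 3)"
      using G by (simp add: lienard_fps_def power3_eq_cube algebra_simps)
    then have G': "fps_deriv G = - (fps_const (m * (c - m)) * fps_X * G ^ 3)" using p0 by (simp only: mult_cancel_left) simp
    have i: "inverse G * G = 1" using nz by (simp add: inverse_mult_eq_1)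
    have "fps_deriv ((inverse G)\<^sup>2) = 2 * inverse G * fps_deriv (inverse G)" by (simp add: power2_eq_square)
    also have "fps_deriv (inverse G) = - fps_deriv G * (inverse G)\<^sup>2" using nz by (simp add: fps_inverse_deriv)
    also have "2 * inverse G * (- fps_deriv G * (inverse G)\<^sup>2) = 2 * fps_const (m * (c - m)) * fps_X * (inverse G * G) ^ 3"
      unfolding G' by (simp add: power2_eq_square power3_eq_cube mult_ac)
    finally show ?thesis by (simp add: i)
  qed
  have "fps_deriv ((inverse F)\<^sup>2) = fps_deriv ((inverse F')\<^sup>2)" unfolding der[OF 1] der[OF 2] eq ..
  then have "(inverse F)\<^sup>2 = fps_const (fps_nth ((inverse F)\<^sup>2) 0 - fps_nth ((inverse F')\<^sup>2) 0) + (inverse F')\<^sup>2"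
    unfolding fps_deriv_eq_iff .
  moreover have "fps_nth ((inverse F)\<^sup>2) 0 = 1" "fps_nth ((inverse F')\<^sup>2) 0 = 1" using nz by (simp_all add: power2_eq_square)
  ultimately have "(inverse F)\<^sup>2 = (inverse F')\<^sup>2" by simp
  \<comment> \<open>The sum has constant term 2, so only the difference can vanish: the sign of the
    square root is determined.\<close>
  then have "(inverse F - inverse F') * (inverse F + inverse F') = 0" by (simp add: power2_eq_square algebra_simps)
  moreover have "inverse F + inverse F' \<noteq> 0"
  proof
    assume "inverse F + inverse F' = 0"
    then have "fps_nth (inverse F + inverse F') 0 = 0" by simp
    then show False using nz by simp
  qed
  ultimately have "inverse F = inverse F'" by simp
  then have "inverse (inverse F) = inverse (inverse F')" by simp
  then show ?thesis using nz by (simp add: fps_inverse_idempotent)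
qed

text \<open>The change of variables \<open>y \<mapsto> y / (1 - y)\<close> maps one normal form to the other.\<close>

lemma lienard_fps_center2:
  assumes 1: "lienard_fps 1 l n q F" and 2: "lienard_fps (- 1) (1 + l) (n - 1) q' F'"
  shows "F = F'"
proof (rule lienard_fps_unique[OF _ 2])
  define w where "w = 1 - fps_X * q"
  define i where "i = inverse w"
  have w0: "fps_nth w 0 = 1" using 1 by (simp add: w_def lienard_fps_def)
  then have wi: "w * i = 1" unfolding i_def by (metis inverse_mult_eq_1 mult.commute one_neq_zero)
  have "fps_deriv i = - fps_deriv w * i\<^sup>2" unfolding i_def using w0 by (simp add: fps_inverse_deriv)
  then have i': "fps_deriv i = (q + fps_X * fps_deriv q) * i * i" by (simp add: w_def power2_eq_square)
  have Xq: "fps_X * q = 1 - w" by (simp add: w_def)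
  \<comment> \<open>With \<open>i = 1 / w\<close> this shows that \<open>i - 1\<close> is
    \<open>y / (1 - y)\<close>, the new height, so \<open>q * i\<close> is the new first
    series.\<close>
  have Xqi: "fps_X * (q * i) = i - 1" using wi by (simp add: mult.assoc[symmetric] Xq algebra_simps)
  have e1: "q * (q + fps_X * fps_deriv q) = F * F * ((1 - fps_const n * (1 - w)) * w)"
    and e2: "q * fps_deriv F = F * F * (F * (fps_const (n + l) - fps_const (n * (1 + l)) * (1 - w)))"
    using 1 by (simp_all add: lienard_fps_def Xq)
  show "lienard_fps (- 1) (1 + l) (n - 1) (q * i) F"
    unfolding lienard_fps_def Xqi
  proof (intro conjI)
    show "fps_nth (q * i) 0 = 1" "fps_nth F 0 = 1" using 1 w0 by (simp_all add: lienard_fps_def i_def)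
    have "q * i + fps_X * fps_deriv (q * i) = (q + fps_X * fps_deriv q) * i * (1 + fps_X * (q * i))"
      by (simp add: i' algebra_simps)
    also have "\<dots> = (q + fps_X * fps_deriv q) * i * i" unfolding Xqi by simp
    finally have "q * i * (q * i + fps_X * fps_deriv (q * i)) = (q * (q + fps_X * fps_deriv q)) * i * i * i"
      by (simp only: mult_ac)
    also have "\<dots> = F * F * (((w * i) * i - fps_const n * (w * i) * (i - w * i)) * i)" unfolding e1 by (simp add: algebra_simps)
    also have "\<dots> = F * F * ((1 - fps_const (n - 1) * (i - 1)) * (1 - fps_const (- 1) * (i - 1)))"
      unfolding wi fps_const_sub[symmetric] fps_const_neg[symmetric] by (simp add: algebra_simps)
    finally show "q * i * (q * i + fps_X * fps_deriv (q * i)) = F * F * ((1 - fps_const (n - 1) * (i - 1)) * (1 - fps_const (- 1) * (i - 1)))" .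
    have "q * i * fps_deriv F = (q * fps_deriv F) * i" by (simp add: mult_ac)
    also have "\<dots> = F * F * (F * (fps_const (n + l) * i - fps_const (n * (1 + l)) * (i - w * i)))" unfolding e2 by (simp add: algebra_simps)
    also have "fps_const (n + l) * i - fps_const (n * (1 + l)) * (i - w * i) =
      fps_const (n - 1 + (1 + l)) - fps_const ((n - 1) * (- 1 + (1 + l))) * (i - 1)"
    proof -
      have "fps_const (n * (1 + l)) = fps_const (n + l) + fps_const ((n - 1) * l)" by (simp add: algebra_simps)
      moreover have "A * i - (A + B) * (i - 1) = A - B * (i - 1)" for A B :: "'a fps"
        by (simp add: algebra_simps)
      moreover have "n - 1 + (1 + l) = n + l" "- 1 + (1 + l) = l" by simp_all
      ultimately show ?thesis unfolding wi by (simp only:)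
    qed
    finally show "q * i * fps_deriv F = F * F * (F * (fps_const (n - 1 + (1 + l)) - fps_const ((n - 1) * (- 1 + (1 + l))) * (i - 1)))" .
  qed
qed

text \<open>The successive obstructions to equal dampings, each computed when the earlier linear
  conditions hold. The two linear conditions together imply \<open>2 * l2 + 3 * n1 - n2 = 0\<close>,
  whence the shape of \<open>weak_focus_set\<close>.\<close>

lemma lienard_fps_diff:
  fixes l1 l2 n1 n2 :: "'a::field_char_0"
  assumes 1: "lienard_fps 1 l1 n1 q1 F1" and 2: "lienard_fps (- 1) (- l2) (- n2) q2 F2"
  shows "fps_nth F2 1 - fps_nth F1 1 = - (l1 + n1 + l2 + n2)"
    "l1 + n1 + l2 + n2 = 0 \<Longrightarrow> 6 * (fps_nth F2 2 - fps_nth F1 2) = (n1 + n2 - 1) * (2 * l1 - n1 + 3 * n2)"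
    "l1 + n1 + l2 + n2 = 0 \<Longrightarrow> 2 * l1 - n1 + 3 * n2 = 0 \<Longrightarrow>
       24 * (fps_nth F2 3 - fps_nth F1 3) = (n1 - n2) * (n1 + n2 - 1) * (n2 - n1)"
proof -
  note a = lienard_fps_coeffs[OF 1] and b = lienard_fps_coeffs[OF 2]
  show "fps_nth F2 1 - fps_nth F1 1 = - (l1 + n1 + l2 + n2)" unfolding a(1) b(1) by simp
  assume s: "l1 + n1 + l2 + n2 = 0"
  show "6 * (fps_nth F2 2 - fps_nth F1 2) = (n1 + n2 - 1) * (2 * l1 - n1 + 3 * n2)"
    using a(1-3) b(1-3) s by algebra
  assume t: "2 * l1 - n1 + 3 * n2 = 0"
  show "24 * (fps_nth F2 3 - fps_nth F1 3) = (n1 - n2) * (n1 + n2 - 1) * (n2 - n1)"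
    using a b s t by algebra
qed

lemma has_fps_expansion_transform:
  "g has_fps_expansion G \<Longrightarrow> eventually (\<lambda>x. f x = g x) (nhds 0) \<Longrightarrow> f has_fps_expansion G"
  using has_fps_expansion_cong[of f g G G] by simp

section \<open>Series expansion of the damping\<close>

context lienard_normal_form
begin

context
  fixes l n :: real
  assumes ln: "(l, n) \<in> N"
begin

text \<open>The analytic function whose series is the \<open>F\<close> of
  \<open>lienard_fps\<close>.\<close>

definition inv_weight :: "complex \<Rightarrow> complex" where
  "inv_weight v = exp (- (of_real (l * b) * Ln (1 - of_real b * root_inv l n v))) / (1 - of_real n * root_inv l n v)"

text \<open>The energy relation gives \<open>Y Y' = v / (a Z)\<close> with
  \<open>a = 1 - n Y\<close> and \<open>Z = w^(2 l b - 1)\<close>. As \<open>1 / Z = P P w\<close>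
  for \<open>P = w^(- l b)\<close>, the system closes in \<open>Y\<close> and
  \<open>inv_weight\<close>, which is \<open>P / a\<close>.\<close>

lemma root_inv_ode:
  assumes v: "norm v < r0/2"
  defines "Y \<equiv> root_inv l n"
  shows "Y v * deriv Y v = v * (inv_weight v * inv_weight v * ((1 - of_real n * Y v) * (1 - of_real b * Y v)))"
    "inv_weight field_differentiable at v"
    "Y v * deriv inv_weight v = v * (inv_weight v * inv_weight v * (inv_weight v * (of_real (n + l) - of_real (n * (b + l)) * Y v)))"
    "symbol 0 l m n v = of_real m * v * inv_weight v"
proof -
  have v': "norm v \<le> r0/2" using v by simp
  note y = root_inv[OF ln v'] and w = one_minus_root_inv[OF ln v']
  define L where "L = Ln (1 - of_real b * Y v)"
  define J where "J = energy_root_deriv b l n (Y v)"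
  have J: "J \<noteq> 0" unfolding J_def Y_def by (rule energy_root_deriv_nz[OF ln y(1)])
  have wt: "lienard_weight b l n (Y v) = (1 - of_real n * Y v) * exp (of_real (2 * l * b - 1) * L)"
    by (simp add: lienard_weight_def L_def)
  have n0: "1 - of_real n * Y v \<noteq> 0" using weight_nz[OF ln y(1)] unfolding Y_def[symmetric] wt by auto
  have Y': "(Y has_field_derivative inverse J) (at v)" unfolding Y_def J_def by (rule root_inv_has_derivative[OF ln v])
  then have dY: "deriv Y v = inverse J" by (rule DERIV_imp_deriv)
  have "v * J = Y v * csqrt (energy_factor b l n (Y v)) * (lienard_weight b l n (Y v) / csqrt (energy_factor b l n (Y v)))"
    unfolding J_def energy_root_deriv_def using y(2) by (simp add: Y_def energy_root_def)
  then have "v * J = Y v * lienard_weight b l n (Y v)"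
    using csqrt_energy_nz[OF ln y(1)] by (simp add: Y_def)
  then have YJ: "Y v * inverse J = v / ((1 - of_real n * Y v) * exp (of_real (2 * l * b - 1) * L))"
    using J n0 unfolding wt by (simp add: field_simps)
  define P where "P = exp (- (of_real (l * b) * L))"
  define Z where "Z = exp (of_real (2 * l * b - 1) * L)"
  define w where "w = 1 - of_real b * Y v"
  define a where "a = 1 - of_real n * Y v"
  have X: "inv_weight v = P / a" by (simp add: inv_weight_def L_def Y_def P_def a_def)
  have eL: "exp L = w" using w(2) by (simp add: L_def Y_def w_def)
  have nz: "P \<noteq> 0" "Z \<noteq> 0" "a \<noteq> 0" "w \<noteq> 0" using n0 w(2) by (auto simp: P_def Z_def a_def w_def Y_def)
  have "P * P * exp L * Z =
     exp (- (of_real (l * b) * L) + - (of_real (l * b) * L) + L + of_real (2 * l * b - 1) * L)"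
    unfolding P_def Z_def by (simp only: exp_add)
  also have "\<dots> = 1" by (simp add: algebra_simps)
  finally have Zi: "inverse Z = P * P * w" using nz unfolding eL by (intro inverse_unique) (simp add: mult_ac)
  have YJ: "Y v * inverse J = v * inverse a * inverse Z" unfolding YJ Z_def a_def by (simp add: divide_inverse)
  have YJ': "Y v * inverse J = v * (inv_weight v * inv_weight v * (a * w))"
    unfolding YJ Zi X using nz by (simp add: divide_inverse mult_ac)
  then show "Y v * deriv Y v = v * (inv_weight v * inv_weight v * ((1 - of_real n * Y v) * (1 - of_real b * Y v)))"
    unfolding dY a_def w_def .
  have "((\<lambda>v. Ln (1 - of_real b * Y v)) has_field_derivative - of_real b * inverse J / (1 - of_real b * Y v)) (at v)"
    using w(1) unfolding Y_def[symmetric] by (auto intro!: derivative_eq_intros Y' simp: divide_inverse mult_ac)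
  then have E: "((\<lambda>v. exp (- (of_real (l * b) * Ln (1 - of_real b * Y v)))) has_field_derivative P * - (of_real (l * b) * (- of_real b * inverse J / w))) (at v)"
    unfolding P_def L_def w_def by (intro DERIV_chain2[OF DERIV_exp] DERIV_minus DERIV_cmult)
  have D: "((\<lambda>v. 1 - of_real n * Y v) has_field_derivative - (of_real n * inverse J)) (at v)"
    by (auto intro!: derivative_eq_intros Y')
  have "(inv_weight has_field_derivative (P * - (of_real (l * b) * (- of_real b * inverse J / w)) * a - P * (- (of_real n * inverse J))) / (a * a)) (at v)"
    using DERIV_divide[OF E D n0] unfolding inv_weight_def[abs_def] Y_def[symmetric] L_def[symmetric] P_def[symmetric] a_def[symmetric] .
  moreover have "(P * - (of_real (l * b) * (- of_real b * inverse J / w)) * a - P * (- (of_real n * inverse J))) / (a * a)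
     = inv_weight v * inverse J * (of_real (n + l) - of_real (n * (b + l)) * Y v) / (a * w)"
  proof -
    have bb: "of_real b * of_real b = (1::complex)" using b_square by (metis of_real_1 of_real_mult)
    have "- (of_real (l * b) * (- of_real b * inverse J / w)) = (of_real b * of_real b) * (of_real l * inverse J / w)"
      by simp
    then have r: "- (of_real (l * b) * (- of_real b * inverse J / w)) = of_real l * inverse J / w"
      unfolding bb by simp
    have k: "of_real l * a + of_real n * w = of_real (n + l) - of_real (n * (b + l)) * Y v"
      by (simp add: a_def w_def algebra_simps)
    have eq: "P * (x * i / w) * a - P * (- (y * i)) = P * i * (x * a + y * w) / w" for x y i
      using nz by (simp add: field_simps)
    have "(P * (of_real l * inverse J / w) * a - P * (- (of_real n * inverse J))) / (a * a) = P * inverse J * (of_real l * a + of_real n * w) / (a * a * w)"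
      unfolding eq by (simp add: mult_ac)
    then show ?thesis unfolding r k X using nz by simp
  qed
  ultimately have X': "(inv_weight has_field_derivative inv_weight v * inverse J * (of_real (n + l) - of_real (n * (b + l)) * Y v) / (a * w)) (at v)"
    by simp
  then show "inv_weight field_differentiable at v" by (auto simp: field_differentiable_def)
  have "Y v * deriv inv_weight v = (Y v * inverse J) * (inv_weight v * (of_real (n + l) - of_real (n * (b + l)) * Y v) / (a * w))"
    unfolding DERIV_imp_deriv[OF X'] by simp
  also have "\<dots> = v * (inv_weight v * inv_weight v * (inv_weight v * (of_real (n + l) - of_real (n * (b + l)) * Y v)))"
    unfolding YJ' using nz by simp
  finally show "Y v * deriv inv_weight v = v * (inv_weight v * inv_weight v * (inv_weight v * (of_real (n + l) - of_real (n * (b + l)) * Y v)))" .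
  have "symbol 0 l m n v = of_real m * (Y v * inverse J) * exp (of_real (l * b - 1) * L)"
    unfolding symbol_def Y_def[symmetric] J_def L_def by (simp add: divide_inverse)
  also have "\<dots> = of_real m * v * (exp (of_real (l * b - 1) * L) * inverse Z * inverse a)"
    unfolding YJ by simp
  also have "exp (of_real (l * b - 1) * L) * inverse Z = P"
  proof -
    have "exp (of_real (l * b - 1) * L) * inverse Z = exp (of_real (l * b - 1) * L + - (of_real (2 * l * b - 1) * L))"
      by (simp only: Z_def exp_minus[symmetric] exp_add[symmetric])
    also have "of_real (l * b - 1) * L + - (of_real (2 * l * b - 1) * L) = - (of_real (l * b) * L)" by (simp add: algebra_simps)
    finally show ?thesis unfolding P_def .
  qed
  finally show "symbol 0 l m n v = of_real m * v * inv_weight v" unfolding X by (simp add: divide_inverse)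
qed

text \<open>The series \<open>F\<close> is obtained before \<open>m\<close>, which enters the
  damping only as a factor. The differential equations first carry an extra \<open>fps_X\<close>,
  which cancels because power series form an integral domain.\<close>

lemma symbol_fps:
  obtains q F where "lienard_fps (of_real b) (of_real l) (of_real n) q F"
    "\<And>m. symbol 0 l m n has_fps_expansion fps_const (of_real m) * fps_X * F"
proof -
  let ?Y = "root_inv l n"
  have ev: "eventually (\<lambda>v :: complex. norm v < r0/2) (nhds 0)"
  proof -
    have "eventually (\<lambda>v :: complex. v \<in> ball 0 (r0/2)) (nhds 0)" using r0 by (intro eventually_nhds_in_open) auto
    then show ?thesis by eventually_elim simp
  qed
  have z: "norm (0::complex) < r0/2" "(0 :: complex) \<in> ball 0 (r0/2)" using r0 by auto
  have "?Y analytic_on {0}"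
    using holomorphic_on_imp_analytic_at[OF holomorphic_root_inv[OF ln] open_ball z(2)] .
  then have Y: "?Y has_fps_expansion fps_expansion ?Y 0" by (rule analytic_at_imp_has_fps_expansion_0)
  have "inv_weight holomorphic_on ball 0 (r0/2)"
    unfolding holomorphic_on_def by (intro ballI field_differentiable_at_within[OF root_inv_ode(2)]) simp
  from holomorphic_on_imp_analytic_at[OF this open_ball z(2)] have "inv_weight analytic_on {0}" .
  then have X: "inv_weight has_fps_expansion fps_expansion inv_weight 0" by (rule analytic_at_imp_has_fps_expansion_0)
  define FY where "FY = fps_expansion ?Y 0"
  define F where "F = fps_expansion inv_weight 0"
  note Y = Y[folded FY_def] and X = X[folded F_def]
  define q where "q = fps_shift 1 FY"
  have Y0: "fps_nth FY 0 = 0" using root_inv_0[OF ln] by (simp add: FY_def fps_expansion_def)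
  then have FYq: "FY = fps_X * q" unfolding q_def by (intro fps_ext) simp
  have "deriv ?Y 0 = 1"
    using DERIV_imp_deriv[OF root_inv_has_derivative[OF ln z(1)]] root_inv_0[OF ln] 
    by (simp add: energy_root_deriv_def energy_factor_0[OF b] weight_0[OF b])
  then have q0: "fps_nth q 0 = 1" by (simp add: q_def FY_def fps_expansion_def)
  have F0: "fps_nth F 0 = 1" using root_inv_0[OF ln] by (simp add: F_def fps_expansion_def inv_weight_def)
  note intro = has_fps_expansion_mult has_fps_expansion_diff has_fps_expansion_deriv has_fps_expansion_const
    has_fps_expansion_1 has_fps_expansion_fps_X Y X
  have eq1: "FY * fps_deriv FY = fps_X * (F * F * ((1 - fps_const (of_real n) * FY) * (1 - fps_const (of_real b) * FY)))"
  proof (rule fps_expansion_unique_complex)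
    show "(\<lambda>v. ?Y v * deriv ?Y v) has_fps_expansion FY * fps_deriv FY" by (intro intro)
    have "(\<lambda>v. v * (inv_weight v * inv_weight v * ((1 - of_real n * ?Y v) * (1 - of_real b * ?Y v)))) has_fps_expansion
        fps_X * (F * F * ((1 - fps_const (of_real n) * FY) * (1 - fps_const (of_real b) * FY)))" by (intro intro)
    moreover have "eventually (\<lambda>v. ?Y v * deriv ?Y v = v * (inv_weight v * inv_weight v * ((1 - of_real n * ?Y v) * (1 - of_real b * ?Y v)))) (nhds 0)"
      using ev by eventually_elim (rule root_inv_ode(1))
    ultimately show "(\<lambda>v. ?Y v * deriv ?Y v) has_fps_expansion
        fps_X * (F * F * ((1 - fps_const (of_real n) * FY) * (1 - fps_const (of_real b) * FY)))"
      by (rule has_fps_expansion_transform)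
  qed
  have eq2: "FY * fps_deriv F = fps_X * (F * F * (F * (fps_const (of_real (n + l)) - fps_const (of_real (n * (b + l))) * FY)))"
  proof (rule fps_expansion_unique_complex)
    show "(\<lambda>v. ?Y v * deriv inv_weight v) has_fps_expansion FY * fps_deriv F" by (intro intro)
    have "(\<lambda>v. v * (inv_weight v * inv_weight v * (inv_weight v * (of_real (n + l) - of_real (n * (b + l)) * ?Y v)))) has_fps_expansion
        fps_X * (F * F * (F * (fps_const (of_real (n + l)) - fps_const (of_real (n * (b + l))) * FY)))" by (intro intro)
    moreover have "eventually (\<lambda>v. ?Y v * deriv inv_weight v = v * (inv_weight v * inv_weight v * (inv_weight v * (of_real (n + l) - of_real (n * (b + l)) * ?Y v)))) (nhds 0)"
      using ev by eventually_elim (rule root_inv_ode(3))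
    ultimately show "(\<lambda>v. ?Y v * deriv inv_weight v) has_fps_expansion
        fps_X * (F * F * (F * (fps_const (of_real (n + l)) - fps_const (of_real (n * (b + l))) * FY)))"
      by (rule has_fps_expansion_transform)
  qed
  have X0: "(fps_X :: complex fps) \<noteq> 0" by simp
  show thesis
  proof (rule that[of q F])
    show "lienard_fps (of_real b) (of_real l) (of_real n) q F"
      unfolding lienard_fps_def
    proof (intro conjI q0 F0)
      have "fps_X * (q * (q + fps_X * fps_deriv q)) = FY * fps_deriv FY" by (simp add: FYq algebra_simps)
      then show "q * (q + fps_X * fps_deriv q) = F * F * ((1 - fps_const (of_real n) * (fps_X * q)) * (1 - fps_const (of_real b) * (fps_X * q)))"
        unfolding eq1 unfolding FYq by (rule mult_left_cancel[OF X0, THEN iffD1])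
      have "fps_X * (q * fps_deriv F) = FY * fps_deriv F" by (simp add: FYq algebra_simps)
      then show "q * fps_deriv F = F * F * (F * (fps_const (of_real n + of_real l) - fps_const (of_real n * (of_real b + of_real l)) * (fps_X * q)))"
        unfolding eq2 unfolding FYq of_real_add of_real_mult by (rule mult_left_cancel[OF X0, THEN iffD1])
    qed
    fix m :: real
    have "(\<lambda>v. of_real m * v * inv_weight v) has_fps_expansion fps_const (of_real m) * fps_X * F" by (intro intro)
    moreover have "eventually (\<lambda>v. symbol 0 l m n v = of_real m * v * inv_weight v) (nhds 0)"
      using ev by eventually_elim (rule root_inv_ode(4))
    ultimately show "symbol 0 l m n has_fps_expansion fps_const (of_real m) * fps_X * F"
      by (rule has_fps_expansion_transform)
  qed
qed

lemma symbol_at_0: "symbol d l m n 0 = of_real d"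
  using root_inv_0[OF ln] by (simp add: symbol_def energy_root_deriv_def energy_factor_0[OF b] weight_0[OF b])

end

end

section \<open>Order of the displacement map\<close>

text \<open>The displacement exists only for positive radii, so its expansion must be unique from
  one-sided data: division by powers of \<open>r\<close> isolates each coefficient as a right-hand
  limit.\<close>

lemma powser_zero_right:
  fixes w :: "nat \<Rightarrow> real"
  assumes \<rho>: "0 < \<rho>" and w: "\<And>r. 0 < r \<Longrightarrow> r < \<rho> \<Longrightarrow> (\<lambda>k. w k * r ^ k) sums 0"
  shows "w k = 0"
proof (induction k rule: less_induct)
  case (less k)
  define h where "h x = (\<Sum>i. w (i + k) * x ^ i)" for x
  have s: "(\<lambda>i. w (i + k) * r ^ i) sums 0" if r: "0 < r" "r < \<rho>" for r
  proof -
    have "(\<lambda>i. w (i + k) * r ^ (i + k)) sums 0"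
      using w[OF r] less by (subst sums_iff_shift) simp
    then have "(\<lambda>i. w (i + k) * r ^ (i + k) / r ^ k) sums (0 / r ^ k)" by (rule sums_divide)
    then show ?thesis using r by (simp add: power_add)
  qed
  have "(h \<longlongrightarrow> w (0 + k)) (at 0)"
  proof (rule powser_limit_0[of "\<rho>/2"])
    fix x :: real assume "norm x < \<rho>/2"
    then have "summable (\<lambda>i. w (i + k) * x ^ i)"
      using powser_inside[OF sums_summable[OF s[of "\<rho>/2"]], of x] \<rho> by simp
    then show "(\<lambda>i. w (i + k) * x ^ i) sums h x" unfolding h_def by (rule summable_sums)
  qed (use \<rho> in simp)
  then have "(h \<longlongrightarrow> w k) (at_right 0)" by (simp add: filterlim_at_split)
  moreover have "eventually (\<lambda>x. 0 = h x) (at_right 0)"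
    unfolding eventually_at_right_field using \<rho> s sums_unique h_def by metis
  then have "(h \<longlongrightarrow> 0) (at_right 0)" by (rule Lim_transform_eventually[OF tendsto_const])
  ultimately show "w k = 0" by (intro tendsto_unique[of "at_right 0" h]) auto
qed

text \<open>If \<open>p\<close> is the first index with \<open>w p \<noteq> 0\<close>, then
  \<open>\<bar>D r\<bar> / r ^ p\<close> tends to \<open>\<bar>w p\<bar>\<close>. The upper bound
  excludes \<open>p < N\<close> and the lower bound excludes \<open>p > N\<close>.\<close>

lemma powser_order:
  fixes w :: "nat \<Rightarrow> real"
  assumes \<rho>: "0 < \<rho>" and w: "\<And>r. 0 < r \<Longrightarrow> r < \<rho> \<Longrightarrow> (\<lambda>k. w k * r ^ k) sums D r"
    and a: "0 < a" and bd: "\<And>r. 0 < r \<Longrightarrow> r < \<rho> \<Longrightarrow> a * r ^ N \<le> \<bar>D r\<bar>" "\<And>r. 0 < r \<Longrightarrow> r < \<rho> \<Longrightarrow> \<bar>D r\<bar> \<le> K * r ^ N"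
  shows "(\<forall>k<N. w k = 0) \<and> w N \<noteq> 0"
proof -
  have "\<exists>k. w k \<noteq> 0"
  proof (rule ccontr)
    assume "\<nexists>k. w k \<noteq> 0"
    then have "(\<lambda>k. 0) sums D (\<rho>/2)" using w[of "\<rho>/2"] \<rho> by simp
    from sums_unique2[OF this sums_zero] have "D (\<rho>/2) = 0" .
    moreover have "0 < a * (\<rho>/2) ^ N" using a \<rho> by simp
    moreover have "a * (\<rho>/2) ^ N \<le> \<bar>D (\<rho>/2)\<bar>" by (rule bd(1)) (use \<rho> in auto)
    ultimately show False by linarith
  qed
  define p where "p = (LEAST k. w k \<noteq> 0)"
  have p: "w p \<noteq> 0" unfolding p_def by (rule LeastI_ex[OF \<open>\<exists>k. w k \<noteq> 0\<close>])
  have less_p: "w k = 0" if "k < p" for k using not_less_Least[OF that[unfolded p_def]] by simp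
  define h where "h x = (\<Sum>i. w (i + p) * x ^ i)" for x
  have s: "(\<lambda>i. w (i + p) * r ^ i) sums (D r / r ^ p)" if r: "0 < r" "r < \<rho>" for r
  proof -
    have "(\<lambda>i. w (i + p) * r ^ (i + p)) sums D r"
      using w[OF r] by (subst sums_iff_shift) (simp add: less_p)
    then have "(\<lambda>i. w (i + p) * r ^ (i + p) / r ^ p) sums (D r / r ^ p)" by (rule sums_divide)
    then show ?thesis using r by (simp add: power_add)
  qed
  have "(h \<longlongrightarrow> w (0 + p)) (at 0)"
  proof (rule powser_limit_0[of "\<rho>/2"])
    fix x :: real assume "norm x < \<rho>/2"
    then have "summable (\<lambda>i. w (i + p) * x ^ i)"
      using powser_inside[OF sums_summable[OF s[of "\<rho>/2"]], of x] \<rho> by simp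
    then show "(\<lambda>i. w (i + p) * x ^ i) sums h x" unfolding h_def by (rule summable_sums)
  qed (use \<rho> in simp)
  then have "(h \<longlongrightarrow> w p) (at_right 0)" by (simp add: filterlim_at_split)
  then have lim: "((\<lambda>r. \<bar>h r\<bar>) \<longlongrightarrow> \<bar>w p\<bar>) (at_right 0)" by (rule tendsto_rabs)
  have D: "\<bar>D r\<bar> = \<bar>h r\<bar> * r ^ p" if "0 < r" "r < \<rho>" for r
  proof -
    have "h r = D r / r ^ p" unfolding h_def by (rule sums_unique[OF s[OF that], symmetric])
    then show ?thesis using that by simp
  qed
  have ev: "eventually (\<lambda>r. 0 < r \<and> r < \<rho>) (at_right 0)"
    unfolding eventually_at_right_field using \<rho> by auto
  have tz: "((\<lambda>r. r ^ m) \<longlongrightarrow> 0) (at_right (0::real))" if "0 < m" for m :: nat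
    using tendsto_power[OF tendsto_ident_at[of 0 "{0<..}::real set"], of m] that by simp
  consider "p < N" | "N < p" | "p = N" by linarith
  then show ?thesis
  proof cases
    case 1
    have "eventually (\<lambda>r. \<bar>h r\<bar> \<le> K * r ^ (N - p)) (at_right 0)"
      using ev
    proof eventually_elim
      case (elim r)
      then have "\<bar>h r\<bar> * r ^ p \<le> (K * r ^ (N - p)) * r ^ p"
        using bd(2)[of r] D[of r] 1 by (simp add: mult.assoc flip: power_add)
      then show ?case using elim by (simp add: mult_le_cancel_right_pos)
    qed
    from tendsto_le[OF _ tendsto_mult[OF tendsto_const tz] lim this] have "\<bar>w p\<bar> \<le> 0" using 1 by simp
    then show ?thesis using p by simp
  next
    case 2
    have "eventually (\<lambda>r. a \<le> \<bar>h r\<bar> * r ^ (p - N)) (at_right 0)"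
      using ev
    proof eventually_elim
      case (elim r)
      then have "a * r ^ N \<le> (\<bar>h r\<bar> * r ^ (p - N)) * r ^ N"
        using bd(1)[of r] D[of r] 2 by (simp add: mult.assoc flip: power_add)
      then show ?case using elim by (simp add: mult_le_cancel_right_pos)
    qed
    from tendsto_le[OF _ tendsto_mult[OF lim tz] tendsto_const this] have "a \<le> 0" using 2 by simp
    then show ?thesis using a by simp
  next
    case 3
    then show ?thesis using p less_p by auto
  qed
qed

context damping_pair
begin

text \<open>Near the origin \<open>\<phi>2 - \<phi>1\<close> is \<open>z ^ j\<close> times a
  function close to \<open>c\<close>; on the positive axis it thus lies between
  \<open>c / 2 * x ^ j\<close> and \<open>3 / 2 * c * x ^ j\<close>.\<close>

lemma half_return_diff_leading_pos:
  assumes S: "\<phi>1 has_fps_expansion S1" "\<phi>2 has_fps_expansion S2" "\<And>i. i < j \<Longrightarrow> fps_nth S1 i = fps_nth S2 i"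
    and c: "fps_nth S2 j - fps_nth S1 j = of_real c" "0 < c"
  shows "\<exists>R a K. 0 < R \<and> 0 < a \<and> (\<forall>r. 0 < r \<and> r < R \<longrightarrow>
    a * r ^ Suc j \<le> Re (D2.half_return (of_real r) - D1.half_return (of_real r)) \<and>
    Re (D2.half_return (of_real r) - D1.half_return (of_real r)) \<le> K * r ^ Suc j)"
proof -
  define G where "G = fps_shift j (S2 - S1)"
  have diff: "(\<lambda>z. \<phi>2 z - \<phi>1 z) has_fps_expansion S2 - S1" by (intro has_fps_expansion_diff S)
  then have rad: "0 < fps_conv_radius G" by (simp add: G_def has_fps_expansion_def)
  have G: "eval_fps G has_fps_expansion G" by (rule eval_fps_has_fps_expansion[OF rad])
  have XG: "S2 - S1 = fps_X ^ j * G"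
    unfolding G_def by (intro fps_ext) (auto simp: fps_X_power_mult_nth S(3))
  have "(\<lambda>z. z ^ j * eval_fps G z) has_fps_expansion fps_X ^ j * G"
    by (intro has_fps_expansion_mult has_fps_expansion_fps_X_power G)
  with diff have "eventually (\<lambda>z. \<phi>2 z - \<phi>1 z = z ^ j * eval_fps G z) (nhds 0)"
    unfolding XG has_fps_expansion_def by (auto elim: eventually_elim2)
  moreover have "eventually (\<lambda>z. dist (eval_fps G z) (of_real c) < c / 2) (nhds 0)"
  proof -
    have "isCont (eval_fps G) 0" by (rule has_fps_expansion_imp_continuous[OF G])
    then have "(eval_fps G \<longlongrightarrow> eval_fps G 0) (nhds 0)" by (simp add: isCont_def tendsto_at_iff_tendsto_nhds)
    moreover have "eval_fps G 0 = of_real c" using c by (simp add: eval_fps_at_0 G_def)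
    ultimately show ?thesis using c(2) by (auto dest: tendstoD[of _ _ _ "c / 2"])
  qed
  ultimately have "eventually (\<lambda>z. \<phi>2 z - \<phi>1 z = z ^ j * eval_fps G z \<and> dist (eval_fps G z) (of_real c) < c / 2) (nhds 0)"
    by (rule eventually_conj)
  then obtain e where e: "0 < e" "\<And>z. dist z 0 < e \<Longrightarrow> \<phi>2 z - \<phi>1 z = z ^ j * eval_fps G z \<and> dist (eval_fps G z) (of_real c) < c / 2"
    unfolding eventually_nhds_metric by blast
  have b: "c / 2 * x ^ j \<le> Re (\<phi>2 (of_real x) - \<phi>1 (of_real x))" "Re (\<phi>2 (of_real x) - \<phi>1 (of_real x)) \<le> 3 / 2 * c * x ^ j"
    if x: "0 \<le> x" "x < e" for x
  proof -
    have E: "\<phi>2 (of_real x) - \<phi>1 (of_real x) = of_real x ^ j * eval_fps G (of_real x)" "dist (eval_fps G (of_real x)) (of_real c) < c / 2"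
      using e(2)[of "of_real x"] x by auto
    have R: "Re (\<phi>2 (of_real x) - \<phi>1 (of_real x)) = Re (eval_fps G (of_real x)) * x ^ j"
      unfolding E(1) by (simp flip: of_real_power)
    have "\<bar>Re (eval_fps G (of_real x)) - c\<bar> \<le> c / 2"
      using abs_Re_le_cmod[of "eval_fps G (of_real x) - of_real c"] E(2) by (simp add: dist_norm)
    then have lohi: "c / 2 \<le> Re (eval_fps G (of_real x))" "Re (eval_fps G (of_real x)) \<le> 3 / 2 * c" unfolding abs_le_iff by linarith+
    show "c / 2 * x ^ j \<le> Re (\<phi>2 (of_real x) - \<phi>1 (of_real x))" "Re (\<phi>2 (of_real x) - \<phi>1 (of_real x)) \<le> 3 / 2 * c * x ^ j"
      unfolding R by (rule mult_right_mono[OF lohi(1)], use x in simp) (rule mult_right_mono[OF lohi(2)], use x in simp)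
  qed
  \<comment> \<open>Solutions started at \<open>r\<close> reach radius at most
    \<open>3/2 * r\<close>, which is below \<open>e\<close> for \<open>r < e/2\<close>.\<close>
  define R where "R = min (\<delta>/4) (e/2)"
  define M where "M = cos_sin_moment j"
  show ?thesis
  proof (intro exI conjI allI impI)
    show "0 < R" using e D1.delta_pos by (simp add: R_def)
    show "0 < c / 2 * (1/2) ^ Suc j * (M / 2)" using c cos_sin_moment_pos[of j] by (simp add: M_def)
    fix r assume "0 < r \<and> r < R"
    then have r: "0 < r" "r < \<delta>/4" "3/2 * r < e" by (auto simp: R_def)
    have 1: "c / 2 * (r/2) ^ Suc j * (M / 2) \<le> Re (D2.half_return (of_real r) - D1.half_return (of_real r))"
      unfolding M_def by (rule half_return_diff_real_bounds(1)[OF r(1,2), where \<beta> = "3/2 * c"]) (use r c b in auto)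
    have 2: "Re (D2.half_return (of_real r) - D1.half_return (of_real r)) \<le> 3/2 * c * (3/2 * r) ^ Suc j * (2 * M)"
      unfolding M_def by (rule half_return_diff_real_bounds(2)[OF r(1,2), where \<alpha> = "c / 2"]) (use r c b in auto)
    show "c / 2 * (1/2) ^ Suc j * (M / 2) * r ^ Suc j \<le> Re (D2.half_return (of_real r) - D1.half_return (of_real r))"
      using 1 by (simp add: power_divide mult_ac)
    show "Re (D2.half_return (of_real r) - D1.half_return (of_real r)) \<le> 3/2 * c * (3/2) ^ Suc j * (2 * M) * r ^ Suc j"
      using 2 by (simp add: power_mult_distrib power_divide mult_ac)
  qed
qed

lemma half_return_diff_leading:
  assumes S: "\<phi>1 has_fps_expansion S1" "\<phi>2 has_fps_expansion S2" "\<And>i. i < j \<Longrightarrow> fps_nth S1 i = fps_nth S2 i"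
    and c: "fps_nth S2 j - fps_nth S1 j = of_real c" "c \<noteq> 0"
  obtains R a K where "0 < R" "0 < a"
    "\<And>r. 0 < r \<Longrightarrow> r < R \<Longrightarrow> a * r ^ Suc j \<le> sgn c * Re (D2.half_return (of_real r) - D1.half_return (of_real r))"
    "\<And>r. 0 < r \<Longrightarrow> r < R \<Longrightarrow> sgn c * Re (D2.half_return (of_real r) - D1.half_return (of_real r)) \<le> K * r ^ Suc j"
proof (cases "0 < c")
  case True
  with half_return_diff_leading_pos[OF S c(1)] that show thesis by (auto simp: sgn_if)
next
  case False
  \<comment> \<open>For negative \<open>c\<close> the two equations exchange their roles.\<close>
  interpret swap: damping_pair \<phi>2 \<phi>1 \<delta> ..
  have "fps_nth S1 j - fps_nth S2 j = of_real (- c)" using c by (simp add: algebra_simps)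
  from swap.half_return_diff_leading_pos[OF S(2,1) _ this] S(3) False c(2) that show thesis by (force simp: sgn_if)
qed

end

lemma fps_const_X_mult_nth: "fps_nth (fps_const c * fps_X * (F :: 'a::comm_ring_1 fps)) k = (if k = 0 then 0 else c * fps_nth F (k - 1))"
  unfolding mult.assoc[of "fps_const c"] fps_mult_left_const_nth fps_X_mult_nth by simp

section \<open>Displacement coefficients and focal values\<close>

context switching_pair
begin

abbreviation "return_gap x \<equiv> P2 x - P1 x"

lemma return_gap_holomorphic: "(\<lambda>x. return_gap x) holomorphic_on ball 0 (\<delta>/4)"
  by (intro holomorphic_on_diff pair.D1.half_return_holomorphic pair.D2.half_return_holomorphic)

lemma return_gap_0: "return_gap 0 = 0"
  by (simp add: pair.D1.half_return_0 pair.D2.half_return_0)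

lemma displacement_taylor:
  assumes a: "0 \<le> a" "a < \<delta>/4"
  shows "displacement_series \<theta> a (\<lambda>k. Re ((deriv ^^ k) (\<lambda>x. return_gap x) (of_real a) / fact k))"
  unfolding displacement_series_def
proof (intro exI[of _ "\<delta>/4 - a"] conjI allI impI)
  show "0 < \<delta>/4 - a" using a by simp
  fix r :: real assume "0 < r" and ra: "\<bar>r - a\<bar> < \<delta>/4 - a"
  then have r: "0 < r" "r < \<delta>/4" by auto
  show "r \<in> displacement_domain \<theta>" by (rule displacement_eq(1)[OF r])
  have "ball (complex_of_real a) (\<delta>/4 - a) \<subseteq> ball 0 (\<delta>/4)"
    using a by (simp add: ball_subset_ball_iff)
  then have "(\<lambda>x. return_gap x) holomorphic_on ball (of_real a) (\<delta>/4 - a)"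
    by (rule holomorphic_on_subset[OF return_gap_holomorphic])
  moreover have "of_real r \<in> ball (complex_of_real a) (\<delta>/4 - a)"
    using ra by (simp add: dist_norm abs_minus_commute flip: of_real_diff)
  ultimately have "(\<lambda>k. (deriv ^^ k) (\<lambda>x. return_gap x) (of_real a) / fact k * (of_real r - of_real a) ^ k) sums return_gap (of_real r)"
    by (rule holomorphic_power_series)
  from sums_Re[OF this] have "(\<lambda>k. Re ((deriv ^^ k) (\<lambda>x. return_gap x) (of_real a) / fact k * (of_real r - of_real a) ^ k)) sums displacement \<theta> r"
    unfolding displacement_eq(2)[OF r] .
  moreover have "Re (z * (of_real r - of_real a) ^ k) = Re z * (r - a) ^ k" for z k
    by (simp flip: of_real_diff of_real_power)
  ultimately show "(\<lambda>k. Re ((deriv ^^ k) (\<lambda>x. return_gap x) (of_real a) / fact k) * (r - a) ^ k) sums displacement \<theta> r"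
    by (simp only:)
qed

text \<open>One-sided uniqueness of power series justifies the definite description in
  \<open>displacement_coeff\<close> and identifies it with the Taylor coefficients of a holomorphic
  function.\<close>

lemma displacement_coeff_series:
  "displacement_coeff \<theta> k = Re ((deriv ^^ k) (\<lambda>x. return_gap x) 0 / fact k)"
  "displacement_series \<theta> 0 (displacement_coeff \<theta>)"
proof -
  define w where "w k = Re ((deriv ^^ k) (\<lambda>x. return_gap x) 0 / fact k)" for k
  have w: "w 0 = 0 \<and> displacement_series \<theta> 0 w"
    using displacement_taylor[of 0] pair.D1.delta_pos return_gap_0 by (simp add: w_def[abs_def])
  have "w' = w" if w': "displacement_series \<theta> 0 w'" for w'
  proof
    fix k
    obtain \<rho> \<rho>' where \<rho>: "0 < \<rho>" "\<And>r. 0 < r \<Longrightarrow> r < \<rho> \<Longrightarrow> (\<lambda>k. w k * r ^ k) sums displacement \<theta> r"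
      "0 < \<rho>'" "\<And>r. 0 < r \<Longrightarrow> r < \<rho>' \<Longrightarrow> (\<lambda>k. w' k * r ^ k) sums displacement \<theta> r"
      using conjunct2[OF w] w' unfolding displacement_series_def by auto
    have "w' k - w k = 0"
    proof (rule powser_zero_right[of "min \<rho> \<rho>'"])
      fix r assume "0 < r" "r < min \<rho> \<rho>'"
      then show "(\<lambda>k. (w' k - w k) * r ^ k) sums 0"
        using sums_diff[OF \<rho>(4) \<rho>(2), of r r] by (simp add: left_diff_distrib)
    qed (use \<rho> in simp)
    then show "w' k = w k" by simp
  qed
  then have "displacement_coeff \<theta> = w" unfolding displacement_coeff_def using w by (intro the_equality) auto
  then show "displacement_coeff \<theta> k = Re ((deriv ^^ k) (\<lambda>x. return_gap x) 0 / fact k)"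
    "displacement_series \<theta> 0 (displacement_coeff \<theta>)" using w by (simp_all add: w_def)
qed

text \<open>The value \<open>c = 0\<close> is allowed, since the focal values are computed first and
  compared with zero afterwards. A nonzero \<open>c\<close> at order \<open>j\<close> makes
  \<open>Suc j\<close> the order of the displacement and fixes its sign for small radii.\<close>

definition leading_term :: "nat \<Rightarrow> real \<Rightarrow> bool" where
  "leading_term j c \<longleftrightarrow> (\<exists>S1 S2. up.symbol d1 l1 m1 n1 has_fps_expansion S1 \<and> lo.symbol (- d2) (- l2) m2 (- n2) has_fps_expansion S2 \<and>
     (\<forall>i<j. fps_nth S1 i = fps_nth S2 i) \<and> fps_nth S2 j - fps_nth S1 j = of_real c)"

lemma leading_termE:
  assumes "leading_term j c" "c \<noteq> 0"
  obtains R a K where "0 < R" "R < \<delta>/4" "0 < a"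
    "\<And>r. 0 < r \<Longrightarrow> r < R \<Longrightarrow> a * r ^ Suc j \<le> sgn c * Re (return_gap (of_real r))"
    "\<And>r. 0 < r \<Longrightarrow> r < R \<Longrightarrow> sgn c * Re (return_gap (of_real r)) \<le> K * r ^ Suc j"
proof -
  obtain S1 S2 where S: "up.symbol d1 l1 m1 n1 has_fps_expansion S1" "lo.symbol (- d2) (- l2) m2 (- n2) has_fps_expansion S2"
     "\<And>i. i < j \<Longrightarrow> fps_nth S1 i = fps_nth S2 i" "fps_nth S2 j - fps_nth S1 j = of_real c"
    using assms(1) by (auto simp: leading_term_def)
  obtain R a K where "0 < R" "0 < a"
    "\<And>r. 0 < r \<Longrightarrow> r < R \<Longrightarrow> a * r ^ Suc j \<le> sgn c * Re (return_gap (of_real r))"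
    "\<And>r. 0 < r \<Longrightarrow> r < R \<Longrightarrow> sgn c * Re (return_gap (of_real r)) \<le> K * r ^ Suc j"
    using pair.half_return_diff_leading[OF S assms(2)] by blast
  then show thesis using pair.D1.delta_pos by (intro that[of "min R (\<delta>/8)" a K]) auto
qed

lemma displacement_coeff_order:
  assumes "leading_term j c" "c \<noteq> 0"
  shows "(\<forall>k\<le>j. displacement_coeff \<theta> k = 0) \<and> displacement_coeff \<theta> (Suc j) \<noteq> 0"
proof -
  obtain \<rho> where \<rho>: "0 < \<rho>" "\<And>r. 0 < r \<Longrightarrow> r < \<rho> \<Longrightarrow> (\<lambda>k. displacement_coeff \<theta> k * r ^ k) sums displacement \<theta> r"
    using displacement_coeff_series(2) unfolding displacement_series_def by auto
  obtain R a K where R: "0 < R" "R < \<delta>/4" "0 < a"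
    "\<And>r. 0 < r \<Longrightarrow> r < R \<Longrightarrow> a * r ^ Suc j \<le> sgn c * Re (return_gap (of_real r))"
    "\<And>r. 0 < r \<Longrightarrow> r < R \<Longrightarrow> sgn c * Re (return_gap (of_real r)) \<le> K * r ^ Suc j"
    using leading_termE[OF assms] by blast
  have abs: "\<bar>displacement \<theta> r\<bar> = sgn c * Re (return_gap (of_real r))" if r: "0 < r" "r < R" for r
  proof -
    have "0 \<le> a * r ^ Suc j" using R(3) r by simp
    then have "0 \<le> sgn c * Re (return_gap (of_real r))" using R(4)[OF r] by linarith
    then have "\<bar>sgn c * Re (return_gap (of_real r))\<bar> = sgn c * Re (return_gap (of_real r))" by simp
    then show ?thesis using displacement_eq(2)[of r] r R(2) assms(2) by (simp add: abs_mult abs_sgn_eq)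
  qed
  have "(\<forall>k<Suc j. displacement_coeff \<theta> k = 0) \<and> displacement_coeff \<theta> (Suc j) \<noteq> 0"
    by (rule powser_order[where \<rho> = "min \<rho> R" and a = a and K = K and D = "displacement \<theta>"])
       (use \<rho> R abs in auto)
  then show ?thesis by (simp add: less_Suc_eq_le)
qed

lemma displacement_coeff_center:
  assumes S: "up.symbol d1 l1 m1 n1 has_fps_expansion S" "lo.symbol (- d2) (- l2) m2 (- n2) has_fps_expansion S"
  shows "displacement_coeff \<theta> k = 0"
proof -
  obtain \<rho> where \<rho>: "0 < \<rho>" "\<And>r. 0 < r \<Longrightarrow> r < \<rho> \<Longrightarrow> (\<lambda>k. displacement_coeff \<theta> k * r ^ k) sums displacement \<theta> r"
    using displacement_coeff_series(2) unfolding displacement_series_def by auto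
  have "eventually (\<lambda>v. up.symbol d1 l1 m1 n1 v = lo.symbol (- d2) (- l2) m2 (- n2) v) (nhds 0)"
    using S unfolding has_fps_expansion_def by (auto elim: eventually_elim2)
  then obtain e where e: "0 < e" "\<And>v. norm v < e \<Longrightarrow> up.symbol d1 l1 m1 n1 v = lo.symbol (- d2) (- l2) m2 (- n2) v"
    unfolding eventually_nhds_metric by auto
  have "displacement \<theta> r = 0" if "0 < r" "r < \<delta>/4" "r < e/2" for r
    using pair.half_return_cong[where x = "of_real r", OF e(2)] displacement_eq(2)[of r] that by simp
  then show ?thesis
    using \<rho> e(1) pair.D1.delta_pos
    by (intro powser_zero_right[of "min \<rho> (min (\<delta>/4) (e/2))"]) force+
qed

text \<open>The damping takes the value \<open>d1\<close> at the origin above and, because of the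
  time reversal, \<open>- d2\<close> below.\<close>

lemma leading_term_0: "leading_term 0 (- d2 - d1)"
proof -
  have z: "(0::complex) \<in> ball 0 (r1/2)" "(0::complex) \<in> ball 0 (r2/2)" using up.r0 lo.r0 by auto
  let ?S1 = "fps_expansion (up.symbol d1 l1 m1 n1) 0" and ?S2 = "fps_expansion (lo.symbol (- d2) (- l2) m2 (- n2)) 0"
  have "up.symbol d1 l1 m1 n1 has_fps_expansion ?S1"
    by (rule analytic_at_imp_has_fps_expansion_0[OF holomorphic_on_imp_analytic_at[OF up.holomorphic_symbol[OF N1] open_ball z(1)]])
  moreover have "lo.symbol (- d2) (- l2) m2 (- n2) has_fps_expansion ?S2"
    by (rule analytic_at_imp_has_fps_expansion_0[OF holomorphic_on_imp_analytic_at[OF lo.holomorphic_symbol[OF N2] open_ball z(2)]])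
  moreover have "fps_nth ?S2 0 - fps_nth ?S1 0 = of_real (- d2 - d1)"
    by (simp add: fps_expansion_def up.symbol_at_0[OF N1] lo.symbol_at_0[OF N2])
  ultimately show ?thesis unfolding leading_term_def by blast
qed

context
  assumes d: "d1 = 0" "d2 = 0"
begin

lemma symbol_pair_fps:
  obtains q1 F1 q2 F2 where "lienard_fps 1 (of_real l1) (of_real n1) q1 F1" "lienard_fps (- 1) (- of_real l2) (- of_real n2) q2 F2"
    "fps_nth F1 0 = 1" "fps_nth F2 0 = 1"
    "up.symbol d1 l1 m1 n1 has_fps_expansion fps_const (of_real m1) * fps_X * F1"
    "lo.symbol (- d2) (- l2) m2 (- n2) has_fps_expansion fps_const (of_real m2) * fps_X * F2"
proof -
  obtain q1 F1 where 1: "lienard_fps (of_real 1) (of_real l1) (of_real n1) q1 F1" "\<And>m. up.symbol 0 l1 m n1 has_fps_expansion fps_const (of_real m) * fps_X * F1"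
    using up.symbol_fps[OF N1] by blast
  obtain q2 F2 where 2: "lienard_fps (of_real (- 1)) (of_real (- l2)) (of_real (- n2)) q2 F2" "\<And>m. lo.symbol 0 (- l2) m (- n2) has_fps_expansion fps_const (of_real m) * fps_X * F2"
    using lo.symbol_fps[OF N2] by blast
  show thesis
    using 1 2 d by (intro that[of q1 F1 q2 F2]) (auto simp: lienard_fps_def)
qed

lemma leading_term_1: "leading_term 1 (m2 - m1)"
proof -
  obtain q1 F1 q2 F2 where S: "fps_nth F1 0 = 1" "fps_nth F2 0 = 1"
    "up.symbol d1 l1 m1 n1 has_fps_expansion fps_const (of_real m1) * fps_X * F1"
    "lo.symbol (- d2) (- l2) m2 (- n2) has_fps_expansion fps_const (of_real m2) * fps_X * F2"
    by (rule symbol_pair_fps) blast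
  show ?thesis unfolding leading_term_def
    by (rule exI conjI S(3,4))+ (use S(1,2) in \<open>auto simp: fps_const_X_mult_nth\<close>)
qed

context
  assumes m: "m1 = m2"
begin

lemma leading_term_2: "leading_term 2 (- m2 * (l1 + n1 + l2 + n2))"
proof -
  obtain q1 F1 q2 F2 where S: "lienard_fps 1 (of_real l1) (of_real n1) q1 F1" "lienard_fps (- 1) (- of_real l2) (- of_real n2) q2 F2"
    "fps_nth F1 0 = 1" "fps_nth F2 0 = 1"
    "up.symbol d1 l1 m1 n1 has_fps_expansion fps_const (of_real m1) * fps_X * F1"
    "lo.symbol (- d2) (- l2) m2 (- n2) has_fps_expansion fps_const (of_real m2) * fps_X * F2"
    by (rule symbol_pair_fps)
  have "fps_nth (fps_const (of_real m2) * fps_X * F2) 2 - fps_nth (fps_const (of_real m1) * fps_X * F1) 2 = of_real m2 * (fps_nth F2 1 - fps_nth F1 1)"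
    unfolding fps_const_X_mult_nth m by (simp add: right_diff_distrib)
  also have "\<dots> = of_real (- m2 * (l1 + n1 + l2 + n2))" unfolding lienard_fps_diff(1)[OF S(1,2)] by (simp add: algebra_simps)
  finally show ?thesis unfolding leading_term_def using S(3-6)
    by (auto simp: m fps_const_X_mult_nth less_Suc_eq numeral_2_eq_2 intro!: exI conjI)
qed

context
  assumes s: "l1 + n1 + l2 + n2 = 0"
begin

lemma sum_zero: "complex_of_real l1 + of_real n1 + of_real l2 + of_real n2 = 0"
  using s by (simp flip: of_real_add)

lemma leading_term_3: "leading_term 3 (m2 * (n1 + n2 - 1) * (2 * l1 - n1 + 3 * n2) / 6)"
proof -
  obtain q1 F1 q2 F2 where S: "lienard_fps 1 (of_real l1) (of_real n1) q1 F1" "lienard_fps (- 1) (- of_real l2) (- of_real n2) q2 F2"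
    "fps_nth F1 0 = 1" "fps_nth F2 0 = 1"
    "up.symbol d1 l1 m1 n1 has_fps_expansion fps_const (of_real m1) * fps_X * F1"
    "lo.symbol (- d2) (- l2) m2 (- n2) has_fps_expansion fps_const (of_real m2) * fps_X * F2"
    by (rule symbol_pair_fps)
  have 1: "fps_nth F2 1 = fps_nth F1 1" using lienard_fps_diff(1)[OF S(1,2)] sum_zero by simp
  have "fps_nth (fps_const (of_real m2) * fps_X * F2) 3 - fps_nth (fps_const (of_real m1) * fps_X * F1) 3 = of_real m2 * (6 * (fps_nth F2 2 - fps_nth F1 2)) / 6"
    unfolding fps_const_X_mult_nth m by (simp add: right_diff_distrib)
  also have "\<dots> = of_real (m2 * (n1 + n2 - 1) * (2 * l1 - n1 + 3 * n2) / 6)" unfolding lienard_fps_diff(2)[OF S(1,2) sum_zero] by simp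
  finally show ?thesis unfolding leading_term_def using S(3-6) 1
    by (auto simp: m fps_const_X_mult_nth less_Suc_eq numeral_3_eq_3 intro!: exI conjI)
qed

lemma leading_term_4:
  assumes t: "2 * l1 - n1 + 3 * n2 = 0"
  shows "leading_term 4 (m2 * (n1 - n2) * (n1 + n2 - 1) * (n2 - n1) / 24)"
proof -
  obtain q1 F1 q2 F2 where S: "lienard_fps 1 (of_real l1) (of_real n1) q1 F1" "lienard_fps (- 1) (- of_real l2) (- of_real n2) q2 F2"
    "fps_nth F1 0 = 1" "fps_nth F2 0 = 1"
    "up.symbol d1 l1 m1 n1 has_fps_expansion fps_const (of_real m1) * fps_X * F1"
    "lo.symbol (- d2) (- l2) m2 (- n2) has_fps_expansion fps_const (of_real m2) * fps_X * F2"
    by (rule symbol_pair_fps)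
  have t': "2 * complex_of_real l1 - of_real n1 + 3 * of_real n2 = 0"
    using arg_cong[OF t, of complex_of_real] by simp
  have 1: "fps_nth F2 1 = fps_nth F1 1" using lienard_fps_diff(1)[OF S(1,2)] sum_zero by simp
  have "6 * (fps_nth F2 2 - fps_nth F1 2) = 0" using lienard_fps_diff(2)[OF S(1,2) sum_zero] t' by simp
  then have 2: "fps_nth F2 2 = fps_nth F1 2" by simp
  have "fps_nth (fps_const (of_real m2) * fps_X * F2) 4 - fps_nth (fps_const (of_real m1) * fps_X * F1) 4 = of_real m2 * (24 * (fps_nth F2 3 - fps_nth F1 3)) / 24"
    unfolding fps_const_X_mult_nth m by (simp add: right_diff_distrib)
  also have "\<dots> = of_real (m2 * (n1 - n2) * (n1 + n2 - 1) * (n2 - n1) / 24)" unfolding lienard_fps_diff(3)[OF S(1,2) sum_zero t'] by simp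
  finally have e: "fps_nth (fps_const (of_real m2) * fps_X * F2) 4 - fps_nth (fps_const (of_real m1) * fps_X * F1) 4 = of_real (m2 * (n1 - n2) * (n1 + n2 - 1) * (n2 - n1) / 24)" .
  have "fps_nth (fps_const (of_real m1) * fps_X * F1) i = fps_nth (fps_const (of_real m2) * fps_X * F2) i" if "i < 4" for i
  proof -
    have "i = 0 \<or> i = 1 \<or> i = 2 \<or> i = 3" using that by linarith
    then show ?thesis using S(3,4) 1 2 by (auto simp: m fps_const_X_mult_nth)
  qed
  then show ?thesis unfolding leading_term_def using S(5,6) e by blast
qed

text \<open>In the three cases the dampings vanish, are related by
  \<open>y \<mapsto> y / (1 - y)\<close>, or belong to the integrable case \<open>l = - n\<close>.
  Each time both have the same series, so the displacement is zero near the origin.\<close>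

lemma displacement_coeff_center_family:
  assumes "m2 = 0 \<or> n1 + n2 = 1 \<or> (n1 = n2 \<and> 2 * l1 - n1 + 3 * n2 = 0)"
  shows "displacement_coeff \<theta> k = 0"
proof -
  obtain q1 F1 q2 F2 where S: "lienard_fps 1 (of_real l1) (of_real n1) q1 F1" "lienard_fps (- 1) (- of_real l2) (- of_real n2) q2 F2"
    "up.symbol d1 l1 m1 n1 has_fps_expansion fps_const (of_real m1) * fps_X * F1"
    "lo.symbol (- d2) (- l2) m2 (- n2) has_fps_expansion fps_const (of_real m2) * fps_X * F2"
    by (rule symbol_pair_fps)
  from assms consider "m2 = 0" | "n1 + n2 = 1" | "n1 = n2" "2 * l1 - n1 + 3 * n2 = 0" by blast
  then have "fps_const (of_real m1) * fps_X * F1 = fps_const (of_real m2) * fps_X * F2"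
  proof cases
    case 1
    then show ?thesis by (simp add: m)
  next
    case 2
    then have "- l2 = 1 + l1" "- n2 = n1 - 1" using s by auto
    then have "- complex_of_real l2 = 1 + of_real l1" "- complex_of_real n2 = of_real n1 - 1"
      by (simp_all flip: of_real_minus)
    then have "F1 = F2" using lienard_fps_center2[OF S(1), of q2 F2] S(2) by simp
    then show ?thesis by (simp add: m)
  next
    case 3
    then have e: "l1 = - n1" "l2 = - n1" "n2 = n1" using s by auto
    have "F1 = F2" using lienard_fps_center1[of 1 "of_real n1" q1 F1 "- 1" "- of_real n1" q2 F2] S(1,2)
      by (simp add: e algebra_simps)
    then show ?thesis by (simp add: m)
  qed
  then show ?thesis using S(3,4) by (intro displacement_coeff_center) (simp_all only:)
qed

end

end

text \<open>Every leading term of order \<open>j < 5\<close> must vanish, since otherwise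
  coefficient \<open>Suc j\<close> would not. Solving these conditions leaves only the families on
  which both dampings coincide.\<close>

lemma weak_focus_order_le_5:
  assumes "\<And>k. k \<le> 5 \<Longrightarrow> displacement_coeff \<theta> k = 0"
  shows "displacement_coeff \<theta> k = 0"
proof -
  have z: "c = 0" if "leading_term j c" "j < 5" for j c
    using displacement_coeff_order[OF that(1)] assms[of "Suc j"] that(2) by auto
  have m: "m1 = m2" using z[OF leading_term_1] by simp
  have m0: "displacement_coeff \<theta> k = 0" if "m2 = 0"
  proof -
    obtain q1 F1 q2 F2 where "up.symbol d1 l1 m1 n1 has_fps_expansion fps_const (of_real m1) * fps_X * F1"
      "lo.symbol (- d2) (- l2) m2 (- n2) has_fps_expansion fps_const (of_real m2) * fps_X * F2"
      by (rule symbol_pair_fps) blast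
    then show ?thesis using that m by (intro displacement_coeff_center[of 0]) auto
  qed
  show ?thesis
  proof (cases "m2 = 0")
    case False
    then have s: "l1 + n1 + l2 + n2 = 0" using z[OF leading_term_2[OF m]] by simp
    then have "(n1 + n2 - 1) * (2 * l1 - n1 + 3 * n2) = 0" using z[OF leading_term_3[OF m s]] False by simp
    moreover have "(n1 - n2) * (n1 + n2 - 1) * (n2 - n1) = 0" if "2 * l1 - n1 + 3 * n2 = 0"
      using z[OF leading_term_4[OF m s that]] False by simp
    ultimately show ?thesis by (intro displacement_coeff_center_family[OF m s]) auto
  qed (rule m0)
qed

end

end

section \<open>Continuity of the damping in the parameters\<close>

context lienard_normal_form
begin

text \<open>Uniform continuity on a compact product makes the estimate uniform over the disc of
  \<open>v\<close>, as the comparison of half-return maps requires.\<close>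

lemma symbol_close:
  assumes ln: "(l, n) \<in> N" and \<epsilon>: "0 < \<epsilon>"
  obtains \<eta> where "0 < \<eta>" "\<And>d' l' m' n' v. dist (d', l', m', n') (d, l, m, n) < \<eta> \<Longrightarrow> (l', n') \<in> N \<Longrightarrow> norm v \<le> r0/2 \<Longrightarrow>
    norm (symbol d' l' m' n' v - symbol d l m n v) \<le> \<epsilon>"
proof -
  define q where "q p = (fst (snd p), snd (snd (snd p)))" for p :: "real \<times> real \<times> real \<times> real"
  define f where "f = (\<lambda>(p, v). symbol (fst p) (fst (snd p)) (fst (snd (snd p))) (snd (snd (snd p))) v)"
  define K where "K = (q -` N \<inter> cball (d, l, m, n) 1) \<times> cball (0::complex) (r0/2)"
  have "closed (q -` N)"
    by (rule continuous_closed_vimage[OF compact_imp_closed[OF N]]) (unfold q_def[abs_def], intro continuous_intros)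
  then have K: "compact K" unfolding K_def
    by (intro compact_Times closed_Int_compact compact_cball)
  have "continuous_on K f" unfolding f_def
    by (rule continuous_on_subset[OF continuous_on_symbol]) (auto simp: K_def q_def)
  then have "uniformly_continuous_on K f" using K by (rule compact_uniformly_continuous)
  then obtain \<eta> where \<eta>: "0 < \<eta>" "\<And>x y. x \<in> K \<Longrightarrow> y \<in> K \<Longrightarrow> dist y x < \<eta> \<Longrightarrow> dist (f y) (f x) < \<epsilon>"
    unfolding uniformly_continuous_on_def using \<epsilon> by meson
  show thesis
  proof (rule that[of "min \<eta> 1"])
    fix d' l' m' n' v assume d: "dist (d', l', m', n') (d, l, m, n) < min \<eta> 1" and l': "(l', n') \<in> N" and v: "norm (v::complex) \<le> r0/2"
    have "((d', l', m', n'), v) \<in> K" "((d, l, m, n), v) \<in> K"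
      using d l' v ln by (auto simp: K_def q_def dist_commute)
    moreover have "dist ((d', l', m', n'), v) ((d, l, m, n), v) < \<eta>"
      using d by (simp add: dist_Pair_Pair[of "(d', l', m', n')"])
    ultimately have "dist (f ((d', l', m', n'), v)) (f ((d, l, m, n), v)) < \<epsilon>" using \<eta>(2) by blast
    then show "norm (symbol d' l' m' n' v - symbol d l m n v) \<le> \<epsilon>" by (simp add: f_def dist_norm)
  qed (use \<eta> in simp)
qed

text \<open>With zero trace the damping vanishes at the origin and is below \<open>1/80\<close> on a
  small disc; nearby parameters change it by at most \<open>1/80\<close>. One radius thus serves all
  of them.\<close>

lemma damping_near:
  assumes ln: "(l, n) \<in> N"
  obtains \<eta> \<delta> where "0 < \<eta>" "0 < \<delta>"
    "\<And>d' l' m' n' \<delta>'. dist (d', l', m', n') (0, l, m, n) < \<eta> \<Longrightarrow> (l', n') \<in> N \<Longrightarrow> 0 < \<delta>' \<Longrightarrow> \<delta>' \<le> \<delta> \<Longrightarrow> \<delta>' \<le> r0/2 \<Longrightarrow>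
      damping (symbol d' l' m' n') \<delta>'"
proof -
  obtain \<eta> where \<eta>: "0 < \<eta>" "\<And>d' l' m' n' v. dist (d', l', m', n') (0, l, m, n) < \<eta> \<Longrightarrow> (l', n') \<in> N \<Longrightarrow> norm v \<le> r0/2 \<Longrightarrow>
    norm (symbol d' l' m' n' v - symbol 0 l m n v) \<le> 1/80"
    using symbol_close[OF ln, of "1/80" 0 m] by auto
  have "isCont (symbol 0 l m n) 0"
    using holomorphic_on_imp_continuous_on[OF holomorphic_symbol[OF ln]] r0 by (auto simp: continuous_on_eq_continuous_at)
  then obtain \<delta> where \<delta>: "0 < \<delta>" "\<And>v. norm v < \<delta> \<Longrightarrow> norm (symbol 0 l m n v) < 1/80"
    unfolding continuous_at_eps_delta using symbol_at_0[OF ln, of 0 m]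
    by (metis dist_0_norm dist_commute of_real_0 zero_less_divide_iff zero_less_numeral zero_less_one)
  show thesis
  proof (rule that[OF \<eta>(1) \<delta>(1)])
    fix d' l' m' n' \<delta>' :: real assume *: "dist (d', l', m', n') (0, l, m, n) < \<eta>" "(l', n') \<in> N" "0 < \<delta>'" "\<delta>' \<le> \<delta>" "\<delta>' \<le> r0/2"
    show "damping (symbol d' l' m' n') \<delta>'"
    proof (rule damping_symbol[OF *(2,3,5)])
      fix v :: complex assume v: "norm v < \<delta>'"
      then have "norm (symbol d' l' m' n' v - symbol 0 l m n v) \<le> 1/80" using \<eta>(2)[OF *(1,2), of v] * by auto
      moreover have "norm (symbol 0 l m n v) < 1/80" using \<delta>(2)[of v] v * by auto
      ultimately show "norm (symbol d' l' m' n' v) \<le> 1/40"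
        using norm_triangle_sub[of "symbol d' l' m' n' v" "symbol 0 l m n v"] by linarith
    qed
  qed
qed

end

section \<open>Perturbation of the parameters\<close>

text \<open>The parameters of each half-plane in the normalization of \<open>half_field\<close>,
  hence the signs in \<open>lower_par\<close>.\<close>

definition upper_par :: "params \<Rightarrow> real \<times> real \<times> real \<times> real" where
  "upper_par \<theta> = (fst \<theta>, fst (snd (snd \<theta>)), fst (snd (snd (snd (snd \<theta>)))), fst (snd (snd (snd (snd (snd (snd \<theta>)))))))"

definition lower_par :: "params \<Rightarrow> real \<times> real \<times> real \<times> real" where
  "lower_par \<theta> = (- fst (snd \<theta>), - fst (snd (snd (snd \<theta>))), fst (snd (snd (snd (snd (snd \<theta>))))), - snd (snd (snd (snd (snd (snd (snd \<theta>)))))))"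

lemma par_simps [simp]:
  "upper_par (d1, d2, l1, l2, m1, m2, n1, n2) = (d1, l1, m1, n1)"
  "lower_par (d1, d2, l1, l2, m1, m2, n1, n2) = (- d2, - l2, m2, - n2)"
  by (simp_all add: upper_par_def lower_par_def)

lemma continuous_par: "continuous_on UNIV upper_par" "continuous_on UNIV lower_par"
  unfolding upper_par_def lower_par_def by (intro continuous_intros)+

lemma open_par_ball: "open {\<theta>. dist (upper_par \<theta>) a < e \<and> dist (lower_par \<theta>) c < e}"
  by (intro open_Collect_conj open_Collect_less continuous_intros continuous_par)

text \<open>Because \<open>\<delta>\<close> is common to all parameters in \<open>V\<close>, their
  displacement maps can be compared on one fixed disc.\<close>

locale switching_family =
  up: lienard_normal_form 1 r1 N1 + lo: lienard_normal_form "-1" r2 N2 for r1 N1 r2 N2 +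
  fixes \<delta> :: real and V :: "params set"
  assumes open_V: "open V"
    and pair: "(d1, d2, l1, l2, m1, m2, n1, n2) \<in> V \<Longrightarrow> switching_pair r1 N1 r2 N2 d1 d2 l1 l2 m1 m2 n1 n2 \<delta>"

lemma dist_par_component:
  fixes d l m n :: real
  assumes "dist (d', l', m', n') (d, l, m, n) < e"
  shows "l' \<in> cball l e" "n' \<in> cball n e"
proof -
  have "dist l' l \<le> dist (d', l', m', n') (d, l, m, n)" "dist n' n \<le> dist (d', l', m', n') (d, l, m, n)"
    using dist_fst_le[of "snd (d', l', m', n')" "snd (d, l, m, n)"] dist_snd_le[of "(d', l', m', n')" "(d, l, m, n)"]
      dist_snd_le[of "snd (d', l', m', n')" "snd (d, l, m, n)"] dist_snd_le[of "snd (snd (d', l', m', n'))" "snd (snd (d, l, m, n))"]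
    by simp_all
  then show "l' \<in> cball l e" "n' \<in> cball n e" using assms by (simp_all add: dist_commute)
qed

lemma switching_family_exists:
  assumes "zero_traces \<theta>"
  obtains r1 N1 r2 N2 \<delta> V where "switching_family r1 N1 r2 N2 \<delta> V" "\<theta> \<in> V"
proof -
  obtain l1 l2 m1 m2 n1 n2 where \<theta>: "\<theta> = (0, 0, l1, l2, m1, m2, n1, n2)"
    using assms by (metis surj_pair zero_traces.simps)
  obtain e1 r1 where e1: "0 < e1" "lienard_normal_form 1 r1 (cball l1 e1 \<times> cball n1 e1)"
    using lienard_normal_form_exists[of 1 l1 n1] by auto
  obtain e2 r2 where e2: "0 < e2" "lienard_normal_form (- 1) r2 (cball (- l2) e2 \<times> cball (- n2) e2)"
    using lienard_normal_form_exists[of "- 1" "- l2" "- n2"] by auto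
  let ?N1 = "cball l1 e1 \<times> cball n1 e1" and ?N2 = "cball (- l2) e2 \<times> cball (- n2) e2"
  interpret up: lienard_normal_form 1 r1 ?N1 by fact
  interpret lo: lienard_normal_form "- 1" r2 ?N2 by fact
  obtain \<eta>1 \<delta>1 where 1: "0 < \<eta>1" "0 < \<delta>1"
    "\<And>d' l' m' n' \<delta>'. dist (d', l', m', n') (0, l1, m1, n1) < \<eta>1 \<Longrightarrow> (l', n') \<in> ?N1 \<Longrightarrow> 0 < \<delta>' \<Longrightarrow> \<delta>' \<le> \<delta>1 \<Longrightarrow> \<delta>' \<le> r1/2 \<Longrightarrow>
      damping (up.symbol d' l' m' n') \<delta>'"
    using up.damping_near[of l1 n1 m1] e1 by auto
  obtain \<eta>2 \<delta>2 where 2: "0 < \<eta>2" "0 < \<delta>2"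
    "\<And>d' l' m' n' \<delta>'. dist (d', l', m', n') (0, - l2, m2, - n2) < \<eta>2 \<Longrightarrow> (l', n') \<in> ?N2 \<Longrightarrow> 0 < \<delta>' \<Longrightarrow> \<delta>' \<le> \<delta>2 \<Longrightarrow> \<delta>' \<le> r2/2 \<Longrightarrow>
      damping (lo.symbol d' l' m' n') \<delta>'"
    using lo.damping_near[of "- l2" "- n2" m2] e2 by auto
  define e where "e = min (min e1 e2) (min \<eta>1 \<eta>2)"
  define \<delta> where "\<delta> = min (min \<delta>1 \<delta>2) (min (r1/2) (r2/2))"
  define V where "V = {\<theta>. dist (upper_par \<theta>) (0, l1, m1, n1) < e \<and> dist (lower_par \<theta>) (0, - l2, m2, - n2) < e}"
  have \<delta>: "0 < \<delta>" "\<delta> \<le> r1/2" "\<delta> \<le> r2/2" "\<delta> \<le> \<delta>1" "\<delta> \<le> \<delta>2" using 1 2 up.r0 lo.r0 by (auto simp: \<delta>_def)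
  have "switching_family r1 ?N1 r2 ?N2 \<delta> V"
  proof (intro switching_family.intro switching_family_axioms.intro up.lienard_normal_form_axioms lo.lienard_normal_form_axioms)
    show "open V" unfolding V_def by (rule open_par_ball)
    fix d1' d2' l1' l2' m1' m2' n1' n2' assume "(d1', d2', l1', l2', m1', m2', n1', n2') \<in> V"
    then have d1: "dist (d1', l1', m1', n1') (0, l1, m1, n1) < e1" "dist (d1', l1', m1', n1') (0, l1, m1, n1) < \<eta>1"
      and d2: "dist (- d2', - l2', m2', - n2') (0, - l2, m2, - n2) < e2" "dist (- d2', - l2', m2', - n2') (0, - l2, m2, - n2) < \<eta>2"
      unfolding V_def mem_Collect_eq par_simps e_def min_less_iff_conj by blast+
    have N: "(l1', n1') \<in> ?N1" "(- l2', - n2') \<in> ?N2"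
      by (intro SigmaI dist_par_component[OF d1(1)] dist_par_component[OF d2(1)])+
    show "switching_pair r1 ?N1 r2 ?N2 d1' d2' l1' l2' m1' m2' n1' n2' \<delta>"
      by (intro switching_pair.intro switching_pair_axioms.intro up.lienard_normal_form_axioms lo.lienard_normal_form_axioms)
        (rule N \<delta>(2,3) 1(3)[OF d1(2) N(1) \<delta>(1,4,2)] 2(3)[OF d2(2) N(2) \<delta>(1,5,3)])+
  qed
  moreover have "\<theta> \<in> V" using e1 e2 1 2 by (simp add: V_def \<theta> e_def)
  ultimately show thesis by (rule that)
qed

lemma weak_focus_order_bound:
  assumes "weak_focus_of_order \<theta> k"
  shows "k \<le> 5"
proof (rule ccontr)
  assume k: "\<not> k \<le> 5"
  have z: "zero_traces \<theta>" using assms by (simp add: weak_focus_of_order_def)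
  obtain r1 N1 r2 N2 \<delta> V where V: "switching_family r1 N1 r2 N2 \<delta> V" "\<theta> \<in> V"
    using switching_family_exists[OF z] by blast
  obtain d1 d2 l1 l2 m1 m2 n1 n2 where \<theta>: "\<theta> = (d1, d2, l1, l2, m1, m2, n1, n2)" by (metis surj_pair)
  interpret switching_pair r1 N1 r2 N2 d1 d2 l1 l2 m1 m2 n1 n2 \<delta>
    by (rule switching_family.pair[OF V[unfolded \<theta>]])
  have d: "d1 = 0" "d2 = 0" using assms by (auto simp: \<theta> weak_focus_of_order_def)
  have "displacement_coeff \<theta> 0 = 0" using displacement_coeff_series(1)[of 0] return_gap_0 by (simp add: \<theta>)
  moreover have "displacement_coeff \<theta> i = 0" if "1 \<le> i" "i \<le> 5" for i
    using assms k that by (auto simp: weak_focus_of_order_def)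
  ultimately have "displacement_coeff \<theta> i = 0" if "i \<le> 5" for i using that by (cases "i = 0") auto
  then have "displacement_coeff \<theta> k = 0" using weak_focus_order_le_5[OF d] by (simp add: \<theta>)
  then show False using assms by (simp add: weak_focus_of_order_def)
qed

lemma weak_focus_set_order:
  assumes "\<theta> \<in> weak_focus_set"
  shows "weak_focus_of_order \<theta> 5"
proof -
  obtain d1 d2 l1 l2 m1 m2 n1 n2 where \<theta>: "\<theta> = (d1, d2, l1, l2, m1, m2, n1, n2)" by (metis surj_pair)
  have d: "d1 = 0" "d2 = 0" and l: "2 * l2 + 3 * n1 - n2 = 0" "2 * l1 - n1 + 3 * n2 = 0" and m: "m1 = m2"
    and nz: "m2 * (n1 - n2) * (n1 + n2 - 1) * (n2 - n1) / 24 \<noteq> 0"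
    using assms by (auto simp: weak_focus_set_def \<theta>)
  have z: "zero_traces \<theta>" by (simp add: \<theta> d)
  obtain r1 N1 r2 N2 \<delta> V where V: "switching_family r1 N1 r2 N2 \<delta> V" "\<theta> \<in> V"
    using switching_family_exists[OF z] by blast
  interpret switching_pair r1 N1 r2 N2 d1 d2 l1 l2 m1 m2 n1 n2 \<delta>
    by (rule switching_family.pair[OF V[unfolded \<theta>]])
  have s: "l1 + n1 + l2 + n2 = 0" using l by simp
  \<comment> \<open>Order 4 of the damping difference is order 5 of the displacement.\<close>
  show ?thesis
    using displacement_coeff_order[OF leading_term_4[OF d m s l(2)] nz] z
    by (auto simp: weak_focus_of_order_def \<theta> eval_nat_numeral)
qed

context lienard_normal_form
begin

lemma half_return_near:
  assumes ln: "(l, n) \<in> N" and damp: "damping (symbol d l m n) \<delta>" and \<delta>: "\<delta> \<le> r0/2" and \<epsilon>: "0 < \<epsilon>"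
  obtains \<eta> where "0 < \<eta>" "\<And>d' l' m' n' x. dist (d', l', m', n') (d, l, m, n) < \<eta> \<Longrightarrow> (l', n') \<in> N \<Longrightarrow>
    damping (symbol d' l' m' n') \<delta> \<Longrightarrow> norm x < \<delta>/4 \<Longrightarrow>
    norm (damping.half_return (symbol d' l' m' n') x - damping.half_return (symbol d l m n) x) \<le> \<epsilon>"
proof -
  obtain \<eta> where \<eta>: "0 < \<eta>" "\<And>d' l' m' n' v. dist (d', l', m', n') (d, l, m, n) < \<eta> \<Longrightarrow> (l', n') \<in> N \<Longrightarrow> norm v \<le> r0/2 \<Longrightarrow>
    norm (symbol d' l' m' n' v - symbol d l m n v) \<le> \<epsilon>"
    using symbol_close[OF ln \<epsilon>, of d m] by blast
  show thesis
  proof (rule that[OF \<eta>(1)])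
    fix d' l' m' n' :: real and x :: complex
    assume *: "dist (d', l', m', n') (d, l, m, n) < \<eta>" "(l', n') \<in> N" "damping (symbol d' l' m' n') \<delta>" "norm x < \<delta>/4"
    interpret damping_pair "symbol d l m n" "symbol d' l' m' n'" \<delta>
      using damp *(3) by (simp add: damping_pair_def)
    have "norm (D2.half_return x - D1.half_return x) \<le> 10 * norm x * \<epsilon>"
      by (rule norm_half_return_diff_le[OF *(4) \<eta>(2)[OF *(1,2)]]) (use \<delta> D1.delta_pos in linarith)
    \<comment> \<open>From \<open>norm x < \<delta>/4 \<le> r0/8 \<le> 1/16\<close> the factor
      \<open>10 * norm x\<close> is less than 1.\<close>
    also have "\<dots> \<le> 1 * \<epsilon>" using *(4) \<delta> r0 \<epsilon> by (intro mult_right_mono) linarith+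
    finally show "norm (D2.half_return x - D1.half_return x) \<le> \<epsilon>" by simp
  qed
qed

end

context switching_pair
begin

lemma leading_term_sign:
  assumes "leading_term j c" "sgn c = \<sigma>" "\<bar>\<sigma>\<bar> = 1"
  shows "\<exists>R>0. \<forall>r. 0 < r \<and> r < R \<longrightarrow> 0 < \<sigma> * Re (return_gap (of_real r))"
proof -
  have c: "c \<noteq> 0" using assms(2,3) by auto
  obtain R a K where R: "0 < R" "0 < a" "\<And>r. 0 < r \<Longrightarrow> r < R \<Longrightarrow> a * r ^ Suc j \<le> sgn c * Re (return_gap (of_real r))"
    using leading_termE[OF assms(1) c] by metis
  have "0 < \<sigma> * Re (return_gap (of_real r))" if r: "0 < r" "r < R" for r
  proof -
    have "0 < a * r ^ Suc j" using R(2) r by simp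
    then show ?thesis using R(3)[OF r] unfolding assms(2) by linarith
  qed
  then show ?thesis using R(1) by blast
qed

end

context switching_family
begin

text \<open>The displacement with complex argument and with the parameter tuple as a variable, so
  that parameters can vary within one statement.\<close>

fun bif :: "params \<Rightarrow> complex \<Rightarrow> complex" where
  "bif (d1, d2, l1, l2, m1, m2, n1, n2) x =
     damping.half_return (lo.symbol (- d2) (- l2) m2 (- n2)) x - damping.half_return (up.symbol d1 l1 m1 n1) x"

lemma bif_close:
  assumes \<theta>0: "\<theta>0 \<in> V" and \<epsilon>: "0 < \<epsilon>"
  shows "eventually (\<lambda>\<theta>. \<theta> \<in> V \<and> (\<forall>x. norm x < \<delta>/4 \<longrightarrow> norm (bif \<theta> x - bif \<theta>0 x) \<le> \<epsilon>)) (nhds \<theta>0)"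
proof -
  obtain d1 d2 l1 l2 m1 m2 n1 n2 where t0: "\<theta>0 = (d1, d2, l1, l2, m1, m2, n1, n2)" by (metis surj_pair)
  interpret P: switching_pair r1 N1 r2 N2 d1 d2 l1 l2 m1 m2 n1 n2 \<delta>
    by (rule pair[OF \<theta>0[unfolded t0]])
  have e2: "0 < \<epsilon>/2" using \<epsilon> by simp
  obtain \<eta>1 where 1: "0 < \<eta>1" "\<And>d' l' m' n' x. dist (d', l', m', n') (d1, l1, m1, n1) < \<eta>1 \<Longrightarrow> (l', n') \<in> N1 \<Longrightarrow>
    damping (up.symbol d' l' m' n') \<delta> \<Longrightarrow> norm x < \<delta>/4 \<Longrightarrow>
    norm (damping.half_return (up.symbol d' l' m' n') x - damping.half_return (up.symbol d1 l1 m1 n1) x) \<le> \<epsilon>/2"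
    using up.half_return_near[OF P.N1 P.damp(1) P.\<delta>(1) e2] by blast
  obtain \<eta>2 where 2: "0 < \<eta>2" "\<And>d' l' m' n' x. dist (d', l', m', n') (- d2, - l2, m2, - n2) < \<eta>2 \<Longrightarrow> (l', n') \<in> N2 \<Longrightarrow>
    damping (lo.symbol d' l' m' n') \<delta> \<Longrightarrow> norm x < \<delta>/4 \<Longrightarrow>
    norm (damping.half_return (lo.symbol d' l' m' n') x - damping.half_return (lo.symbol (- d2) (- l2) m2 (- n2)) x) \<le> \<epsilon>/2"
    using lo.half_return_near[OF P.N2 P.damp(2) P.\<delta>(2) e2] by blast
  let ?W = "{\<theta>. dist (upper_par \<theta>) (d1, l1, m1, n1) < min \<eta>1 \<eta>2 \<and> dist (lower_par \<theta>) (- d2, - l2, m2, - n2) < min \<eta>1 \<eta>2}"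
  have "eventually (\<lambda>\<theta>. \<theta> \<in> V) (nhds \<theta>0)" by (rule eventually_nhds_in_open[OF open_V \<theta>0])
  moreover have "eventually (\<lambda>\<theta>. \<theta> \<in> ?W) (nhds \<theta>0)"
    by (rule eventually_nhds_in_open[OF open_par_ball]) (use 1(1) 2(1) in \<open>simp add: t0\<close>)
  ultimately show ?thesis
  proof eventually_elim
    case (elim \<theta>)
    obtain d1' d2' l1' l2' m1' m2' n1' n2' where t: "\<theta> = (d1', d2', l1', l2', m1', m2', n1', n2')" by (metis surj_pair)
    interpret Q: switching_pair r1 N1 r2 N2 d1' d2' l1' l2' m1' m2' n1' n2' \<delta>
      by (rule pair[OF elim(1)[unfolded t]])
    have d: "dist (d1', l1', m1', n1') (d1, l1, m1, n1) < \<eta>1" "dist (- d2', - l2', m2', - n2') (- d2, - l2, m2, - n2) < \<eta>2"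
      using elim(2) unfolding t mem_Collect_eq par_simps min_less_iff_conj by blast+
    have "norm (bif \<theta> x - bif \<theta>0 x) \<le> \<epsilon>" if x: "norm x < \<delta>/4" for x
    proof -
      let ?A = "damping.half_return (lo.symbol (- d2') (- l2') m2' (- n2')) x - damping.half_return (lo.symbol (- d2) (- l2) m2 (- n2)) x"
      let ?B = "damping.half_return (up.symbol d1' l1' m1' n1') x - damping.half_return (up.symbol d1 l1 m1 n1) x"
      have eq: "bif \<theta> x - bif \<theta>0 x = ?A - ?B" by (simp add: t t0)
      have "norm (?A - ?B) \<le> norm ?A + norm ?B" by (rule norm_triangle_ineq4)
      moreover note 1(2)[OF d(1) Q.N1 Q.damp(1) x] 2(2)[OF d(2) Q.N2 Q.damp(2) x]
      ultimately show ?thesis unfolding eq by linarith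
    qed
    then show ?case using elim(1) by blast
  qed
qed

lemma bif_sign_open:
  assumes \<theta>0: "\<theta>0 \<in> V" and r: "0 < r" "r < \<delta>/4" and \<sigma>: "\<bar>\<sigma>\<bar> = 1" "0 < \<sigma> * Re (bif \<theta>0 (of_real r))"
  shows "eventually (\<lambda>\<theta>. 0 < \<sigma> * Re (bif \<theta> (of_real r))) (nhds \<theta>0)"
proof -
  have "0 < \<sigma> * Re (bif \<theta>0 (of_real r)) / 2" using \<sigma> by simp
  from bif_close[OF \<theta>0 this] show ?thesis
  proof eventually_elim
    case (elim \<theta>)
    then have "norm (bif \<theta> (of_real r) - bif \<theta>0 (of_real r)) \<le> \<sigma> * Re (bif \<theta>0 (of_real r)) / 2" using r by simp
    then have "\<bar>Re (bif \<theta> (of_real r)) - Re (bif \<theta>0 (of_real r))\<bar> \<le> \<sigma> * Re (bif \<theta>0 (of_real r)) / 2"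
      using abs_Re_le_cmod[of "bif \<theta> (of_real r) - bif \<theta>0 (of_real r)"] by simp
    then have b: "\<bar>Re (bif \<theta> (of_real r)) - Re (bif \<theta>0 (of_real r))\<bar> \<le> \<sigma> * Re (bif \<theta>0 (of_real r)) / 2" .
    consider "\<sigma> = 1" | "\<sigma> = - 1" using \<sigma>(1) by linarith
    then show ?case
    proof cases
      case 1
      then show ?thesis using b \<sigma>(2) unfolding 1 abs_le_iff by linarith
    next
      case 2
      then show ?thesis using b \<sigma>(2) unfolding 2 abs_le_iff by linarith
    qed
  qed
qed

lemma bif_holomorphic: "\<theta> \<in> V \<Longrightarrow> bif \<theta> holomorphic_on ball 0 (\<delta>/4)"
proof -
  assume \<theta>: "\<theta> \<in> V"
  obtain d1 d2 l1 l2 m1 m2 n1 n2 where t: "\<theta> = (d1, d2, l1, l2, m1, m2, n1, n2)" by (metis surj_pair)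
  interpret P: switching_pair r1 N1 r2 N2 d1 d2 l1 l2 m1 m2 n1 n2 \<delta>
    by (rule pair[OF \<theta>[unfolded t]])
  have "bif \<theta> = (\<lambda>x. P.return_gap x)" by (rule ext) (simp only: t bif.simps)
  then show ?thesis using P.return_gap_holomorphic by (simp only:)
qed

lemma delta_pos: "\<theta> \<in> V \<Longrightarrow> 0 < \<delta>"
proof -
  assume \<theta>: "\<theta> \<in> V"
  obtain d1 d2 l1 l2 m1 m2 n1 n2 where t: "\<theta> = (d1, d2, l1, l2, m1, m2, n1, n2)" by (metis surj_pair)
  interpret P: switching_pair r1 N1 r2 N2 d1 d2 l1 l2 m1 m2 n1 n2 \<delta>
    by (rule pair[OF \<theta>[unfolded t]])
  show ?thesis by (rule P.pair.D1.delta_pos)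
qed

text \<open>Displacement maps of nearby parameters are uniformly close on a complex disc, and
  Cauchy's inequality converts this into closeness of their \<open>k\<close>-th derivatives.\<close>

lemma bif_higher_deriv:
  assumes \<theta>0: "\<theta>0 \<in> V" and nz: "Re ((deriv ^^ k) (bif \<theta>0) 0) \<noteq> 0"
  obtains R where "0 < R" "R < \<delta>/8"
    "eventually (\<lambda>\<theta>. \<forall>x. \<bar>x\<bar> < R \<longrightarrow> Re ((deriv ^^ k) (bif \<theta>) (of_real x)) \<noteq> 0) (nhds \<theta>0)"
proof -
  note \<delta> = delta_pos[OF \<theta>0]
  define A where "A = \<bar>Re ((deriv ^^ k) (bif \<theta>0) 0)\<bar>"
  have A: "0 < A" using nz by (simp add: A_def)
  have "(deriv ^^ k) (bif \<theta>0) holomorphic_on ball 0 (\<delta>/4)"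
    by (rule holomorphic_higher_deriv[OF bif_holomorphic[OF \<theta>0] open_ball])
  then have "isCont ((deriv ^^ k) (bif \<theta>0)) 0"
    using \<delta> by (auto dest!: holomorphic_on_imp_continuous_on simp: continuous_on_eq_continuous_at)
  then obtain R0 where R0: "0 < R0" "\<And>x. dist x 0 < R0 \<Longrightarrow> dist ((deriv ^^ k) (bif \<theta>0) x) ((deriv ^^ k) (bif \<theta>0) 0) < A / 2"
    unfolding continuous_at_eps_delta using A by (meson half_gt_zero)
  define R where "R = min R0 (\<delta>/16)"
  \<comment> \<open>Chosen so that Cauchy's inequality on discs of radius \<open>\<delta>/16\<close>
    yields \<open>A / 2\<close>.\<close>
  define \<epsilon> where "\<epsilon> = A / 2 / (fact k) * (\<delta>/16) ^ k"
  have \<epsilon>: "0 < \<epsilon>" using A \<delta> by (simp add: \<epsilon>_def)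
  show thesis
  proof (rule that[of R])
    show "0 < R" "R < \<delta>/8" using R0 \<delta> by (auto simp: R_def)
    show "eventually (\<lambda>\<theta>. \<forall>x. \<bar>x\<bar> < R \<longrightarrow> Re ((deriv ^^ k) (bif \<theta>) (of_real x)) \<noteq> 0) (nhds \<theta>0)"
      using bif_close[OF \<theta>0 \<epsilon>]
    proof eventually_elim
      case (elim \<theta>)
      show ?case
      proof (intro allI impI)
        fix x :: real assume x: "\<bar>x\<bar> < R"
        have sub: "cball (of_real x) (\<delta>/16) \<subseteq> ball (0::complex) (\<delta>/4)"
        proof
          fix y assume "y \<in> cball (complex_of_real x) (\<delta>/16)"
          then have "norm (y - of_real x) \<le> \<delta>/16" by (simp add: dist_norm norm_minus_commute)
          then show "y \<in> ball 0 (\<delta>/4)"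
            using norm_triangle_sub[of y "of_real x"] x \<delta> by (simp add: R_def)
        qed
        have hol: "(\<lambda>w. bif \<theta> w - bif \<theta>0 w) holomorphic_on ball 0 (\<delta>/4)"
          by (intro holomorphic_on_diff bif_holomorphic \<theta>0) (use elim in blast)
        have "norm ((deriv ^^ k) (\<lambda>w. bif \<theta> w - bif \<theta>0 w) (of_real x)) \<le> fact k * \<epsilon> / (\<delta>/16) ^ k"
        proof (rule Cauchy_inequality)
          show "(\<lambda>w. bif \<theta> w - bif \<theta>0 w) holomorphic_on ball (of_real x) (\<delta>/16)"
            by (rule holomorphic_on_subset[OF hol]) (use sub in auto)
          show "continuous_on (cball (of_real x) (\<delta>/16)) (\<lambda>w. bif \<theta> w - bif \<theta>0 w)"
            by (rule continuous_on_subset[OF holomorphic_on_imp_continuous_on[OF hol] sub])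
          fix y assume "norm (complex_of_real x - y) = \<delta>/16"
          then have "y \<in> ball 0 (\<delta>/4)" using sub by (auto simp: dist_norm)
          then show "norm (bif \<theta> y - bif \<theta>0 y) \<le> \<epsilon>" using elim by simp
        qed (use \<delta> in simp)
        also have "\<dots> = A / 2" using \<delta> by (simp add: \<epsilon>_def)
        also have "(deriv ^^ k) (\<lambda>w. bif \<theta> w - bif \<theta>0 w) (of_real x) = (deriv ^^ k) (bif \<theta>) (of_real x) - (deriv ^^ k) (bif \<theta>0) (of_real x)"
          by (rule higher_deriv_diff[OF bif_holomorphic bif_holomorphic[OF \<theta>0] open_ball]) (use elim x \<delta> in \<open>auto simp: R_def\<close>)
        finally have 1: "norm ((deriv ^^ k) (bif \<theta>) (of_real x) - (deriv ^^ k) (bif \<theta>0) (of_real x)) \<le> A / 2" .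
        have 2: "norm ((deriv ^^ k) (bif \<theta>0) (of_real x) - (deriv ^^ k) (bif \<theta>0) 0) < A / 2"
          using R0(2)[of "of_real x"] x by (simp add: R_def dist_norm)
        have "norm ((deriv ^^ k) (bif \<theta>) (of_real x) - (deriv ^^ k) (bif \<theta>0) 0) < A"
          using norm_triangle_ineq[of "(deriv ^^ k) (bif \<theta>) (of_real x) - (deriv ^^ k) (bif \<theta>0) (of_real x)" "(deriv ^^ k) (bif \<theta>0) (of_real x) - (deriv ^^ k) (bif \<theta>0) 0"] 1 2
          by simp
        then have "\<bar>Re ((deriv ^^ k) (bif \<theta>) (of_real x)) - Re ((deriv ^^ k) (bif \<theta>0) 0)\<bar> < A"
          using abs_Re_le_cmod[of "(deriv ^^ k) (bif \<theta>) (of_real x) - (deriv ^^ k) (bif \<theta>0) 0"] by simp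
        then show "Re ((deriv ^^ k) (bif \<theta>) (of_real x)) \<noteq> 0" by (auto simp: A_def)
      qed
    qed
  qed
qed

text \<open>One step of the unfolding. \<open>Q\<close> collects the signs arranged at larger radii;
  holding in a neighbourhood, it survives a small move along \<open>p\<close>. The new leading term
  then fixes the sign \<open>\<sigma>\<close> at a smaller radius, again for all nearby
  parameters.\<close>

lemma perturb:
  assumes p: "isCont p (0::real)" "p 0 \<in> V" and Q: "eventually Q (nhds (p 0))" and \<sigma>: "\<bar>\<sigma>\<bar> = 1" and \<rho>: "0 < \<rho>"
    and lead: "\<And>\<epsilon>. 0 < \<epsilon> \<Longrightarrow> p \<epsilon> \<in> V \<Longrightarrow> \<exists>R>0. \<forall>r. 0 < r \<and> r < R \<longrightarrow> 0 < \<sigma> * Re (bif (p \<epsilon>) (of_real r))"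
  obtains \<epsilon> r where "0 < \<epsilon>" "p \<epsilon> \<in> V" "0 < r" "r < \<rho>" "r < \<delta>/4"
    "eventually (\<lambda>\<theta>. Q \<theta> \<and> 0 < \<sigma> * Re (bif \<theta> (of_real r))) (nhds (p \<epsilon>))"
proof -
  have "eventually (\<lambda>\<theta>. \<theta> \<in> V \<and> eventually Q (nhds \<theta>)) (nhds (p 0))"
    using eventually_conj[OF eventually_nhds_in_open[OF open_V p(2)]] Q by (simp add: eventually_eventually)
  then have "eventually (\<lambda>\<epsilon>. p \<epsilon> \<in> V \<and> eventually Q (nhds (p \<epsilon>))) (nhds 0)"
    using p(1) unfolding isCont_def tendsto_at_iff_tendsto_nhds by (rule eventually_compose_filterlim)
  then obtain e where e: "0 < e" "\<And>\<epsilon>. dist \<epsilon> 0 < e \<Longrightarrow> p \<epsilon> \<in> V \<and> eventually Q (nhds (p \<epsilon>))"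
    unfolding eventually_nhds_metric by blast
  define \<epsilon> where "\<epsilon> = e / 2"
  have \<epsilon>: "0 < \<epsilon>" "p \<epsilon> \<in> V" "eventually Q (nhds (p \<epsilon>))" using e by (auto simp: \<epsilon>_def dist_norm)
  obtain R where R: "0 < R" "\<And>r. 0 < r \<and> r < R \<Longrightarrow> 0 < \<sigma> * Re (bif (p \<epsilon>) (of_real r))" using lead[OF \<epsilon>(1,2)] by blast
  define r where "r = min (min \<rho> R) (\<delta>/4) / 2"
  have r: "0 < r" "r < \<rho>" "r < R" "r < \<delta>/4" using \<rho> R(1) delta_pos[OF \<epsilon>(2)] by (auto simp: r_def)
  show thesis
    by (rule that[OF \<epsilon>(1,2) r(1,2,4)]) (rule eventually_conj[OF \<epsilon>(3) bif_sign_open[OF \<epsilon>(2) r(1,4) \<sigma> R(2)]], use r in simp)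
qed

text \<open>The leading order of the damping difference is lowered from 4 to 0 one by one, with
  alternating signs. Each step adds a sign at a radius below the earlier ones.\<close>

lemma bif_alternating:
  assumes T: "\<theta>0 \<in> weak_focus_set" and \<theta>0: "\<theta>0 \<in> V" and Q: "eventually Q (nhds \<theta>0)" and \<rho>: "0 < \<rho>"
  obtains \<theta> x1 x2 x3 x4 x5 s where "\<theta> \<in> V" "Q \<theta>" "0 < x1" "x1 < x2" "x2 < x3" "x3 < x4" "x4 < x5" "x5 < \<rho>" "\<bar>s\<bar> = 1"
    "0 < s * Re (bif \<theta> (of_real x1))" "0 < - s * Re (bif \<theta> (of_real x2))" "0 < s * Re (bif \<theta> (of_real x3))"
    "0 < - s * Re (bif \<theta> (of_real x4))" "0 < s * Re (bif \<theta> (of_real x5))"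
proof -
  obtain l1 l2 m n1 n2 where t0: "\<theta>0 = (0, 0, l1, l2, m, m, n1, n2)"
    and l: "2 * l2 + 3 * n1 - n2 = 0" "2 * l1 - n1 + 3 * n2 = 0" and nz: "m \<noteq> 0" "n1 + n2 - 1 \<noteq> 0" "n2 - n1 \<noteq> 0"
    using T by (auto simp: weak_focus_set_def)
  have sum: "l1 + n1 + l2 + n2 = 0" using l by simp
  define s where "s = sgn (m * (n1 - n2) * (n1 + n2 - 1) * (n2 - n1) / 24)"
  have s: "\<bar>s\<bar> = 1" unfolding s_def abs_sgn_eq using nz by simp
  then have s': "\<bar>- s\<bar> = 1" "s = 1 \<or> s = - 1" by auto
  have sg: "sgn (k * \<epsilon>) = sgn k" if "0 < \<epsilon>" for k \<epsilon> :: real using that by (simp add: sgn_mult)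
  obtain \<epsilon>5 x5 where 5: "0 < x5" "x5 < \<rho>" "eventually (\<lambda>\<theta>. Q \<theta> \<and> 0 < s * Re (bif \<theta> (of_real x5))) (nhds \<theta>0)"
  proof (rule perturb[of "\<lambda>_. \<theta>0" Q s \<rho>])
    interpret switching_pair r1 N1 r2 N2 0 0 l1 l2 m m n1 n2 \<delta> by (rule pair[OF \<theta>0[unfolded t0]])
    show "\<exists>R>0. \<forall>r. 0 < r \<and> r < R \<longrightarrow> 0 < s * Re (bif \<theta>0 (of_real r))"
      using leading_term_sign[OF leading_term_4[OF refl refl refl sum l(2)] _ s] by (simp only: t0 bif.simps s_def)
  qed (use \<theta>0 Q s \<rho> in auto)
  \<comment> \<open>Moving \<open>l1\<close> and \<open>l2\<close> in opposite directions keeps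
    \<open>l1 + n1 + l2 + n2 = 0\<close>, so the term of order 2 stays zero; \<open>k4\<close> gives
    the term of order 3 the sign \<open>- s\<close>.\<close>
  define k4 where "k4 = - s * sgn (m * (n1 + n2 - 1))"
  define p4 where "p4 \<epsilon> = (0::real, 0::real, l1 + k4 * \<epsilon>, l2 - k4 * \<epsilon>, m, m, n1, n2)" for \<epsilon>
  have p4: "p4 0 = \<theta>0" by (simp add: p4_def t0)
  obtain e4 x4 where 4: "p4 e4 \<in> V" "0 < x4" "x4 < x5"
    "eventually (\<lambda>\<theta>. (Q \<theta> \<and> 0 < s * Re (bif \<theta> (of_real x5))) \<and> 0 < - s * Re (bif \<theta> (of_real x4))) (nhds (p4 e4))"
  proof (rule perturb[of p4 "\<lambda>\<theta>. Q \<theta> \<and> 0 < s * Re (bif \<theta> (of_real x5))" "- s" x5])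
    fix \<epsilon> :: real assume \<epsilon>: "0 < \<epsilon>" "p4 \<epsilon> \<in> V"
    interpret switching_pair r1 N1 r2 N2 0 0 "l1 + k4 * \<epsilon>" "l2 - k4 * \<epsilon>" m m n1 n2 \<delta> by (rule pair[OF \<epsilon>(2)[unfolded p4_def]])
    have sm: "l1 + k4 * \<epsilon> + n1 + (l2 - k4 * \<epsilon>) + n2 = 0" using sum by simp
    have "2 * (l1 + k4 * \<epsilon>) - n1 + 3 * n2 = 2 * k4 * \<epsilon>" using l(2) by (simp add: algebra_simps)
    then have e: "m * (n1 + n2 - 1) * (2 * (l1 + k4 * \<epsilon>) - n1 + 3 * n2) / 6 = (m * (n1 + n2 - 1) * k4) * (\<epsilon> / 3)"
      by (simp only:)
    have sk: "sgn (m * (n1 + n2 - 1) * k4) = - s"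
      using nz s'(2) by (auto simp: k4_def sgn_mult sgn_if)
    have "0 < \<epsilon> / 3" using \<epsilon>(1) by simp
    then have "sgn (m * (n1 + n2 - 1) * (2 * (l1 + k4 * \<epsilon>) - n1 + 3 * n2) / 6) = - s"
      unfolding e by (rule trans[OF sg sk])
    from leading_term_sign[OF leading_term_3[OF refl refl refl sm] this s'(1)]
    show "\<exists>R>0. \<forall>r. 0 < r \<and> r < R \<longrightarrow> 0 < - s * Re (bif (p4 \<epsilon>) (of_real r))"
      by (simp only: p4_def bif.simps)
  next
    show "isCont p4 0" unfolding p4_def[abs_def] by (intro continuous_intros)
  qed (use \<theta>0 5 s' p4 in auto)
  define a1 where "a1 = l1 + k4 * e4"
  define a2 where "a2 = l2 - k4 * e4"
  have sum': "a1 + n1 + a2 + n2 = 0" using sum by (simp add: a1_def a2_def)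
  \<comment> \<open>Only \<open>l2\<close> moves, so the sum becomes \<open>k3 * \<epsilon>\<close>,
    and \<open>- m * k3\<close> has the sign \<open>s\<close>.\<close>
  define k3 where "k3 = - s * sgn m"
  define p3 where "p3 \<epsilon> = (0::real, 0::real, a1, a2 + k3 * \<epsilon>, m, m, n1, n2)" for \<epsilon>
  have p3: "p3 0 = p4 e4" by (simp add: p3_def p4_def a1_def a2_def)
  obtain e3 x3 where 3: "p3 e3 \<in> V" "0 < x3" "x3 < x4"
    "eventually (\<lambda>\<theta>. ((Q \<theta> \<and> 0 < s * Re (bif \<theta> (of_real x5))) \<and> 0 < - s * Re (bif \<theta> (of_real x4))) \<and> 0 < s * Re (bif \<theta> (of_real x3))) (nhds (p3 e3))"
  proof (rule perturb[of p3 "\<lambda>\<theta>. (Q \<theta> \<and> 0 < s * Re (bif \<theta> (of_real x5))) \<and> 0 < - s * Re (bif \<theta> (of_real x4))" s x4])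
    fix \<epsilon> :: real assume \<epsilon>: "0 < \<epsilon>" "p3 \<epsilon> \<in> V"
    interpret switching_pair r1 N1 r2 N2 0 0 a1 "a2 + k3 * \<epsilon>" m m n1 n2 \<delta> by (rule pair[OF \<epsilon>(2)[unfolded p3_def]])
    have "- m * (a1 + n1 + (a2 + k3 * \<epsilon>) + n2) = - m * ((a1 + n1 + a2 + n2) + k3 * \<epsilon>)" by (simp add: algebra_simps)
    then have e: "- m * (a1 + n1 + (a2 + k3 * \<epsilon>) + n2) = (- m * k3) * \<epsilon>" by (simp add: sum')
    have sk: "sgn (- m * k3) = s" using nz s'(2) by (auto simp: k3_def sgn_mult sgn_if)
    have "sgn (- m * (a1 + n1 + (a2 + k3 * \<epsilon>) + n2)) = s" unfolding e by (rule trans[OF sg[OF \<epsilon>(1)] sk])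
    from leading_term_sign[OF leading_term_2[OF refl refl refl] this s]
    show "\<exists>R>0. \<forall>r. 0 < r \<and> r < R \<longrightarrow> 0 < s * Re (bif (p3 \<epsilon>) (of_real r))"
      by (simp only: p3_def bif.simps)
  next
    show "isCont p3 0" unfolding p3_def[abs_def] by (intro continuous_intros)
  qed (use 4 s p3 in auto)
  define b2 where "b2 = a2 + k3 * e3"
  define p2 where "p2 \<epsilon> = (0::real, 0::real, a1, b2, m, m + - s * \<epsilon>, n1, n2)" for \<epsilon>
  have p2: "p2 0 = p3 e3" by (simp add: p2_def p3_def b2_def)
  obtain e2 x2 where 2: "p2 e2 \<in> V" "0 < x2" "x2 < x3"
    "eventually (\<lambda>\<theta>. (((Q \<theta> \<and> 0 < s * Re (bif \<theta> (of_real x5))) \<and> 0 < - s * Re (bif \<theta> (of_real x4))) \<and> 0 < s * Re (bif \<theta> (of_real x3))) \<and>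
       0 < - s * Re (bif \<theta> (of_real x2))) (nhds (p2 e2))"
  proof (rule perturb[of p2 "\<lambda>\<theta>. ((Q \<theta> \<and> 0 < s * Re (bif \<theta> (of_real x5))) \<and> 0 < - s * Re (bif \<theta> (of_real x4))) \<and> 0 < s * Re (bif \<theta> (of_real x3))" "- s" x3])
    fix \<epsilon> :: real assume \<epsilon>: "0 < \<epsilon>" "p2 \<epsilon> \<in> V"
    interpret switching_pair r1 N1 r2 N2 0 0 a1 b2 m "m + - s * \<epsilon>" n1 n2 \<delta> by (rule pair[OF \<epsilon>(2)[unfolded p2_def]])
    have "sgn (m + - s * \<epsilon> - m) = - s" using sg[OF \<epsilon>(1), of "- s"] s'(2) by auto
    from leading_term_sign[OF leading_term_1[OF refl refl] this s'(1)]
    show "\<exists>R>0. \<forall>r. 0 < r \<and> r < R \<longrightarrow> 0 < - s * Re (bif (p2 \<epsilon>) (of_real r))"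
      by (simp only: p2_def bif.simps)
  next
    show "isCont p2 0" unfolding p2_def[abs_def] by (intro continuous_intros)
  qed (use 3 s' p2 in auto)
  define m' where "m' = m + - s * e2"
  \<comment> \<open>The term of order 0 is \<open>- d2 - d1\<close>, so
    \<open>d1 = - s * \<epsilon>\<close> gives it the sign \<open>s\<close>.\<close>
  define p1 where "p1 \<epsilon> = (- s * \<epsilon>, 0::real, a1, b2, m, m', n1, n2)" for \<epsilon>
  have p1: "p1 0 = p2 e2" by (simp add: p1_def p2_def m'_def)
  obtain e1 x1 where 1: "p1 e1 \<in> V" "0 < x1" "x1 < x2"
    "eventually (\<lambda>\<theta>. ((((Q \<theta> \<and> 0 < s * Re (bif \<theta> (of_real x5))) \<and> 0 < - s * Re (bif \<theta> (of_real x4))) \<and> 0 < s * Re (bif \<theta> (of_real x3))) \<and>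
       0 < - s * Re (bif \<theta> (of_real x2))) \<and> 0 < s * Re (bif \<theta> (of_real x1))) (nhds (p1 e1))"
  proof (rule perturb[of p1 "\<lambda>\<theta>. (((Q \<theta> \<and> 0 < s * Re (bif \<theta> (of_real x5))) \<and> 0 < - s * Re (bif \<theta> (of_real x4))) \<and> 0 < s * Re (bif \<theta> (of_real x3))) \<and>
       0 < - s * Re (bif \<theta> (of_real x2))" s x2])
    fix \<epsilon> :: real assume \<epsilon>: "0 < \<epsilon>" "p1 \<epsilon> \<in> V"
    interpret switching_pair r1 N1 r2 N2 "- s * \<epsilon>" 0 a1 b2 m m' n1 n2 \<delta> by (rule pair[OF \<epsilon>(2)[unfolded p1_def]])
    have "sgn (- 0 - - s * \<epsilon>) = s" using sg[OF \<epsilon>(1), of s] s'(2) by auto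
    from leading_term_sign[OF leading_term_0 this s]
    show "\<exists>R>0. \<forall>r. 0 < r \<and> r < R \<longrightarrow> 0 < s * Re (bif (p1 \<epsilon>) (of_real r))"
      by (simp only: p1_def bif.simps)
  next
    show "isCont p1 0" unfolding p1_def[abs_def] by (intro continuous_intros)
  qed (use 2 s p1 in auto)
  show thesis
    using eventually_nhds_x_imp_x[OF 1(4)]
    by (intro that[of "p1 e1" x1 x2 x3 x4 x5 s]) (use 1(1-3) 2(2,3) 3(2,3) 4(2,3) 5(1,2) s in auto)
qed

end

text \<open>The zeros of the derivative lie strictly between consecutive elements of
  \<open>Z\<close>, hence outside \<open>Z\<close>. This allows a multiple zero in \<open>Z\<close>
  to count as an additional zero of the derivative. The bound by \<open>Max Z\<close> keeps the zero
  added in the induction distinct from the earlier ones.\<close>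

lemma rolle_zeros:
  fixes f f' :: "real \<Rightarrow> real"
  assumes I: "is_interval I" and der: "\<And>x. x \<in> I \<Longrightarrow> (f has_real_derivative f' x) (at x)"
    and Z: "finite Z" "Z \<noteq> {}" "Z \<subseteq> I" "\<And>z. z \<in> Z \<Longrightarrow> f z = 0"
  shows "\<exists>Y. finite Y \<and> Y \<subseteq> I \<and> (\<forall>y\<in>Y. f' y = 0) \<and> Y \<inter> Z = {} \<and> card Z = Suc (card Y) \<and> (\<forall>y\<in>Y. y < Max Z)"
  using Z
proof (induction Z rule: finite_linorder_max_induct)
  case empty
  then show ?case by simp
next
  case (insert b A)
  show ?case
  proof (cases "A = {}")
    case True
    then show ?thesis by (intro exI[of _ "{}"]) auto
  next
    case False
    then obtain Y where Y: "finite Y" "Y \<subseteq> I" "\<forall>y\<in>Y. f' y = 0" "Y \<inter> A = {}" "card A = Suc (card Y)" "\<forall>y\<in>Y. y < Max A"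
      using insert.IH[OF False] insert.prems(2,3) by blast
    define a where "a = Max A"
    have a: "a \<in> A" "a < b" "\<And>x. x \<in> A \<Longrightarrow> x \<le> a" using insert.hyps False by (auto simp: a_def)
    have sub: "x \<in> I" if "a \<le> x" "x \<le> b" for x
      using I a(1) insert.prems that unfolding is_interval_1 by blast
    have "\<exists>y. a < y \<and> y < b \<and> (*) (f' y) = (\<lambda>v. 0)"
    proof (rule Rolle_deriv)
      show "continuous_on {a..b} f"
        by (rule DERIV_continuous_on[where D = f'], rule has_field_derivative_at_within[OF der[OF sub]]) auto
      show "(f has_derivative (*) (f' x)) (at x)" if "a < x" "x < b" for x
        using der[OF sub, of x] that by (simp add: has_field_derivative_def)
    qed (use a insert.prems in auto)
    then obtain y where y: "a < y" "y < b" and "(*) (f' y) = (\<lambda>v. 0)" by blast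
    from fun_cong[OF this(3), of 1] have y': "f' y = 0" by simp
    have M: "Max (insert b A) = b" using insert.hyps a by (intro Max_eqI) auto
    have yY: "y \<notin> Y" using Y(6) y(1) unfolding a_def[symmetric] by auto
    show ?thesis
    proof (intro exI[of _ "insert y Y"] conjI)
      show "insert y Y \<subseteq> I" using Y(2) sub[of y] y by auto
      show "insert y Y \<inter> insert b A = {}" using Y(4,6) y a insert.hyps unfolding a_def[symmetric] by fastforce
      show "card (insert b A) = Suc (card (insert y Y))"
        using Y(1,5) yY insert.hyps by auto
      show "\<forall>z\<in>insert y Y. z < Max (insert b A)" unfolding M using Y(6) y a unfolding a_def[symmetric] by fastforce
    qed (use Y y' in auto)
  qed
qed

text \<open>Each use of Rolle's theorem costs one zero and one derivative.\<close>

lemma card_zeros_le: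
  fixes fs :: "nat \<Rightarrow> real \<Rightarrow> real"
  assumes I: "is_interval I" and der: "\<And>k x. x \<in> I \<Longrightarrow> (fs k has_real_derivative fs (Suc k) x) (at x)"
    and nz: "\<And>x. x \<in> I \<Longrightarrow> fs (m + N) x \<noteq> 0"
    and Z: "finite Z" "Z \<subseteq> I" "\<And>z. z \<in> Z \<Longrightarrow> fs m z = 0"
  shows "card Z \<le> N"
  using nz Z
proof (induction N arbitrary: m Z)
  case 0
  then have "Z = {}" by (metis add_0_right equals0I subsetD)
  then show ?case by simp
next
  case (Suc N)
  show ?case
  proof (cases "Z = {}")
    case False
    obtain Y where "finite Y" "Y \<subseteq> I" "\<forall>y\<in>Y. fs (Suc m) y = 0" "card Z = Suc (card Y)"
      using rolle_zeros[where f = "fs m" and f' = "fs (Suc m)", OF I der Suc.prems(2) False Suc.prems(3,4)] by blast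
    then show ?thesis using Suc.IH[of "Suc m" Y] Suc.prems(1) by simp
  qed simp
qed

section \<open>From simple zeros to limit cycles\<close>

context switching_pair
begin

lemma Re_higher_deriv_has_derivative:
  assumes "\<bar>x\<bar> < \<delta>/4"
  shows "((\<lambda>x. Re ((deriv ^^ k) (\<lambda>x. return_gap x) (of_real x))) has_real_derivative Re ((deriv ^^ Suc k) (\<lambda>x. return_gap x) (of_real x))) (at x)"
proof -
  have "(deriv ^^ k) (\<lambda>x. return_gap x) holomorphic_on ball 0 (\<delta>/4)"
    by (rule holomorphic_higher_deriv[OF return_gap_holomorphic open_ball])
  then have "((deriv ^^ k) (\<lambda>x. return_gap x) has_field_derivative (deriv ^^ Suc k) (\<lambda>x. return_gap x) (of_real x)) (at (of_real x))"
    using assms by (auto intro: holomorphic_derivI)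
  from bounded_linear.has_vector_derivative[OF bounded_linear_Re has_vector_derivative_real_field[OF this]]
  show ?thesis by (simp add: has_real_derivative_iff_has_vector_derivative)
qed

text \<open>With finitely many zeros below \<open>\<rho>\<close>, the zero \<open>r\<close> has a
  positive distance \<open>\<epsilon>\<close> from the others;
  \<open>min \<epsilon> (\<rho> - r)\<close> keeps the search for zeros below
  \<open>\<rho>\<close>.\<close>

lemma cycle_of_simple_zero:
  assumes r: "0 < r" "r < \<rho>" "\<rho> < \<delta>/4" and zero: "Re (return_gap (of_real r)) = 0"
    and simple: "Re (deriv (\<lambda>x. return_gap x) (of_real r)) \<noteq> 0"
    and fin: "finite {x. 0 < x \<and> x < \<rho> \<and> Re (return_gap (of_real x)) = 0}"
    and R: "slow_rotation \<theta> R" "R < \<delta>/4" "(2 * exp (max \<bar>l1\<bar> \<bar>l2\<bar>) + 3) * r < R"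
  shows "crossing_limit_cycle \<theta> (cycle r)" "cycle r \<subseteq> ball 0 R" "(0, 0) \<in> inside (cycle r)" "cycle_of_multiplicity \<theta> (cycle r) 1"
proof -
  have r4: "r < \<delta>/4" using r by simp
  have z: "Re (P1 (of_real r)) = Re (P2 (of_real r))" using zero by simp
  show sub: "cycle r \<subseteq> ball 0 R"
    using norm_cycle_le[OF r(1) r4 z] R(3) by fastforce
  show "(0, 0) \<in> inside (cycle r)" by (rule origin_inside_cycle[OF r(1) r4 z])
  have "displacement_zero_of_multiplicity \<theta> r 1"
    unfolding displacement_zero_of_multiplicity_def
    using r(1) displacement_taylor[of r] r4 zero simple by (auto intro!: exI)
  then show "cycle_of_multiplicity \<theta> (cycle r) 1"
    unfolding cycle_of_multiplicity_def using start_in_cycle[OF r(1) r4 z] r(1) by blast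
  obtain \<epsilon> where \<epsilon>: "0 < \<epsilon>" "\<And>x. x \<in> {x. 0 < x \<and> x < \<rho> \<and> Re (return_gap (of_real x)) = 0} \<Longrightarrow> x \<noteq> r \<Longrightarrow> \<epsilon> \<le> dist r x"
    using finite_set_avoid[OF fin, of r] by blast
  show "crossing_limit_cycle \<theta> (cycle r)"
  proof (rule crossing_limit_cycle_if_isolated[OF periodic_orbit_cycle[OF r(1) r4 z] r(1) start_in_cycle[OF r(1) r4 z] sub R(1,2), of "min \<epsilon> (\<rho> - r)"])
    show "0 < min \<epsilon> (\<rho> - r)" using \<epsilon> r by simp
    show "x = r" if "0 < x" "\<bar>x - r\<bar> < min \<epsilon> (\<rho> - r)" "Re (P1 (of_real x)) = Re (P2 (of_real x))" for x
      using \<epsilon>(2)[of x] that by (force simp: dist_real_def)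
    show "x = r" if "0 < x" "(x, 0) \<in> cycle r" for x by (rule cycle_once[OF r(1) r4 z that])
  qed
qed

end

lemma sign_change_zero:
  fixes f :: "real \<Rightarrow> real"
  assumes "a < b" "continuous_on {a..b} f" "0 < s * f a" "0 < - s * f b"
  obtains z where "a < z" "z < b" "f z = 0"
proof -
  have "continuous_on {a..b} (\<lambda>x. - (s * f x))" by (intro continuous_intros assms)
  then obtain z where "a \<le> z" "z \<le> b" "- (s * f z) = 0"
    using IVT'[of "\<lambda>x. - (s * f x)" a 0 b] assms by auto
  then show thesis using that[of z] assms by (cases "z = a"; cases "z = b") (auto simp: less_le)
qed

lemma weak_focus_set_unfolds:
  assumes T: "\<theta>0 \<in> weak_focus_set"
  shows "unfolds_limit_cycles \<theta>0 4"
  unfolding unfolds_limit_cycles_def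
proof (intro allI impI)
  fix U :: "(real \<times> real) set" and W :: "params set"
  assume UW: "open U \<and> (0, 0) \<in> U \<and> open W \<and> \<theta>0 \<in> W"
  have wf: "weak_focus_of_order \<theta>0 5" by (rule weak_focus_set_order[OF T])
  then have z: "zero_traces \<theta>0" by (simp add: weak_focus_of_order_def)
  obtain r1 N1 r2 N2 \<delta> V where V: "switching_family r1 N1 r2 N2 \<delta> V" "\<theta>0 \<in> V"
    using switching_family_exists[OF z] by blast
  interpret switching_family r1 N1 r2 N2 \<delta> V by (rule V(1))
  obtain d1 d2 l1 l2 m1 m2 n1 n2 where t0: "\<theta>0 = (d1, d2, l1, l2, m1, m2, n1, n2)" by (metis surj_pair)
  have d0: "d1 = 0" "d2 = 0" using z by (auto simp: t0)
  have D5: "Re ((deriv ^^ 5) (bif \<theta>0) 0) \<noteq> 0"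
  proof -
    interpret P: switching_pair r1 N1 r2 N2 d1 d2 l1 l2 m1 m2 n1 n2 \<delta>
      by (rule pair[OF V(2)[unfolded t0]])
    have "bif \<theta>0 = (\<lambda>x. P.return_gap x)" by (rule ext) (simp only: t0 bif.simps)
    moreover have "displacement_coeff \<theta>0 5 \<noteq> 0" using wf by (simp add: weak_focus_of_order_def)
    moreover have "Re (z / fact 5) = Re z / fact 5" for z by (metis Re_divide_of_real of_real_fact)
    ultimately show ?thesis using P.displacement_coeff_series(1)[of 5] by (auto simp: t0)
  qed
  obtain \<rho> where \<rho>: "0 < \<rho>" "\<rho> < \<delta>/8"
    "eventually (\<lambda>\<theta>. \<forall>x. \<bar>x\<bar> < \<rho> \<longrightarrow> Re ((deriv ^^ 5) (bif \<theta>) (of_real x)) \<noteq> 0) (nhds \<theta>0)"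
    by (rule bif_higher_deriv[OF V(2) D5])
  obtain u where u: "0 < u" "ball (0, 0) u \<subseteq> U" using UW by (meson open_contains_ball)
  \<comment> \<open>A strict bound on the sums of absolute values in both half-planes, so that it
    persists for nearby parameters.\<close>
  define c where "c = max (\<bar>l1\<bar> + \<bar>m1\<bar> + \<bar>n1\<bar>) (\<bar>l2\<bar> + \<bar>m2\<bar> + \<bar>n2\<bar>) + 1"
  have c: "0 < c" by (simp add: c_def)
  \<comment> \<open>The first two bounds keep cycles in \<open>U\<close> and below
    \<open>\<delta>/4\<close>; the last gives \<open>(c + 1) * R \<le> 1/4\<close>, as
    \<open>slow_rotation\<close> requires.\<close>
  define R where "R = min (min u (\<delta>/8)) (1 / (4 * (c + 1)))"
  have R: "0 < R" "R \<le> u" "R < \<delta>/4" "(c + 1) * R \<le> 1/4"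
  proof -
    have "0 < \<delta>" using \<rho> by simp
    then show "0 < R" "R \<le> u" "R < \<delta>/4" using u c by (auto simp: R_def)
    have "(c + 1) * R \<le> (c + 1) * (1 / (4 * (c + 1)))" using c by (intro mult_left_mono) (auto simp: R_def)
    also have "\<dots> = 1/4" using c by (simp add: field_simps)
    finally show "(c + 1) * R \<le> 1/4" .
  qed
  define C where "C = 2 * exp c + 3"
  have C: "0 < C" by (simp add: C_def add_pos_pos)
  \<comment> \<open>A cycle started at radius \<open>r\<close> has norm at most
    \<open>C * r\<close>, so radii below \<open>R / C\<close> keep it in the ball of radius
    \<open>R\<close>.\<close>
  define \<rho>' where "\<rho>' = min \<rho> (R / C)"
  have \<rho>': "0 < \<rho>'" "\<rho>' \<le> \<rho>" "C * \<rho>' \<le> R" using \<rho> R C by (auto simp: \<rho>'_def min_def field_simps)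
  define small where "small \<theta> \<longleftrightarrow> \<bar>fst (upper_par \<theta>)\<bar> < 1/2 \<and> \<bar>fst (lower_par \<theta>)\<bar> < 1/2 \<and>
     \<bar>fst (snd (upper_par \<theta>))\<bar> + \<bar>fst (snd (snd (upper_par \<theta>)))\<bar> + \<bar>snd (snd (snd (upper_par \<theta>)))\<bar> < c \<and>
     \<bar>fst (snd (lower_par \<theta>))\<bar> + \<bar>fst (snd (snd (lower_par \<theta>)))\<bar> + \<bar>snd (snd (snd (lower_par \<theta>)))\<bar> < c" for \<theta>
  have "open {\<theta>. small \<theta>}" unfolding small_def
    by (intro open_Collect_conj open_Collect_less continuous_intros continuous_par)
  moreover have "\<bar>l1\<bar> + \<bar>m1\<bar> + \<bar>n1\<bar> < c" "\<bar>l2\<bar> + \<bar>m2\<bar> + \<bar>n2\<bar> < c" unfolding c_def by linarith+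
  then have "small \<theta>0" by (simp add: small_def t0 d0)
  ultimately have "eventually small (nhds \<theta>0)" using eventually_nhds_in_open[of "{\<theta>. small \<theta>}" \<theta>0] by simp
  moreover have "eventually (\<lambda>\<theta>. \<theta> \<in> W) (nhds \<theta>0)" using UW by (intro eventually_nhds_in_open) auto
  ultimately have Q: "eventually (\<lambda>\<theta>. (small \<theta> \<and> \<theta> \<in> W) \<and> (\<forall>x. \<bar>x\<bar> < \<rho> \<longrightarrow> Re ((deriv ^^ 5) (bif \<theta>) (of_real x)) \<noteq> 0)) (nhds \<theta>0)"
    using \<rho>(3) by (intro eventually_conj)
  obtain \<theta> x1 x2 x3 x4 x5 s where \<theta>: "\<theta> \<in> V" "(small \<theta> \<and> \<theta> \<in> W) \<and> (\<forall>x. \<bar>x\<bar> < \<rho> \<longrightarrow> Re ((deriv ^^ 5) (bif \<theta>) (of_real x)) \<noteq> 0)"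
    and x: "0 < x1" "x1 < x2" "x2 < x3" "x3 < x4" "x4 < x5" "x5 < \<rho>'"
    and sg: "0 < s * Re (bif \<theta> (of_real x1))" "0 < - s * Re (bif \<theta> (of_real x2))" "0 < s * Re (bif \<theta> (of_real x3))"
    "0 < - s * Re (bif \<theta> (of_real x4))" "0 < s * Re (bif \<theta> (of_real x5))"
    by (rule bif_alternating[OF T V(2) Q \<rho>'(1)]) blast
  obtain e1 e2 a1 a2 b1 b2 c1 c2 where t: "\<theta> = (e1, e2, a1, a2, b1, b2, c1, c2)" by (metis surj_pair)
  interpret P: switching_pair r1 N1 r2 N2 e1 e2 a1 a2 b1 b2 c1 c2 \<delta>
    by (rule pair[OF \<theta>(1)[unfolded t]])
  have bif: "bif \<theta> = (\<lambda>x. P.return_gap x)" by (rule ext) (simp only: t bif.simps)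
  define fs where "fs k x = Re ((deriv ^^ k) (\<lambda>x. P.return_gap x) (of_real x))" for k and x :: real
  define I where "I = {-\<rho><..<\<rho>}"
  have I: "is_interval I" by (simp add: I_def is_interval_oo)
  have der: "(fs k has_real_derivative fs (Suc k) x) (at x)" if "x \<in> I" for k x
    unfolding fs_def by (rule P.Re_higher_deriv_has_derivative) (use that \<rho> in \<open>auto simp: I_def\<close>)
  have nz: "fs 5 x \<noteq> 0" if "x \<in> I" for x
  proof -
    have "\<bar>x\<bar> < \<rho>" using that by (auto simp: I_def)
    then show ?thesis using \<theta>(2) unfolding bif fs_def by blast
  qed
  have f0: "fs 0 x = Re (P.return_gap (of_real x))" for x by (simp add: fs_def)
  have sgf: "0 < s * fs 0 x1" "0 < - s * fs 0 x2" "0 < s * fs 0 x3" "0 < - s * fs 0 x4" "0 < s * fs 0 x5"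
    using sg unfolding bif f0 .
  have cont: "continuous_on {a..b} (fs 0)" if "0 \<le> a" "b < \<rho>" for a b
    by (rule DERIV_continuous_on[OF has_field_derivative_at_within[OF der]]) (use that in \<open>auto simp: I_def\<close>)
  obtain z1 where z1: "x1 < z1" "z1 < x2" "fs 0 z1 = 0"
    by (rule sign_change_zero[OF x(2) cont sgf(1,2)]) (use x \<rho>' in auto)
  obtain z2 where z2: "x2 < z2" "z2 < x3" "fs 0 z2 = 0"
    by (rule sign_change_zero[OF x(3) cont sgf(2)]) (use x \<rho>' sgf(3) in auto)
  obtain z3 where z3: "x3 < z3" "z3 < x4" "fs 0 z3 = 0"
    by (rule sign_change_zero[OF x(4) cont sgf(3,4)]) (use x \<rho>' in auto)
  obtain z4 where z4: "x4 < z4" "z4 < x5" "fs 0 z4 = 0"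
    by (rule sign_change_zero[OF x(5) cont sgf(4)]) (use x \<rho>' sgf(5) in auto)
  define Z where "Z = {z1, z2, z3, z4}"
  have Zc: "card Z = 4" using z1(1,2) z2(1,2) z3(1,2) z4(1,2) x by (simp add: Z_def)
  have Zb: "0 < z \<and> z < \<rho>' \<and> fs 0 z = 0" if "z \<in> Z" for z
  proof -
    have "0 < z1" "z1 < \<rho>'" "0 < z2" "z2 < \<rho>'" "0 < z3" "z3 < \<rho>'" "0 < z4" "z4 < \<rho>'"
      using z1(1,2) z2(1,2) z3(1,2) z4(1,2) x by linarith+
    then show ?thesis using that z1(3) z2(3) z3(3) z4(3) unfolding Z_def by blast
  qed
  \<comment> \<open>Rolle's theorem, applied to the five zeros in \<open>insert 0 Z\<close>, gives
    four zeros of the derivative outside this set, and a double zero \<open>z\<close> would be a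
    fifth. But at most four are possible, as the fifth derivative of the displacement has no
    zero.\<close>
  have simple: "fs 1 z \<noteq> 0" if zZ: "z \<in> Z" for z
  proof
    assume z0: "fs 1 z = 0"
    have ZI: "y \<in> I" if "y \<in> insert 0 Z" for y
    proof (cases "y = 0")
      case False
      then have "y \<in> Z" using that by simp
      from Zb[OF this] have "- \<rho> < y" "y < \<rho>" using \<rho>(1) \<rho>'(2) by linarith+
      then show ?thesis by (simp add: I_def)
    qed (use \<rho>(1) in \<open>simp add: I_def\<close>)
    have Z00: "fs 0 y = 0" if "y \<in> insert 0 Z" for y
      using that Zb[of y] by (cases "y = 0") (simp_all add: f0 P.return_gap_0[simplified])
    have Z0: "finite (insert 0 Z)" "insert 0 Z \<noteq> {}" "insert 0 Z \<subseteq> I" "\<And>y. y \<in> insert 0 Z \<Longrightarrow> fs 0 y = 0"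
      using ZI Z00 by (simp_all only: subsetI) (simp_all add: Z_def)
    obtain Y where Y: "finite Y" "Y \<subseteq> I" "\<forall>y\<in>Y. fs (Suc 0) y = 0" "Y \<inter> insert 0 Z = {}" "card (insert 0 Z) = Suc (card Y)"
      using rolle_zeros[OF I der Z0] by blast
    have "card (insert 0 Z) = 5" using Zc Zb by (subst card_insert_disjoint) (auto simp: Z_def)
    then have "card Y = 4" using Y(5) by simp
    then have "card (insert z Y) = 5" using Y(1,4) zZ by (subst card_insert_disjoint) auto
    moreover have "card (insert z Y) \<le> 4"
      by (rule card_zeros_le[where fs = fs and m = 1, OF I der]) (use nz Y z0 Z0(3) zZ in auto)
    ultimately show False by simp
  qed
  \<comment> \<open>Infinitely many zeros would include six, whereas the nonvanishing fifth
    derivative allows five.\<close>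
  have "finite {x. 0 < x \<and> x < \<rho>' \<and> fs 0 x = 0}" (is "finite ?F")
  proof (rule ccontr)
    assume "infinite ?F"
    then obtain B where B: "finite B" "card B = 6" "B \<subseteq> ?F" using infinite_arbitrarily_large by blast
    have "card B \<le> 5"
      by (rule card_zeros_le[where fs = fs and m = 0, OF I der]) (use nz B \<rho>'(2) in \<open>auto simp: I_def\<close>)
    then show False using B by simp
  qed
  then have fin: "finite {x. 0 < x \<and> x < \<rho>' \<and> Re (P.return_gap (of_real x)) = 0}" unfolding f0 .
  have sm: "\<bar>e1\<bar> < 1/2" "\<bar>e2\<bar> < 1/2" "\<bar>a1\<bar> + \<bar>b1\<bar> + \<bar>c1\<bar> < c" "\<bar>a2\<bar> + \<bar>b2\<bar> + \<bar>c2\<bar> < c"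
    using \<theta>(2) by (auto simp: t small_def)
  have slow: "slow_rotation \<theta> R"
  proof -
    have "(\<bar>a1\<bar> + \<bar>b1\<bar> + \<bar>c1\<bar> + 1) * R \<le> (c + 1) * R" "(\<bar>a2\<bar> + \<bar>b2\<bar> + \<bar>c2\<bar> + 1) * R \<le> (c + 1) * R"
      using sm R(1) by (auto intro!: mult_right_mono)
    then show ?thesis using sm R(4) by (auto simp: t)
  qed
  have cyc: "crossing_limit_cycle \<theta> (P.cycle z)" "P.cycle z \<subseteq> ball 0 R" "(0, 0) \<in> inside (P.cycle z)" "cycle_of_multiplicity \<theta> (P.cycle z) 1"
    if "z \<in> Z" for z
  proof -
    have "max \<bar>a1\<bar> \<bar>a2\<bar> \<le> c" using sm(3,4) by linarith
    then have "exp (max \<bar>a1\<bar> \<bar>a2\<bar>) \<le> exp c" by (simp only: exp_le_cancel_iff)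
    then have "(2 * exp (max \<bar>a1\<bar> \<bar>a2\<bar>) + 3) * z \<le> C * z" using Zb[OF that] unfolding C_def by (intro mult_right_mono) auto
    also have "\<dots> < C * \<rho>'" using Zb[OF that] C by simp
    finally have bd: "(2 * exp (max \<bar>a1\<bar> \<bar>a2\<bar>) + 3) * z < R" using \<rho>'(3) by simp
    have "Re (deriv (\<lambda>x. P.return_gap x) (of_real z)) \<noteq> 0" using simple[OF that] by (simp add: fs_def)
    moreover have "\<rho>' < \<delta>/4" using \<rho> \<rho>' by simp
    moreover have "Re (P.return_gap (of_real z)) = 0" using Zb[OF that] unfolding f0 by blast
    ultimately show "crossing_limit_cycle \<theta> (P.cycle z)" "P.cycle z \<subseteq> ball 0 R" "(0, 0) \<in> inside (P.cycle z)" "cycle_of_multiplicity \<theta> (P.cycle z) 1"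
      using P.cycle_of_simple_zero[of z \<rho>' R] Zb[OF that] fin slow R(3) bd unfolding t by blast+
  qed
  have inj: "inj_on P.cycle Z"
  proof (rule inj_onI)
    fix y z assume yz: "y \<in> Z" "z \<in> Z" "P.cycle y = P.cycle z"
    have b: "y < \<delta>/4" "z < \<delta>/4" "Re (P.return_gap (of_real y)) = 0" "Re (P.return_gap (of_real z)) = 0"
      using Zb[OF yz(1)] Zb[OF yz(2)] \<rho> \<rho>'(2) unfolding f0 by auto
    have "(y, 0) \<in> P.cycle z" using P.start_in_cycle[of y] b Zb[OF yz(1)] yz(3) by simp
    then show "y = z" using P.cycle_once[of z y] b Zb[OF yz(1)] Zb[OF yz(2)] by simp
  qed
  show "\<exists>\<theta>\<in>W. \<exists>C \<mu>. finite C \<and>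
           (\<forall>\<Gamma>\<in>C. crossing_limit_cycle \<theta> \<Gamma> \<and> \<Gamma> \<subseteq> U \<and> (0, 0) \<in> inside \<Gamma> \<and>
              cycle_of_multiplicity \<theta> \<Gamma> (\<mu> \<Gamma>)) \<and>
           (\<Sum>\<Gamma>\<in>C. \<mu> \<Gamma>) = 4"
  \<comment> \<open>All four zeros are simple, so every cycle has multiplicity 1.\<close>
  proof (intro bexI[of _ \<theta>] exI[of _ "P.cycle ` Z"] exI[of _ "\<lambda>_. 1"] conjI ballI)
    show "finite (P.cycle ` Z)" by (simp add: Z_def)
    show "(\<Sum>\<Gamma>\<in>P.cycle ` Z. 1) = (4::nat)" using card_image[OF inj] Zc by simp
    show "\<theta> \<in> W" using \<theta>(2) by blast
    fix \<Gamma> assume "\<Gamma> \<in> P.cycle ` Z"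
    then obtain z where z: "z \<in> Z" "\<Gamma> = P.cycle z" by blast
    show "crossing_limit_cycle \<theta> \<Gamma>" "(0, 0) \<in> inside \<Gamma>" "cycle_of_multiplicity \<theta> \<Gamma> 1" using cyc[OF z(1)] z(2) by auto
    have "ball 0 R \<subseteq> U" using u(2) R(2) by (auto simp: zero_prod_def)
    then show "\<Gamma> \<subseteq> U" using cyc(2)[OF z(1)] z(2) by blast
  qed
qed

theorem proposition4p2:
  shows "(\<exists>\<theta>. weak_focus_of_order \<theta> 5) \<and>
    (\<forall>\<theta> k. weak_focus_of_order \<theta> k \<longrightarrow> k \<le> 5) \<and>
    (\<forall>\<theta>\<in>weak_focus_set. weak_focus_of_order \<theta> 5) \<and>
    (\<forall>\<theta>\<in>weak_focus_set. unfolds_limit_cycles \<theta> 4)"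
proof -
  \<comment> \<open>The choice \<open>n1 = 0\<close>, \<open>n2 = 2\<close> satisfies the
    inequalities and determines \<open>l1\<close> and \<open>l2\<close>.\<close>
  have "(0, 0, - 3, 1, 1, 1, 0, 2) \<in> weak_focus_set" by (simp add: weak_focus_set_def)
  then have "\<exists>\<theta>. weak_focus_of_order \<theta> 5" using weak_focus_set_order by blast
  then show ?thesis using weak_focus_order_bound weak_focus_set_order weak_focus_set_unfolds by blast
qed

end
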